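(* Let $w\in S_n$ be a fireworks permutation. Then the homogenized Grothendieck polynomial $\widetilde{\mathfrak G}_w$ has M-convex support, i.e., $\widetilde{\mathfrak G}_w$ has saturated Newton polytope and its Newton polytope is a generalized permutahedron. In particular, $\mathfrak G_w$ has saturated Newton polytope, each degree component $\mathfrak G_w^{(c)}$ also has M-convex support, and the sizes $|\mathrm{supp}(\mathfrak G_w^{(c)})|$ of their supports form a log-concave sequence in $c$.
   Context: Notation: $[n]=\{1,\dots,n\}$; permutations are in one-line notation; $\ell(w)$ is the number of inversions; $w_0$ is the longest element of $S_n$; $s_i$ is the adjacent transposition $(i\ i+1)$. Fireworks: $w\in S_n$ is fireworks if the initial terms of its decreasing runs (maximal decreasing strings of consecutive entries $w(a)>w(a+1)>\dots>w(b)$) are increasing from left to right. Equivalently, there are no $i<j$ with $w(j)<w(j+1)<w(i)$. Grothendieck polynomials: for $i\in[n-1]$ and $f\in\mathbb Z[x_1,\dots,x_n]$ let $\partial_i(f)=\frac{f-s_if}{x_i-x_{i+1}}$, where $s_i$ acts by switching $x_i$ and $x_{i+1}$, and $\overline\partial_i(f)=\partial_i((1-x_{i+1})f)$. Then $\mathfrak G_{w_0}=x_1^{n-1}x_2^{n-2}\cdots x_{n-1}$ and $\mathfrak G_w=\overline\partial_i(\mathfrak G_{ws_i})$ whenever $\ell(w)<\ell(ws_i)$. $\mathfrak G_w^{(c)}$ denotes the homogeneous degree-$c$ component of $\mathfrak G_w$. The homogenization is $\widetilde{\mathfrak G}_w=\sum_c x_{n+1}^{d-c}\,\mathfrak G_w^{(c)}\in\mathbb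 Z[x_1,\dots,x_{n+1}]$, where $d=\deg\mathfrak G_w$. For a polynomial $f\in\mathbb Z[x_1,\dots,x_N]$, $\mathrm{supp}(f)\subset\mathbb Z_{\ge0}^N$ is the set of exponent vectors of monomials with nonzero coefficient; $\mathrm{Newton}(f)=\mathrm{conv}(\mathrm{supp}(f))$; $f$ has saturated Newton polytope (SNP) if $\mathrm{supp}(f)=\mathrm{Newton}(f)\cap\mathbb Z^N$. A set $S\subset\mathbb Z^N$ is M-convex if for any $\alpha,\beta\in S$ and any $i\in[N]$ with $\alpha_i>\beta_i$ there is $j\in[N]$ with $\alpha_j<\beta_j$ and $\alpha-\mathbf e_i+\mathbf e_j\in S$ and $\beta+\mathbf e_i-\mathbf e_j\in S$. A generalized permutahedron in $\mathbb R^N$ is a polytope of the form $\{x\in\mathbb R^N:\sum_{i\in I}x_i\le z(I)\text{ for all }I\subseteq[N],\ \sum_{i=1}^Nx_i=z([N])\}$ for some submodular $z:2^{[N]}\to\mathbb R$ (i.e. $z(I)+z(J)\ge z(I\cup J)+z(I\cap J)$ for all $I,J$) with $z(\emptyset)=0$. A sequence $(a_c)$ of nonnegative numbers is log-concave if $a_c^2\ge a_{c-1}a_{c+1}$ for all $c$. *)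

theory Defs
  imports "HOL-Analysis.Convex" "HOL-Analysis.Finite_Function_Topology"
    "HOL-Combinatorics.Permutations"
begin

section \<open>Integer polynomials\<close>

text \<open>
  A monomial is its exponent vector, a finitely supported map from variable indices to exponents.
  Elements of \<open>\<int>[x\<^sub>1, \<dots>, x\<^sub>N]\<close> are those in which only indices in \<open>{1..N}\<close> occur.
\<close>

type_synonym ipoly = "(nat \<Rightarrow>\<^sub>0 nat) \<Rightarrow>\<^sub>0 int"

definition Var :: "nat \<Rightarrow> ipoly" where
  "Var i = Poly_Mapping.single (Poly_Mapping.single i 1) 1"

definition mon_degree :: "(nat \<Rightarrow>\<^sub>0 nat) \<Rightarrow> nat" where
  "mon_degree m = (\<Sum>i\<in>Poly_Mapping.keys m. Poly_Mapping.lookup m i)"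

definition total_degree :: "ipoly \<Rightarrow> nat" where
  "total_degree f = Max (insert 0 (mon_degree ` Poly_Mapping.keys f))"

definition hom_component :: "nat \<Rightarrow> ipoly \<Rightarrow> ipoly" where
  "hom_component c f =
     (\<Sum>m | m \<in> Poly_Mapping.keys f \<and> mon_degree m = c.
        Poly_Mapping.single m (Poly_Mapping.lookup f m))"

definition homogenization :: "nat \<Rightarrow> ipoly \<Rightarrow> ipoly" where
  "homogenization n f =
     (\<Sum>c\<le>total_degree f. Var (Suc n) ^ (total_degree f - c) * hom_component c f)"

text \<open>
  Since \<open>s\<^sub>i\<close> is an involution, the coefficient of a monomial in \<open>s\<^sub>i f\<close> is the coefficient of
  the swapped monomial in \<open>f\<close>.
\<close>

definition swap_vars :: "nat \<Rightarrow> ipoly \<Rightarrow> ipoly" where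
  "swap_vars i f = Poly_Mapping.map_key (Poly_Mapping.map_key (transpose i (Suc i))) f"

text \<open>The quotient exists and is unique, see \<open>divided_difference\<close> below.\<close>

definition div_diff :: "nat \<Rightarrow> ipoly \<Rightarrow> ipoly" where
  "div_diff i f = (THE g. (Var i - Var (Suc i)) * g = f - swap_vars i f)"

definition K_div_diff :: "nat \<Rightarrow> ipoly \<Rightarrow> ipoly" where
  "K_div_diff i f = div_diff i ((1 - Var (Suc i)) * f)"


section \<open>Permutations and Grothendieck polynomials\<close>

definition longest_perm :: "nat \<Rightarrow> nat \<Rightarrow> nat" where
  "longest_perm n i = (if i \<in> {1..n} then n + 1 - i else i)"

definition inv_length :: "nat \<Rightarrow> (nat \<Rightarrow> nat) \<Rightarrow> nat" where
  "inv_length n w = card {(i, j). i \<in> {1..n} \<and> j \<in> {1..n} \<and> i < j \<and> w j < w i}"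

definition decreasing_run :: "nat \<Rightarrow> (nat \<Rightarrow> nat) \<Rightarrow> nat \<Rightarrow> nat \<Rightarrow> bool" where
  "decreasing_run n w a b \<longleftrightarrow>
     1 \<le> a \<and> a \<le> b \<and> b \<le> n \<and> strict_antimono_on {a..b} w \<and>
     \<not> (1 < a \<and> w (a - 1) > w a) \<and> \<not> (b < n \<and> w b > w (b + 1))"

definition fireworks :: "nat \<Rightarrow> (nat \<Rightarrow> nat) \<Rightarrow> bool" where
  "fireworks n w \<longleftrightarrow>
     (\<forall>a b a' b'. decreasing_run n w a b \<longrightarrow> decreasing_run n w a' b' \<longrightarrow> a < a' \<longrightarrow> w a < w a')"

text \<open>
  \<open>is_grothendieck n w f\<close> says that \<open>f\<close> is obtained for \<open>w\<close> by the recursion along some chain of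
  ascents up to the longest element; \<open>w s\<^sub>i\<close> acts first by \<open>s\<^sub>i\<close>, hence swaps positions.
\<close>

inductive is_grothendieck :: "nat \<Rightarrow> (nat \<Rightarrow> nat) \<Rightarrow> ipoly \<Rightarrow> bool" for n where
  longest: "is_grothendieck n (longest_perm n) (\<Prod>i\<in>{1..n}. Var i ^ (n - i))"
| step: "\<lbrakk>w permutes {1..n}; i \<in> {1..<n};
          inv_length n w < inv_length n (w \<circ> transpose i (Suc i));
          is_grothendieck n (w \<circ> transpose i (Suc i)) f\<rbrakk>
         \<Longrightarrow> is_grothendieck n w (K_div_diff i f)"

text \<open>
  Independence of the chain is proved at the end of this theory
  (\<open>grothendieck_longest\<close>, \<open>grothendieck_step\<close>).
\<close>

definition grothendieck :: "nat \<Rightarrow> (nat \<Rightarrow> nat) \<Rightarrow> ipoly" where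
  "grothendieck n w = (THE f. is_grothendieck n w f)"


section \<open>Supports, Newton polytopes, M-convexity\<close>

text \<open>
  \<open>\<int>\<^sup>N\<close> and \<open>\<real>\<^sup>N\<close> are the finitely supported functions on \<open>nat\<close> with support in \<open>{1..N}\<close>,
  because the dimension depends on a natural number that varies inside statements.
\<close>

definition int_space :: "nat \<Rightarrow> (nat \<Rightarrow>\<^sub>0 int) set" where
  "int_space N = {v. Poly_Mapping.keys v \<subseteq> {1..N}}"

definition real_space :: "nat \<Rightarrow> (nat \<Rightarrow>\<^sub>0 real) set" where
  "real_space N = {v. Poly_Mapping.keys v \<subseteq> {1..N}}"

definition supp :: "ipoly \<Rightarrow> (nat \<Rightarrow>\<^sub>0 int) set" where
  "supp f = Poly_Mapping.map int ` Poly_Mapping.keys f"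

definition newton :: "ipoly \<Rightarrow> (nat \<Rightarrow>\<^sub>0 real) set" where
  "newton f = convex hull (Poly_Mapping.map real_of_int ` supp f)"

definition SNP :: "nat \<Rightarrow> ipoly \<Rightarrow> bool" where
  "SNP N f \<longleftrightarrow> supp f = {v \<in> int_space N. Poly_Mapping.map real_of_int v \<in> newton f}"

definition M_convex :: "nat \<Rightarrow> (nat \<Rightarrow>\<^sub>0 int) set \<Rightarrow> bool" where
  "M_convex N S \<longleftrightarrow> S \<subseteq> int_space N \<and>
     (\<forall>\<alpha>\<in>S. \<forall>\<beta>\<in>S. \<forall>i\<in>{1..N}. Poly_Mapping.lookup \<alpha> i > Poly_Mapping.lookup \<beta> i \<longrightarrow>
       (\<exists>j\<in>{1..N}. Poly_Mapping.lookup \<alpha> j < Poly_Mapping.lookup \<beta> j \<and>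
          \<alpha> - Poly_Mapping.single i 1 + Poly_Mapping.single j 1 \<in> S \<and>
          \<beta> + Poly_Mapping.single i 1 - Poly_Mapping.single j 1 \<in> S))"

definition submodular :: "nat \<Rightarrow> (nat set \<Rightarrow> real) \<Rightarrow> bool" where
  "submodular N z \<longleftrightarrow>
     (\<forall>I J. I \<subseteq> {1..N} \<longrightarrow> J \<subseteq> {1..N} \<longrightarrow> z (I \<union> J) + z (I \<inter> J) \<le> z I + z J)"

definition generalized_permutahedron :: "nat \<Rightarrow> (nat \<Rightarrow>\<^sub>0 real) set \<Rightarrow> bool" where
  "generalized_permutahedron N P \<longleftrightarrow>
     (\<exists>z. submodular N z \<and> z {} = 0 \<and>
        P = {x \<in> real_space N.
               (\<forall>I. I \<subseteq> {1..N} \<longrightarrow> (\<Sum>i\<in>I. Poly_Mapping.lookup x i) \<le> z I) \<and>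
               (\<Sum>i\<in>{1..N}. Poly_Mapping.lookup x i) = z {1..N}})"

definition log_concave :: "(nat \<Rightarrow> real) \<Rightarrow> bool" where
  "log_concave a \<longleftrightarrow> (\<forall>c. 0 \<le> a c) \<and> (\<forall>c\<ge>1. a (c - 1) * a (c + 1) \<le> a c ^ 2)"


section \<open>Well-definedness\<close>

subsection \<open>Divided differences\<close>

abbreviation (input) swap_exp :: "nat \<Rightarrow> (nat \<Rightarrow>\<^sub>0 nat) \<Rightarrow> (nat \<Rightarrow>\<^sub>0 nat)" where
  "swap_exp i \<equiv> Poly_Mapping.map_key (transpose i (Suc i))"

lemma swap_exp_invol: "swap_exp i (swap_exp i m) = m"
  by (simp add: map_key_compose) (simp add: map_key_id id_def)

lemma inj_swap_exp: "inj (swap_exp i)"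
  by (metis injI swap_exp_invol)

lemma swap_exp_add: "swap_exp i (m + m') = swap_exp i m + swap_exp i m'"
  by (rule map_key_plus) simp

lemma swap_vars_add: "swap_vars i (f + g) = swap_vars i f + swap_vars i g"
  unfolding swap_vars_def by (rule map_key_plus) (rule inj_swap_exp)

lemma swap_vars_zero [simp]: "swap_vars i 0 = 0"
  unfolding swap_vars_def by (rule map_key_zero) (rule inj_swap_exp)

lemma swap_vars_diff: "swap_vars i (f - g) = swap_vars i f - swap_vars i g"
  by (metis diff_add_cancel eq_diff_eq swap_vars_add)

lemma swap_vars_single:
  "swap_vars i (Poly_Mapping.single m c) = Poly_Mapping.single (swap_exp i m) c"
  unfolding swap_vars_def by (metis inj_swap_exp map_key_single swap_exp_invol)

lemma ipoly_induct [case_names zero add]: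
  fixes f :: ipoly
  assumes "P 0" "\<And>m c f. P f \<Longrightarrow> P (Poly_Mapping.single m c + f)"
  shows "P f"
proof (induction f rule: Poly_Mapping.update_induct)
  case const
  show ?case by (rule assms)
next
  case (update f a b)
  have "Poly_Mapping.update a b f = Poly_Mapping.single a b + f"
    using update(1)
    by (intro poly_mapping_eqI)
       (auto simp: lookup_update lookup_add lookup_single when_def in_keys_iff)
  then show ?case using assms(2) update by simp
qed

lemma swap_vars_mult: "swap_vars i (f * g) = swap_vars i f * swap_vars i g"
proof (induction f rule: ipoly_induct)
  case (add m c f)
  have "swap_vars i (Poly_Mapping.single m c * g) =
        swap_vars i (Poly_Mapping.single m c) * swap_vars i g"
    by (induction g rule: ipoly_induct)
       (simp_all add: swap_vars_add swap_vars_single mult_single swap_exp_add distrib_left)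
  then show ?case using add by (simp add: swap_vars_add distrib_right)
qed simp

lemma swap_vars_const: "swap_vars i (Poly_Mapping.single 0 c) = Poly_Mapping.single 0 c"
  by (simp add: swap_vars_single)

lemma swap_vars_one [simp]: "swap_vars i 1 = 1"
  using swap_vars_const[of i 1] by simp

lemma swap_vars_Var: "swap_vars i (Var k) = Var (transpose i (Suc i) k)"
proof -
  have "swap_exp i (Poly_Mapping.single k 1) = Poly_Mapping.single (transpose i (Suc i) k) (1::nat)"
    by (metis inj_transpose map_key_single transpose_involutory)
  then show ?thesis by (simp add: Var_def swap_vars_single)
qed

lemma swap_vars_invol: "swap_vars i (swap_vars i f) = f"
  by (induction f rule: ipoly_induct) (simp_all add: swap_vars_add swap_vars_single swap_exp_invol)

lemma swap_vars_commute:
  assumes "i \<noteq> j" "Suc i \<noteq> j" "Suc j \<noteq> i"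
  shows "swap_vars i (swap_vars j f) = swap_vars j (swap_vars i f)"
proof -
  have "transpose j (Suc j) \<circ> transpose i (Suc i) = transpose i (Suc i) \<circ> transpose j (Suc j)"
    using assms by (auto simp: fun_eq_iff transpose_def)
  then have "swap_exp i (swap_exp j m) = swap_exp j (swap_exp i m)" for m
    by (simp add: map_key_compose)
  then show ?thesis
    by (induction f rule: ipoly_induct) (simp_all add: swap_vars_add swap_vars_single)
qed

lemma swap_vars_braid:
  "swap_vars i (swap_vars (Suc i) (swap_vars i f)) =
   swap_vars (Suc i) (swap_vars i (swap_vars (Suc i) f))"
proof -
  let ?s = "transpose i (Suc i)" and ?t = "transpose (Suc i) (Suc (Suc i))"
  have "?s \<circ> (?t \<circ> ?s) = ?t \<circ> (?s \<circ> ?t)"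
    by (auto simp: fun_eq_iff transpose_def)
  then have "swap_exp i (swap_exp (Suc i) (swap_exp i m)) =
        swap_exp (Suc i) (swap_exp i (swap_exp (Suc i) m))" for m
    by (simp add: map_key_compose inj_compose comp_assoc)
  then show ?thesis
    by (induction f rule: ipoly_induct) (simp_all add: swap_vars_add swap_vars_single)
qed

lemma Var_diff_nonzero:
  assumes "i \<noteq> j"
  shows "Var i - Var j \<noteq> 0"
proof -
  have "Poly_Mapping.single j (1::nat) \<noteq> Poly_Mapping.single i 1"
    using assms by (metis lookup_single_eq lookup_single_not_eq zero_neq_one)
  then have "Poly_Mapping.lookup (Var i - Var j) (Poly_Mapping.single i 1) = 1"
    unfolding Var_def lookup_minus lookup_single_eq by (subst lookup_single_not_eq) simp_all
  then show ?thesis by (metis lookup_zero zero_neq_one)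
qed

lemma monomial_decomp:
  "Poly_Mapping.single m (c::int) =
     Poly_Mapping.single 0 c * (\<Prod>i\<in>Poly_Mapping.keys m. Var i ^ Poly_Mapping.lookup m i)"
proof -
  have pow: "Var i ^ k = Poly_Mapping.single (Poly_Mapping.single i k) 1" for i k
    by (induction k) (simp_all add: Var_def mult_single flip: single_add)
  have prod: "(\<Prod>i\<in>A. Poly_Mapping.single (g i) 1) = Poly_Mapping.single (sum g A) (1::int)"
    if "finite A" for A and g :: "nat \<Rightarrow> nat \<Rightarrow>\<^sub>0 nat"
    using that by (induction A rule: finite_induct) (simp_all add: mult_single)
  have "(\<Sum>i\<in>Poly_Mapping.keys m. Poly_Mapping.single i (Poly_Mapping.lookup m i)) = m"
    by (intro poly_mapping_eqI)
       (auto simp: lookup_sum lookup_single when_def in_keys_iff sum.delta)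
  then show ?thesis by (simp add: pow prod mult_single)
qed

lemma dvd_diff_swap_vars: "Var i - Var (Suc i) dvd f - swap_vars i f"
proof -
  let ?d = "Var i - Var (Suc i)"
  define Q where "Q f \<longleftrightarrow> ?d dvd f - swap_vars i f" for f
  have mult: "Q (f * g)" if "Q f" "Q g" for f g
  proof -
    have "f * g - swap_vars i (f * g) =
          f * (g - swap_vars i g) + (f - swap_vars i f) * swap_vars i g"
      by (simp add: swap_vars_mult algebra_simps)
    then show ?thesis using that unfolding Q_def by simp
  qed
  have add: "Q (f + g)" if "Q f" "Q g" for f g
  proof -
    have "f + g - swap_vars i (f + g) = (f - swap_vars i f) + (g - swap_vars i g)"
      by (simp add: swap_vars_add)
    then show ?thesis using that unfolding Q_def by (metis dvd_add)
  qed
  have one: "Q 1" by (simp add: Q_def)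
  have var: "Q (Var k)" for k
  proof -
    consider "k = i" | "k = Suc i" | "transpose i (Suc i) k = k"
      using transpose_apply_other[of k i "Suc i"] by blast
    then show ?thesis
    proof cases
      case 2
      then have "Var k - swap_vars i (Var k) = ?d * (- 1)"
        by (simp add: swap_vars_Var)
      then show ?thesis unfolding Q_def by (rule dvdI)
    qed (simp_all add: Q_def swap_vars_Var)
  qed
  have "Q (Var k ^ e)" for k e by (induction e) (simp_all add: one mult var)
  then have prod: "Q (\<Prod>i\<in>A. Var i ^ e i)" for A e
    by (induction A rule: infinite_finite_induct) (simp_all add: one mult)
  have "Q (Poly_Mapping.single m c)" for m c
    by (subst monomial_decomp) (intro mult prod, simp add: Q_def swap_vars_const)
  then have "Q f"
    by (induction f rule: ipoly_induct) (simp_all add: add, simp add: Q_def)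
  then show ?thesis by (simp add: Q_def)
qed

theorem divided_difference: "(Var i - Var (Suc i)) * div_diff i f = f - swap_vars i f"
proof -
  obtain g where g: "f - swap_vars i f = (Var i - Var (Suc i)) * g"
    using dvd_diff_swap_vars by (rule dvdE)
  have "(Var i - Var (Suc i)) * (THE g. (Var i - Var (Suc i)) * g = f - swap_vars i f) =
        f - swap_vars i f"
    by (rule theI[of _ g]) (use g Var_diff_nonzero[of i "Suc i"] in auto)
  then show ?thesis by (simp add: div_diff_def)
qed

subsection \<open>Braid relations\<close>

lemma K_div_diff_eq:
  "(Var i - Var (Suc i)) * K_div_diff i f =
   (1 - Var (Suc i)) * f - (1 - Var i) * swap_vars i f"
  by (simp add: K_div_diff_def divided_difference swap_vars_mult swap_vars_diff
      swap_vars_Var)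

lemma K_div_diff_commute:
  assumes "i \<noteq> j" "Suc i \<noteq> j" "Suc j \<noteq> i"
  shows "K_div_diff i (K_div_diff j f) = K_div_diff j (K_div_diff i f)"
proof -
  have *: "(Var i - Var (Suc i)) * ((Var j - Var (Suc j)) *
        K_div_diff j (K_div_diff i f)) =
      (1 - Var (Suc j)) * (1 - Var (Suc i)) * f - (1 - Var (Suc j)) * (1 - Var i) * swap_vars i f
      - (1 - Var j) * (1 - Var (Suc i)) * swap_vars j f
      + (1 - Var j) * (1 - Var i) * swap_vars j (swap_vars i f)"
    if ij: "i \<noteq> j" "Suc i \<noteq> j" "Suc j \<noteq> i" for i j
  proof -
    let ?g = "K_div_diff i f"
    have 1: "(Var i - Var (Suc i)) * ?g = (1 - Var (Suc i)) * f - (1 - Var i) * swap_vars i f"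
      by (rule K_div_diff_eq)
    have 2: "(Var i - Var (Suc i)) * swap_vars j ?g =
             (1 - Var (Suc i)) * swap_vars j f - (1 - Var i) * swap_vars j (swap_vars i f)"
      using arg_cong[OF 1, of "swap_vars j"] ij
      by (simp add: swap_vars_mult swap_vars_diff swap_vars_Var transpose_def)
    have "(Var i - Var (Suc i)) * ((Var j - Var (Suc j)) * K_div_diff j ?g) =
      (1 - Var (Suc j)) * ((Var i - Var (Suc i)) * ?g)
      - (1 - Var j) * ((Var i - Var (Suc i)) * swap_vars j ?g)"
      unfolding K_div_diff_eq[of j] by (simp add: algebra_simps)
    then show ?thesis unfolding 1 2 by (simp add: algebra_simps)
  qed
  have "(Var i - Var (Suc i)) * ((Var j - Var (Suc j)) *
          K_div_diff i (K_div_diff j f)) =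
        (Var i - Var (Suc i)) * ((Var j - Var (Suc j)) *
          K_div_diff j (K_div_diff i f))"
    unfolding *[OF assms] using *[of j i] assms swap_vars_commute[OF assms, of f]
    by (simp add: algebra_simps)
  then show ?thesis
    using Var_diff_nonzero[of i "Suc i"] Var_diff_nonzero[of j "Suc j"] by simp
qed

lemma braid_ring:
  fixes a b c :: "'a :: idom"
  assumes "(a - b) * g = (1 - b) * f - (1 - a) * sf"
      and "(a - c) * tg = (1 - c) * tf - (1 - a) * tsf"
      and "(b - c) * stg = (1 - c) * stf - (1 - b) * stsf"
      and "(b - c) * h = (1 - c) * g - (1 - b) * tg"
      and "(a - c) * sh = (1 - c) * g - (1 - a) * stg"
      and "(a - b) * k = (1 - b) * h - (1 - a) * sh"
      and "a \<noteq> b"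
  shows "(a - b) * (b - c) * (a - c) * k =
     (1 - b) * (1 - c)^2 * f - (1 - a) * (1 - c)^2 * sf - (1 - b)^2 * (1 - c) * tf
     + (1 - b)^2 * (1 - a) * tsf + (1 - a)^2 * (1 - c) * stf - (1 - a)^2 * (1 - b) * stsf"
    (is "?l = ?r")
proof -
  have "(a - b) * ?l = (a - b) * (b - c) * (a - c) * ((a - b) * k)"
    by algebra
  also have "\<dots> = (a - b) * (1 - b) * (a - c) * ((b - c) * h)
                 - (a - b) * (1 - a) * (b - c) * ((a - c) * sh)"
    unfolding assms(6) by algebra
  also have "\<dots> = (1 - b) * (a - c) * (1 - c) * ((a - b) * g)
                 - (a - b) * (1 - b)^2 * ((a - c) * tg)
                 - (1 - a) * (b - c) * (1 - c) * ((a - b) * g)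
                 + (a - b) * (1 - a)^2 * ((b - c) * stg)"
    unfolding assms(4,5) by algebra
  also have "\<dots> = (a - b) * ?r"
    unfolding assms(1,2,3) by algebra
  finally show ?thesis using assms(7) by simp
qed

lemma swap_K_div_diff: "swap_vars i (K_div_diff i f) = K_div_diff i f"
proof -
  have "(Var (Suc i) - Var i) * swap_vars i (K_div_diff i f) =
        (1 - Var i) * swap_vars i f - (1 - Var (Suc i)) * f"
    using arg_cong[OF K_div_diff_eq[of i f], of "swap_vars i"]
    by (simp add: swap_vars_mult swap_vars_diff swap_vars_Var swap_vars_invol)
  then have "(Var i - Var (Suc i)) * swap_vars i (K_div_diff i f) =
             (Var i - Var (Suc i)) * K_div_diff i f"
    unfolding K_div_diff_eq by (simp add: algebra_simps)
  then show ?thesis using Var_diff_nonzero[of i "Suc i"] by simp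
qed

lemma K_div_diff_braid:
  "K_div_diff i (K_div_diff (Suc i) (K_div_diff i f)) =
   K_div_diff (Suc i) (K_div_diff i (K_div_diff (Suc i) f))"
proof -
  define j where "j = Suc i"
  define a b c where "a = Var i" and "b = Var (Suc i)" and "c = Var (Suc (Suc i))"
  note abc = a_def[symmetric] b_def[symmetric] c_def[symmetric]
  let ?s = "swap_vars i" and ?t = "swap_vars j"
  let ?D = "K_div_diff i" and ?E = "K_div_diff j"
  have v: "?s a = b" "?s b = a" "?s c = c" "?t a = a" "?t b = c" "?t c = b"
    by (simp_all add: a_def b_def c_def j_def swap_vars_Var transpose_def)
  note hom = swap_vars_mult swap_vars_diff v
  have ne: "a \<noteq> b" "b \<noteq> c" "a \<noteq> c"
    using Var_diff_nonzero[of i "Suc i"] Var_diff_nonzero[of "Suc i" "Suc (Suc i)"]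
      Var_diff_nonzero[of i "Suc (Suc i)"] by (auto simp: a_def b_def c_def)
  have D: "(a - b) * ?D p = (1 - b) * p - (1 - a) * ?s p" for p
    using K_div_diff_eq[of i p] by (simp add: abc)
  have E: "(b - c) * ?E p = (1 - c) * p - (1 - b) * ?t p" for p
    using K_div_diff_eq[of j p] by (simp add: j_def abc)
  have tD: "(a - c) * ?t (?D p) = (1 - c) * ?t p - (1 - a) * ?t (?s p)" for p
    using arg_cong[OF D, of ?t p] by (simp add: hom)
  have sE: "(a - c) * ?s (?E p) = (1 - c) * ?s p - (1 - a) * ?s (?t p)" for p
    using arg_cong[OF E, of ?s p] by (simp add: hom)
  have stD: "(b - c) * ?s (?t (?D p)) = (1 - c) * ?s (?t p) - (1 - b) * ?s (?t (?s p))" for p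
    using arg_cong[OF tD, of ?s p] by (simp add: hom)
  have tsE: "(a - b) * ?t (?s (?E p)) = (1 - b) * ?t (?s p) - (1 - a) * ?t (?s (?t p))" for p
    using arg_cong[OF sE, of ?t p] by (simp add: hom)
  have "(a - b) * (b - c) * (a - c) * ?D (?E (?D f)) =
     (1 - b) * (1 - c)^2 * f - (1 - a) * (1 - c)^2 * ?s f - (1 - b)^2 * (1 - c) * ?t f
     + (1 - b)^2 * (1 - a) * ?t (?s f) + (1 - a)^2 * (1 - c) * ?s (?t f)
     - (1 - a)^2 * (1 - b) * ?s (?t (?s f))"
    by (rule braid_ring[OF D tD stD E _ D ne(1)]) (simp add: sE swap_K_div_diff)
  moreover have "(a - b) * (b - c) * (a - c) * ?E (?D (?E f)) =
     (1 - b) * (1 - c)^2 * f - (1 - a) * (1 - c)^2 * ?s f - (1 - b)^2 * (1 - c) * ?t f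
     + (1 - b)^2 * (1 - a) * ?t (?s f) + (1 - a)^2 * (1 - c) * ?s (?t f)
     - (1 - a)^2 * (1 - b) * ?t (?s (?t f))" (is "?l = ?r")
  proof -
    have tDE: "(a - c) * ?t (?D (?E f)) = (1 - c) * ?E f - (1 - a) * ?t (?s (?E f))"
      using tD[of "?E f"] by (simp add: swap_K_div_diff)
    have "(b - c) * ?l = (a - b) * (b - c) * (a - c) * ((b - c) * ?E (?D (?E f)))"
      by algebra
    also have "\<dots> = (b - c) * (1 - c) * (a - c) * ((a - b) * ?D (?E f))
                 - (b - c) * (1 - b) * (a - b) * ((a - c) * ?t (?D (?E f)))"
      unfolding E by algebra
    also have "\<dots> = (1 - c) * (a - c) * (1 - b) * ((b - c) * ?E f)
                   - (b - c) * (1 - c) * (1 - a) * ((a - c) * ?s (?E f))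
                   - (1 - b) * (a - b) * (1 - c) * ((b - c) * ?E f)
                   + (b - c) * (1 - b) * (1 - a) * ((a - b) * ?t (?s (?E f)))"
      unfolding D tDE by algebra
    also have "\<dots> = (b - c) * ?r"
      unfolding E sE tsE by algebra
    finally show ?thesis using ne by simp
  qed
  moreover have "?s (?t (?s f)) = ?t (?s (?t f))"
    by (simp add: j_def swap_vars_braid)
  ultimately have "(a - b) * (b - c) * (a - c) * ?D (?E (?D f)) =
                   (a - b) * (b - c) * (a - c) * ?E (?D (?E f))"
    by simp
  then show ?thesis using ne by (simp add: j_def)
qed

subsection \<open>Length and ascents\<close>

lemma permutes_comp_adj:
  assumes "w permutes {1..n}" "i \<in> {1..<n}"
  shows "w \<circ> transpose i (Suc i) permutes {1..n}"
  using assms by (intro permutes_compose permutes_swap_id) auto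

lemma inv_length_ascent:
  assumes w: "w permutes {1..n}" and i: "i \<in> {1..<n}" and asc: "w i < w (Suc i)"
  shows "inv_length n (w \<circ> transpose i (Suc i)) = Suc (inv_length n w)"
proof -
  let ?s = "transpose i (Suc i)"
  let ?I = "\<lambda>w. {(i, j). i \<in> {1..n} \<and> j \<in> {1..n} \<and> i < j \<and> w j < w i}"
  have fin: "finite (?I w)"
    by (rule finite_subset[of _ "{1..n} \<times> {1..n}"]) auto
  have s_in: "?s p \<in> {1..n} \<longleftrightarrow> p \<in> {1..n}" for p
    using i by (auto simp: transpose_def)
  have s_less: "?s p < ?s q" if "p < q" "(p, q) \<noteq> (i, Suc i)" for p q
    using that by (auto simp: transpose_def)
  have "?I (w \<circ> ?s) = insert (i, Suc i) (map_prod ?s ?s ` ?I w)"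
  proof (intro equalityI subsetI)
    fix x assume "x \<in> ?I (w \<circ> ?s)"
    then obtain p q where x: "x = (p, q)" "p \<in> {1..n}" "q \<in> {1..n}" "p < q" "w (?s q) < w (?s p)"
      by auto
    show "x \<in> insert (i, Suc i) (map_prod ?s ?s ` ?I w)"
    proof (cases "(p, q) = (i, Suc i)")
      case False
      have "(?s p, ?s q) \<in> ?I w"
        using x s_less[OF x(4) False] s_in[of p] s_in[of q] by auto
      then have "map_prod ?s ?s (?s p, ?s q) \<in> map_prod ?s ?s ` ?I w"
        by (rule imageI)
      then show ?thesis using x by simp
    qed (use x in simp)
  next
    fix x assume "x \<in> insert (i, Suc i) (map_prod ?s ?s ` ?I w)"
    then consider "x = (i, Suc i)" | p q where "x = (?s p, ?s q)" "(p, q) \<in> ?I w"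
      by auto
    then show "x \<in> ?I (w \<circ> ?s)"
    proof cases
      case 1
      then show ?thesis using i asc by auto
    next
      case 2
      then have "(p, q) \<noteq> (i, Suc i)" using asc by auto
      then show ?thesis
        using 2 s_less[of p q] s_in[of p] s_in[of q] by auto
    qed
  qed
  moreover have "(i, Suc i) \<notin> map_prod ?s ?s ` ?I w"
  proof
    assume "(i, Suc i) \<in> map_prod ?s ?s ` ?I w"
    then obtain p q where "(p, q) \<in> ?I w" "i = ?s p" "Suc i = ?s q"
      by (fastforce simp only: map_prod_simp prod.inject elim: imageE)
    then have "p = Suc i" "q = i"
      by (metis transpose_apply_first transpose_apply_second transpose_involutory)+
    with \<open>(p, q) \<in> ?I w\<close> show False by auto
  qed
  moreover have "inj_on (map_prod ?s ?s) (?I w)"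
    by (rule inj_on_subset[OF prod.inj_map subset_UNIV]) simp_all
  ultimately show ?thesis
    unfolding inv_length_def using fin by (simp add: card_image)
qed

lemma inv_length_less_iff:
  assumes w: "w permutes {1..n}" and i: "i \<in> {1..<n}"
  shows "inv_length n w < inv_length n (w \<circ> transpose i (Suc i)) \<longleftrightarrow> w i < w (Suc i)"
proof (cases "w i < w (Suc i)")
  case False
  have "w i \<noteq> w (Suc i)"
    using permutes_inj[OF w] by (metis injD n_not_Suc_n)
  then have "inv_length n ((w \<circ> transpose i (Suc i)) \<circ> transpose i (Suc i)) =
        Suc (inv_length n (w \<circ> transpose i (Suc i)))"
    using False by (intro inv_length_ascent permutes_comp_adj assms) auto
  then show ?thesis using False by (simp add: comp_assoc)
qed (use inv_length_ascent[OF assms] in simp)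

lemma inv_length_le: "inv_length n w \<le> n * n"
proof -
  have "inv_length n w \<le> card ({1..n} \<times> {1..n})"
    unfolding inv_length_def by (rule card_mono) auto
  then show ?thesis by simp
qed

lemma longest_perm_permutes: "longest_perm n permutes {1..n}"
proof (rule bij_imp_permutes)
  show "bij_betw (longest_perm n) {1..n} {1..n}"
    by (rule bij_betw_byWitness[where f' = "longest_perm n"]) (auto simp: longest_perm_def)
qed (auto simp: longest_perm_def)

lemma no_ascent_imp_longest:
  assumes w: "w permutes {1..n}" and desc: "\<And>i. i \<in> {1..<n} \<Longrightarrow> \<not> w i < w (Suc i)"
  shows "w = longest_perm n"
proof -
  have bounds: "w i \<in> {1..n}" if "i \<in> {1..n}" for i
    using permutes_in_image[OF w] that by simp
  have step: "w (Suc i) < w i" if "i \<in> {1..<n}" for i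
  proof -
    have "w i \<noteq> w (Suc i)" using permutes_inj[OF w] by (metis injD n_not_Suc_n)
    then show ?thesis using desc[OF that] by simp
  qed
  have up: "w i + i \<le> n + 1" if "1 \<le> i" "i \<le> n" for i
    using that
  proof (induction i rule: nat_induct_at_least)
    case base
    then show ?case using bounds[of 1] by simp
  next
    case (Suc i)
    then show ?case using step[of i] by simp
  qed
  have lo: "n + 1 \<le> w i + i" if "i \<le> n" "1 \<le> i" for i
    using that
  proof (induction i rule: inc_induct)
    case base
    then show ?case using bounds[of n] by simp
  next
    case (step i)
    then show ?case using \<open>\<And>i. i \<in> {1..<n} \<Longrightarrow> w (Suc i) < w i\<close>[of i] by simp
  qed
  show ?thesis
  proof
    fix i
    show "w i = longest_perm n i"
    proof (cases "i \<in> {1..n}")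
      case True
      then show ?thesis using up[of i] lo[of i] by (simp add: longest_perm_def)
    next
      case False
      then show ?thesis using permutes_not_in[OF w] by (auto simp: longest_perm_def)
    qed
  qed
qed

lemma longest_no_ascent: "i \<in> {1..<n} \<Longrightarrow> \<not> longest_perm n i < longest_perm n (Suc i)"
  by (auto simp: longest_perm_def)

subsection \<open>Existence and uniqueness\<close>

lemma is_grothendieck_asc:
  assumes "w permutes {1..n}" "i \<in> {1..<n}" "w i < w (Suc i)"
    and "is_grothendieck n (w \<circ> transpose i (Suc i)) f"
  shows "is_grothendieck n w (K_div_diff i f)"
  using assms by (intro is_grothendieck.step) (simp_all add: inv_length_less_iff)

lemma is_grothendieck_ex:
  assumes "w permutes {1..n}"
  shows "\<exists>f. is_grothendieck n w f"
  using assms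
proof (induction "n * n - inv_length n w" arbitrary: w rule: less_induct)
  case less
  show ?case
  proof (cases "\<exists>i\<in>{1..<n}. w i < w (Suc i)")
    case True
    then obtain i where i: "i \<in> {1..<n}" "w i < w (Suc i)" by blast
    let ?u = "w \<circ> transpose i (Suc i)"
    have "inv_length n ?u = Suc (inv_length n w)"
      using inv_length_ascent less.prems i by blast
    then have "n * n - inv_length n ?u < n * n - inv_length n w"
      using inv_length_le[of n ?u] by simp
    then show ?thesis
      using less.hyps permutes_comp_adj[OF less.prems i(1)] is_grothendieck_asc[OF less.prems i]
      by blast
  next
    case False
    then have "w = longest_perm n" using no_ascent_imp_longest less.prems by blast
    then show ?thesis using is_grothendieck.longest by blast
  qed
qed

lemma is_grothendieck_cases:
  assumes "is_grothendieck n w f"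
  obtains "w = longest_perm n" "f = (\<Prod>i\<in>{1..n}. Var i ^ (n - i))"
  | i g where "i \<in> {1..<n}" "w i < w (Suc i)" "f = K_div_diff i g"
      "is_grothendieck n (w \<circ> transpose i (Suc i)) g"
  using assms by cases (auto simp: inv_length_less_iff)

lemma is_grothendieck_unique:
  assumes "w permutes {1..n}" "is_grothendieck n w f" "is_grothendieck n w f'"
  shows "f = f'"
  using assms
proof (induction "n * n - inv_length n w" arbitrary: w f f' rule: less_induct)
  case less
  note w = less.prems(1)
  have IH: "g = g'"
    if i: "i \<in> {1..<n}" "w i < w (Suc i)"
      and g: "is_grothendieck n (w \<circ> transpose i (Suc i)) g"
             "is_grothendieck n (w \<circ> transpose i (Suc i)) g'" for i g g'
  proof (rule less.hyps[OF _ permutes_comp_adj[OF w i(1)] g])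
    show "n * n - inv_length n (w \<circ> transpose i (Suc i)) < n * n - inv_length n w"
      using inv_length_ascent[OF w i] inv_length_le[of n "w \<circ> transpose i (Suc i)"] by simp
  qed
  have main: "K_div_diff i g = K_div_diff j g'"
    if i: "i \<in> {1..<n}" "w i < w (Suc i)" and j: "j \<in> {1..<n}" "w j < w (Suc j)" and "i < j"
      and g: "is_grothendieck n (w \<circ> transpose i (Suc i)) g"
      and g': "is_grothendieck n (w \<circ> transpose j (Suc j)) g'" for i j g g'
  proof (cases "j = Suc i")
    case False
    let ?s = "transpose i (Suc i)" and ?t = "transpose j (Suc j)"
    have comm: "w \<circ> ?t \<circ> ?s = w \<circ> ?s \<circ> ?t"
      using \<open>i < j\<close> False by (auto simp: fun_eq_iff transpose_def)
    have ws: "w \<circ> ?s permutes {1..n}" and wt: "w \<circ> ?t permutes {1..n}"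
      using permutes_comp_adj[OF w] i j by blast+
    obtain h where h: "is_grothendieck n (w \<circ> ?s \<circ> ?t) h"
      using is_grothendieck_ex permutes_comp_adj[OF ws j(1)] by blast
    have "is_grothendieck n (w \<circ> ?s) (K_div_diff j h)"
      by (rule is_grothendieck_asc[OF ws j(1) _ h])
         (use \<open>i < j\<close> False j in \<open>auto simp: transpose_def\<close>)
    moreover have "is_grothendieck n (w \<circ> ?t) (K_div_diff i h)"
      by (rule is_grothendieck_asc[OF wt i(1)])
         (use \<open>i < j\<close> False i h comm in \<open>auto simp: transpose_def\<close>)
    ultimately have "g = K_div_diff j h" "g' = K_div_diff i h"
      using IH[OF i g] IH[OF j g'] by blast+
    then show ?thesis
      using K_div_diff_commute[of i j h] \<open>i < j\<close> False by simp
  next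
    case True
    let ?s = "transpose i (Suc i)" and ?t = "transpose (Suc i) (Suc (Suc i))"
    have j': "Suc i \<in> {1..<n}" using j True by simp
    have braid: "w \<circ> ?t \<circ> ?s \<circ> ?t = w \<circ> ?s \<circ> ?t \<circ> ?s"
      by (auto simp: fun_eq_iff transpose_def)
    have ws: "w \<circ> ?s permutes {1..n}" and wt: "w \<circ> ?t permutes {1..n}"
      using permutes_comp_adj[OF w] i j' by blast+
    have wst: "w \<circ> ?s \<circ> ?t permutes {1..n}" and wts: "w \<circ> ?t \<circ> ?s permutes {1..n}"
      using permutes_comp_adj[OF ws j'] permutes_comp_adj[OF wt i(1)] by blast+
    obtain h where h: "is_grothendieck n (w \<circ> ?s \<circ> ?t \<circ> ?s) h"
      using is_grothendieck_ex permutes_comp_adj[OF wst i(1)] by blast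
    have "is_grothendieck n (w \<circ> ?s \<circ> ?t) (K_div_diff i h)"
      by (rule is_grothendieck_asc[OF wst i(1) _ h])
         (use j True in \<open>simp add: transpose_def\<close>)
    then have "is_grothendieck n (w \<circ> ?s) (K_div_diff (Suc i) (K_div_diff i h))"
      by (rule is_grothendieck_asc[OF ws j', rotated])
         (use i j True in \<open>simp add: transpose_def\<close>)
    moreover have "is_grothendieck n (w \<circ> ?t \<circ> ?s) (K_div_diff (Suc i) h)"
      by (rule is_grothendieck_asc[OF wts j'])
         (use i h braid in \<open>simp_all add: transpose_def\<close>)
    then have "is_grothendieck n (w \<circ> ?t) (K_div_diff i (K_div_diff (Suc i) h))"
      by (rule is_grothendieck_asc[OF wt i(1), rotated])
         (use i j True in \<open>simp add: transpose_def\<close>)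
    ultimately have "g = K_div_diff (Suc i) (K_div_diff i h)"
      "g' = K_div_diff i (K_div_diff (Suc i) h)"
      using IH[OF i g] IH[OF j g'] True by blast+
    then show ?thesis
      using K_div_diff_braid[of i h] True by simp
  qed
  from less.prems(2) show ?case
  proof (cases rule: is_grothendieck_cases)
    case 1
    from less.prems(3) show ?thesis
      by (cases rule: is_grothendieck_cases) (use 1 longest_no_ascent in blast)+
  next
    case (2 i g)
    from less.prems(3) show ?thesis
    proof (cases rule: is_grothendieck_cases)
      case 1
      then show ?thesis using 2 longest_no_ascent by blast
    next
      case (2 j g')
      note f' = this
      note f = \<open>i \<in> {1..<n}\<close> \<open>w i < w (Suc i)\<close> \<open>f = K_div_diff i g\<close>
        \<open>is_grothendieck n (w \<circ> transpose i (Suc i)) g\<close>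
      consider "i = j" | "i < j" | "j < i" by linarith
      then show ?thesis
      proof cases
        case 1
        then show ?thesis using IH f f' by blast
      next
        case 2
        then show ?thesis using main[of i j g g'] f f' by simp
      next
        case 3
        then show ?thesis using main[of j i g' g] f f' by simp
      qed
    qed
  qed
qed

lemma grothendieck_eqI:
  assumes "w permutes {1..n}" "is_grothendieck n w f"
  shows "grothendieck n w = f"
  unfolding grothendieck_def
  by (rule the_equality) (fact assms(2), rule is_grothendieck_unique[OF assms(1) _ assms(2)])

theorem grothendieck_longest:
  "grothendieck n (longest_perm n) = (\<Prod>i\<in>{1..n}. Var i ^ (n - i))"
  by (intro grothendieck_eqI longest_perm_permutes is_grothendieck.longest)

theorem grothendieck_step:
  assumes w: "w permutes {1..n}" and i: "i \<in> {1..<n}"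
    and len: "inv_length n w < inv_length n (w \<circ> transpose i (Suc i))"
  shows "grothendieck n w = K_div_diff i (grothendieck n (w \<circ> transpose i (Suc i)))"
proof -
  obtain g where g: "is_grothendieck n (w \<circ> transpose i (Suc i)) g"
    using is_grothendieck_ex[OF permutes_comp_adj[OF w i]] by blast
  have "grothendieck n (w \<circ> transpose i (Suc i)) = g"
    by (rule grothendieck_eqI[OF permutes_comp_adj[OF w i] g])
  then show ?thesis
    using grothendieck_eqI[OF w is_grothendieck.step[OF w i len g]] by simp
qed

end

theory Submission
  imports Defs
begin

text \<open>
  Substituting \<open>-x\<close> for \<open>x\<close> and dividing by a sign turns the Grothendieck polynomial of \<open>w\<close> into
  \<open>pgroth n w\<close>, which has the same support and satisfies the recursion with \<open>1 + x\<^sub>i\<^sub>+\<^sub>1\<close> in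
  place of \<open>1 - x\<^sub>i\<^sub>+\<^sub>1\<close>. All coefficients of \<open>pgroth n w\<close> and of its divided differences are
  nonnegative (\<open>pgroth_nonneg\<close>), so nothing cancels in what follows.

  If the letter 1 stands at position \<open>k\<close> of \<open>w\<close>, then \<open>pgroth\<close> of \<open>w\<close> is \<open>x\<^sub>1 \<cdots> x\<^sub>k\<^sub>-\<^sub>1\<close> times
  the result of applying the operators \<open>lascoux_op m, \<dots>, lascoux_op k\<close> to \<open>pgroth\<close> of the
  permutation with that letter removed (\<open>pgroth_insert_one\<close>). For fireworks permutations this
  determines the support: it is a Minkowski sum of families \<open>cols D\<close> of 0/1 vectors, one for
  each descent of \<open>w\<close>, where \<open>cols D\<close> consists of the sets \<open>C\<close> in \<open>{1..Max D}\<close> with at least as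
  many elements as \<open>D\<close> in every initial interval. Applying \<open>lascoux_op i\<close> replaces \<open>i\<close> by
  \<open>i + 1\<close> in every \<open>D\<close> (\<open>lascoux_op_support\<close>), and the factor \<open>x\<^sub>1 \<cdots> x\<^sub>k\<^sub>-\<^sub>1\<close> adds the set
  \<open>{1..k - 1}\<close> (\<open>fireworks_support\<close>). The operator statement needs distinct maxima of the sets
  \<open>D\<close>. These are the descents of the permutation, and the fireworks condition guarantees that
  \<open>k - 1\<close> is not yet a descent when the set \<open>{1..k - 1}\<close> is added.

  M-convexity of such a sum, homogenized, is proved by an exchange of paths
  (\<open>hom_sums_M_convex\<close>). For every \<open>D\<close>, the elements of \<open>C - B\<close> are paired with those of
  \<open>B - C\<close>, or with the homogenizing variable, in such a way that any set of pairs may be swapped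
  without leaving \<open>cols D\<close>. Where the first exponent exceeds the second, a path along pairs
  leads to a coordinate where it is smaller, and swapping the pairs on this path is the
  exchange.

  The rest holds for every polynomial with M-convex homogenized support. The maxima of
  coordinate sums over a finite M-convex set form a submodular function whose base polytope is
  the convex hull, and the set contains every lattice point of it
  (\<open>m_convex_generalized_permutahedron\<close>, \<open>m_convex_lattice_points\<close>); the homogeneous components
  are slices, and the support of the polynomial itself is a coordinate projection.

  Log-concavity of the slice sizes is an instance of the Alexandrov--Fenchel inequality for
  Lorentzian polynomials (\<open>alexandrov_fenchel\<close>). The polynomials are encoded as weights on
  subsets of a finite set, which corresponds to multiaffine polynomials. The Lorentzian
  polynomial attached to an M-convex set \<open>S\<close> counts \<open>\<alpha> \<in> S\<close> with weight \<open>1 / \<alpha>!\<close>, not with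
  weight 1. To obtain equal weights, \<open>S\<close> is multiplied by the M-convex set of all vectors \<open>\<beta>\<close> of
  fixed coordinate sum with entries at most \<open>M\<close>, and derivatives are taken in directions that
  force \<open>\<beta>\<close> to complement \<open>\<alpha>\<close>; the factorials then combine with binomial coefficients to a
  constant (\<open>m_exchange_slices_log_concave\<close>).
\<close>

section \<open>Divided differences\<close>

lemma div_diff_eqI:
  assumes "(Var i - Var (Suc i)) * g = f - swap_vars i f"
  shows "div_diff i f = g"
  using assms divided_difference[of i f] Var_diff_nonzero[of i "Suc i"] by (metis mult_left_cancel n_not_Suc_n)

lemma div_diff_add: "div_diff i (f + g) = div_diff i f + div_diff i g"
  by (rule div_diff_eqI) (simp add: distrib_left divided_difference swap_vars_add)

lemma div_diff_mult:
  "div_diff i (f * g) = f * div_diff i g + div_diff i f * swap_vars i g"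
proof (rule div_diff_eqI)
  have "(Var i - Var (Suc i)) * (f * div_diff i g + div_diff i f * swap_vars i g) =
    f * ((Var i - Var (Suc i)) * div_diff i g) + ((Var i - Var (Suc i)) * div_diff i f) * swap_vars i g"
    by (simp add: algebra_simps)
  also have "\<dots> = f * g - swap_vars i (f * g)"
    unfolding divided_difference swap_vars_mult by (simp add: algebra_simps)
  finally show "(Var i - Var (Suc i)) * (f * div_diff i g + div_diff i f * swap_vars i g) =
    f * g - swap_vars i (f * g)" .
qed

lemma div_diff_sym: "swap_vars i f = f \<Longrightarrow> div_diff i f = 0"
  by (rule div_diff_eqI) simp

lemma div_diff_mult_sym: "swap_vars i c = c \<Longrightarrow> div_diff i (c * f) = c * div_diff i f"
  by (simp add: div_diff_mult div_diff_sym)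

lemma div_diff_Var: "div_diff i (Var i) = 1"
  by (rule div_diff_eqI) (simp add: swap_vars_Var)

lemma div_diff_Var_Suc: "div_diff i (Var (Suc i)) = - 1"
  by (rule div_diff_eqI) (simp add: swap_vars_Var)

lemma swap_div_diff: "swap_vars i (div_diff i f) = div_diff i f"
proof -
  have "swap_vars i ((Var i - Var (Suc i)) * div_diff i f) = swap_vars i (f - swap_vars i f)"
    by (simp add: divided_difference)
  then have "(Var i - Var (Suc i)) * swap_vars i (div_diff i f) = f - swap_vars i f"
    by (simp add: swap_vars_mult swap_vars_diff swap_vars_Var swap_vars_invol algebra_simps)
  then show ?thesis using div_diff_eqI by metis
qed

lemma swap_div_diff_commute:
  assumes "i \<noteq> j" "Suc i \<noteq> j" "Suc j \<noteq> i"
  shows "swap_vars j (div_diff i f) = div_diff i (swap_vars j f)"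
proof (rule div_diff_eqI[symmetric])
  have "swap_vars j ((Var i - Var (Suc i)) * div_diff i f) = swap_vars j (f - swap_vars i f)"
    by (simp add: divided_difference)
  then show "(Var i - Var (Suc i)) * swap_vars j (div_diff i f) =
    swap_vars j f - swap_vars i (swap_vars j f)"
    using assms by (simp add: swap_vars_mult swap_vars_diff swap_vars_Var transpose_def
        swap_vars_commute)
qed

lemma div_diff_commute:
  assumes "i \<noteq> j" "Suc i \<noteq> j" "Suc j \<noteq> i"
  shows "div_diff i (div_diff j f) = div_diff j (div_diff i f)"
proof (rule div_diff_eqI)
  let ?x = "Var i - Var (Suc i)" and ?y = "Var j - Var (Suc j)"
  have s: "swap_vars i ?y = ?y" "swap_vars j ?x = ?x"
    using assms by (simp_all add: swap_vars_diff swap_vars_Var transpose_def)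
  have "?y * (?x * div_diff j (div_diff i f)) =
      ?x * (div_diff i f - swap_vars j (div_diff i f))"
    unfolding divided_difference[of j "div_diff i f", symmetric] by (simp add: algebra_simps)
  also have "\<dots> = (f - swap_vars i f) - (swap_vars j f - swap_vars i (swap_vars j f))"
    unfolding right_diff_distrib swap_div_diff_commute[OF assms] divided_difference ..
  also have "\<dots> = (f - swap_vars j f) - (swap_vars i f - swap_vars j (swap_vars i f))"
    using swap_vars_commute[OF assms] by simp
  also have "\<dots> = ?y * (div_diff j f) - ?y * swap_vars i (div_diff j f)"
    using assms by (simp add: swap_div_diff_commute[of j i] divided_difference)
  finally have "?y * (?x * div_diff j (div_diff i f)) =
     ?y * (div_diff j f - swap_vars i (div_diff j f))" by (simp add: algebra_simps)
  then show "?x * div_diff j (div_diff i f) = div_diff j f - swap_vars i (div_diff j f)"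
    using Var_diff_nonzero[of j "Suc j"] by simp
qed

text \<open>
  The operator of the Grothendieck recursion after the substitution of \<open>-x\<close> for \<open>x\<close>.
\<close>

definition pdd :: "nat \<Rightarrow> ipoly \<Rightarrow> ipoly" where
  "pdd i f = div_diff i ((1 + Var (Suc i)) * f)"

text \<open>
  The isobaric version of \<open>pdd\<close>; these operators define the Lascoux polynomials, up to signs.
\<close>

definition lascoux_op :: "nat \<Rightarrow> ipoly \<Rightarrow> ipoly" where
  "lascoux_op i f = pdd i (Var i * f)"

lemma pdd_eq: "pdd i f = (1 + Var i) * div_diff i f - f"
proof -
  have "div_diff i (1 + Var (Suc i)) = -1"
    by (simp add: div_diff_add div_diff_Var_Suc div_diff_sym)
  then have "div_diff i (f * (1 + Var (Suc i))) = f * (- 1) + div_diff i f * (1 + Var i)"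
    by (simp add: div_diff_mult swap_vars_add swap_vars_Var)
  then show ?thesis
    by (simp add: pdd_def mult.commute[of _ f] mult.commute[of _ "1 + Var i"])
qed

lemma lascoux_op_eq_dd: "lascoux_op i f = f + Var (Suc i) * (1 + Var i) * div_diff i f"
  using div_diff_mult[of i f "Var i"]
  by (simp add: lascoux_op_def pdd_eq div_diff_Var swap_vars_Var algebra_simps)

lemma lascoux_op_eq: "lascoux_op i f = (1 + Var (Suc i)) * f + Var (Suc i) * pdd i f"
  by (simp add: lascoux_op_eq_dd pdd_eq algebra_simps)

lemma lascoux_op_add: "lascoux_op i (f + g) = lascoux_op i f + lascoux_op i g"
  by (simp add: lascoux_op_eq_dd div_diff_add algebra_simps)

lemma lascoux_op_mult_sym: "swap_vars i c = c \<Longrightarrow> lascoux_op i (c * f) = c * lascoux_op i f"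
  by (simp add: lascoux_op_eq_dd div_diff_mult_sym algebra_simps)

lemma lascoux_op_sym: "swap_vars i f = f \<Longrightarrow> lascoux_op i f = f"
  by (simp add: lascoux_op_eq_dd div_diff_sym)

lemma swap_lascoux_op: "swap_vars i (lascoux_op i f) = lascoux_op i f"
  unfolding lascoux_op_def pdd_def by (rule swap_div_diff)

lemma swap_pdd: "swap_vars i (pdd i f) = pdd i f"
  unfolding pdd_def by (rule swap_div_diff)

lemma swap_lascoux_op_commute:
  assumes "i \<noteq> j" "Suc i \<noteq> j" "Suc j \<noteq> i"
  shows "swap_vars j (lascoux_op i f) = lascoux_op i (swap_vars j f)"
  using assms
  by (simp add: lascoux_op_eq_dd swap_vars_add swap_vars_mult swap_div_diff_commute swap_vars_Var
      transpose_def)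

lemma div_diff_lascoux_op_commute:
  assumes "i \<noteq> j" "Suc i \<noteq> j" "Suc j \<noteq> i"
  shows "div_diff j (lascoux_op i f) = lascoux_op i (div_diff j f)"
proof -
  have "swap_vars j (Var (Suc i) * (1 + Var i)) = Var (Suc i) * (1 + Var i)"
    using assms by (simp add: swap_vars_mult swap_vars_add swap_vars_Var transpose_def)
  then show ?thesis
    using assms by (simp add: lascoux_op_eq_dd div_diff_add div_diff_mult_sym div_diff_commute)
qed

lemma pdd_mult_sym: "swap_vars i c = c \<Longrightarrow> pdd i (c * f) = c * pdd i f"
  by (simp add: pdd_eq div_diff_mult_sym algebra_simps)

section \<open>Grothendieck polynomials with positive signs\<close>

lemma mon_degree_superset:
  assumes "finite A" "Poly_Mapping.keys m \<subseteq> A"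
  shows "mon_degree m = (\<Sum>i\<in>A. Poly_Mapping.lookup m i)"
  unfolding mon_degree_def
  by (rule sum.mono_neutral_left) (use assms in \<open>auto simp: in_keys_iff\<close>)

lemma mon_degree_add: "mon_degree (m + m') = mon_degree m + mon_degree m'"
proof -
  let ?A = "Poly_Mapping.keys m \<union> Poly_Mapping.keys m'"
  have "Poly_Mapping.keys (m + m') \<subseteq> ?A" by (rule keys_add)
  then show ?thesis
    by (simp add: mon_degree_superset[of ?A] lookup_add sum.distrib)
qed

lemma mon_degree_single [simp]: "mon_degree (Poly_Mapping.single i k) = k"
  by (simp add: mon_degree_superset[of "{i}"])

lemma mon_degree_zero [simp]: "mon_degree 0 = 0"
  by (simp add: mon_degree_def)

definition twist :: "ipoly \<Rightarrow> ipoly" where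
  "twist f = Poly_Mapping.mapp (\<lambda>m c. (-1) ^ mon_degree m * c) f"

lemma lookup_twist: "Poly_Mapping.lookup (twist f) m = (-1) ^ mon_degree m * Poly_Mapping.lookup f m"
  unfolding twist_def by (simp add: lookup_mapp when_def in_keys_iff)

lemma keys_twist: "Poly_Mapping.keys (twist f) = Poly_Mapping.keys f"
  by (auto simp: in_keys_iff lookup_twist)

lemma twist_add: "twist (f + g) = twist f + twist g"
  by (intro poly_mapping_eqI) (simp add: lookup_twist lookup_add algebra_simps)

lemma twist_minus: "twist (f - g) = twist f - twist g"
  by (intro poly_mapping_eqI) (simp add: lookup_twist lookup_minus algebra_simps)

lemma twist_zero [simp]: "twist 0 = 0"
  by (intro poly_mapping_eqI) (simp add: lookup_twist)

lemma twist_single: "twist (Poly_Mapping.single m c) = Poly_Mapping.single m ((-1) ^ mon_degree m * c)"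
  by (intro poly_mapping_eqI) (simp add: lookup_twist lookup_single when_def)

lemma twist_one [simp]: "twist 1 = 1"
  using twist_single[of 0 1] by simp

lemma twist_Var: "twist (Var i) = - Var i"
  unfolding Var_def by (simp add: twist_single single_uminus)

lemma twist_mult: "twist (f * g) = twist f * twist g"
proof (induction f rule: ipoly_induct)
  case (add m c f)
  have "twist (Poly_Mapping.single m c * g) = twist (Poly_Mapping.single m c) * twist g"
    by (induction g rule: ipoly_induct)
       (simp_all add: twist_add twist_single mult_single mon_degree_add power_add distrib_left mult_ac)
  then show ?case using add by (simp add: twist_add distrib_right)
qed simp

lemma mon_degree_swap: "mon_degree (Poly_Mapping.map_key (transpose i (Suc i)) m) = mon_degree m"
proof -
  have k: "Poly_Mapping.keys (Poly_Mapping.map_key (transpose i (Suc i)) m) =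
     transpose i (Suc i) ` Poly_Mapping.keys m"
    by (auto simp: keys_map_key intro!: image_eqI[of _ _ "transpose i (Suc i) _"])
  have "inj_on (transpose i (Suc i)) (Poly_Mapping.keys m)"
    by (rule inj_on_subset[OF inj_transpose]) simp
  then show ?thesis unfolding mon_degree_def k
    by (subst sum.reindex) (simp_all add: map_key.rep_eq)
qed

lemma lookup_swap_vars:
  "Poly_Mapping.lookup (swap_vars i f) m =
   Poly_Mapping.lookup f (Poly_Mapping.map_key (transpose i (Suc i)) m)"
  unfolding swap_vars_def by (simp add: map_key.rep_eq inj_swap_exp)

lemma twist_swap_vars: "twist (swap_vars i f) = swap_vars i (twist f)"
  by (intro poly_mapping_eqI) (simp add: lookup_twist lookup_swap_vars mon_degree_swap)

lemma twist_div_diff: "twist (div_diff i f) = - div_diff i (twist f)"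
proof -
  have "twist ((Var i - Var (Suc i)) * div_diff i f) = twist (f - swap_vars i f)"
    by (simp add: divided_difference)
  then have "div_diff i (twist f) = - twist (div_diff i f)"
    by (intro div_diff_eqI) (simp add: twist_mult twist_minus twist_Var twist_swap_vars algebra_simps)
  then show ?thesis by simp
qed

lemma twist_K_div_diff: "twist (K_div_diff i f) = - pdd i (twist f)"
  by (simp add: K_div_diff_def pdd_def twist_div_diff twist_mult twist_minus twist_Var)

text \<open>
  The exponent is the degree \<open>\<Sum> (n - i)\<close> of the monomial for the longest element plus the number
  of steps from the longest element down to \<open>w\<close>, up to parity; \<open>twist\<close> contributes one sign for
  each unit of this degree and one for each step.
\<close>

definition pgroth :: "nat \<Rightarrow> (nat \<Rightarrow> nat) \<Rightarrow> ipoly" where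
  "pgroth n w = (-1) ^ ((\<Sum>i\<in>{1..n}. n - i) + inv_length n (longest_perm n) + inv_length n w)
     * twist (grothendieck n w)"

lemma keys_pgroth: "Poly_Mapping.keys (pgroth n w) = Poly_Mapping.keys (grothendieck n w)"
proof -
  have "Poly_Mapping.keys ((-1) ^ k * f) = Poly_Mapping.keys f" for k and f :: ipoly
    by (cases "even k") (auto simp: in_keys_iff)
  then show ?thesis by (simp add: pgroth_def keys_twist)
qed

lemma pgroth_longest: "pgroth n (longest_perm n) = (\<Prod>i\<in>{1..n}. Var i ^ (n - i))"
proof -
  have p: "twist (Var i ^ k) = (-1) ^ k * Var i ^ k" for i k
    by (induction k) (simp_all add: twist_mult twist_Var)
  have "twist (\<Prod>i\<in>A. Var i ^ (n - i)) = (-1) ^ (\<Sum>i\<in>A. n - i) * (\<Prod>i\<in>A. Var i ^ (n - i))"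
    if "finite A" for A
    using that by induction (simp_all add: twist_mult p power_add mult_ac)
  then have t: "twist (\<Prod>i\<in>{1..n}. Var i ^ (n - i)) =
    (-1) ^ (\<Sum>i\<in>{1..n}. n - i) * (\<Prod>i\<in>{1..n}. Var i ^ (n - i))" by simp
  show ?thesis
    unfolding pgroth_def grothendieck_longest t mult.assoc[symmetric] power_add[symmetric]
    by (auto simp: minus_one_power_iff)
qed

lemma pgroth_step:
  assumes "w permutes {1..n}" "i \<in> {1..<n}" "w i < w (Suc i)"
  shows "pgroth n w = pdd i (pgroth n (w \<circ> transpose i (Suc i)))"
proof -
  have s: "pdd i ((-1) ^ k * f) = (-1) ^ k * pdd i f" for k f
    by (rule pdd_mult_sym, cases "even k") (use swap_vars_diff[of i 0 1] in simp_all)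
  have "grothendieck n w = K_div_diff i (grothendieck n (w \<circ> transpose i (Suc i)))"
    using assms by (intro grothendieck_step) (simp_all add: inv_length_less_iff)
  then show ?thesis
    unfolding pgroth_def using inv_length_ascent[OF assms]
    by (simp only: s twist_K_div_diff) simp
qed

text \<open>
  Descending induction on the length: a permutation without ascents is the longest one.
\<close>

lemma perm_ascent_induct [consumes 1, case_names longest ascent]:
  assumes "w permutes {1..n}" and "P (longest_perm n)"
    and "\<And>w i. \<lbrakk>w permutes {1..n}; i \<in> {1..<n}; w i < w (Suc i); P (w \<circ> transpose i (Suc i))\<rbrakk> \<Longrightarrow> P w"
  shows "P w"
  using assms(1)
proof (induction "n * n - inv_length n w" arbitrary: w rule: less_induct)
  case less
  show ?case
  proof (cases "\<exists>i\<in>{1..<n}. w i < w (Suc i)")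
    case True
    then obtain i where i: "i \<in> {1..<n}" "w i < w (Suc i)" by blast
    let ?u = "w \<circ> transpose i (Suc i)"
    have "n * n - inv_length n ?u < n * n - inv_length n w"
      using inv_length_le[of n ?u] inv_length_ascent[OF less.prems i] by simp
    then show ?thesis
      using less.hyps permutes_comp_adj[OF less.prems i(1)] assms(3)[OF less.prems i] by blast
  next
    case False
    then show ?thesis using no_ascent_imp_longest[OF less.prems] assms(2) by metis
  qed
qed

section \<open>Removing the letter 1\<close>

text \<open>
  In one-line notation: every letter of \<open>v\<close> is raised by one, and the letter 1 is inserted at
  position \<open>k\<close>.
\<close>

definition insert_one :: "nat \<Rightarrow> (nat \<Rightarrow> nat) \<Rightarrow> nat \<Rightarrow> nat" where
  "insert_one k v i =
     (if i = 0 then 0 else if i < k then Suc (v i) else if i = k then 1 else Suc (v (i - 1)))"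

lemma permutes_interval_iff:
  fixes v :: "nat \<Rightarrow> nat"
  shows "v permutes {1..m} \<longleftrightarrow> inj_on v {1..m} \<and> v ` {1..m} \<subseteq> {1..m} \<and> (\<forall>i. i \<notin> {1..m} \<longrightarrow> v i = i)"
proof
  assume "v permutes {1..m}"
  then show "inj_on v {1..m} \<and> v ` {1..m} \<subseteq> {1..m} \<and> (\<forall>i. i \<notin> {1..m} \<longrightarrow> v i = i)"
    by (auto simp: permutes_inj_on permutes_not_in dest: permutes_in_image[THEN iffD2])
next
  assume *: "inj_on v {1..m} \<and> v ` {1..m} \<subseteq> {1..m} \<and> (\<forall>i. i \<notin> {1..m} \<longrightarrow> v i = i)"
  then have "v ` {1..m} = {1..m}" by (intro endo_inj_surj) auto
  with * show "v permutes {1..m}" by (intro bij_imp_permutes) (auto simp: bij_betw_def)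
qed

lemma permutes_zero: "v permutes {1..m::nat} \<Longrightarrow> v i = 0 \<longleftrightarrow> i = 0"
  by (metis atLeastAtMost_iff not_one_le_zero permutes_def)

lemma insert_one_permutes:
  assumes v: "v permutes {1..m}" and k: "k \<in> {1..Suc m}"
  shows "insert_one k v permutes {1..Suc m}"
  unfolding permutes_interval_iff
proof (intro conjI inj_onI subsetI allI impI)
  have inj: "v a = v b \<longleftrightarrow> a = b" for a b by (simp add: inj_eq permutes_inj[OF v])
  fix a b assume *: "a \<in> {1..Suc m}" "b \<in> {1..Suc m}" "insert_one k v a = insert_one k v b"
  have v0: "v i = 0 \<longleftrightarrow> i = 0" for i using permutes_zero[OF v] .
  have *: "1 \<le> a" "1 \<le> b" "insert_one k v a = insert_one k v b" using * by auto
  consider "a < k" | "a = k" | "k < a" by linarith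
  then show "a = b"
  proof cases
    case 1
    then show ?thesis using * inj v0[of a]
      by (cases b k rule: linorder_cases) (auto simp: insert_one_def)
  next
    case 2
    then show ?thesis using * inj v0[of b] v0[of "b - 1"]
      by (cases b k rule: linorder_cases) (auto simp: insert_one_def)
  next
    case 3
    then show ?thesis using * inj v0[of "a - 1"] k
      by (cases b k rule: linorder_cases) (auto simp: insert_one_def)
  qed
next
  have in_m: "v i \<le> m" if "i \<le> m" for i
    using permutes_in_image[OF v, of i] permutes_zero[OF v, of i] that by (cases "i = 0") auto
  fix a assume "a \<in> insert_one k v ` {1..Suc m}"
  then obtain i where "i \<in> {1..Suc m}" "a = insert_one k v i" by auto
  then show "a \<in> {1..Suc m}"
    using in_m[of i] in_m[of "i - 1"] k by (auto simp: insert_one_def)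
next
  fix i assume i: "i \<notin> {1..Suc m}"
  show "insert_one k v i = i"
  proof (cases "i = 0")
    case False
    then have "v (i - 1) = i - 1" using i by (intro permutes_not_in[OF v]) auto
    then show ?thesis using False i k by (auto simp: insert_one_def)
  qed (simp add: insert_one_def)
qed

lemma insert_one_cases:
  assumes w: "w permutes {1..Suc m}"
  obtains k v where "k \<in> {1..Suc m}" "v permutes {1..m}" "w = insert_one k v"
proof -
  obtain k where k: "w k = 1"
    using permutes_surj[OF w] by (metis surjD)
  have kin: "k \<in> {1..Suc m}" using permutes_not_in[OF w, of k] k by auto
  have inj: "w a = w b \<longleftrightarrow> a = b" for a b by (simp add: inj_eq permutes_inj[OF w])
  have ge: "2 \<le> w i" if "i \<noteq> k" "i \<noteq> 0" for i
  proof -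
    have "w i \<noteq> 1" using k inj that by metis
    moreover have "w i \<noteq> 0" using permutes_zero[OF w] that by simp
    ultimately show ?thesis by linarith
  qed
  have in_m: "w i \<le> Suc m" if "i \<le> Suc m" for i
    using permutes_in_image[OF w, of i] permutes_zero[OF w, of i] that by (cases "i = 0") auto
  define v where "v i = (if i = 0 then 0 else if i < k then w i - 1 else w (Suc i) - 1)" for i
  have "v permutes {1..m}"
    unfolding permutes_interval_iff
  proof (intro conjI inj_onI subsetI allI impI)
    fix a b assume *: "a \<in> {1..m}" "b \<in> {1..m}" "v a = v b"
    have "w (if a < k then a else Suc a) = w (if b < k then b else Suc b)"
      using * ge[of a] ge[of "Suc a"] ge[of b] ge[of "Suc b"]
      by (auto simp: v_def split: if_splits)
    then show "a = b" unfolding inj by (auto split: if_splits)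
  next
    fix a assume "a \<in> v ` {1..m}"
    then obtain i where i: "i \<in> {1..m}" "a = v i" by auto
    then show "a \<in> {1..m}"
      using ge[of i] ge[of "Suc i"] in_m[of i] in_m[of "Suc i"] by (auto simp: v_def)
  next
    fix i assume "i \<notin> {1..m}"
    then show "v i = i" using kin permutes_not_in[OF w, of "Suc i"] by (auto simp: v_def)
  qed
  moreover have "w = insert_one k v"
  proof
    fix i
    consider "i = 0" | "i = k" | "i \<noteq> k" "i \<noteq> 0" by blast
    then show "w i = insert_one k v i"
    proof cases
      case 3
      then show ?thesis using ge[of i] kin by (auto simp: insert_one_def v_def)
    qed (use permutes_zero[OF w] k kin in \<open>auto simp: insert_one_def\<close>)
  qed
  ultimately show ?thesis using that kin by blast
qed

lemma insert_one_swap: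
  "1 \<le> k \<Longrightarrow> insert_one k v \<circ> transpose k (Suc k) = insert_one (Suc k) v"
  by (auto simp: fun_eq_iff insert_one_def transpose_def)

lemma swap_vars_prod_Var:
  assumes "i \<in> A \<longleftrightarrow> Suc i \<in> A"
  shows "swap_vars i (\<Prod>a\<in>A. Var a) = (\<Prod>a\<in>A. Var a)"
proof -
  let ?t = "transpose i (Suc i)"
  have "swap_vars i (\<Prod>a\<in>A. Var a) = (\<Prod>a\<in>A. Var (?t a))"
    by (induction A rule: infinite_finite_induct) (simp_all add: swap_vars_mult swap_vars_Var)
  also have "\<dots> = (\<Prod>a\<in>?t ` A. Var a)"
    by (subst prod.reindex) (simp_all add: inj_on_subset[OF inj_transpose])
  also have "?t ` A = A" using assms by (rule transpose_image_eq)
  finally show ?thesis .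
qed

text \<open>
  A 1 in the last position is never moved by the recursion from \<open>v\<close> up to the longest element,
  and the extra factor is symmetric in all variables concerned, so it passes through every
  operator.
\<close>

lemma pgroth_insert_last:
  assumes "v permutes {1..m}"
  shows "pgroth (Suc m) (insert_one (Suc m) v) = (\<Prod>i\<in>{1..m}. Var i) * pgroth m v"
  using assms
proof (induction rule: perm_ascent_induct)
  case longest
  have "insert_one (Suc m) (longest_perm m) = longest_perm (Suc m)"
    by (auto simp: fun_eq_iff insert_one_def longest_perm_def)
  moreover have "(\<Prod>i\<in>{1..Suc m}. Var i ^ (Suc m - i)) =
      (\<Prod>i\<in>{1..m}. Var i) * (\<Prod>i\<in>{1..m}. Var i ^ (m - i))"
    by (simp add: prod.nat_ivl_Suc' Suc_diff_le flip: prod.distrib)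
  ultimately show ?case by (simp add: pgroth_longest)
next
  case (ascent v i)
  let ?w = "insert_one (Suc m) v"
  have "?w permutes {1..Suc m}" using insert_one_permutes[OF ascent(1)] by simp
  moreover have "?w i < ?w (Suc i)" using ascent by (simp add: insert_one_def)
  ultimately have "pgroth (Suc m) ?w = pdd i (pgroth (Suc m) (?w \<circ> transpose i (Suc i)))"
    using ascent(2) by (intro pgroth_step) auto
  also have "?w \<circ> transpose i (Suc i) = insert_one (Suc m) (v \<circ> transpose i (Suc i))"
    using ascent(2) by (auto simp: fun_eq_iff insert_one_def transpose_def)
  finally show ?case
    using ascent pgroth_step[OF ascent(1,2,3)] by (simp add: pdd_mult_sym swap_vars_prod_Var o_def)
qed

definition lascoux_chain :: "nat \<Rightarrow> nat \<Rightarrow> ipoly \<Rightarrow> ipoly" where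
  "lascoux_chain k l f = foldr lascoux_op [k..<l] f"

lemma lascoux_chain_refl [simp]: "lascoux_chain l l f = f"
  by (simp add: lascoux_chain_def)

lemma lascoux_chain_Suc: "k < l \<Longrightarrow> lascoux_chain k l f = lascoux_op k (lascoux_chain (Suc k) l f)"
  by (simp add: lascoux_chain_def upt_conv_Cons)

text \<open>
  Moving the letter 1 from position \<open>k + 1\<close> to position \<open>k\<close> is a step of the recursion. The
  factor \<open>x\<^sub>k\<close> present for position \<open>k + 1\<close> turns \<open>pdd k\<close> into \<open>lascoux_op k\<close>, and the factors
  before it are symmetric in \<open>x\<^sub>k\<close> and \<open>x\<^sub>k\<^sub>+\<^sub>1\<close>.
\<close>

lemma pgroth_insert_one:
  assumes v: "v permutes {1..m}" and k: "k \<le> Suc m" "1 \<le> k"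
  shows "pgroth (Suc m) (insert_one k v) =
    (\<Prod>i\<in>{1..<k}. Var i) * lascoux_chain k (Suc m) (pgroth m v)"
  using k
proof (induction k rule: inc_induct)
  case base
  then show ?case using pgroth_insert_last[OF v] by (simp add: atLeastLessThanSuc_atLeastAtMost)
next
  case (step k)
  have "insert_one k v permutes {1..Suc m}" using insert_one_permutes[OF v] step by simp
  moreover have "insert_one k v k < insert_one k v (Suc k)"
    using step permutes_zero[OF v, of k] by (auto simp: insert_one_def)
  ultimately have "pgroth (Suc m) (insert_one k v) = pdd k (pgroth (Suc m) (insert_one (Suc k) v))"
    using step pgroth_step[of "insert_one k v" "Suc m" k] by (simp add: insert_one_swap)
  also have "\<dots> = pdd k ((\<Prod>i\<in>{1..<k}. Var i) * (Var k * lascoux_chain (Suc k) (Suc m) (pgroth m v)))"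
    using step by (simp add: mult_ac)
  also have "\<dots> = (\<Prod>i\<in>{1..<k}. Var i) * lascoux_op k (lascoux_chain (Suc k) (Suc m) (pgroth m v))"
    unfolding lascoux_op_def by (rule pdd_mult_sym) (simp add: swap_vars_prod_Var)
  finally show ?case using step by (simp add: lascoux_chain_Suc)
qed

lemma swap_lascoux_chain:
  assumes "l < j" "swap_vars j f = f"
  shows "swap_vars j (lascoux_chain k l f) = lascoux_chain k l f"
proof (cases "k \<le> l")
  case True
  then show ?thesis
    by (induction k rule: inc_induct)
       (use assms in \<open>simp_all add: lascoux_chain_Suc swap_lascoux_op_commute\<close>)
qed (use assms in \<open>simp add: lascoux_chain_def\<close>)

text \<open>
  Only the variables \<open>x\<^sub>1, \<dots>, x\<^sub>m\<^sub>-\<^sub>1\<close> occur in \<open>pgroth m v\<close>. This form of the fact is the one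
  that the operators use.
\<close>

lemma swap_pgroth_ge:
  assumes "v permutes {1..m}" "m \<le> j"
  shows "swap_vars j (pgroth m v) = pgroth m v"
  using assms
proof (induction m arbitrary: v j)
  case 0
  then have "v = longest_perm 0" by (auto simp: fun_eq_iff longest_perm_def)
  then show ?case by (simp add: pgroth_longest)
next
  case (Suc m)
  obtain k u where k: "k \<in> {1..Suc m}" and u: "u permutes {1..m}" and v: "v = insert_one k u"
    using insert_one_cases[OF Suc.prems(1)] by blast
  have "swap_vars j (lascoux_chain k (Suc m) (pgroth m u)) = lascoux_chain k (Suc m) (pgroth m u)"
  proof (cases "k = Suc m")
    case True
    then show ?thesis using Suc.IH[OF u] Suc.prems by simp
  next
    case False
    \<comment> \<open>The outermost factor of the chain at index m acts trivially.\<close>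
    have "lascoux_chain k (Suc m) (pgroth m u) = lascoux_chain k m (pgroth m u)"
      using False k Suc.IH[OF u, of m] by (simp add: lascoux_chain_def lascoux_op_sym)
    then show ?thesis using Suc.IH[OF u] Suc.prems by (simp add: swap_lascoux_chain)
  qed
  moreover have "swap_vars j (\<Prod>i\<in>{1..<k}. Var i) = (\<Prod>i\<in>{1..<k}. Var i)"
    using k Suc.prems by (intro swap_vars_prod_Var) auto
  ultimately show ?case
    using k by (simp add: v pgroth_insert_one[OF u] swap_vars_mult)
qed

text \<open>
  At an ascent the polynomial is in the image of \<open>pdd i\<close>, hence symmetric; at a descent \<open>pdd i\<close>
  goes one step down the recursion.
\<close>

lemma pgroth_sym_or_descent:
  assumes v: "v permutes {1..m}" and i: "1 \<le> i"
  shows "swap_vars i (pgroth m v) = pgroth m v \<or>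
         (\<exists>v'. v' permutes {1..m} \<and> pdd i (pgroth m v) = pgroth m v')"
proof (cases "i < m")
  case False
  then show ?thesis using swap_pgroth_ge[OF v] by simp
next
  case True
  then have i: "i \<in> {1..<m}" using i by simp
  show ?thesis
  proof (cases "v i < v (Suc i)")
    case True
    then show ?thesis using pgroth_step[OF v i] swap_pdd by metis
  next
    case False
    let ?u = "v \<circ> transpose i (Suc i)"
    have "v i \<noteq> v (Suc i)" using permutes_inj[OF v] by (metis injD n_not_Suc_n)
    then have "pgroth m ?u = pdd i (pgroth m (?u \<circ> transpose i (Suc i)))"
      using False by (intro pgroth_step permutes_comp_adj v i) auto
    then show ?thesis using permutes_comp_adj[OF v i] by (auto simp: comp_assoc)
  qed
qed

section \<open>Nonnegative polynomials\<close>

definition nonneg_poly :: "ipoly \<Rightarrow> bool" where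
  "nonneg_poly f \<longleftrightarrow> (\<forall>m. 0 \<le> Poly_Mapping.lookup f m)"

lemma lookup_Var_mult:
  "Poly_Mapping.lookup (Var i * f) m =
   (if Poly_Mapping.lookup m i = 0 then 0
    else Poly_Mapping.lookup f (m - Poly_Mapping.single i 1))"
proof (induction f rule: ipoly_induct)
  case (add a c f)
  have "Poly_Mapping.single i 1 + a = m \<longleftrightarrow>
      Poly_Mapping.lookup m i \<noteq> 0 \<and> a = m - Poly_Mapping.single i 1"
  proof
    assume "Poly_Mapping.lookup m i \<noteq> 0 \<and> a = m - Poly_Mapping.single i 1"
    then show "Poly_Mapping.single i 1 + a = m"
      by (auto intro!: poly_mapping_eqI simp: lookup_add lookup_minus lookup_single when_def)
  qed (auto simp: lookup_add)
  then have "Poly_Mapping.lookup (Var i * Poly_Mapping.single a c) m =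
      (if Poly_Mapping.lookup m i = 0 then 0
       else Poly_Mapping.lookup (Poly_Mapping.single a c) (m - Poly_Mapping.single i 1))"
    by (auto simp: Var_def mult_single lookup_single when_def)
  then show ?case using add by (simp add: distrib_left lookup_add)
qed simp

lemma nonneg_poly_Var: "nonneg_poly f \<Longrightarrow> nonneg_poly (Var i * f)"
  by (simp add: nonneg_poly_def lookup_Var_mult)

lemma nonneg_poly_add: "nonneg_poly f \<Longrightarrow> nonneg_poly g \<Longrightarrow> nonneg_poly (f + g)"
  by (simp add: nonneg_poly_def lookup_add)

lemma nonneg_poly_zero: "nonneg_poly 0"
  by (simp add: nonneg_poly_def)

lemma nonneg_poly_prod_Var: "nonneg_poly f \<Longrightarrow> nonneg_poly ((\<Prod>i\<in>A. Var i) * f)"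
  by (induction A rule: infinite_finite_induct) (simp_all add: nonneg_poly_Var mult.assoc)

text \<open>
  Nonnegative combinations of \<open>B\<close> with coefficients in the variables of index above \<open>k\<close>. An
  operator that leaves these variables alone can be pushed through to the generators
  (\<open>var_cone_image\<close>), which is how positivity is propagated along a chain of operators.
\<close>

inductive_set var_cone :: "ipoly set \<Rightarrow> nat \<Rightarrow> ipoly set" for B k where
  base: "f \<in> B \<Longrightarrow> f \<in> var_cone B k"
| zero: "0 \<in> var_cone B k"
| add: "f \<in> var_cone B k \<Longrightarrow> g \<in> var_cone B k \<Longrightarrow> f + g \<in> var_cone B k"
| var: "f \<in> var_cone B k \<Longrightarrow> k < j \<Longrightarrow> Var j * f \<in> var_cone B k"

lemma var_cone_one_plus: "f \<in> var_cone B k \<Longrightarrow> k < j \<Longrightarrow> (1 + Var j) * f \<in> var_cone B k"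
  by (simp add: distrib_right var_cone.add var_cone.var)

lemma var_cone_nonneg: "f \<in> var_cone B k \<Longrightarrow> (\<And>b. b \<in> B \<Longrightarrow> nonneg_poly b) \<Longrightarrow> nonneg_poly f"
  by (induction rule: var_cone.induct)
     (auto intro: nonneg_poly_add nonneg_poly_zero nonneg_poly_Var)

lemma var_cone_image:
  assumes f: "f \<in> var_cone B k"
    and add: "\<And>f g. L (f + g) = L f + L g"
    and var: "\<And>j f. k < j \<Longrightarrow> L (Var j * f) = Var j * L f"
    and base: "\<And>b. b \<in> B \<Longrightarrow> L b \<in> var_cone B' k'" and "k' \<le> k"
  shows "L f \<in> var_cone B' k'"
  using f
proof induction
  case (base b)
  then show ?case by (rule assms)
next
  case zero
  have "L 0 = 0" using add[of 0 0] by simp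
  then show ?case by (simp add: var_cone.zero)
next
  case (add f g)
  then show ?case unfolding assms(2) by (intro var_cone.add)
next
  case (var f j)
  then show ?case using \<open>k' \<le> k\<close> by (simp add: assms(3) var_cone.var)
qed

definition pgroths :: "nat \<Rightarrow> ipoly set" where
  "pgroths m = pgroth m ` {u. u permutes {1..m}}"

lemma pgroths_cases:
  assumes "f \<in> pgroths m" "1 \<le> i"
  obtains (sym) "swap_vars i f = f"
  | (descent) "pdd i f \<in> pgroths m"
proof -
  obtain v where v: "v permutes {1..m}" "f = pgroth m v"
    using assms(1) by (auto simp: pgroths_def)
  from pgroth_sym_or_descent[OF v(1) assms(2)] show ?thesis
    using that v(2) by (auto simp: pgroths_def)
qed

lemma lascoux_op_cone:
  assumes "f \<in> pgroths m" "1 \<le> k" "k' \<le> k"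
  shows "lascoux_op k f \<in> var_cone (pgroths m) k'"
  using assms(1,2)
proof (cases rule: pgroths_cases)
  case sym
  then show ?thesis using assms by (simp add: lascoux_op_sym var_cone.base)
next
  case descent
  then have "f \<in> var_cone (pgroths m) k'" "pdd k f \<in> var_cone (pgroths m) k'"
    using assms by (simp_all add: var_cone.base)
  then show ?thesis unfolding lascoux_op_eq
    using assms by (simp add: var_cone.add var_cone_one_plus var_cone.var)
qed

lemma lascoux_op_Var: "j \<noteq> i \<Longrightarrow> j \<noteq> Suc i \<Longrightarrow> lascoux_op i (Var j * f) = Var j * lascoux_op i f"
  by (rule lascoux_op_mult_sym) (simp add: swap_vars_Var transpose_def)

lemma div_diff_Var_mult: "j \<noteq> i \<Longrightarrow> j \<noteq> Suc i \<Longrightarrow> div_diff i (Var j * f) = Var j * div_diff i f"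
  by (rule div_diff_mult_sym) (simp add: swap_vars_Var transpose_def)

lemma div_diff_Var_left: "div_diff i (Var i * g) = g + Var (Suc i) * div_diff i g"
proof -
  have "div_diff i (Var i * g) = div_diff i (g * Var i)" by (simp only: mult.commute)
  also have "\<dots> = g + div_diff i g * Var (Suc i)"
    unfolding div_diff_mult by (simp add: div_diff_Var swap_vars_Var)
  finally show ?thesis by (simp only: mult.commute)
qed

lemma lascoux_chain_cone:
  assumes "f \<in> pgroths m" "k \<le> l" "1 \<le> k"
  shows "lascoux_chain k l f \<in> var_cone (pgroths m) k"
  using assms(2,3)
proof (induction k rule: inc_induct)
  case base
  then show ?case using assms by (simp add: var_cone.base)
next
  case (step k)
  then have "lascoux_chain (Suc k) l f \<in> var_cone (pgroths m) (Suc k)" by simp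
  then have "lascoux_op k (lascoux_chain (Suc k) l f) \<in> var_cone (pgroths m) k"
    by (rule var_cone_image)
       (use step in \<open>auto simp: lascoux_op_add lascoux_op_Var intro: lascoux_op_cone\<close>)
  then show ?case using step by (simp add: lascoux_chain_Suc)
qed

text \<open>
  The only position at which the divided difference does not commute past the chain. Put \<open>y = x\<^sub>i\<close> and
  \<open>z = x\<^sub>i\<^sub>+\<^sub>1\<close>. Depending on whether \<open>f\<close> and \<open>pdd i f\<close> are symmetric in \<open>x\<^sub>i\<^sub>-\<^sub>1\<close> and \<open>x\<^sub>i\<close>, or else go down
  the recursion under \<open>pdd (i - 1)\<close>, the polynomial \<open>lascoux_op (i - 1) (lascoux_op i f)\<close> is a combination of
  terms whose divided difference is visible: the symmetric polynomial \<open>e = lascoux_op i f\<close>, its multiple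
  \<open>(1 + y) e\<close>, and multiples of members of \<open>pgroths m\<close> by \<open>y\<close> or \<open>y z\<close>.
\<close>

lemma div_diff_lascoux_two_cone:
  assumes f: "f \<in> pgroths m" and i: "2 \<le> i"
  shows "div_diff i (lascoux_op (i - 1) (lascoux_op i f)) \<in>
    var_cone (pgroths m \<union> div_diff i ` pgroths m) (i - 1)"
proof -
  define B where "B = var_cone (pgroths m \<union> div_diff i ` pgroths m) (i - 1)"
  define y z where "y = Var i" and "z = Var (Suc i)"
  have i1: "Suc (i - 1) = i" using i by simp
  have cadd: "g + h \<in> B" if "g \<in> B" "h \<in> B" for g h
    using that unfolding B_def by (rule var_cone.add)
  have cvar: "y * g \<in> B" "z * g \<in> B" if "g \<in> B" for g
    using that i unfolding B_def y_def z_def by (auto intro!: var_cone.var simp del: One_nat_def)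
  note clos = cadd cvar
  have pg: "g \<in> B" "div_diff i g \<in> B" if "g \<in> pgroths m" for g
    using that by (auto simp: B_def intro: var_cone.base)
  have zero: "0 \<in> B" by (simp add: B_def var_cone.zero)
  have up: "lascoux_op (i - 1) g = g \<or>
    (\<exists>g'\<in>pgroths m. lascoux_op (i - 1) g = (1 + y) * g + y * g')" if g: "g \<in> pgroths m" for g
  proof -
    have "1 \<le> i - 1" using i by simp
    with g show ?thesis
    proof (cases rule: pgroths_cases)
      case sym
      then show ?thesis by (simp add: lascoux_op_sym)
    next
      case descent
      then show ?thesis unfolding lascoux_op_eq i1 y_def by blast
    qed
  qed
  have dy: "div_diff i (y * g) = g + z * div_diff i g" for g
    unfolding y_def z_def by (rule div_diff_Var_left)
  have dyz: "div_diff i (y * (z * g)) = y * (z * div_diff i g)" for g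
  proof -
    have "swap_vars i (y * z) = y * z"
      unfolding y_def z_def swap_vars_mult swap_vars_Var by (simp add: mult.commute)
    from div_diff_mult_sym[OF this, of g] show ?thesis by (simp only: mult.assoc)
  qed
  note add = div_diff_add
  have dsym: "div_diff i ((1 + y) * e) = e" if "swap_vars i e = e" for e
    using that by (simp add: distrib_right add dy div_diff_sym)
  have "1 \<le> i" using i by simp
  with f have "div_diff i (lascoux_op (i - 1) (lascoux_op i f)) \<in> B"
  proof (cases rule: pgroths_cases)
    case sym
    then have L: "lascoux_op i f = f" by (rule lascoux_op_sym)
    from up[OF f] show ?thesis
    proof (elim disjE bexE)
      assume "lascoux_op (i - 1) f = f"
      then show ?thesis using L sym zero by (simp add: div_diff_sym)
    next
      fix f' assume f': "f' \<in> pgroths m" "lascoux_op (i - 1) f = (1 + y) * f + y * f'"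
      then show ?thesis using pg[OF f] pg[OF f'(1)]
        by (simp add: L add dsym[OF sym] dy clos)
    qed
  next
    case descent
    define f1 where "f1 = pdd i f"
    have f1: "f1 \<in> pgroths m" "swap_vars i f1 = f1"
      using descent by (simp_all add: f1_def swap_pdd)
    define e where "e = lascoux_op i f"
    have e: "e = (1 + z) * f + z * f1" by (simp add: e_def lascoux_op_eq f1_def z_def)
    have eB: "e \<in> B" using pg f f1 by (simp add: e distrib_right clos)
    have esym: "swap_vars i e = e" by (simp add: e_def swap_lascoux_op)
    have d1: "div_diff i f1 = 0" using f1 by (simp add: div_diff_sym)
    have "lascoux_op (i - 1) (z * g) = z * lascoux_op (i - 1) g" for g
      unfolding z_def using i by (intro lascoux_op_Var) auto
    then have Le: "lascoux_op (i - 1) e = (1 + z) * lascoux_op (i - 1) f + z * lascoux_op (i - 1) f1"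
      by (simp add: e distrib_right lascoux_op_add)
    \<comment> \<open>In the mixed case where only \<open>f1\<close> is fixed by \<open>lascoux_op (i - 1)\<close>, the identity for \<open>e\<close>
    has the extra term \<open>y z f1\<close> on the left; its divided difference vanishes because \<open>f1\<close> and
    \<open>y z\<close> are symmetric.\<close>
    from up[OF f] up[OF f1(1)] show ?thesis unfolding e_def[symmetric]
    proof (elim disjE bexE)
      assume "lascoux_op (i - 1) f = f" "lascoux_op (i - 1) f1 = f1"
      then have "lascoux_op (i - 1) e = e" using Le e by simp
      then show "div_diff i (lascoux_op (i - 1) e) \<in> B" using zero esym by (simp add: div_diff_sym)
    next
      fix f1' assume *: "lascoux_op (i - 1) f = f" "f1' \<in> pgroths m"
        "lascoux_op (i - 1) f1 = (1 + y) * f1 + y * f1'"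
      have "lascoux_op (i - 1) e = e + y * (z * f1) + y * (z * f1')"
        unfolding Le unfolding * by (simp add: e algebra_simps)
      then show "div_diff i (lascoux_op (i - 1) e) \<in> B" using pg *(2) esym zero
        by (simp add: add dyz d1 div_diff_sym clos)
    next
      fix f' assume *: "lascoux_op (i - 1) f1 = f1" "f' \<in> pgroths m"
        "lascoux_op (i - 1) f = (1 + y) * f + y * f'"
      have "lascoux_op (i - 1) e + y * (z * f1) = (1 + y) * e + y * f' + y * (z * f')"
        unfolding Le unfolding * by (simp add: e algebra_simps)
      then have "div_diff i (lascoux_op (i - 1) e) + y * (z * div_diff i f1) =
         e + (f' + z * div_diff i f') + y * (z * div_diff i f')"
        by (metis add dy dyz dsym[OF esym])
      then show "div_diff i (lascoux_op (i - 1) e) \<in> B" using pg *(2) eB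
        by (simp add: d1 clos)
    next
      fix f' f1' assume *: "f' \<in> pgroths m" "f1' \<in> pgroths m"
        "lascoux_op (i - 1) f = (1 + y) * f + y * f'" "lascoux_op (i - 1) f1 = (1 + y) * f1 + y * f1'"
      have "lascoux_op (i - 1) e = (1 + y) * e + y * f' + y * (z * f') + y * (z * f1')"
        unfolding Le unfolding * by (simp add: e algebra_simps)
      then have "div_diff i (lascoux_op (i - 1) e) = div_diff i ((1 + y) * e) + div_diff i (y * f') +
          y * (z * div_diff i f') + y * (z * div_diff i f1')"
        by (simp only: add dyz)
      then show "div_diff i (lascoux_op (i - 1) e) \<in> B" using pg *(1,2) eB
        by (simp add: dy dsym[OF esym] clos)
    qed
  qed
  then show ?thesis by (simp add: B_def)
qed

text \<open>
  For \<open>l < i - 1\<close> the divided difference commutes with \<open>lascoux_op l\<close>, so the claim is carried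
  down the chain from \<open>l = i - 1\<close>, where it is \<open>div_diff_lascoux_two_cone\<close>.
\<close>

lemma div_diff_chain_cone:
  assumes f: "f \<in> pgroths m" and k: "1 \<le> k" "k < i" "i \<le> m"
  shows "div_diff i (lascoux_chain k (Suc m) f) \<in> var_cone (pgroths m \<union> div_diff i ` pgroths m) k"
proof -
  define B where "B = pgroths m \<union> div_diff i ` pgroths m"
  have "k \<le> i - 1" using k by simp
  then have "div_diff i (lascoux_chain k (Suc m) f) \<in> var_cone B k" using k(1)
  proof (induction k rule: inc_induct)
    case base
    have "lascoux_chain (i - 1) (Suc m) f =
        lascoux_op (i - 1) (lascoux_op i (lascoux_chain (Suc i) (Suc m) f))"
      using k lascoux_chain_Suc[of "i - 1" "Suc m" f] lascoux_chain_Suc[of i "Suc m" f] by simp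
    moreover have "lascoux_chain (Suc i) (Suc m) f \<in> var_cone (pgroths m) (Suc i)"
      using f k by (intro lascoux_chain_cone) auto
    then have "div_diff i (lascoux_op (i - 1) (lascoux_op i (lascoux_chain (Suc i) (Suc m) f)))
        \<in> var_cone B (i - 1)"
    proof (rule var_cone_image)
      fix b assume "b \<in> pgroths m"
      then show "div_diff i (lascoux_op (i - 1) (lascoux_op i b)) \<in> var_cone B (i - 1)"
        unfolding B_def using k by (intro div_diff_lascoux_two_cone) auto
    qed (use k in \<open>auto simp: lascoux_op_add div_diff_add lascoux_op_Var div_diff_Var_mult\<close>)
    ultimately show ?case by simp
  next
    case (step l)
    have "div_diff i (lascoux_chain (Suc l) (Suc m) f) \<in> var_cone B (Suc l)"
      using step by simp
    then have "lascoux_op l (div_diff i (lascoux_chain (Suc l) (Suc m) f)) \<in> var_cone B l"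
    proof (rule var_cone_image)
      fix b assume "b \<in> B"
      then consider "b \<in> pgroths m" | g where "g \<in> pgroths m" "b = div_diff i g"
        by (auto simp: B_def)
      then show "lascoux_op l b \<in> var_cone B l"
      proof cases
        case 1
        have "lascoux_op l b \<in> var_cone (pgroths m) l" using 1 step by (intro lascoux_op_cone) auto
        then show ?thesis
          by (rule var_cone_image[where L = "\<lambda>x. x"]) (auto simp: B_def intro: var_cone.base)
      next
        case 2
        have "lascoux_op l b = div_diff i (lascoux_op l g)"
          unfolding 2 using step by (intro div_diff_lascoux_op_commute[symmetric]) auto
        moreover have "div_diff i (lascoux_op l g) \<in> var_cone B l"
          using 2(1) step(4)
        proof (cases rule: pgroths_cases)
          case sym
          then show ?thesis using 2 by (auto simp: lascoux_op_sym B_def intro: var_cone.base)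
        next
          case descent
          have dv: "div_diff i (Var (Suc l) * h) = Var (Suc l) * div_diff i h" for h
            using step by (intro div_diff_Var_mult) auto
          have "div_diff i g \<in> var_cone B l" "div_diff i (pdd l g) \<in> var_cone B l"
            using 2 descent by (auto simp: B_def intro: var_cone.base)
          then show ?thesis
            unfolding lascoux_op_eq distrib_right div_diff_add dv
            by (auto intro!: var_cone.add var_cone.var)
        qed
        ultimately show ?thesis by simp
      qed
    qed (use step in \<open>auto simp: lascoux_op_add lascoux_op_Var\<close>)
    moreover have "div_diff i (lascoux_chain l (Suc m) f) =
       lascoux_op l (div_diff i (lascoux_chain (Suc l) (Suc m) f))"
      using step k by (subst lascoux_chain_Suc) (auto intro: div_diff_lascoux_op_commute)
    ultimately show ?case by simp
  qed
  then show ?thesis by (simp add: B_def)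
qed

text \<open>
  Both claims are needed together: the induction removes the letter 1 and expresses either one
  for \<open>m + 1\<close> by both for \<open>m\<close>. The case distinction compares \<open>i\<close> with the position \<open>k\<close> of the
  letter 1. For \<open>i = k\<close> there is an ascent and the divided difference is zero.
\<close>

theorem pgroth_nonneg:
  assumes "v permutes {1..m}"
  shows "nonneg_poly (pgroth m v)" and "1 \<le> i \<Longrightarrow> nonneg_poly (div_diff i (pgroth m v))"
proof -
  have "nonneg_poly (pgroth m v) \<and> (\<forall>i\<ge>1. nonneg_poly (div_diff i (pgroth m v)))"
    using assms
  proof (induction m arbitrary: v)
    case 0
    then have "v = longest_perm 0" by (auto simp: fun_eq_iff longest_perm_def)
    then show ?case
      by (simp add: pgroth_longest div_diff_sym nonneg_poly_zero)
         (simp add: nonneg_poly_def lookup_one when_def)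
  next
    case (Suc m)
    have IH: "nonneg_poly f" "1 \<le> i \<Longrightarrow> nonneg_poly (div_diff i f)" if "f \<in> pgroths m" for f i
      using Suc.IH that by (auto simp: pgroths_def)
    obtain k u where k: "k \<in> {1..Suc m}" and u: "u permutes {1..m}" and v: "v = insert_one k u"
      using insert_one_cases[OF Suc.prems(1)] by blast
    define P H where "P = (\<Prod>i\<in>{1..<k}. Var i)" and "H = lascoux_chain k (Suc m) (pgroth m u)"
    have G: "pgroth (Suc m) v = P * H"
      using k u by (simp add: v P_def H_def pgroth_insert_one)
    have pu: "pgroth m u \<in> pgroths m" using u by (simp add: pgroths_def)
    then have Hc: "H \<in> var_cone (pgroths m) k"
      unfolding H_def using k by (intro lascoux_chain_cone) auto
    have H0: "nonneg_poly H" using var_cone_nonneg[OF Hc] IH by blast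
    have small: "nonneg_poly (div_diff i H)" if "i < k" "1 \<le> i" for i
    proof -
      have "div_diff i H \<in> var_cone (div_diff i ` pgroths m) k"
        by (rule var_cone_image[OF Hc])
           (use that in \<open>auto simp: div_diff_add div_diff_Var_mult intro: var_cone.base\<close>)
      then show ?thesis by (rule var_cone_nonneg) (use IH that in auto)
    qed
    have "nonneg_poly (div_diff i (P * H))" if i: "1 \<le> i" for i
    proof -
      consider "i = k - 1" "2 \<le> k" | "i < k - 1" | "i = k" "k \<le> m" | "k < i" "i \<le> m" | "Suc m \<le> i"
        using k i by fastforce
      then show ?thesis
      proof cases
        case 1
        have "{1..<k} = insert i {1..<i}" using 1 by auto
        then have PH: "P * H = (\<Prod>j\<in>{1..<i}. Var j) * (Var i * H)"
          by (simp add: P_def mult_ac)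
        have "swap_vars i (\<Prod>j\<in>{1..<i}. Var j) = (\<Prod>j\<in>{1..<i}. Var j)"
          by (rule swap_vars_prod_Var) simp
        then have "div_diff i (P * H) =
            (\<Prod>j\<in>{1..<i}. Var j) * (H + Var (Suc i) * div_diff i H)"
          unfolding PH by (simp add: div_diff_mult_sym div_diff_Var_left)
        moreover have "nonneg_poly (div_diff i H)" using small[of i] 1 i by simp
        ultimately show ?thesis
          using H0 by (simp add: nonneg_poly_prod_Var nonneg_poly_add nonneg_poly_Var)
      next
        case 2
        then have "swap_vars i P = P" unfolding P_def using i by (intro swap_vars_prod_Var) auto
        then show ?thesis
          using small[of i] 2 i by (simp add: div_diff_mult_sym nonneg_poly_prod_Var P_def)
      next
        case 3
        then have "swap_vars i P = P" unfolding P_def using i by (intro swap_vars_prod_Var) auto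
        moreover have "swap_vars i H = H"
          using 3 by (simp add: H_def lascoux_chain_Suc swap_lascoux_op)
        ultimately show ?thesis
          by (simp add: div_diff_sym swap_vars_mult nonneg_poly_zero)
      next
        case 4
        then have "swap_vars i P = P" unfolding P_def using i by (intro swap_vars_prod_Var) auto
        moreover have "nonneg_poly (div_diff i H)"
          unfolding H_def by (rule var_cone_nonneg[OF div_diff_chain_cone[OF pu]])
            (use 4 k i IH in auto)
        ultimately show ?thesis by (simp add: div_diff_mult_sym nonneg_poly_prod_Var P_def)
      next
        case 5
        then show ?thesis
          using swap_pgroth_ge[OF Suc.prems 5] by (simp add: G[symmetric] div_diff_sym nonneg_poly_zero)
      qed
    qed
    then show ?case using H0 by (simp add: G) (simp add: P_def nonneg_poly_prod_Var)
  qed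
  then show "nonneg_poly (pgroth m v)" and "1 \<le> i \<Longrightarrow> nonneg_poly (div_diff i (pgroth m v))"
    by auto
qed

section \<open>Sums of column sets\<close>

definition cnt :: "nat set \<Rightarrow> nat \<Rightarrow> nat" where
  "cnt C t = card (C \<inter> {1..t})"

text \<open>
  Equivalently, \<open>C\<close> contains a set that is obtained from \<open>D\<close> by moving elements down, and \<open>C\<close>
  has no element above \<open>Max D\<close>.
\<close>

definition cols :: "nat set \<Rightarrow> nat set set" where
  "cols D = {C. C \<subseteq> {1..Max D} \<and> (\<forall>t. cnt D t \<le> cnt C t)}"

text \<open>
  The Minkowski sum of the families \<open>\<phi> k\<close>, a set being read as its 0/1 indicator vector. The
  index set allows the same family to occur several times.
\<close>

definition col_sums :: "'k set \<Rightarrow> ('k \<Rightarrow> nat set set) \<Rightarrow> (nat \<Rightarrow>\<^sub>0 nat) set" where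
  "col_sums K \<phi> = {m. \<exists>C. (\<forall>k\<in>K. C k \<in> \<phi> k) \<and>
     (\<forall>i. Poly_Mapping.lookup m i = card {k \<in> K. i \<in> C k})}"

definition move_up :: "nat \<Rightarrow> nat set \<Rightarrow> nat set" where
  "move_up i D = (if i \<in> D then insert (Suc i) (D - {i}) else D)"

lemma cnt_Suc: "cnt C (Suc t) = cnt C t + of_bool (Suc t \<in> C)"
proof -
  have "C \<inter> {1..Suc t} = (if Suc t \<in> C then insert (Suc t) (C \<inter> {1..t}) else C \<inter> {1..t})"
    by (auto simp: le_Suc_eq)
  then show ?thesis by (simp add: cnt_def)
qed

lemma cnt_pred: "1 \<le> i \<Longrightarrow> cnt C i = cnt C (i - 1) + of_bool (i \<in> C)"
  using cnt_Suc[of C "i - 1"] by simp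

lemma cnt_mono: "C \<subseteq> C' \<Longrightarrow> cnt C t \<le> cnt C' t"
  unfolding cnt_def by (intro card_mono) auto

lemma cnt_cong: "(\<And>j. 1 \<le> j \<Longrightarrow> j \<le> t \<Longrightarrow> j \<in> C \<longleftrightarrow> j \<in> C') \<Longrightarrow> cnt C t = cnt C' t"
  unfolding cnt_def by (rule arg_cong[of _ _ card]) auto

lemma cnt_change_two:
  assumes i: "1 \<le> i" and C: "\<And>j. j \<noteq> i \<Longrightarrow> j \<noteq> Suc i \<Longrightarrow> j \<in> C \<longleftrightarrow> j \<in> C'"
  shows "t < i \<Longrightarrow> cnt C t = cnt C' t"
    and "i < t \<Longrightarrow> cnt C t + of_bool (i \<in> C') + of_bool (Suc i \<in> C') =
           cnt C' t + of_bool (i \<in> C) + of_bool (Suc i \<in> C)"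
proof -
  show *: "cnt C t = cnt C' t" if "t < i" for t
    using that C by (intro cnt_cong) auto
  assume "i < t"
  then have "Suc i \<le> t" by simp
  then show "cnt C t + of_bool (i \<in> C') + of_bool (Suc i \<in> C') =
           cnt C' t + of_bool (i \<in> C) + of_bool (Suc i \<in> C)"
  proof (induction t rule: dec_induct)
    case base
    then show ?case using *[of "i - 1"] i cnt_pred[of i] by (simp add: cnt_Suc)
  next
    case (step t)
    then show ?case using C[of "Suc t"] by (simp add: cnt_Suc)
  qed
qed

lemma cnt_move_up:
  assumes "1 \<le> i" "Suc i \<notin> D"
  shows "t \<noteq> i \<Longrightarrow> cnt (move_up i D) t = cnt D t"
    and "cnt D i = cnt (move_up i D) i + of_bool (i \<in> D)"
proof -
  have *: "\<And>j. j \<noteq> i \<Longrightarrow> j \<noteq> Suc i \<Longrightarrow> j \<in> D \<longleftrightarrow> j \<in> move_up i D"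
    by (auto simp: move_up_def)
  show "cnt (move_up i D) t = cnt D t" if "t \<noteq> i"
    using cnt_change_two[OF assms(1) *, of t] that assms(2)
    by (cases t i rule: linorder_cases) (auto simp: move_up_def split: if_splits)
  have "cnt D (i - 1) = cnt (move_up i D) (i - 1)"
    using cnt_change_two(1)[OF assms(1) *, of "i - 1"] assms by simp
  then show "cnt D i = cnt (move_up i D) i + of_bool (i \<in> D)"
    using cnt_pred[OF assms(1)] by (simp add: move_up_def)
qed

text \<open>
  The situation in which \<open>lascoux_op i\<close> replaces \<open>i\<close> by \<open>i + 1\<close> in \<open>D\<close>. As \<open>i + 1\<close> is not in
  \<open>D\<close>, only the condition on the initial interval ending at \<open>i\<close> changes, apart from a possible
  change of \<open>Max D\<close>.
\<close>

locale column =
  fixes D :: "nat set" and i :: nat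
  assumes fin: "finite D" and ne: "D \<noteq> {}" and pos: "D \<subseteq> {1..}" and i: "1 \<le> i" and Suc_i: "Suc i \<notin> D"
begin

abbreviation "D' \<equiv> move_up i D"

lemma i_notin: "i \<notin> D'" by (simp add: move_up_def)

lemma Max_move_up: "Max D' = (if Max D = i then Suc i else Max D)"
proof (cases "i \<in> D")
  case True
  show ?thesis
  proof (cases "Max D = i")
    case True
    then have "\<forall>x\<in>D. x \<le> i" using fin by (metis Max_ge)
    then show ?thesis using \<open>i \<in> D\<close> True fin
      by (auto simp: move_up_def intro!: Max_eqI)
  next
    case False
    then have "Max D \<in> D - {i}" using fin ne by simp
    moreover have "\<forall>x\<in>D. x \<le> Max D" using fin by simp
    moreover have "Suc i \<le> Max D" using False Max_ge[OF fin True] by linarith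
    ultimately show ?thesis using True False fin
      by (auto simp: move_up_def intro!: Max_eqI)
  qed
next
  case False
  then have "Max D \<noteq> i" using Max_in[OF fin ne] by metis
  then show ?thesis using False by (simp add: move_up_def)
qed

lemma Max_D'_ne: "Max D' \<noteq> i"
  by (simp add: Max_move_up)

lemma cols_move_up: "cols D \<subseteq> cols D'"
proof
  fix C assume C: "C \<in> cols D"
  have "Max D \<le> Max D'" by (simp add: Max_move_up)
  moreover have "cnt D' t \<le> cnt D t" for t
    using cnt_move_up[OF i Suc_i] by (cases "t = i") auto
  ultimately show "C \<in> cols D'" using C unfolding cols_def
    by (auto intro: order_trans)
qed

text \<open>
  As \<open>i\<close> is not in \<open>D'\<close>, the condition at \<open>i\<close> follows from the one at \<open>i - 1\<close>. So a column with
  \<open>i\<close> or \<open>i + 1\<close> may have it replaced by the other one or by both.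
\<close>

lemma cols_change:
  assumes C: "C \<in> cols D'" and same: "\<And>j. j \<noteq> i \<Longrightarrow> j \<noteq> Suc i \<Longrightarrow> j \<in> C \<longleftrightarrow> j \<in> C'"
    and le: "of_bool (i \<in> C) + of_bool (Suc i \<in> C) \<le> (of_bool (i \<in> C') + of_bool (Suc i \<in> C') :: nat)"
    and emp: "i \<notin> C \<Longrightarrow> Suc i \<notin> C \<Longrightarrow> i \<notin> C' \<and> Suc i \<notin> C'"
  shows "C' \<in> cols D'"
proof -
  have Cb: "C \<subseteq> {1..Max D'}" and Cc: "cnt D' t \<le> cnt C t" for t using C by (auto simp: cols_def)
  have "C' \<subseteq> {1..Max D'}"
  proof
    fix j assume j: "j \<in> C'"
    show "j \<in> {1..Max D'}"
    proof (cases "j = i \<or> j = Suc i")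
      case False
      then show ?thesis using j same Cb by blast
    next
      case True
      then have "i \<in> C \<or> Suc i \<in> C" using j emp by blast
      then have "i \<le> Max D'" using Cb by auto
      then show ?thesis using True i Max_D'_ne by auto
    qed
  qed
  moreover have "cnt D' t \<le> cnt C' t" for t
  proof (cases t i rule: linorder_cases)
    case less
    then show ?thesis using cnt_change_two(1)[OF i same, of t] Cc[of t] by simp
  next
    case equal
    have "cnt D' i = cnt D' (i - 1)" using cnt_pred[OF i, of D'] i_notin by simp
    also have "\<dots> \<le> cnt C' (i - 1)"
      using Cc[of "i - 1"] cnt_change_two(1)[OF i same, of "i - 1"] i by simp
    also have "\<dots> \<le> cnt C' i" using cnt_pred[OF i, of C'] by simp
    finally show ?thesis using equal by simp
  next
    case greater
    then show ?thesis using cnt_change_two(2)[OF i same, of t] Cc[of t] le by linarith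
  qed
  ultimately show ?thesis by (simp add: cols_def)
qed

lemma cols_up: "C \<in> cols D \<Longrightarrow> C \<subseteq> C' \<Longrightarrow> C' \<subseteq> {1..Max D} \<Longrightarrow> C' \<in> cols D"
  unfolding cols_def using cnt_mono order_trans by blast

lemma cols_lower:
  assumes C: "C \<in> cols D" and "Suc i \<in> C" "i \<notin> C"
  shows "insert i (C - {Suc i}) \<in> cols D"
proof -
  let ?C' = "insert i (C - {Suc i})"
  have same: "\<And>j. j \<noteq> i \<Longrightarrow> j \<noteq> Suc i \<Longrightarrow> j \<in> C \<longleftrightarrow> j \<in> ?C'" by auto
  have "cnt C t \<le> cnt ?C' t" for t
  proof (cases t i rule: linorder_cases)
    case equal
    then show ?thesis
      using cnt_pred[OF i, of C] cnt_pred[OF i, of ?C'] cnt_change_two(1)[OF i same, of "i - 1"] i assms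
      by simp
  qed (use cnt_change_two[OF i same, of t] assms in auto)
  moreover have "Suc i \<le> Max D" using C assms by (auto simp: cols_def)
  ultimately show ?thesis using C i unfolding cols_def by (auto intro: order_trans)
qed

text \<open>
  A retraction of \<open>cols D'\<close> onto \<open>cols D\<close> that changes only the membership of \<open>i\<close> and \<open>i + 1\<close>.
\<close>

definition lower_col :: "nat set \<Rightarrow> nat set" where
  "lower_col C = (if C \<in> cols D then C else if i \<in> C then C - {Suc i} else insert i (C - {Suc i}))"

text \<open>
  A set in \<open>cols D'\<close> that is not in \<open>cols D\<close> either has one element too few up to \<open>i\<close>, which is
  repaired by moving \<open>i + 1\<close> down, or contains \<open>i + 1\<close> although \<open>Max D = i\<close>, and then \<open>i + 1\<close>
  can be dropped.
\<close>

lemma lower_col: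
  assumes C: "C \<in> cols D'"
  shows "lower_col C \<in> cols D"
    and "C \<notin> cols D \<Longrightarrow> Suc i \<in> C"
    and "C \<notin> cols D \<Longrightarrow> i \<in> C \<Longrightarrow> Max D = i"
proof -
  have Cb: "C \<subseteq> {1..Max D'}" and Cc: "cnt D' t \<le> cnt C t" for t using C by (auto simp: cols_def)
  have Cc': "cnt D t \<le> cnt C t" if "t \<noteq> i" for t
    using Cc[of t] cnt_move_up(1)[OF i Suc_i that] by simp
  have D_Suc: "cnt D (Suc i) = cnt D i" using Suc_i by (simp add: cnt_Suc)
  have main: "lower_col C \<in> cols D \<and> Suc i \<in> C \<and> (i \<in> C \<longrightarrow> Max D = i)" if nC: "C \<notin> cols D"
  proof -
    have iD: "i \<in> D" using nC C by (auto simp: move_up_def split: if_splits)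
    then have iM: "i \<le> Max D" using fin by simp
    have im: "cnt D (i - 1) \<le> cnt C (i - 1)" using Cc'[of "i - 1"] i by simp
    have Max_or: "Max D = i \<and> Max D' = Suc i \<or> Suc i \<le> Max D \<and> Max D' = Max D"
      using Max_move_up iM by (cases "Max D = i") auto
    show ?thesis
    proof (cases "i \<in> C")
      case True
      have ci: "cnt D i \<le> cnt C i" using im cnt_pred[OF i, of D] cnt_pred[OF i, of C] True iD by simp
      then have "cnt D t \<le> cnt C t" for t using Cc' by (cases "t = i") auto
      then have "\<not> C \<subseteq> {1..Max D}" using nC by (auto simp: cols_def)
      then have M: "Max D = i" "Suc i \<in> C" using Cb Max_or by (auto simp: le_Suc_eq subset_iff) 
      have sub: "C - {Suc i} \<subseteq> {1..i}" using Cb Max_or M by (auto simp: le_Suc_eq subset_iff)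
      have "cnt D t \<le> cnt (C - {Suc i}) t" for t
      proof (cases "t \<le> i")
        case True
        then have "cnt (C - {Suc i}) t = cnt C t" by (intro cnt_cong) auto
        then show ?thesis using Cc'[of t] ci by (cases "t = i") auto
      next
        case False
        have "D \<subseteq> {1..i}" using M(1) fin pos by (metis Max_ge atLeastAtMost_iff atLeast_iff subset_iff)
        then have "D \<inter> {1..t} = D \<inter> {1..i}" "(C - {Suc i}) \<inter> {1..t} = C \<inter> {1..i}"
          using sub False by auto
        then show ?thesis using ci by (simp add: cnt_def)
      qed
      then show ?thesis using True nC M sub by (simp add: lower_col_def cols_def)
    next
      case False
      have SiC: "Suc i \<in> C"
      proof (rule ccontr)
        assume n: "Suc i \<notin> C"
        have "cnt D i \<le> cnt C i" using Cc'[of "Suc i"] D_Suc n by (simp add: cnt_Suc)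
        then have "cnt D t \<le> cnt C t" for t using Cc' by (cases "t = i") auto
        moreover have "C \<subseteq> {1..Max D}" using Cb Max_or False n by (auto simp: le_Suc_eq subset_iff)
        ultimately show False using nC by (simp add: cols_def)
      qed
      let ?C' = "insert i (C - {Suc i})"
      have same: "\<And>j. j \<noteq> i \<Longrightarrow> j \<noteq> Suc i \<Longrightarrow> j \<in> C \<longleftrightarrow> j \<in> ?C'" by auto
      have "cnt D t \<le> cnt ?C' t" for t
      proof (cases t i rule: linorder_cases)
        case equal
        then show ?thesis
          using cnt_pred[OF i, of D] cnt_pred[OF i, of ?C'] cnt_change_two(1)[OF i same, of "i - 1"] i im iD
          by simp
      qed (use cnt_change_two[OF i same, of t] Cc'[of t] SiC False in auto)
      moreover have "?C' \<subseteq> {1..Max D}" using Cb Max_or iM i by (auto simp: le_Suc_eq subset_iff)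
      ultimately show ?thesis using False nC SiC by (simp add: lower_col_def cols_def)
    qed
  qed
  show "lower_col C \<in> cols D" using main by (cases "C \<in> cols D") (auto simp: lower_col_def)
  show "C \<notin> cols D \<Longrightarrow> Suc i \<in> C" "C \<notin> cols D \<Longrightarrow> i \<in> C \<Longrightarrow> Max D = i" using main by auto
qed

end

section \<open>Exponents of two adjacent variables\<close>

text \<open>
  Divided differences act on the exponents of \<open>x\<^sub>i\<close> and \<open>x\<^sub>i\<^sub>+\<^sub>1\<close> only. The remaining exponents
  are kept fixed in \<open>\<delta>\<close>, so that a polynomial becomes an array of coefficients indexed by two
  numbers.
\<close>

definition two_exp :: "nat \<Rightarrow> (nat \<Rightarrow>\<^sub>0 nat) \<Rightarrow> nat \<Rightarrow> nat \<Rightarrow> (nat \<Rightarrow>\<^sub>0 nat)" where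
  "two_exp i \<delta> a b = \<delta> + Poly_Mapping.single i a + Poly_Mapping.single (Suc i) b"

definition free_of_two :: "nat \<Rightarrow> (nat \<Rightarrow>\<^sub>0 nat) \<Rightarrow> bool" where
  "free_of_two i \<delta> \<longleftrightarrow> Poly_Mapping.lookup \<delta> i = 0 \<and> Poly_Mapping.lookup \<delta> (Suc i) = 0"

lemma lookup_two_exp:
  "free_of_two i \<delta> \<Longrightarrow> Poly_Mapping.lookup (two_exp i \<delta> a b) j =
    (if j = i then a else if j = Suc i then b else Poly_Mapping.lookup \<delta> j)"
  by (auto simp: two_exp_def free_of_two_def lookup_add lookup_single when_def)

lemma two_exp_cases:
  obtains \<delta> where "free_of_two i \<delta>"
    "m = two_exp i \<delta> (Poly_Mapping.lookup m i) (Poly_Mapping.lookup m (Suc i))"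
proof -
  define \<delta> where "\<delta> = m - Poly_Mapping.single i (Poly_Mapping.lookup m i)
    - Poly_Mapping.single (Suc i) (Poly_Mapping.lookup m (Suc i))"
  have f: "free_of_two i \<delta>"
    by (simp add: \<delta>_def free_of_two_def lookup_minus lookup_single when_def)
  moreover have "m = two_exp i \<delta> (Poly_Mapping.lookup m i) (Poly_Mapping.lookup m (Suc i))"
    by (rule poly_mapping_eqI)
       (auto simp: lookup_two_exp[OF f], auto simp: \<delta>_def lookup_minus lookup_single when_def)
  ultimately show ?thesis using that by blast
qed

lemma lookup_swap_two_exp:
  assumes "free_of_two i \<delta>"
  shows "Poly_Mapping.lookup (swap_vars i f) (two_exp i \<delta> a b) =
    Poly_Mapping.lookup f (two_exp i \<delta> b a)"
proof -
  have "Poly_Mapping.map_key (transpose i (Suc i)) (two_exp i \<delta> a b) = two_exp i \<delta> b a"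
    by (rule poly_mapping_eqI)
       (simp add: map_key.rep_eq lookup_two_exp[OF assms] transpose_def)
  then show ?thesis by (simp add: lookup_swap_vars)
qed

lemma lookup_Var_two_exp:
  assumes "free_of_two i \<delta>"
  shows "Poly_Mapping.lookup (Var i * f) (two_exp i \<delta> a b) =
      (if a = 0 then 0 else Poly_Mapping.lookup f (two_exp i \<delta> (a - 1) b))"
    and "Poly_Mapping.lookup (Var (Suc i) * f) (two_exp i \<delta> a b) =
      (if b = 0 then 0 else Poly_Mapping.lookup f (two_exp i \<delta> a (b - 1)))"
proof -
  have "two_exp i \<delta> a b - Poly_Mapping.single i 1 = two_exp i \<delta> (a - 1) b" if "a \<noteq> 0"
    by (rule poly_mapping_eqI)
       (auto simp: lookup_minus lookup_two_exp[OF assms] lookup_single when_def)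
  then show "Poly_Mapping.lookup (Var i * f) (two_exp i \<delta> a b) =
      (if a = 0 then 0 else Poly_Mapping.lookup f (two_exp i \<delta> (a - 1) b))"
    by (simp add: lookup_Var_mult lookup_two_exp[OF assms])
  have "two_exp i \<delta> a b - Poly_Mapping.single (Suc i) 1 = two_exp i \<delta> a (b - 1)" if "b \<noteq> 0"
    by (rule poly_mapping_eqI)
       (auto simp: lookup_minus lookup_two_exp[OF assms] lookup_single when_def)
  then show "Poly_Mapping.lookup (Var (Suc i) * f) (two_exp i \<delta> a b) =
      (if b = 0 then 0 else Poly_Mapping.lookup f (two_exp i \<delta> a (b - 1)))"
    by (simp add: lookup_Var_mult lookup_two_exp[OF assms])
qed

context
  fixes f :: ipoly and i :: nat and \<delta> :: "nat \<Rightarrow>\<^sub>0 nat" and g F :: "nat \<Rightarrow> nat \<Rightarrow> int"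
  assumes \<delta>: "free_of_two i \<delta>"
  defines "g \<equiv> \<lambda>a b. Poly_Mapping.lookup f (two_exp i \<delta> a b)"
    and "F \<equiv> \<lambda>a b. Poly_Mapping.lookup (div_diff i f) (two_exp i \<delta> a b)"
begin

lemma div_diff_coeff:
  "(if a = 0 then 0 else F (a - 1) b) - (if b = 0 then 0 else F a (b - 1)) = g a b - g b a"
proof -
  have "Poly_Mapping.lookup ((Var i - Var (Suc i)) * div_diff i f) (two_exp i \<delta> a b) = g a b - g b a"
    by (simp add: divided_difference lookup_minus lookup_swap_two_exp[OF \<delta>] g_def)
  then show ?thesis
    unfolding left_diff_distrib lookup_minus lookup_Var_two_exp[OF \<delta>] F_def .
qed

lemma div_diff_coeff_sym: "F a b = F b a"
  using lookup_swap_two_exp[OF \<delta>, of "div_diff i f" a b] by (simp add: swap_div_diff F_def)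

lemma lascoux_op_coeff:
  "Poly_Mapping.lookup (lascoux_op i f) (two_exp i \<delta> a b) =
    g a b + (if b = 0 then 0 else F a (b - 1)) + (if a = 0 \<or> b = 0 then 0 else F (a - 1) (b - 1))"
proof -
  have "lascoux_op i f = f + (Var (Suc i) * div_diff i f + Var i * (Var (Suc i) * div_diff i f))"
    unfolding lascoux_op_eq_dd by (simp add: algebra_simps)
  then show ?thesis
    by (simp add: lookup_add lookup_Var_two_exp[OF \<delta>] g_def F_def)
qed

text \<open>
  By \<open>div_diff_coeff\<close>, the coefficients of the divided difference are partial sums of the
  antisymmetrized coefficients of \<open>f\<close> along an antidiagonal, starting at its far end.
\<close>

lemma div_diff_coeff_nonzero:
  assumes "F c e \<noteq> 0"
  shows "\<exists>a. c < a \<and> e < a \<and> a \<le> c + e + 1 \<and> (g a (c + e + 1 - a) \<noteq> 0 \<or> g (c + e + 1 - a) a \<noteq> 0)"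
proof -
  have *: "\<exists>a. c < a \<and> a \<le> c + e + 1 \<and> (g a (c + e + 1 - a) \<noteq> 0 \<or> g (c + e + 1 - a) a \<noteq> 0)"
    if "F c e \<noteq> 0" for c e
    using that
  proof (induction e arbitrary: c)
    case 0
    then show ?case using div_diff_coeff[of "Suc c" 0] by (intro exI[of _ "Suc c"]) auto
  next
    case (Suc e)
    show ?case
    proof (cases "g (Suc c) (Suc e) = 0 \<and> g (Suc e) (Suc c) = 0")
      case False
      then show ?thesis by (intro exI[of _ "Suc c"]) auto
    next
      case True
      then have "F (Suc c) e \<noteq> 0" using div_diff_coeff[of "Suc c" "Suc e"] Suc.prems by simp
      then obtain a where "Suc c < a" "a \<le> Suc c + e + 1"
        "g a (Suc c + e + 1 - a) \<noteq> 0 \<or> g (Suc c + e + 1 - a) a \<noteq> 0" using Suc.IH by blast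
      then show ?thesis by (intro exI[of _ a]) auto
    qed
  qed
  show ?thesis
  proof (cases "e \<le> c")
    case True
    then show ?thesis using *[OF assms] by fastforce
  next
    case False
    have "F e c \<noteq> 0" using assms by (simp add: div_diff_coeff_sym[of e c])
    then obtain a where "e < a" "a \<le> e + c + 1" "g a (e + c + 1 - a) \<noteq> 0 \<or> g (e + c + 1 - a) a \<noteq> 0"
      using * by blast
    then show ?thesis using False by (intro exI[of _ a]) (auto simp: add.commute)
  qed
qed

text \<open>
  In the same partial sum every subtracted term vanishes by assumption, and one of the others is
  positive.
\<close>

lemma div_diff_coeff_pos:
  assumes g0: "\<And>a b. 0 \<le> g a b" and F0: "\<And>a b. 0 \<le> F a b"
    and a: "c < a" "a \<le> c + e + 1" "0 < g a (c + e + 1 - a)"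
    and zero: "\<And>a'. c < a' \<Longrightarrow> a' \<le> c + e + 1 \<Longrightarrow> g (c + e + 1 - a') a' = 0"
  shows "0 < F c e"
proof -
  define m where "m = c + e"
  have step: "F x (m - x) = (if x = m then 0 else F (Suc x) (m - Suc x)) + g (Suc x) (m - x)"
    if "c \<le> x" "x \<le> m" for x
    using div_diff_coeff[of "Suc x" "m - x"] zero[of "Suc x"] that by (auto simp: m_def)
  have "0 < F x (m - x)" if "x \<le> a - 1" "c \<le> x" for x
    using that
  proof (induction x rule: inc_induct)
    case base
    have "Suc (a - 1) = a" "m - (a - 1) = c + e + 1 - a" using a by (auto simp: m_def)
    then show ?case using step[of "a - 1"] a F0[of a "m - a"] base by (auto simp: m_def)
  next
    case (step x)
    then have "x \<le> m" "x \<noteq> m" using a by (auto simp: m_def)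
    then show ?case using step \<open>\<And>x. \<lbrakk>c \<le> x; x \<le> m\<rbrakk> \<Longrightarrow> F x (m - x) = _\<close>[of x] g0[of "Suc x" "m - x"] by auto
  qed
  from this[of c] show ?thesis using a by (simp add: m_def)
qed

end

section \<open>Supports under the Lascoux operator\<close>

text \<open>
  Moves towards the diagonal \<open>p = q\<close>, keeping the degree or raising it by one. The columns that
  contain exactly one of \<open>i\<close> and \<open>i + 1\<close> can be redistributed freely by \<open>cols_change\<close>; to raise
  the degree, one of them receives both.
\<close>

lemma spread_columns:
  assumes fin: "finite K"
    and C: "\<And>k. k \<in> K \<Longrightarrow> column (D k) i" "\<And>k. k \<in> K \<Longrightarrow> C k \<in> cols (move_up i (D k))"
    and p: "p = card {k \<in> K. i \<in> C k}" and q: "q = card {k \<in> K. Suc i \<in> C k}"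
    and cd: "c + d = p + q \<and> min p q \<le> c \<and> c \<le> max p q \<or>
      c + d = p + q + 1 \<and> min p q + 1 \<le> c \<and> c \<le> max p q"
  shows "\<exists>C'. (\<forall>k\<in>K. C' k \<in> cols (move_up i (D k))) \<and>
    (\<forall>k\<in>K. \<forall>j. j \<noteq> i \<longrightarrow> j \<noteq> Suc i \<longrightarrow> (j \<in> C' k \<longleftrightarrow> j \<in> C k)) \<and>
    card {k \<in> K. i \<in> C' k} = c \<and> card {k \<in> K. Suc i \<in> C' k} = d"
proof -
  define N where "N = {k \<in> K. (i \<in> C k) \<noteq> (Suc i \<in> C k)}"
  define B where "B = {k \<in> K. i \<in> C k \<and> Suc i \<in> C k}"
  define N1 where "N1 = {k \<in> K. i \<in> C k \<and> Suc i \<notin> C k}"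
  define N2 where "N2 = {k \<in> K. i \<notin> C k \<and> Suc i \<in> C k}"
  have fins: "finite N" "finite B" "finite N1" "finite N2"
    using fin by (simp_all add: N_def B_def N1_def N2_def)
  have "{k \<in> K. i \<in> C k} = N1 \<union> B" "{k \<in> K. Suc i \<in> C k} = N2 \<union> B" "N = N1 \<union> N2"
    "N1 \<inter> B = {}" "N2 \<inter> B = {}" "N1 \<inter> N2 = {}"
    by (auto simp: N_def B_def N1_def N2_def)
  then have pq: "p = card N1 + card B" "q = card N2 + card B" "card N = card N1 + card N2"
    using fins by (simp_all add: p q card_Un_disjoint)
  \<comment> \<open>U and V are the columns of N that are to contain \<open>i\<close> and \<open>i + 1\<close>.\<close>
  have "\<exists>U V. U \<subseteq> N \<and> V \<subseteq> N \<and> U \<union> V = N \<and> card U + card B = c \<and> card V + card B = d"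
  proof (cases "c + d = p + q")
    case True
    then have cN: "c - card B \<le> card N" "card B \<le> c" using cd pq by auto
    then obtain U where U: "U \<subseteq> N" "card U = c - card B"
      by (meson obtain_subset_with_card_n)
    moreover have "card (N - U) = card N - card U"
      using U fins by (intro card_Diff_subset) (auto intro: finite_subset)
    ultimately show ?thesis using True pq cN
      by - (rule exI[of _ U], rule exI[of _ "N - U"], auto)
  next
    case False
    then have cd': "c + d = p + q + 1" "min p q + 1 \<le> c" "c \<le> max p q" using cd by auto
    then have "N \<noteq> {}" using pq by (auto simp: min_def max_def split: if_splits)
    then obtain e where e: "e \<in> N" by blast
    have "card (N - {e}) = card N - 1" using e fins by simp
    moreover have B: "card B + 1 \<le> c" "c \<le> card N + card B" using cd' pq by auto
    ultimately have "c - 1 - card B \<le> card (N - {e})" by simp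
    then obtain U where U: "U \<subseteq> N - {e}" "card U = c - 1 - card B"
      by (meson obtain_subset_with_card_n)
    have finU: "finite U" using U fins by (meson finite_Diff finite_subset)
    have "card (insert e U) = Suc (card U)" using U finU by (intro card_insert_disjoint) auto
    moreover have "card (N - U) = card N - card U"
      using U finU by (intro card_Diff_subset) auto
    moreover have "card U \<le> card N" using U fins by (intro card_mono) auto
    ultimately show ?thesis using cd' pq B U e
      by - (rule exI[of _ "insert e U"], rule exI[of _ "N - U"], auto)
  qed
  then obtain U V where UV: "U \<subseteq> N" "V \<subseteq> N" "U \<union> V = N" "card U + card B = c" "card V + card B = d"
    by blast
  define C' where "C' k = (if k \<in> N then (C k - {i, Suc i}) \<union> (if k \<in> U then {i} else {}) \<union>
    (if k \<in> V then {Suc i} else {}) else C k)" for k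
  have i_in: "i \<in> C' k \<longleftrightarrow> k \<in> U \<union> B" "Suc i \<in> C' k \<longleftrightarrow> k \<in> V \<union> B" if "k \<in> K" for k
    using that UV by (auto simp: C'_def N_def B_def)
  have "C' k \<in> cols (move_up i (D k))" if k: "k \<in> K" for k
  proof (cases "k \<in> N")
    case True
    interpret column "D k" i using C(1)[OF k] .
    have "k \<in> U \<or> k \<in> V" using True UV by auto
    then show ?thesis using True
      by (intro cols_change[OF C(2)[OF k]]) (auto simp: C'_def N_def)
  next
    case False
    then show ?thesis using C k by (simp add: C'_def)
  qed
  moreover have "card {k \<in> K. i \<in> C' k} = c" "card {k \<in> K. Suc i \<in> C' k} = d"
  proof -
    have "{k \<in> K. i \<in> C' k} = U \<union> B" "{k \<in> K. Suc i \<in> C' k} = V \<union> B" "U \<inter> B = {}" "V \<inter> B = {}"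
      using i_in UV by (auto simp: N_def B_def)
    then show "card {k \<in> K. i \<in> C' k} = c" "card {k \<in> K. Suc i \<in> C' k} = d"
      using UV fins finite_subset[of U N] finite_subset[of V N] by (simp_all add: card_Un_disjoint)
  qed
  moreover have "\<forall>k\<in>K. \<forall>j. j \<noteq> i \<longrightarrow> j \<noteq> Suc i \<longrightarrow> (j \<in> C' k \<longleftrightarrow> j \<in> C k)"
    by (auto simp: C'_def)
  ultimately show ?thesis by blast
qed

lemma col_sums_two_exp:
  assumes "free_of_two i \<delta>"
    and "two_exp i \<delta> p q \<in> col_sums K \<phi>"
  obtains C where "\<And>k. k \<in> K \<Longrightarrow> C k \<in> \<phi> k" "p = card {k \<in> K. i \<in> C k}" "q = card {k \<in> K. Suc i \<in> C k}"
    "\<And>j. j \<noteq> i \<Longrightarrow> j \<noteq> Suc i \<Longrightarrow> Poly_Mapping.lookup \<delta> j = card {k \<in> K. j \<in> C k}"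
proof -
  obtain C where C: "\<forall>k\<in>K. C k \<in> \<phi> k" and
    l: "\<And>j. Poly_Mapping.lookup (two_exp i \<delta> p q) j = card {k \<in> K. j \<in> C k}"
    using assms(2) unfolding col_sums_def by blast
  show ?thesis
  proof (rule that[of C])
    fix j assume "j \<noteq> i" "j \<noteq> Suc i"
    then show "Poly_Mapping.lookup \<delta> j = card {k \<in> K. j \<in> C k}"
      using l[of j] by (simp add: lookup_two_exp[OF assms(1)])
  qed (use C l[of i] l[of "Suc i"] in \<open>auto simp: lookup_two_exp[OF assms(1)]\<close>)
qed

lemma two_exp_col_sums:
  assumes "free_of_two i \<delta>"
    and "\<And>k. k \<in> K \<Longrightarrow> C k \<in> \<phi> k" "p = card {k \<in> K. i \<in> C k}" "q = card {k \<in> K. Suc i \<in> C k}"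
    "\<And>j. j \<noteq> i \<Longrightarrow> j \<noteq> Suc i \<Longrightarrow> Poly_Mapping.lookup \<delta> j = card {k \<in> K. j \<in> C k}"
  shows "two_exp i \<delta> p q \<in> col_sums K \<phi>"
  unfolding col_sums_def mem_Collect_eq lookup_two_exp[OF assms(1)]
  by (rule exI[of _ C]) (simp add: assms(2-))

lemma spread_col_sums:
  assumes fin: "finite K" and D: "\<And>k. k \<in> K \<Longrightarrow> column (D k) i" and \<delta>: "free_of_two i \<delta>"
    and m: "two_exp i \<delta> p q \<in> col_sums K (\<lambda>k. cols (move_up i (D k)))"
    and cd: "c + d = p + q \<and> min p q \<le> c \<and> c \<le> max p q \<or>
      c + d = p + q + 1 \<and> min p q + 1 \<le> c \<and> c \<le> max p q"
  shows "two_exp i \<delta> c d \<in> col_sums K (\<lambda>k. cols (move_up i (D k)))"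
proof -
  obtain C where C: "\<And>k. k \<in> K \<Longrightarrow> C k \<in> cols (move_up i (D k))"
    "p = card {k \<in> K. i \<in> C k}" "q = card {k \<in> K. Suc i \<in> C k}"
    "\<And>j. j \<noteq> i \<Longrightarrow> j \<noteq> Suc i \<Longrightarrow> Poly_Mapping.lookup \<delta> j = card {k \<in> K. j \<in> C k}"
    using col_sums_two_exp[OF \<delta> m] by blast
  obtain C' where C': "\<forall>k\<in>K. C' k \<in> cols (move_up i (D k))"
    "\<forall>k\<in>K. \<forall>j. j \<noteq> i \<longrightarrow> j \<noteq> Suc i \<longrightarrow> (j \<in> C' k \<longleftrightarrow> j \<in> C k)"
    "card {k \<in> K. i \<in> C' k} = c" "card {k \<in> K. Suc i \<in> C' k} = d"
    using spread_columns[OF fin D C(1-3) cd] by blast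
  have "Poly_Mapping.lookup \<delta> j = card {k \<in> K. j \<in> C' k}" if "j \<noteq> i" "j \<noteq> Suc i" for j
  proof -
    have "{k \<in> K. j \<in> C' k} = {k \<in> K. j \<in> C k}" using C' that by auto
    then show ?thesis using C that by simp
  qed
  then show ?thesis using C' by (intro two_exp_col_sums[OF \<delta>, of _ C']) auto
qed

text \<open>
  Write \<open>y = x\<^sub>i\<close> and \<open>z = x\<^sub>i\<^sub>+\<^sub>1\<close>, so that \<open>lascoux_op i f = f + (1 + y) z \<partial> f\<close>. The support
  of \<open>\<partial> f\<close> arises from that of \<open>f\<close> by moves towards the diagonal, under which the right-hand
  side is closed (\<open>spread_col_sums\<close>); this gives one inclusion.

  For the other one, let \<open>y\<^sup>c z\<^sup>d\<close> with \<open>d \<le> c\<close> occur on the right-hand side, which suffices by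
  symmetry. If it does not occur in \<open>f\<close>, lowering its columns with \<open>lower_col\<close> produces an
  exponent of \<open>f\<close> further from the diagonal. It has the same degree if no column loses an
  element. At most one column does, since it has \<open>Max (D k) = i\<close>, and its loss can be made up by
  adding \<open>i\<close> or \<open>i + 1\<close> to another column unless all columns are full. The exponents of \<open>f\<close> are
  closed under moving \<open>i + 1\<close> to \<open>i\<close>, so the mirror images with respect to the diagonal do not
  occur, and \<open>div_diff_coeff_pos\<close> applies. If all columns are full, then \<open>c = d\<close>, and the
  exponent comes from the term \<open>y z \<partial> f\<close>.
\<close>

theorem lascoux_op_support:
  fixes K :: "'k set"
  assumes fin: "finite K" and D: "\<And>k. k \<in> K \<Longrightarrow> column (D k) i"
    and inj: "\<And>k k'. \<lbrakk>k \<in> K; k' \<in> K; Max (D k) = i; Max (D k') = i\<rbrakk> \<Longrightarrow> k = k'"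
    and f0: "nonneg_poly f" "nonneg_poly (div_diff i f)"
    and keys: "Poly_Mapping.keys f = col_sums K (\<lambda>k. cols (D k))"
  shows "Poly_Mapping.keys (lascoux_op i f) = col_sums K (\<lambda>k. cols (move_up i (D k)))"
proof (intro equalityI subsetI)
  define X where "X = col_sums K (\<lambda>k. cols (D k))"
  define X' where "X' = col_sums K (\<lambda>k. cols (move_up i (D k)))"
  have XX': "X \<subseteq> X'"
  proof -
    have "cols (D k) \<subseteq> cols (move_up i (D k))" if "k \<in> K" for k
      using column.cols_move_up[OF D[OF that]] .
    then show ?thesis unfolding X_def X'_def col_sums_def by blast
  qed
  {
    fix m assume m: "m \<in> Poly_Mapping.keys (lascoux_op i f)"
    obtain \<delta> c d where \<delta>: "free_of_two i \<delta>" and m_eq: "m = two_exp i \<delta> c d"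
      using two_exp_cases by metis
    define g where "g = (\<lambda>a b. Poly_Mapping.lookup f (two_exp i \<delta> a b))"
    define F where "F = (\<lambda>a b. Poly_Mapping.lookup (div_diff i f) (two_exp i \<delta> a b))"
    have gX: "two_exp i \<delta> a b \<in> X'" if "g a b \<noteq> 0" for a b
      using that keys XX' by (auto simp: g_def X_def in_keys_iff)
    have spread: "two_exp i \<delta> c d \<in> X'"
      if "two_exp i \<delta> p q \<in> X'" "c + d = p + q \<and> min p q \<le> c \<and> c \<le> max p q \<or>
        c + d = p + q + 1 \<and> min p q + 1 \<le> c \<and> c \<le> max p q" for p q c d
      using spread_col_sums[of K D i, OF fin D \<delta>] that unfolding X'_def by blast
    have nonzero: "\<exists>a. c < a \<and> e < a \<and> a \<le> c + e + 1 \<and>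
        (g a (c + e + 1 - a) \<noteq> 0 \<or> g (c + e + 1 - a) a \<noteq> 0)" if "F c e \<noteq> 0" for c e
      using div_diff_coeff_nonzero[OF \<delta>, of f c e] that by (simp add: g_def F_def)
    have "g c d \<noteq> 0 \<or> d \<noteq> 0 \<and> F c (d - 1) \<noteq> 0 \<or> c \<noteq> 0 \<and> d \<noteq> 0 \<and> F (c - 1) (d - 1) \<noteq> 0"
      using m unfolding m_eq in_keys_iff lascoux_op_coeff[OF \<delta>] g_def F_def by (auto split: if_splits)
    then consider "g c d \<noteq> 0" | "d \<noteq> 0" "F c (d - 1) \<noteq> 0" | "c \<noteq> 0" "d \<noteq> 0" "F (c - 1) (d - 1) \<noteq> 0"
      by blast
    then show "m \<in> col_sums K (\<lambda>k. cols (move_up i (D k)))" unfolding X'_def[symmetric] m_eq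
    proof cases
      case 1
      then show "two_exp i \<delta> c d \<in> X'" by (rule gX)
    next
      case 2
      obtain a where a: "c < a" "d - 1 < a" "a \<le> c + (d - 1) + 1"
        "g a (c + (d - 1) + 1 - a) \<noteq> 0 \<or> g (c + (d - 1) + 1 - a) a \<noteq> 0"
        using nonzero[OF 2(2)] by blast
      from a(4) show "two_exp i \<delta> c d \<in> X'"
      proof
        assume "g a (c + (d - 1) + 1 - a) \<noteq> 0"
        then show ?thesis by (rule spread[OF gX]) (use a 2 in auto)
      next
        assume "g (c + (d - 1) + 1 - a) a \<noteq> 0"
        then show ?thesis by (rule spread[OF gX]) (use a 2 in auto)
      qed
    next
      case 3
      obtain a where a: "c - 1 < a" "d - 1 < a" "a \<le> c - 1 + (d - 1) + 1"
        "g a (c - 1 + (d - 1) + 1 - a) \<noteq> 0 \<or> g (c - 1 + (d - 1) + 1 - a) a \<noteq> 0"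
        using nonzero[OF 3(3)] by blast
      from a(4) show "two_exp i \<delta> c d \<in> X'"
      proof
        assume "g a (c - 1 + (d - 1) + 1 - a) \<noteq> 0"
        then show ?thesis by (rule spread[OF gX]) (use a 3 in auto)
      next
        assume "g (c - 1 + (d - 1) + 1 - a) a \<noteq> 0"
        then show ?thesis by (rule spread[OF gX]) (use a 3 in auto)
      qed
    qed
  }
  {
    fix m assume m: "m \<in> col_sums K (\<lambda>k. cols (move_up i (D k)))"
    obtain \<delta> c0 d0 where \<delta>: "free_of_two i \<delta>" and m_eq: "m = two_exp i \<delta> c0 d0"
      using two_exp_cases by metis
    define g where "g = (\<lambda>a b. Poly_Mapping.lookup f (two_exp i \<delta> a b))"
    define F where "F = (\<lambda>a b. Poly_Mapping.lookup (div_diff i f) (two_exp i \<delta> a b))"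
    have g0: "0 \<le> g a b" for a b using f0(1) unfolding g_def nonneg_poly_def by blast
    have F0: "0 \<le> F a b" for a b using f0(2) unfolding F_def nonneg_poly_def by blast
    have g_iff: "0 < g a b \<longleftrightarrow> two_exp i \<delta> a b \<in> X" for a b
    proof -
      have "two_exp i \<delta> a b \<in> X \<longleftrightarrow> g a b \<noteq> 0"
        unfolding X_def g_def keys[symmetric] in_keys_iff ..
      then show ?thesis using g0[of a b] by linarith
    qed
    define P where "P = (\<lambda>a b. Poly_Mapping.lookup (lascoux_op i f) (two_exp i \<delta> a b))"
    have P_eq: "P a b = g a b + (if b = 0 then 0 else F a (b - 1)) +
        (if a = 0 \<or> b = 0 then 0 else F (a - 1) (b - 1))" for a b
      unfolding P_def g_def F_def by (rule lascoux_op_coeff[OF \<delta>])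
    have P_sym: "P a b = P b a" for a b
      using lookup_swap_two_exp[OF \<delta>, of "lascoux_op i f" a b] by (simp add: P_def swap_lascoux_op)
    have spread: "two_exp i \<delta> c d \<in> X'"
      if "two_exp i \<delta> p q \<in> X'" "c + d = p + q \<and> min p q \<le> c \<and> c \<le> max p q \<or>
        c + d = p + q + 1 \<and> min p q + 1 \<le> c \<and> c \<le> max p q" for p q c d
      using spread_col_sums[of K D i, OF fin D \<delta>] that unfolding X'_def by blast
    \<comment> \<open>The coefficient is a sum of three nonnegative numbers, so it is enough that one of them
    is positive.\<close>
    have main: "0 < P c d" if cd: "two_exp i \<delta> c d \<in> X'" "d \<le> c" for c d
    proof -
      obtain C where C: "\<And>k. k \<in> K \<Longrightarrow> C k \<in> cols (move_up i (D k))"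
        "c = card {k \<in> K. i \<in> C k}" "d = card {k \<in> K. Suc i \<in> C k}"
        "\<And>j. j \<noteq> i \<Longrightarrow> j \<noteq> Suc i \<Longrightarrow> Poly_Mapping.lookup \<delta> j = card {k \<in> K. j \<in> C k}"
        using col_sums_two_exp[OF \<delta> cd(1)[unfolded X'_def]] by blast
      define L where "L k = column.lower_col (D k) i (C k)" for k
      have L: "L k \<in> cols (D k)" if "k \<in> K" for k
        unfolding L_def using column.lower_col(1)[OF D C(1)] that by blast
      have XI: "two_exp i \<delta> (card {k \<in> K. i \<in> B k}) (card {k \<in> K. Suc i \<in> B k}) \<in> X"
        if "\<And>k. k \<in> K \<Longrightarrow> B k \<in> cols (D k)"
          "\<And>k j. k \<in> K \<Longrightarrow> j \<noteq> i \<Longrightarrow> j \<noteq> Suc i \<Longrightarrow> j \<in> B k \<longleftrightarrow> j \<in> C k" for B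
        unfolding X_def using that C(4)
        by (intro two_exp_col_sums[OF \<delta>, of _ B]) (auto intro!: arg_cong[of _ _ card])
      \<comment> \<open>R: the columns in which \<open>i + 1\<close> moves down to \<open>i\<close>; Q: those that lose \<open>i + 1\<close>.\<close>
      define R where "R = {k \<in> K. C k \<notin> cols (D k) \<and> i \<notin> C k}"
      define Q where "Q = {k \<in> K. C k \<notin> cols (D k) \<and> i \<in> C k}"
      have finRQ: "finite R" "finite Q" using fin by (simp_all add: R_def Q_def)
      have Suc_in: "Suc i \<in> C k" if "k \<in> R \<union> Q" for k
        using column.lower_col(2)[OF D[of k] C(1)[of k]] that by (auto simp: R_def Q_def)
      have Q_Max: "Max (D k) = i" if "k \<in> Q" for k
        using column.lower_col(3)[OF D[of k] C(1)[of k]] that by (auto simp: Q_def)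
      have L_iff: "i \<in> L k \<longleftrightarrow> i \<in> C k \<or> k \<in> R" "Suc i \<in> L k \<longleftrightarrow> Suc i \<in> C k \<and> k \<notin> R \<and> k \<notin> Q"
        "j \<noteq> i \<Longrightarrow> j \<noteq> Suc i \<Longrightarrow> j \<in> L k \<longleftrightarrow> j \<in> C k" if "k \<in> K" for k j
        using that by (auto simp: L_def column.lower_col_def[OF D] R_def Q_def)
      have "{k \<in> K. i \<in> L k} = {k \<in> K. i \<in> C k} \<union> R" "{k \<in> K. i \<in> C k} \<inter> R = {}"
        using L_iff by (auto simp: R_def)
      then have cL: "card {k \<in> K. i \<in> L k} = c + card R"
        using fin finRQ by (simp add: card_Un_disjoint C(2))
      have "{k \<in> K. Suc i \<in> C k} = {k \<in> K. Suc i \<in> L k} \<union> (R \<union> Q)" "{k \<in> K. Suc i \<in> L k} \<inter> (R \<union> Q) = {}"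
        "R \<inter> Q = {}"
        using L_iff Suc_in by (auto simp: R_def Q_def)
      then have dL: "d = card {k \<in> K. Suc i \<in> L k} + card R + card Q"
        using fin finRQ by (simp add: card_Un_disjoint C(3))
      have LX: "two_exp i \<delta> (card {k \<in> K. i \<in> L k}) (card {k \<in> K. Suc i \<in> L k}) \<in> X"
        using L L_iff(3) by (intro XI) auto
      have colD: "D k \<noteq> {} \<and> finite (D k)" if "k \<in> K" for k using D[OF that] by (simp add: column_def)
      have i1: "1 \<le> i" if "k \<in> K" for k using D[OF that] by (simp add: column_def)
      have C_le: "j \<le> Max (D k)" if "k \<in> K" "B \<in> cols (D k)" "j \<in> B" for k j B
        using that by (auto simp: cols_def)
      \<comment> \<open>The second alternative is the case in which all columns are full.\<close>
      have cases: "(\<exists>a. c \<le> a \<and> a \<le> c + d \<and> two_exp i \<delta> a (c + d - a) \<in> X) \<or>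
        (c = d \<and> 0 < d \<and> two_exp i \<delta> c (c - 1) \<in> X \<and> two_exp i \<delta> (c - 1) c \<notin> X)"
      proof (cases "Q = {}")
        case True
        then show ?thesis using LX cL dL by (intro disjI1 exI[of _ "c + card R"]) auto
      next
        case False
        then obtain k0 where k0: "k0 \<in> Q" by blast
        then have "k0 \<in> K" by (simp add: Q_def)
        have Qeq: "Q = {k0}" using k0 inj Q_Max by (auto simp: Q_def)
        consider (A) k where "k \<in> K" "Suc i \<le> Max (D k)" "Suc i \<notin> L k"
          | (B) k where "k \<in> K" "i \<le> Max (D k)" "i \<notin> L k"
          | (T) "\<forall>k\<in>K. Suc i \<le> Max (D k) \<longrightarrow> Suc i \<in> L k" "\<forall>k\<in>K. i \<le> Max (D k) \<longrightarrow> i \<in> L k"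
          by blast
        then show ?thesis
        proof cases
          case A
          define L' where "L' = L(k := insert (Suc i) (L k))"
          have "{k \<in> K. i \<in> L' k} = {k \<in> K. i \<in> L k}" "{k \<in> K. Suc i \<in> L' k} = insert k {k \<in> K. Suc i \<in> L k}"
            using A by (auto simp: L'_def)
          then have cards: "card {k \<in> K. i \<in> L' k} = c + card R"
            "card {k \<in> K. Suc i \<in> L' k} = Suc (card {k \<in> K. Suc i \<in> L k})"
            using A fin cL by simp_all
          have "insert (Suc i) (L k) \<in> cols (D k)"
            using L[OF A(1)] A(2) by (intro column.cols_up[OF D[OF A(1)] L[OF A(1)]]) (auto simp: cols_def)
          then have "two_exp i \<delta> (card {k \<in> K. i \<in> L' k}) (card {k \<in> K. Suc i \<in> L' k}) \<in> X"
            using L L_iff(3) by (intro XI) (auto simp: L'_def)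
          then show ?thesis using cards dL Qeq
            by (intro disjI1 exI[of _ "c + card R"]) auto
        next
          case B
          define L' where "L' = L(k := insert i (L k))"
          have "{k \<in> K. i \<in> L' k} = insert k {k \<in> K. i \<in> L k}" "{k \<in> K. Suc i \<in> L' k} = {k \<in> K. Suc i \<in> L k}"
            using B by (auto simp: L'_def)
          then have cards: "card {k \<in> K. i \<in> L' k} = Suc (c + card R)"
            "card {k \<in> K. Suc i \<in> L' k} = card {k \<in> K. Suc i \<in> L k}"
            using B fin cL by simp_all
          have "insert i (L k) \<in> cols (D k)"
            using L[OF B(1)] B(2) i1[OF B(1)]
            by (intro column.cols_up[OF D[OF B(1)] L[OF B(1)]]) (auto simp: cols_def)
          then have "two_exp i \<delta> (card {k \<in> K. i \<in> L' k}) (card {k \<in> K. Suc i \<in> L' k}) \<in> X"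
            using L L_iff(3) by (intro XI) (auto simp: L'_def)
          then show ?thesis using cards dL Qeq
            by (intro disjI1 exI[of _ "Suc (c + card R)"]) auto
        next
          case T
          define H where "H = {k \<in> K. Suc i \<le> Max (D k)}"
          have L_le: "j \<le> Max (D k)" if "k \<in> K" "j \<in> L k" for j k
            using C_le[OF that(1) L[OF that(1)] that(2)] .
          have "{k \<in> K. Suc i \<in> L k} = H" using T(1) by (auto simp: H_def dest: L_le)
          moreover have "{k \<in> K. i \<in> L k} = insert k0 H"
          proof -
            have "{k \<in> K. i \<in> L k} = {k \<in> K. i \<le> Max (D k)}" using T(2) by (auto dest: L_le)
            moreover have "k = k0" if "k \<in> K" "Max (D k) = i" for k
              using inj[of k k0] that \<open>k0 \<in> K\<close> Q_Max[OF k0] by simp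
            then have "{k \<in> K. i \<le> Max (D k)} = insert k0 H"
              using Q_Max[OF k0] \<open>k0 \<in> K\<close> unfolding H_def
              by (intro set_eqI) (metis (mono_tags, lifting) Suc_le_eq insert_iff le_neq_implies_less
                  less_imp_le mem_Collect_eq order_refl)
            ultimately show ?thesis by simp
          qed
          moreover have "k0 \<notin> H" using Q_Max[OF k0] by (simp add: H_def)
          moreover have "finite H" using fin by (simp add: H_def)
          ultimately have H: "card {k \<in> K. Suc i \<in> L k} = card H" "card {k \<in> K. i \<in> L k} = Suc (card H)"
            by simp_all
          moreover have "card Q = 1" using Qeq by simp
          ultimately have "card R = 0" "c = Suc (card H)" "d = Suc (card H)"
            using cL dL cd(2) by linarith+
          moreover have "two_exp i \<delta> (card H) (Suc (card H)) \<notin> X"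
          proof
            assume "two_exp i \<delta> (card H) (Suc (card H)) \<in> X"
            from col_sums_two_exp[OF \<delta> this[unfolded X_def]]
            obtain B where B: "\<And>k. k \<in> K \<Longrightarrow> B k \<in> cols (D k)" "Suc (card H) = card {k \<in> K. Suc i \<in> B k}"
              by metis
            have "{k \<in> K. Suc i \<in> B k} \<subseteq> H" using B(1) by (auto simp: H_def intro: C_le)
            then have "card {k \<in> K. Suc i \<in> B k} \<le> card H" using fin by (intro card_mono) (auto simp: H_def)
            then show False using B by simp
          qed
          ultimately show ?thesis using LX H by (intro disjI2) simp
        qed
      qed
      from cases show ?thesis
      proof (elim disjE exE conjE)
        fix a assume a: "c \<le> a" "a \<le> c + d" "two_exp i \<delta> a (c + d - a) \<in> X"
        show "0 < P c d"
        proof (cases "0 < g c d")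
          case True
          then show ?thesis unfolding P_eq using F0 by (smt (verit))
        next
          case False
          then have "a \<noteq> c" using a g_iff by auto
          then have "c < a" "0 < d" using a by auto
          \<comment> \<open>A mirror exponent of \<open>f\<close> has enough columns with \<open>i + 1\<close> but not \<open>i\<close> to be moved
          back to \<open>(c, d)\<close>.\<close>
          have zero: "g (c + d - a') a' = 0" if a': "c < a'" "a' \<le> c + d" for a'
          proof (rule ccontr)
            assume "g (c + d - a') a' \<noteq> 0"
            then have "0 < g (c + d - a') a'" using g0[of "c + d - a'" a'] by linarith
            then have "two_exp i \<delta> (c + d - a') a' \<in> X" by (simp only: g_iff)
            from col_sums_two_exp[OF \<delta> this[unfolded X_def]] obtain B where B: "\<And>k. k \<in> K \<Longrightarrow> B k \<in> cols (D k)"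
              "c + d - a' = card {k \<in> K. i \<in> B k}" "a' = card {k \<in> K. Suc i \<in> B k}"
              "\<And>j. j \<noteq> i \<Longrightarrow> j \<noteq> Suc i \<Longrightarrow> Poly_Mapping.lookup \<delta> j = card {k \<in> K. j \<in> B k}"
              by blast
            define N where "N = {k \<in> K. Suc i \<in> B k \<and> i \<notin> B k}"
            have "{k \<in> K. Suc i \<in> B k} \<subseteq> N \<union> {k \<in> K. i \<in> B k}" by (auto simp: N_def)
            then have "a' \<le> card (N \<union> {k \<in> K. i \<in> B k})"
              unfolding B(3) using fin by (intro card_mono) (auto simp: N_def)
            also have "\<dots> \<le> card N + (c + d - a')" unfolding B(2) by (rule card_Un_le)
            finally have "c - (c + d - a') \<le> card N" using a' by simp
            then obtain U where U: "U \<subseteq> N" "card U = c - (c + d - a')"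
              by (meson obtain_subset_with_card_n)
            define B' where "B' k = (if k \<in> U then insert i (B k - {Suc i}) else B k)" for k
            have finU: "finite U" using U fin finite_subset by (fastforce simp: N_def)
            have UN: "k \<in> K" "Suc i \<in> B k" "i \<notin> B k" if "k \<in> U" for k using that U by (auto simp: N_def)
            have "B' k \<in> cols (D k)" if "k \<in> K" for k
              using column.cols_lower[OF D[OF that] B(1)[OF that]] B(1)[OF that] UN[of k] by (auto simp: B'_def)
            moreover have "{k \<in> K. i \<in> B' k} = {k \<in> K. i \<in> B k} \<union> U" "{k \<in> K. i \<in> B k} \<inter> U = {}"
              using UN by (auto simp: B'_def)
            then have "card {k \<in> K. i \<in> B' k} = c"
              using fin finU U a' \<open>d \<le> c\<close> by (simp add: card_Un_disjoint B(2)[symmetric])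
            moreover have "{k \<in> K. Suc i \<in> B' k} = {k \<in> K. Suc i \<in> B k} - U"
              using UN by (auto simp: B'_def)
            then have "card {k \<in> K. Suc i \<in> B' k} = a' - card U"
              using fin finU UN by (subst B(3)) (auto intro!: card_Diff_subset)
            then have "card {k \<in> K. Suc i \<in> B' k} = d" using U a' \<open>d \<le> c\<close> by simp
            moreover have "{k \<in> K. j \<in> B' k} = {k \<in> K. j \<in> B k}" if "j \<noteq> i" "j \<noteq> Suc i" for j
              using that by (auto simp: B'_def)
            ultimately have "two_exp i \<delta> c d \<in> X"
              unfolding X_def using B(4) by (intro two_exp_col_sums[OF \<delta>, of _ B']) auto
            then show False using False g_iff by blast
          qed
          have "0 < F c (d - 1)" unfolding F_def
          proof (rule div_diff_coeff_pos[OF \<delta>])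
            show "0 < Poly_Mapping.lookup f (two_exp i \<delta> a (c + (d - 1) + 1 - a))"
              using a g_iff \<open>0 < d\<close> by (simp add: g_def)
            show "Poly_Mapping.lookup f (two_exp i \<delta> (c + (d - 1) + 1 - a') a') = 0"
              if "c < a'" "a' \<le> c + (d - 1) + 1" for a'
              using zero[of a'] that \<open>0 < d\<close> by (simp add: g_def)
          qed (use \<open>c < a\<close> a \<open>0 < d\<close> g0 F0 in \<open>auto simp: g_def F_def\<close>)
          then show ?thesis unfolding P_eq using g0[of c d] F0[of "c - 1" "d - 1"] \<open>0 < d\<close>
            by (cases "c = 0") simp_all
        qed
      next
        assume top: "c = d" "0 < d" "two_exp i \<delta> c (c - 1) \<in> X" "two_exp i \<delta> (c - 1) c \<notin> X"
        have g1: "0 < g c (c - 1)" unfolding g_iff by (rule top)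
        have "\<not> 0 < g (c - 1) c" unfolding g_iff by (rule top)
        then have g2: "g (c - 1) c = 0" using g0[of "c - 1" c] by linarith
        have "F (c - 1) (c - 1) - (if c - 1 = 0 then 0 else F c (c - 1 - 1)) = g c (c - 1) - g (c - 1) c"
          using div_diff_coeff[OF \<delta>, where f = f and a = c and b = "c - 1"] top
          unfolding g_def F_def by simp
        then have "0 < F (c - 1) (c - 1)"
          using g1 g2 F0[of c "c - 1 - 1"] by (simp split: if_split_asm)
        then show "0 < P c d" unfolding P_eq using g0[of c d] F0[of c "d - 1"] top by simp
      qed
    qed
    have "0 < P c0 d0"
    proof (cases "d0 \<le> c0")
      case True
      then show ?thesis using main m by (simp add: m_eq X'_def)
    next
      case False
      have "two_exp i \<delta> d0 c0 \<in> X'"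
        by (rule spread[of c0 d0]) (use m False in \<open>auto simp: m_eq X'_def\<close>)
      then have "0 < P d0 c0" using main False by simp
      then show ?thesis by (simp add: P_sym)
    qed
    then show "m \<in> Poly_Mapping.keys (lascoux_op i f)"
      by (simp add: P_def m_eq in_keys_iff)
  }
qed

section \<open>Supports for fireworks permutations\<close>

text \<open>
  The fireworks condition on positions: whenever \<open>w (p + 1)\<close> is larger than its predecessor, it
  is larger than all earlier values. This form is inherited when the letter 1 is removed.
\<close>

definition records_at_ascents :: "nat \<Rightarrow> (nat \<Rightarrow> nat) \<Rightarrow> bool" where
  "records_at_ascents n w \<longleftrightarrow>
     (\<forall>p q. 1 \<le> p \<longrightarrow> p < n \<longrightarrow> w p < w (Suc p) \<longrightarrow> 1 \<le> q \<longrightarrow> q \<le> p \<longrightarrow> w q < w (Suc p))"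

lemma ex_decreasing_run:
  assumes w: "w permutes {1..n}" and p: "1 \<le> p" "p \<le> n" and start: "\<not> (1 < p \<and> w (p - 1) > w p)"
  obtains b where "decreasing_run n w p b"
proof -
  define Q where "Q b \<longleftrightarrow> p \<le> b \<and> b \<le> n \<and> strict_antimono_on {p..b} w" for b
  have "Q p" using p by (simp add: Q_def monotone_on_def)
  have finQ: "finite {b. Q b}" by (rule finite_subset[of _ "{..n}"]) (auto simp: Q_def)
  define b where "b = Max {b. Q b}"
  have b: "Q b" using Max_in[OF finQ] \<open>Q p\<close> unfolding b_def by blast
  have max: "b' \<le> b" if "Q b'" for b' unfolding b_def using that finQ by simp
  have "\<not> (b < n \<and> w b > w (b + 1))"
  proof
    assume a: "b < n \<and> w b > w (b + 1)"
    have "strict_antimono_on {p..b + 1} w"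
    proof (rule monotone_onI)
      fix x y assume xy: "x \<in> {p..b + 1}" "y \<in> {p..b + 1}" "x < y"
      have dec: "w y' < w x'" if "x' \<in> {p..b}" "y' \<in> {p..b}" "x' < y'" for x' y'
        using b that by (auto simp: Q_def monotone_on_def)
      show "w x > w y"
      proof (cases "y = b + 1")
        case True
        then show ?thesis using xy a dec[of x b] by (cases "x = b") auto
      next
        case False
        then show ?thesis using xy dec[of x y] by auto
      qed
    qed
    then have "Q (b + 1)" using a b by (simp add: Q_def)
    then show False using max by fastforce
  qed
  then have "decreasing_run n w p b" using b p start by (simp add: decreasing_run_def Q_def)
  then show ?thesis using that by blast
qed

lemma fireworks_records:
  assumes w: "w permutes {1..n}" and fw: "fireworks n w"
  shows "records_at_ascents n w"
  unfolding records_at_ascents_def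
proof (intro allI impI)
  fix p q assume p: "1 \<le> p" "p < n" "w p < w (Suc p)" and q: "1 \<le> q" "q \<le> p"
  obtain b where b: "decreasing_run n w (Suc p) b"
    using ex_decreasing_run[OF w, of "Suc p"] p by auto
  \<comment> \<open>Walk back from \<open>q\<close> to the start \<open>a\<close> of its decreasing run; the values only increase.\<close>
  have "\<exists>a. 1 \<le> a \<and> a \<le> q \<and> w q \<le> w a \<and> \<not> (1 < a \<and> w (a - 1) > w a)"
    using q(1)
  proof (induction q rule: nat_induct_at_least)
    case base
    then show ?case by (intro exI[of _ 1]) auto
  next
    case (Suc q)
    show ?case
    proof (cases "w q > w (Suc q)")
      case True
      then show ?thesis using Suc.IH by (meson le_Suc_eq less_imp_le order_trans)
    next
      case False
      then show ?thesis using Suc by (intro exI[of _ "Suc q"]) auto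
    qed
  qed
  then obtain a where a: "1 \<le> a" "a \<le> q" "w q \<le> w a" "\<not> (1 < a \<and> w (a - 1) > w a)" by blast
  then obtain b' where "decreasing_run n w a b'"
    using ex_decreasing_run[OF w, of a] p q by auto
  then have "w a < w (Suc p)" using fw b a q unfolding fireworks_def by (metis le_imp_less_Suc order_trans)
  then show "w q < w (Suc p)" using a by simp
qed

text \<open>
  If the letter 1 stands at position \<open>k\<close>, there is an ascent from \<open>k\<close> to \<open>k + 1\<close>. So \<open>w (k + 1)\<close>
  exceeds all earlier values, which also settles the new neighbours \<open>k - 1\<close> and \<open>k\<close> of \<open>v\<close>.
\<close>

lemma insert_one_records:
  assumes v: "v permutes {1..m}" and k: "k \<in> {1..Suc m}" and fw: "records_at_ascents (Suc m) (insert_one k v)"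
  shows "records_at_ascents m v" and "2 \<le> k \<Longrightarrow> k \<le> m \<Longrightarrow> v (k - 1) < v k"
proof -
  define w where "w = insert_one k v"
  have w1: "w i = Suc (v i)" if "i < k" "1 \<le> i" for i using that by (simp add: w_def insert_one_def)
  have wk: "w k = 1" using k by (simp add: w_def insert_one_def)
  have w2: "w (Suc i) = Suc (v i)" if "k \<le> i" for i using that k by (simp add: w_def insert_one_def)
  have rec: "w q < w (Suc p)" if "1 \<le> p" "p < Suc m" "w p < w (Suc p)" "1 \<le> q" "q \<le> p" for p q
    using fw that unfolding w_def records_at_ascents_def by blast
  have vpos: "0 < v i" if "1 \<le> i" for i using permutes_zero[OF v, of i] that by simp
  have k_rec: "v q < v k" if "1 \<le> q" "q < k" "k \<le> m" for q
    using rec[of k q] that w1[of q] w2[of k] wk vpos[of k] by auto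
  then show "2 \<le> k \<Longrightarrow> k \<le> m \<Longrightarrow> v (k - 1) < v k" by simp
  show "records_at_ascents m v"
    unfolding records_at_ascents_def
  proof (intro allI impI)
    fix p q assume p: "1 \<le> p" "p < m" "v p < v (Suc p)" and q: "1 \<le> q" "q \<le> p"
    consider "Suc p < k" | "Suc p = k" | "k \<le> p" by linarith
    then show "v q < v (Suc p)"
    proof cases
      case 1
      then show ?thesis using rec[of p q] p q w1[of p] w1[of "Suc p"] w1[of q] by auto
    next
      case 2
      then show ?thesis using k_rec[of q] p q by auto
    next
      case 3
      have "w (Suc p) < w (Suc (Suc p))" using w2[of p] w2[of "Suc p"] p 3 by simp
      then have *: "w q' < w (Suc (Suc p))" if "1 \<le> q'" "q' \<le> Suc p" for q'
        using rec[of "Suc p" q'] p that by simp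
      show ?thesis
        using *[of q] *[of "Suc q"] w1[of q] w2[of q] w2[of "Suc p"] p q 3 by (cases "q < k") auto
    qed
  qed
qed

text \<open>
  The positions of \<open>v\<close> inside \<open>insert_one k v\<close>. Going from \<open>shift_above (j + 1)\<close> to
  \<open>shift_above j\<close> on a set is \<open>move_up j\<close>, the effect of one operator of the chain.
\<close>

definition shift_above :: "nat \<Rightarrow> nat \<Rightarrow> nat" where
  "shift_above k q = (if q < k then q else Suc q)"

lemma inj_shift_above: "inj (shift_above k)"
  by (auto simp: inj_def shift_above_def split: if_splits)

lemma Max_shift_above:
  assumes "finite D" "D \<noteq> {}"
  shows "Max (shift_above k ` D) = shift_above k (Max D)"
  using mono_Max_commute[of "shift_above k" D] assms by (auto simp: mono_def shift_above_def)

lemma move_up_shift_above: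
  "move_up j (shift_above (Suc j) ` D) = shift_above j ` D"
proof -
  have "x \<in> move_up j (shift_above (Suc j) ` D) \<longleftrightarrow> x \<in> shift_above j ` D" for x
  proof -
    have s: "y \<in> shift_above l ` D \<longleftrightarrow> (y < l \<and> y \<in> D) \<or> (l < y \<and> y - 1 \<in> D)" for y l
      by (auto simp: shift_above_def image_iff split: if_splits intro: bexI[of _ "y - 1"])
    show ?thesis unfolding move_up_def using s[of j "Suc j"]
      by (cases "x = j"; cases "x = Suc j") (auto simp: s)
  qed
  then show ?thesis by blast
qed

lemma var_cone_div_diff_nonneg:
  assumes "f \<in> var_cone (pgroths m) k" "1 \<le> i" "i < k"
  shows "nonneg_poly (div_diff i f)"
proof -
  have "div_diff i f \<in> var_cone (div_diff i ` pgroths m) k"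
    by (rule var_cone_image[OF assms(1)])
       (use assms in \<open>auto simp: div_diff_add div_diff_Var_mult intro: var_cone.base\<close>)
  then show ?thesis
    by (rule var_cone_nonneg) (use assms pgroth_nonneg(2) in \<open>auto simp: pgroths_def\<close>)
qed

lemma keys_Var_mult:
  "Poly_Mapping.keys (Var i * f) = (\<lambda>a. a + Poly_Mapping.single i 1) ` Poly_Mapping.keys f"
proof (intro equalityI subsetI)
  fix m assume m: "m \<in> Poly_Mapping.keys (Var i * f)"
  then have "Poly_Mapping.lookup m i \<noteq> 0" "m - Poly_Mapping.single i 1 \<in> Poly_Mapping.keys f"
    by (auto simp: in_keys_iff lookup_Var_mult split: if_splits)
  moreover from this(1) have "m - Poly_Mapping.single i 1 + Poly_Mapping.single i 1 = m"
    by (intro poly_mapping_eqI) (auto simp: lookup_add lookup_minus lookup_single when_def)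
  ultimately show "m \<in> (\<lambda>a. a + Poly_Mapping.single i 1) ` Poly_Mapping.keys f"
    by (metis image_eqI)
next
  fix m assume "m \<in> (\<lambda>a. a + Poly_Mapping.single i 1) ` Poly_Mapping.keys f"
  then obtain a where "a \<in> Poly_Mapping.keys f" "m = a + Poly_Mapping.single i 1" by blast
  then show "m \<in> Poly_Mapping.keys (Var i * f)"
    by (simp add: in_keys_iff lookup_Var_mult lookup_add)
qed

lemma keys_prod_Var_mult:
  assumes "finite A"
  shows "Poly_Mapping.keys ((\<Prod>i\<in>A. Var i) * f) =
    (\<lambda>a. a + (\<Sum>i\<in>A. Poly_Mapping.single i 1)) ` Poly_Mapping.keys f"
  using assms
proof induction
  case (insert i A)
  have eq: "(\<Prod>i\<in>insert i A. Var i) * f = Var i * ((\<Prod>i\<in>A. Var i) * f)"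
    using insert by (simp add: mult.assoc)
  show ?case unfolding eq keys_Var_mult[of i] insert.IH image_image
    using insert by (intro image_cong) (simp_all add: add_ac)
qed simp

text \<open>
  An initial interval admits only itself, so its summand is the single monomial \<open>x\<^sub>1 \<cdots> x\<^sub>k\<^sub>-\<^sub>1\<close>.
\<close>

lemma cols_interval:
  assumes "2 \<le> k"
  shows "cols {1..<k} = {{1..<k}}"
proof -
  have Max: "Max {1..<k} = k - 1" using assms by (intro Max_eqI) auto
  have I: "{1..<k} = {1..k - 1}" using assms by auto
  have "C = {1..k - 1}" if C: "C \<subseteq> {1..k - 1}" "\<forall>t. cnt {1..k - 1} t \<le> cnt C t" for C
  proof -
    have "C \<inter> {1..k - 1} = C" using C(1) by blast
    then have "card {1..k - 1} \<le> card C"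
      using C(2)[rule_format, of "k - 1"] by (simp add: cnt_def)
    then show ?thesis using C(1) by (intro card_seteq) auto
  qed
  then show ?thesis unfolding cols_def Max unfolding I by blast
qed

lemma col_sums_reindex:
  assumes "inj_on h K"
  shows "col_sums (h ` K) \<phi> = col_sums K (\<lambda>k. \<phi> (h k))"
proof (intro equalityI subsetI)
  have card: "card {k \<in> h ` K. i \<in> C k} = card {k \<in> K. i \<in> C (h k)}" for C :: "'b \<Rightarrow> nat set" and i
  proof -
    have "{k \<in> h ` K. i \<in> C k} = h ` {k \<in> K. i \<in> C (h k)}" by auto
    moreover have "inj_on h {k \<in> K. i \<in> C (h k)}" using assms by (auto simp: inj_on_def)
    ultimately show ?thesis by (simp add: card_image)
  qed
  {
    fix m assume "m \<in> col_sums (h ` K) \<phi>"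
    then obtain C where "\<forall>k\<in>h ` K. C k \<in> \<phi> k" "\<forall>i. Poly_Mapping.lookup m i = card {k \<in> h ` K. i \<in> C k}"
      by (auto simp: col_sums_def)
    then show "m \<in> col_sums K (\<lambda>k. \<phi> (h k))"
      unfolding col_sums_def card by (intro CollectI exI[of _ "\<lambda>k. C (h k)"]) auto
  next
    fix m assume "m \<in> col_sums K (\<lambda>k. \<phi> (h k))"
    then obtain C where C: "\<forall>k\<in>K. C k \<in> \<phi> (h k)" "\<forall>i. Poly_Mapping.lookup m i = card {k \<in> K. i \<in> C k}"
      by (auto simp: col_sums_def)
    define C' where "C' k = C (inv_into K h k)" for k
    have C': "C' (h k) = C k" if "k \<in> K" for k using that assms by (simp add: C'_def)
    then have "{k \<in> K. i \<in> C' (h k)} = {k \<in> K. i \<in> C k}" for i by auto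
    then show "m \<in> col_sums (h ` K) \<phi>"
      unfolding col_sums_def using C C' by (intro CollectI exI[of _ C']) (auto simp: card)
  }
qed

lemma lookup_sum_single:
  "finite A \<Longrightarrow> Poly_Mapping.lookup (\<Sum>i\<in>A. Poly_Mapping.single i (1::nat)) j = of_bool (j \<in> A)"
  by (induction A rule: finite_induct) (auto simp: lookup_add lookup_single when_def)

lemma col_sums_insert_fixed:
  assumes fin: "finite K" "finite D0" and D0: "D0 \<notin> K" and cols: "cols D0 = {D0}"
  shows "col_sums (insert D0 K) cols = (\<lambda>a. a + (\<Sum>i\<in>D0. Poly_Mapping.single i 1)) ` col_sums K cols"
proof (intro equalityI subsetI)
  have card: "card {k \<in> insert D0 K. i \<in> C k} = of_bool (i \<in> C D0) + card {k \<in> K. i \<in> C k}"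
    for C :: "nat set \<Rightarrow> nat set" and i
  proof -
    have "{k \<in> insert D0 K. i \<in> C k} =
        (if i \<in> C D0 then insert D0 {k \<in> K. i \<in> C k} else {k \<in> K. i \<in> C k})" by auto
    then show ?thesis using fin D0 by simp
  qed
  {
    fix m assume "m \<in> col_sums (insert D0 K) cols"
    then obtain C where C: "\<forall>k\<in>K. C k \<in> cols k" "C D0 = D0"
      "\<And>i. Poly_Mapping.lookup m i = of_bool (i \<in> D0) + card {k \<in> K. i \<in> C k}"
      unfolding col_sums_def card using cols by auto
    define a where "a = m - (\<Sum>i\<in>D0. Poly_Mapping.single i 1)"
    have "Poly_Mapping.lookup a i = card {k \<in> K. i \<in> C k}" for i
      using C(3) fin by (simp add: a_def lookup_minus lookup_sum_single del: One_nat_def)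
    then have "a \<in> col_sums K cols" using C by (auto simp: col_sums_def)
    moreover have "m = a + (\<Sum>i\<in>D0. Poly_Mapping.single i 1)"
      using C(3) fin by (intro poly_mapping_eqI) (simp add: a_def lookup_add lookup_minus lookup_sum_single del: One_nat_def)
    ultimately show "m \<in> (\<lambda>a. a + (\<Sum>i\<in>D0. Poly_Mapping.single i 1)) ` col_sums K cols" by blast
  next
    fix m assume "m \<in> (\<lambda>a. a + (\<Sum>i\<in>D0. Poly_Mapping.single i 1)) ` col_sums K cols"
    then obtain a C where m: "m = a + (\<Sum>i\<in>D0. Poly_Mapping.single i 1)"
      and C: "\<forall>k\<in>K. C k \<in> cols k" "\<forall>i. Poly_Mapping.lookup a i = card {k \<in> K. i \<in> C k}"
      by (auto simp: col_sums_def)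
    define C' where "C' = C(D0 := D0)"
    have "{k \<in> K. i \<in> C' k} = {k \<in> K. i \<in> C k}" for i using D0 by (auto simp: C'_def)
    then have "Poly_Mapping.lookup m i = card {k \<in> insert D0 K. i \<in> C' k}" for i
      unfolding card using C fin by (simp add: m lookup_add lookup_sum_single C'_def del: One_nat_def)
    then show "m \<in> col_sums (insert D0 K) cols"
      unfolding col_sums_def using C cols D0 by (intro CollectI exI[of _ C']) (auto simp: C'_def)
  }
qed

definition descents :: "nat \<Rightarrow> (nat \<Rightarrow> nat) \<Rightarrow> nat set" where
  "descents n w = {p. 1 \<le> p \<and> p < n \<and> w (Suc p) < w p}"

text \<open>
  Let \<open>w = insert_one k v\<close>. The chain of operators shifts the sets for \<open>v\<close> away from \<open>k\<close>, one
  operator at a time; the maxima stay distinct throughout. The prefactor adds the set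
  \<open>{1..k - 1}\<close>, whose maximum is new because \<open>k - 1\<close> is not a descent of \<open>v\<close>
  (\<open>insert_one_records\<close>). The descents appear in the claim because this step of the induction
  refers to those of \<open>v\<close>.
\<close>

theorem fireworks_support:
  assumes "w permutes {1..n}" "records_at_ascents n w"
  shows "\<exists>DD. finite DD \<and> (\<forall>D\<in>DD. D \<noteq> {} \<and> D \<subseteq> {1..<n}) \<and> inj_on Max DD \<and>
    Max ` DD = descents n w \<and> Poly_Mapping.keys (pgroth n w) = col_sums DD cols"
  using assms
proof (induction n arbitrary: w)
  case 0
  then have "w = longest_perm 0" by (auto simp: fun_eq_iff longest_perm_def)
  then have "Poly_Mapping.keys (pgroth 0 w) = {0}" by (simp add: pgroth_longest)
  moreover have "col_sums {} cols = {0}"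
    by (auto simp: col_sums_def intro: poly_mapping_eqI)
  ultimately show ?case by (intro exI[of _ "{}"]) (auto simp: descents_def)
next
  case (Suc m)
  obtain k v where k: "k \<in> {1..Suc m}" and v: "v permutes {1..m}" and w: "w = insert_one k v"
    by (rule insert_one_cases[OF Suc.prems(1)])
  have "records_at_ascents (Suc m) (insert_one k v)" using Suc.prems(2) w by simp
  note rec = insert_one_records[OF v k this]
  obtain DD where DD: "finite DD" "\<And>D. D \<in> DD \<Longrightarrow> D \<noteq> {} \<and> D \<subseteq> {1..<m}" "inj_on Max DD"
    "Max ` DD = descents m v" "Poly_Mapping.keys (pgroth m v) = col_sums DD cols"
    using Suc.IH[OF v rec(1)] by metis
  have finD: "finite D" if "D \<in> DD" for D using DD(2)[OF that] finite_subset by blast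
  have MaxD: "Max D \<in> {1..<m}" if "D \<in> DD" for D
    using Max_in[OF finD[OF that]] DD(2)[OF that] by blast
  have Max_sh: "Max (shift_above l ` D) = shift_above l (Max D)" if "D \<in> DD" for D l
    using DD(2)[OF that] finD[OF that] by (intro Max_shift_above) auto
  have pv: "pgroth m v \<in> pgroths m" using v by (auto simp: pgroths_def)
  have chain: "Poly_Mapping.keys (lascoux_chain j (Suc m) (pgroth m v)) =
      col_sums DD (\<lambda>D. cols (shift_above j ` D))" if "j \<le> Suc m" "1 \<le> j" for j
    using that
  proof (induction j rule: inc_induct)
    case base
    have "shift_above (Suc m) ` D = D" if "D \<in> DD" for D
      using DD(2)[OF that] by (force simp: shift_above_def image_iff)
    then have "col_sums DD (\<lambda>D. cols (shift_above (Suc m) ` D)) = col_sums DD cols"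
      unfolding col_sums_def by simp
    then show ?case using DD(5) by simp
  next
    case (step j)
    let ?f = "lascoux_chain (Suc j) (Suc m) (pgroth m v)"
    have cone: "?f \<in> var_cone (pgroths m) (Suc j)"
      using pv step by (intro lascoux_chain_cone) auto
    have "Poly_Mapping.keys (lascoux_op j ?f) = col_sums DD (\<lambda>D. cols (move_up j (shift_above (Suc j) ` D)))"
    proof (rule lascoux_op_support)
      show "column (shift_above (Suc j) ` D) j" if "D \<in> DD" for D
        using DD(2)[OF that] finD[OF that] step
        by unfold_locales (auto simp: shift_above_def)
      show "D = D'" if "D \<in> DD" "D' \<in> DD" "Max (shift_above (Suc j) ` D) = j" "Max (shift_above (Suc j) ` D') = j"
        for D D'
      proof -
        have "Max D = Max D'"
          using that injD[OF inj_shift_above, of "Suc j" "Max D" "Max D'"] by (simp add: Max_sh)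
        then show ?thesis using DD(3) that by (auto simp: inj_on_def)
      qed
      show "nonneg_poly ?f"
        by (rule var_cone_nonneg[OF cone]) (use pgroth_nonneg(1) in \<open>auto simp: pgroths_def\<close>)
      show "nonneg_poly (div_diff j ?f)"
        by (rule var_cone_div_diff_nonneg[OF cone]) (use step in auto)
    qed (use DD step in auto)
    then show ?case using step by (simp add: lascoux_chain_Suc move_up_shift_above)
  qed
  define SS where "SS = (\<lambda>D. shift_above k ` D) ` DD"
  have inj_im: "inj_on (\<lambda>D. shift_above k ` D) DD"
    by (auto simp: inj_on_def inj_image_eq_iff[OF inj_shift_above])
  have keysH: "Poly_Mapping.keys (lascoux_chain k (Suc m) (pgroth m v)) = col_sums SS cols"
    using chain[of k] k by (simp add: SS_def col_sums_reindex[OF inj_im])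
  have SS: "finite SS" "\<And>D. D \<in> SS \<Longrightarrow> D \<noteq> {} \<and> D \<subseteq> {1..<Suc m}"
    using DD(1,2) by (auto simp: SS_def shift_above_def) (force+)?
  have injSS: "inj_on Max SS"
  proof (rule inj_onI)
    fix A B assume "A \<in> SS" "B \<in> SS" "Max A = Max B"
    then obtain D D' where "D \<in> DD" "D' \<in> DD" "A = shift_above k ` D" "B = shift_above k ` D'"
      "shift_above k (Max D) = shift_above k (Max D')"
      using Max_sh by (auto simp: SS_def)
    then show "A = B" using DD(3) injD[OF inj_shift_above] by (metis inj_onD)
  qed
  have MaxSS: "Max ` SS = shift_above k ` descents m v"
    unfolding DD(4)[symmetric] SS_def image_image using Max_sh by (intro image_cong) auto
  have k_no: "k - 1 \<notin> descents m v"
  proof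
    assume "k - 1 \<in> descents m v"
    then have "2 \<le> k" "k \<le> m" "v k < v (k - 1)" by (auto simp: descents_def)
    then show False using rec(2) by simp
  qed
  have desc: "descents (Suc m) w = shift_above k ` descents m v \<union> (if 2 \<le> k then {k - 1} else {})"
  proof -
    have vp: "0 < v i" if "1 \<le> i" for i using permutes_zero[OF v, of i] that by simp
    have "p \<in> descents (Suc m) w \<longleftrightarrow> p \<in> shift_above k ` descents m v \<union> (if 2 \<le> k then {k - 1} else {})" for p
    proof -
      have s: "p \<in> shift_above k ` descents m v \<longleftrightarrow>
          (p < k \<and> p \<in> descents m v) \<or> (k < p \<and> p - 1 \<in> descents m v)"
        by (auto simp: shift_above_def image_iff split: if_splits intro: bexI[of _ "p - 1"])
      consider "p = 0" | "1 \<le> p" "p < k - 1" | "1 \<le> p" "p = k - 1" | "p = k" | "k < p" using k by fastforce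
      then show ?thesis
      proof cases
        case 3
        then show ?thesis using k vp[of "k - 1"] by (auto simp: descents_def w insert_one_def)
      next
        case 4
        then show ?thesis using k vp[of k] unfolding Un_iff s by (auto simp: descents_def w insert_one_def)
      next
        case 5
        then show ?thesis using k unfolding Un_iff s by (cases p) (auto simp: descents_def w insert_one_def)
      qed (use k in \<open>unfold Un_iff s, auto simp: descents_def w insert_one_def\<close>)
    qed
    then show ?thesis by blast
  qed
  have G: "pgroth (Suc m) w = (\<Prod>i\<in>{1..<k}. Var i) * lascoux_chain k (Suc m) (pgroth m v)"
    using k v by (simp add: w pgroth_insert_one)
  show ?case
  proof (cases "2 \<le> k")
    case False
    then have "k = 1" using k by auto
    then have "Poly_Mapping.keys (pgroth (Suc m) w) = col_sums SS cols"
      using G keysH by simp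
    then show ?thesis using SS injSS MaxSS desc False by (intro exI[of _ SS]) auto
  next
    case True
    have MaxI: "Max {1..<k} = k - 1" using True by (intro Max_eqI) auto
    have "k - 1 \<notin> Max ` SS"
      unfolding MaxSS using k_no True by (auto simp: shift_above_def image_iff split: if_splits)
    then have nin: "{1..<k} \<notin> SS" using MaxI by (metis image_eqI)
    have "Poly_Mapping.keys (pgroth (Suc m) w) = col_sums (insert {1..<k} SS) cols"
      unfolding G keys_prod_Var_mult[OF finite_atLeastLessThan] keysH
        col_sums_insert_fixed[OF SS(1) finite_atLeastLessThan nin cols_interval[OF True]] ..
    moreover have "inj_on Max (insert {1..<k} SS)"
      using injSS nin \<open>k - 1 \<notin> Max ` SS\<close> MaxI by (simp add: inj_on_insert)
    moreover have "Max ` insert {1..<k} SS = descents (Suc m) w"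
      using MaxSS desc True MaxI by auto
    ultimately show ?thesis using SS True k by (intro exI[of _ "insert {1..<k} SS"]) auto
  qed
qed

section \<open>M-convexity of sums of column sets\<close>

text \<open>
  The net outflow at \<open>x\<close> of a set of directed edges.
\<close>

definition flow :: "(nat \<times> nat) set \<Rightarrow> nat \<Rightarrow> int" where
  "flow Q x = (\<Sum>e\<in>Q. of_bool (fst e = x) - of_bool (snd e = x))"

lemma flow_insert: "finite Q \<Longrightarrow> (a, b) \<notin> Q \<Longrightarrow> flow (insert (a, b) Q) x =
    of_bool (a = x) - of_bool (b = x) + flow Q x"
  by (simp add: flow_def)

lemma flow_diff: "finite M \<Longrightarrow> Q \<subseteq> M \<Longrightarrow> flow (M - Q) x = flow M x - flow Q x"
  by (simp add: flow_def sum_diff)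

lemma flow_converse: "flow (Q\<inverse>) x = - flow Q x"
proof -
  have "Q\<inverse> = prod.swap ` Q" by auto
  then have "flow (Q\<inverse>) x = (\<Sum>e\<in>Q. of_bool (snd e = x) - of_bool (fst e = x))"
    unfolding flow_def by (simp add: sum.reindex)
  then show ?thesis by (simp add: flow_def flip: sum_negf)
qed

lemma sum_flow:
  assumes "finite A"
  shows "(\<Sum>x\<in>A. flow Q x) = (\<Sum>e\<in>Q. of_bool (fst e \<in> A) - of_bool (snd e \<in> A))"
proof -
  have "(\<Sum>x\<in>A. flow Q x) = (\<Sum>e\<in>Q. \<Sum>x\<in>A. of_bool (fst e = x) - of_bool (snd e = x))"
    unfolding flow_def by (rule sum.swap)
  also have "\<dots> = (\<Sum>e\<in>Q. of_bool (fst e \<in> A) - of_bool (snd e \<in> A))"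
    using assms by (intro sum.cong refl) (simp add: sum_subtractf of_bool_def sum.delta')
  finally show ?thesis .
qed

text \<open>
  Exchanging the pairs in \<open>Q\<close> between \<open>C\<close> and \<open>B\<close> turns \<open>C\<close> into a set \<open>C'\<close> whose counting
  function is at least the minimum of the two given ones; hence \<open>C'\<close> lies in every \<open>cols D\<close> that
  contains \<open>C\<close> and \<open>B\<close>. The vertex \<open>N\<close> stands for the homogenizing coordinate and absorbs the
  difference in size.
\<close>

definition swappable :: "nat \<Rightarrow> nat set \<Rightarrow> nat set \<Rightarrow> (nat \<times> nat) set \<Rightarrow> bool" where
  "swappable N C B Q \<longleftrightarrow> (\<exists>C'. C' \<subseteq> C \<union> B \<and>
     (\<forall>x<N. (of_bool (x \<in> C') :: int) = of_bool (x \<in> C) - flow Q x) \<and>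
     (\<forall>t. min (cnt C t) (cnt B t) \<le> cnt C' t))"

definition pairing :: "nat \<Rightarrow> nat set \<Rightarrow> nat set \<Rightarrow> (nat \<times> nat) set \<Rightarrow> bool" where
  "pairing N C B M \<longleftrightarrow> finite M \<and> M \<subseteq> insert N (C - B) \<times> insert N (B - C) \<and>
     (\<forall>x<N. (of_bool (x \<in> B) :: int) = of_bool (x \<in> C) - flow M x) \<and>
     (\<forall>Q\<subseteq>M. swappable N C B Q)"

text \<open>
  Swapping \<open>Q\<close> in \<open>B\<close> is the same as swapping the complement of \<open>Q\<close> in \<open>C\<close>.
\<close>

lemma pairing_converse:
  assumes "pairing N B C M"
  shows "pairing N C B (M\<inverse>)"
  unfolding pairing_def
proof (intro conjI allI impI)
  have M: "finite M" "M \<subseteq> insert N (B - C) \<times> insert N (C - B)"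
    "\<And>x. x < N \<Longrightarrow> (of_bool (x \<in> C) :: int) = of_bool (x \<in> B) - flow M x"
    "\<And>Q. Q \<subseteq> M \<Longrightarrow> swappable N B C Q"
    using assms unfolding pairing_def by blast+
  show "finite (M\<inverse>)" "M\<inverse> \<subseteq> insert N (C - B) \<times> insert N (B - C)" using M by auto
  show "(of_bool (x \<in> B) :: int) = of_bool (x \<in> C) - flow (M\<inverse>) x" if "x < N" for x
    using M(3)[OF that] by (simp add: flow_converse)
  fix Q assume Q: "Q \<subseteq> M\<inverse>"
  then have "M - Q\<inverse> \<subseteq> M" "Q\<inverse> \<subseteq> M" by auto
  with M(4)[of "M - Q\<inverse>"] obtain C' where C': "C' \<subseteq> B \<union> C"
    "\<forall>x<N. (of_bool (x \<in> C') :: int) = of_bool (x \<in> B) - flow (M - Q\<inverse>) x"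
    "\<forall>t. min (cnt B t) (cnt C t) \<le> cnt C' t"
    unfolding swappable_def by blast
  have "(of_bool (x \<in> C') :: int) = of_bool (x \<in> C) - flow Q x" if "x < N" for x
    using C'(2)[rule_format, OF that] M(3)[OF that] flow_diff[OF M(1) \<open>Q\<inverse> \<subseteq> M\<close>, of x]
    by (simp add: flow_converse)
  then show "swappable N C B Q"
    unfolding swappable_def using C' by (intro exI[of _ C']) (auto simp: min.commute)
qed

lemma pairing_nested:
  assumes sub: "B \<subseteq> C" and C: "C \<subseteq> {1..<N}"
  shows "pairing N C B ((C - B) \<times> {N})"
  unfolding pairing_def
proof (intro conjI allI impI)
  have fin: "finite C" using C finite_subset by blast
  have fl: "flow Q x = of_bool (x \<in> fst ` Q)" if Q: "Q \<subseteq> (C - B) \<times> {N}" and "x < N" for Q x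
  proof -
    have finQ: "finite Q" using Q fin finite_subset by (metis finite_Diff finite_SigmaI finite.emptyI finite_insert)
    have inj: "inj_on fst Q" using Q by (auto simp: inj_on_def)
    have "flow Q x = (\<Sum>e\<in>Q. of_bool (fst e = x))"
      unfolding flow_def using Q that by (intro sum.cong) auto
    also have "\<dots> = (\<Sum>y\<in>fst ` Q. of_bool (y = x))" by (simp add: sum.reindex[OF inj])
    also have "\<dots> = of_bool (x \<in> fst ` Q)" using finQ by (simp add: of_bool_def)
    finally show ?thesis .
  qed
  show "finite ((C - B) \<times> {N})" using fin by simp
  show "(of_bool (x \<in> B) :: int) = of_bool (x \<in> C) - flow ((C - B) \<times> {N}) x" if "x < N" for x
    using fl[OF subset_refl that] sub by auto
  fix Q assume Q: "Q \<subseteq> (C - B) \<times> {N}"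
  have "(of_bool (x \<in> C - fst ` Q) :: int) = of_bool (x \<in> C) - flow Q x" if "x < N" for x
    using fl[OF Q that] Q by auto
  moreover have "cnt B t \<le> cnt (C - fst ` Q) t" for t using Q sub by (intro cnt_mono) auto
  ultimately show "swappable N C B Q"
    unfolding swappable_def by (intro exI[of _ "C - fst ` Q"]) (auto simp: min.coboundedI2)
qed auto

text \<open>
  Between \<open>p\<close> and \<open>q\<close>, swapping this pair loses an element of \<open>C\<close>. There the counting function
  of \<open>B\<close> is at most that of \<open>C - {p}\<close>, because \<open>B\<close> has no element outside \<open>C\<close> before \<open>q\<close>, so the
  minimum is attained by \<open>B\<close> and is unaffected.
\<close>

lemma pairing_step:
  assumes C: "C \<subseteq> {1..<N}" and B: "B \<subseteq> {1..<N}" and p: "p \<in> C - B" and q: "q \<in> B - C" and "p < q"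
    and below: "\<And>x. x \<in> B - C \<Longrightarrow> q \<le> x"
    and M: "pairing N (C - {p}) (B - {q}) M"
  shows "pairing N C B (insert (p, q) M)"
  unfolding pairing_def
proof (intro conjI allI impI)
  have M': "finite M" "M \<subseteq> insert N (C - {p} - (B - {q})) \<times> insert N (B - {q} - (C - {p}))"
    "\<And>x. x < N \<Longrightarrow> (of_bool (x \<in> B - {q}) :: int) = of_bool (x \<in> C - {p}) - flow M x"
    "\<And>Q. Q \<subseteq> M \<Longrightarrow> swappable N (C - {p}) (B - {q}) Q"
    using M unfolding pairing_def by blast+
  have pN: "p < N" "q < N" "p \<noteq> q" "1 \<le> p" using p q C B \<open>p < q\<close> by auto
  have nin: "(p, q) \<notin> M" using M'(2) pN by auto
  show "finite (insert (p, q) M)" using M' by simp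
  show "insert (p, q) M \<subseteq> insert N (C - B) \<times> insert N (B - C)" using M'(2) p q by auto
  show "(of_bool (x \<in> B) :: int) = of_bool (x \<in> C) - flow (insert (p, q) M) x" if "x < N" for x
    using M'(3)[OF that] p q pN by (auto simp: flow_insert[OF M'(1) nin] split: if_splits)
  fix Q assume Q: "Q \<subseteq> insert (p, q) M"
  define r where "r = (if (p, q) \<in> Q then q else p)"
  have "Q - {(p, q)} \<subseteq> M" using Q by auto
  with M'(4) obtain C1 where C1: "C1 \<subseteq> (C - {p}) \<union> (B - {q})"
    "\<And>x. x < N \<Longrightarrow> (of_bool (x \<in> C1) :: int) = of_bool (x \<in> C - {p}) - flow (Q - {(p, q)}) x"
    "\<And>t. min (cnt (C - {p}) t) (cnt (B - {q}) t) \<le> cnt C1 t"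
    unfolding swappable_def by meson
  have finQ: "finite Q" using Q M'(1) finite_subset by auto
  have pq1: "p \<notin> C1" "q \<notin> C1" using C1(1) p q by auto
  have fQ: "flow Q x = of_bool ((p, q) \<in> Q) * (of_bool (p = x) - of_bool (q = x)) + flow (Q - {(p, q)}) x" for x
  proof (cases "(p, q) \<in> Q")
    case True
    then have "Q = insert (p, q) (Q - {(p, q)})" by auto
    then have "flow Q x = of_bool (p = x) - of_bool (q = x) + flow (Q - {(p, q)}) x"
      using flow_insert[of "Q - {(p, q)}" p q x] finQ by simp
    then show ?thesis using True by simp
  qed simp
  have "(of_bool (x \<in> insert r C1) :: int) = of_bool (x \<in> C) - flow Q x" if "x < N" for x
  proof -
    have "flow (Q - {(p, q)}) x = of_bool (x \<in> C - {p}) - of_bool (x \<in> C1)"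
      using C1(2)[OF that] by linarith
    then show ?thesis using pq1 p q pN unfolding fQ by (auto simp: r_def)
  qed
  moreover have "min (cnt C t) (cnt B t) \<le> cnt (insert r C1) t" for t
  proof -
    have ins: "cnt (insert y A) t = cnt A t + of_bool (y \<le> t)" if "y \<notin> A" "1 \<le> y" for y A
    proof -
      have "insert y A \<inter> {1..t} = (if y \<le> t then insert y (A \<inter> {1..t}) else A \<inter> {1..t})"
        using that by auto
      then show ?thesis using that by (simp add: cnt_def)
    qed
    have cC: "cnt C t = cnt (C - {p}) t + of_bool (p \<le> t)"
      using ins[of p "C - {p}"] p pN by (simp add: insert_absorb)
    have cB: "cnt B t = cnt (B - {q}) t + of_bool (q \<le> t)"
      using ins[of q "B - {q}"] q pN \<open>p < q\<close> by (simp add: insert_absorb)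
    have cr: "cnt (insert r C1) t = cnt C1 t + of_bool (r \<le> t)"
      using ins[of r C1] pq1 pN \<open>p < q\<close> by (simp add: r_def)
    consider "t < p" | "q \<le> t" | "p \<le> t" "t < q" by linarith
    then show ?thesis
    proof cases
      case 3
      have "(B - {q}) \<inter> {1..t} \<subseteq> (C - {p}) \<inter> {1..t}"
        using below 3 p by force
      then have "cnt (B - {q}) t \<le> cnt (C - {p}) t" unfolding cnt_def by (intro card_mono) auto
      then show ?thesis using C1(3)[of t] cC cB cr 3 by auto
    qed (use C1(3)[of t] cC cB cr \<open>p < q\<close> in \<open>auto simp: r_def\<close>)
  qed
  moreover have "insert r C1 \<subseteq> C \<union> B" using C1(1) p q by (auto simp: r_def)
  ultimately show "swappable N C B Q" unfolding swappable_def by (intro exI[of _ "insert r C1"]) auto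
qed

text \<open>
  As long as both differences are nonempty, the larger of the two minima is paired with an
  earlier element of the other difference. What is left in the end lies on one side and is
  paired with \<open>N\<close>.
\<close>

lemma ex_pairing:
  assumes "C \<subseteq> {1..<N}" "B \<subseteq> {1..<N}"
  shows "\<exists>M. pairing N C B M"
  using assms
proof (induction "card (C - B) + card (B - C)" arbitrary: C B rule: less_induct)
  case less
  have fin: "finite C" "finite B" using less.prems finite_subset by blast+
  have step: "\<exists>M. pairing N C B M"
    if C: "C \<subseteq> {1..<N}" "B \<subseteq> {1..<N}" "C - B \<noteq> {}" "B - C \<noteq> {}" "Min (C - B) < Min (B - C)"
      and card: "card (C - B) + card (B - C) \<le> card (C0 - B0) + card (B0 - C0)"
      and IH: "\<And>C B. card (C - B) + card (B - C) < card (C0 - B0) + card (B0 - C0) \<Longrightarrow>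
        C \<subseteq> {1..<N} \<Longrightarrow> B \<subseteq> {1..<N} \<Longrightarrow> \<exists>M. pairing N C B M" for C B C0 B0 :: "nat set"
  proof -
    have fin: "finite C" "finite B" using C finite_subset by blast+
    define q where "q = Min (B - C)"
    have q: "q \<in> B - C" unfolding q_def using C fin by (intro Min_in) auto
    obtain p where p: "p \<in> C - B" "p < q" using C fin Min_in[of "C - B"] by (auto simp: q_def)
    have below: "q \<le> x" if "x \<in> B - C" for x unfolding q_def using that fin by (intro Min_le) auto
    have "C - {p} - (B - {q}) = C - B - {p}" "B - {q} - (C - {p}) = B - C - {q}"
      using p q by blast+
    moreover have "card (C - B - {p}) < card (C - B)" "card (B - C - {q}) < card (B - C)"
      using p q fin by (intro card_Diff1_less; simp)+
    ultimately have "card (C - {p} - (B - {q})) + card (B - {q} - (C - {p})) < card (C0 - B0) + card (B0 - C0)"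
      using card by simp
    then have "\<exists>M. pairing N (C - {p}) (B - {q}) M" using C by (intro IH) auto
    then obtain M where "pairing N (C - {p}) (B - {q}) M" ..
    then show ?thesis using pairing_step[OF C(1,2) p(1) q p(2) below] by blast
  qed
  consider "B - C = {}" | "C - B = {}" | "C - B \<noteq> {}" "B - C \<noteq> {}" "Min (C - B) < Min (B - C)"
    | "C - B \<noteq> {}" "B - C \<noteq> {}" "Min (B - C) < Min (C - B)"
  proof -
    have "Min (C - B) \<noteq> Min (B - C)" if "C - B \<noteq> {}" "B - C \<noteq> {}"
    proof -
      have "Min (C - B) \<in> C - B" "Min (B - C) \<in> B - C" using that fin by (intro Min_in; auto)+
      then show ?thesis by auto
    qed
    then have "C - B \<noteq> {} \<Longrightarrow> B - C \<noteq> {} \<Longrightarrow> Min (C - B) < Min (B - C) \<or> Min (B - C) < Min (C - B)"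
      by (simp add: neq_iff)
    then show ?thesis using that by blast
  qed
  then show ?case
  proof cases
    case 1
    then show ?thesis using pairing_nested[of B C N] less.prems by blast
  next
    case 2
    then show ?thesis using pairing_converse[OF pairing_nested[of C B N]] less.prems by blast
  next
    case 3
    show ?thesis by (rule step[OF less.prems 3 order_refl less.hyps])
  next
    case 4
    have "\<exists>M. pairing N B C M"
      by (rule step[OF less.prems(2,1) 4(2,1,3), of C B]) (use less.hyps in auto)
    then show ?thesis using pairing_converse by blast
  qed
qed

text \<open>
  A shortest path visits no vertex twice, so its edges are distinct and their flow telescopes.
\<close>

lemma path_flow:
  assumes "(i, j) \<in> R\<^sup>*"
  obtains P where "P \<subseteq> R" "finite P" "\<And>x. flow P x = of_bool (i = x) - of_bool (j = x)"
proof -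
  define n where "n = (LEAST n. (i, j) \<in> R ^^ n)"
  have ex: "\<exists>n. (i, j) \<in> R ^^ n" using assms by (rule rtrancl_imp_relpow)
  have n: "(i, j) \<in> R ^^ n" unfolding n_def using ex by (rule LeastI_ex)
  have min: "n \<le> k" if "(i, j) \<in> R ^^ k" for k unfolding n_def using that by (rule Least_le)
  obtain f where f: "f 0 = i" "f n = j" "\<And>k. k < n \<Longrightarrow> (f k, f (Suc k)) \<in> R"
    using n unfolding relpow_fun_conv by blast
  have inj: "a = b" if "a < n" "b < n" "f a = f b" for a b
  proof -
    have False if "a < b" "b < n" "f a = f b" for a b
    proof -
      have "(i, f a) \<in> R ^^ a" unfolding relpow_fun_conv using f that by (intro exI[of _ f]) auto
      moreover have "(f b, j) \<in> R ^^ (n - b)"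
        unfolding relpow_fun_conv using f that by (intro exI[of _ "\<lambda>k. f (b + k)"]) auto
      ultimately have "(i, j) \<in> R ^^ (a + (n - b))" unfolding relpow_add using that by auto
      then show False using min that by fastforce
    qed
    then show ?thesis using that by (metis linorder_neqE_nat)
  qed
  define e where "e k = (f k, f (Suc k))" for k
  have inj_e: "inj_on e {..<n}" using inj by (auto simp: inj_on_def e_def)
  have "flow (e ` {..<n}) x = (\<Sum>k<n. of_bool (f k = x) - of_bool (f (Suc k) = x))" for x
    unfolding flow_def by (simp add: sum.reindex[OF inj_e]) (simp add: e_def)
  also have "(\<Sum>k<n. of_bool (f k = x) - of_bool (f (Suc k) = x)) = (of_bool (i = x) - of_bool (j = x) :: int)" for x
    using sum_lessThan_telescope'[of "\<lambda>k. of_bool (f k = x) :: int" n] f by simp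
  finally show ?thesis using that[of "e ` {..<n}"] f by (auto simp: e_def)
qed

text \<open>
  Homogenized sums of columns: the coordinates below \<open>N\<close> form a sum of columns, and coordinate
  \<open>N\<close> makes up for the degree \<open>d\<close>.
\<close>

definition hom_sums :: "nat \<Rightarrow> int \<Rightarrow> nat set set \<Rightarrow> (nat \<Rightarrow>\<^sub>0 int) set" where
  "hom_sums N d DD = {v. \<exists>C. (\<forall>D\<in>DD. C D \<in> cols D) \<and>
     (\<forall>x<N. Poly_Mapping.lookup v x = (\<Sum>D\<in>DD. of_bool (x \<in> C D))) \<and>
     (\<forall>x>N. Poly_Mapping.lookup v x = 0) \<and> (\<Sum>x\<in>{1..N}. Poly_Mapping.lookup v x) = d}"

text \<open>
  Choose columns \<open>C\<close> for \<open>\<alpha>\<close> and \<open>B\<close> for \<open>\<beta>\<close> and a pairing for each \<open>D\<close>. Then \<open>\<alpha> - \<beta>\<close> is the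
  flow of the union of all pairings. No edge leaves the set of vertices reachable from \<open>i\<close>, so
  the sum of \<open>\<alpha> - \<beta>\<close> over this set is at most 0, although the term at \<open>i\<close> is positive; so some
  reachable \<open>j\<close> has a negative term. Swapping the pairs on a path from \<open>i\<close> to \<open>j\<close> turns \<open>\<alpha>\<close> into
  the first vector of the exchange, and swapping all other pairs instead turns it into the
  second one.
\<close>

theorem hom_sums_M_convex:
  assumes fin: "finite DD" and D: "\<And>D. D \<in> DD \<Longrightarrow> finite D \<and> D \<noteq> {} \<and> D \<subseteq> {1..<N}" and N: "1 \<le> N"
  shows "M_convex N (hom_sums N d DD)"
  unfolding M_convex_def
proof (intro conjI ballI impI)
  have col_sub: "C \<subseteq> {1..<N}" if "D \<in> DD" "C \<in> cols D" for C D
  proof -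
    have "Max D \<in> D" using D[OF that(1)] by (intro Max_in) auto
    then have "Max D < N" using D[OF that(1)] by auto
    then show ?thesis using that by (auto simp: cols_def)
  qed
  show "hom_sums N d DD \<subseteq> int_space N"
  proof
    fix v assume "v \<in> hom_sums N d DD"
    then obtain C where C: "\<forall>D\<in>DD. C D \<in> cols D"
      "\<forall>x<N. Poly_Mapping.lookup v x = (\<Sum>D\<in>DD. of_bool (x \<in> C D))" "\<forall>x>N. Poly_Mapping.lookup v x = 0"
      unfolding hom_sums_def by blast
    have "0 \<notin> C D" if "D \<in> DD" for D using col_sub[OF that, of "C D"] C(1) that by auto
    then have "Poly_Mapping.lookup v 0 = 0" using C(2) N by simp
    then have "x \<in> {1..N}" if "Poly_Mapping.lookup v x \<noteq> 0" for x
      using that C(3) by (cases "x = 0") (auto simp: not_less)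
    then show "v \<in> int_space N" by (auto simp: int_space_def in_keys_iff)
  qed
  fix \<alpha> \<beta> i assume ab: "\<alpha> \<in> hom_sums N d DD" "\<beta> \<in> hom_sums N d DD" and i: "i \<in> {1..N}"
    and gt: "Poly_Mapping.lookup \<alpha> i > Poly_Mapping.lookup \<beta> i"
  let ?l = Poly_Mapping.lookup
  obtain C where C: "\<And>D. D \<in> DD \<Longrightarrow> C D \<in> cols D"
      "\<And>x. x < N \<Longrightarrow> ?l \<alpha> x = (\<Sum>D\<in>DD. of_bool (x \<in> C D))" "\<And>x. x > N \<Longrightarrow> ?l \<alpha> x = 0"
      "(\<Sum>x\<in>{1..N}. ?l \<alpha> x) = d"
    using ab(1) unfolding hom_sums_def by blast
  obtain B where B: "\<And>D. D \<in> DD \<Longrightarrow> B D \<in> cols D"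
      "\<And>x. x < N \<Longrightarrow> ?l \<beta> x = (\<Sum>D\<in>DD. of_bool (x \<in> B D))" "\<And>x. x > N \<Longrightarrow> ?l \<beta> x = 0"
      "(\<Sum>x\<in>{1..N}. ?l \<beta> x) = d"
    using ab(2) unfolding hom_sums_def by blast
  have "\<exists>M. pairing N (C D) (B D) M" if "D \<in> DD" for D
    using ex_pairing col_sub[OF that C(1)[OF that]] col_sub[OF that B(1)[OF that]] by blast
  then obtain M where M: "\<And>D. D \<in> DD \<Longrightarrow> pairing N (C D) (B D) (M D)" by metis
  have M_fin: "finite (M D)"
    and M_sub: "M D \<subseteq> insert N (C D - B D) \<times> insert N (B D - C D)"
    and M_flow: "x < N \<Longrightarrow> (of_bool (x \<in> B D) :: int) = of_bool (x \<in> C D) - flow (M D) x"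
    and M_swap: "Q \<subseteq> M D \<Longrightarrow> swappable N (C D) (B D) Q" if "D \<in> DD" for D x Q
    using M[OF that] unfolding pairing_def by (simp_all only: simp_thms)
  have M_V: "M D \<subseteq> {1..N} \<times> {1..N}" if "D \<in> DD" for D
  proof -
    have "insert N (C D - B D) \<subseteq> {1..N}" "insert N (B D - C D) \<subseteq> {1..N}"
      using col_sub[OF that C(1)[OF that]] col_sub[OF that B(1)[OF that]] N by auto
    then show ?thesis using M_sub[OF that] by blast
  qed
  have sum_V: "(\<Sum>x\<in>{1..N}. flow (M D) x) = 0" if "D \<in> DD" for D
    using M_V[OF that] by (subst sum_flow) (auto intro!: sum.neutral)
  have split_V: "{1..N} = insert N {1..<N}" using N by auto
  have diff: "?l \<alpha> x - ?l \<beta> x = (\<Sum>D\<in>DD. flow (M D) x)" if x: "x \<in> {1..N}" for x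
  proof -
    have *: "?l \<alpha> x - ?l \<beta> x = (\<Sum>D\<in>DD. flow (M D) x)" if "x < N" for x
      unfolding C(2)[OF that] B(2)[OF that] sum_subtractf[symmetric]
      using M_flow that by (intro sum.cong) auto
    show ?thesis
    proof (cases "x = N")
      case True
      have "(\<Sum>x\<in>{1..N}. ?l \<alpha> x - ?l \<beta> x) = 0" using C(4) B(4) by (simp add: sum_subtractf)
      then have "?l \<alpha> N - ?l \<beta> N = - (\<Sum>x\<in>{1..<N}. ?l \<alpha> x - ?l \<beta> x)"
        unfolding split_V by simp
      also have "\<dots> = - (\<Sum>x\<in>{1..<N}. \<Sum>D\<in>DD. flow (M D) x)" using * by simp
      also have "\<dots> = - (\<Sum>D\<in>DD. \<Sum>x\<in>{1..<N}. flow (M D) x)" by (subst sum.swap) simp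
      also have "\<dots> = (\<Sum>D\<in>DD. - (\<Sum>x\<in>{1..<N}. flow (M D) x))" by (simp only: sum_negf)
      also have "\<dots> = (\<Sum>D\<in>DD. flow (M D) N)"
      proof (rule sum.cong[OF refl])
        fix D assume "D \<in> DD"
        from sum_V[OF this] show "- (\<Sum>x\<in>{1..<N}. flow (M D) x) = flow (M D) N"
          unfolding split_V by simp
      qed
      finally show ?thesis using True by simp
    qed (use * x in auto)
  qed
  define R where "R = (\<Union>D\<in>DD. M D)"
  define A where "A = {x. (i, x) \<in> R\<^sup>*}"
  have "A \<subseteq> {1..N}"
  proof
    fix x assume "x \<in> A"
    then have "(i, x) \<in> R\<^sup>*" by (simp add: A_def)
    then show "x \<in> {1..N}"
    proof (cases rule: rtranclE)
      case (step y)
      then obtain D where "D \<in> DD" "(y, x) \<in> M D" by (auto simp: R_def)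
      then show ?thesis using M_V[of D] by blast
    qed (use i in simp)
  qed
  then have finA: "finite A" using finite_subset by blast
  have "\<exists>j\<in>A. ?l \<alpha> j < ?l \<beta> j"
  proof (rule ccontr)
    assume "\<not> ?thesis"
    then have "0 \<le> ?l \<alpha> x - ?l \<beta> x" if "x \<in> A" for x using that by (auto simp: not_less)
    moreover have "i \<in> A" by (simp add: A_def)
    ultimately have "0 < (\<Sum>x\<in>A. ?l \<alpha> x - ?l \<beta> x)"
      using gt finA by (intro sum_pos2[of _ i]) auto
    also have "\<dots> = (\<Sum>x\<in>A. \<Sum>D\<in>DD. flow (M D) x)"
      using diff \<open>A \<subseteq> {1..N}\<close> by (intro sum.cong) auto
    also have "\<dots> = (\<Sum>D\<in>DD. \<Sum>x\<in>A. flow (M D) x)" by (rule sum.swap)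
    also have "\<dots> \<le> 0"
      unfolding sum_flow[OF finA]
    proof (intro sum_nonpos)
      fix D e assume "D \<in> DD" "e \<in> M D"
      then have "snd e \<in> A" if "fst e \<in> A"
        using that unfolding A_def R_def by (cases e) (auto intro: rtrancl_into_rtrancl)
      then show "of_bool (fst e \<in> A) - of_bool (snd e \<in> A) \<le> (0::int)" by auto
    qed
    finally show False by simp
  qed
  then obtain j where j: "(i, j) \<in> R\<^sup>*" "?l \<alpha> j < ?l \<beta> j" "j \<in> {1..N}"
    using \<open>A \<subseteq> {1..N}\<close> by (auto simp: A_def)
  have ij: "i \<noteq> j" using j gt by auto
  obtain P where P: "P \<subseteq> R" "finite P" "\<And>x. flow P x = of_bool (i = x) - of_bool (j = x)"
    using path_flow[OF j(1)] by blast
  have "\<forall>e\<in>P. \<exists>D\<in>DD. e \<in> M D" using P(1) by (auto simp: R_def)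
  then obtain h where h: "\<And>e. e \<in> P \<Longrightarrow> h e \<in> DD \<and> e \<in> M (h e)" by metis
  \<comment> \<open>An edge may belong to several pairings; \<open>h\<close> picks the one in which it is swapped.\<close>
  define Q where "Q D = {e \<in> P. h e = D}" for D
  have Q: "Q D \<subseteq> M D" for D using h by (auto simp: Q_def)
  have sumQ: "(\<Sum>D\<in>DD. flow (Q D) x) = flow P x" for x
    unfolding flow_def Q_def using fin P(2) h by (intro sum.group) auto
  have in_hom: "v \<in> hom_sums N d DD"
    if sw: "\<And>D. D \<in> DD \<Longrightarrow> swappable N (C D) (B D) (T D)"
      and v: "\<And>x. x < N \<Longrightarrow> ?l v x = ?l \<alpha> x - (\<Sum>D\<in>DD. flow (T D) x)"
        "\<And>x. x > N \<Longrightarrow> ?l v x = 0" "(\<Sum>x\<in>{1..N}. ?l v x) = d" for v T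
  proof -
    obtain C' where C': "\<And>D. D \<in> DD \<Longrightarrow> C' D \<subseteq> C D \<union> B D"
      "\<And>D x. D \<in> DD \<Longrightarrow> x < N \<Longrightarrow> (of_bool (x \<in> C' D) :: int) = of_bool (x \<in> C D) - flow (T D) x"
      "\<And>D t. D \<in> DD \<Longrightarrow> min (cnt (C D) t) (cnt (B D) t) \<le> cnt (C' D) t"
      using sw unfolding swappable_def by metis
    have "C' D \<in> cols D" if "D \<in> DD" for D
    proof -
      have "cnt D t \<le> cnt (C' D) t" for t
      proof -
        have "cnt D t \<le> min (cnt (C D) t) (cnt (B D) t)"
          using C(1)[OF that] B(1)[OF that] by (simp add: cols_def)
        then show ?thesis using C'(3)[OF that, of t] by linarith
      qed
      moreover have "C' D \<subseteq> {1..Max D}"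
        using C'(1)[OF that] C(1)[OF that] B(1)[OF that] by (auto simp: cols_def)
      ultimately show ?thesis by (simp add: cols_def)
    qed
    moreover have "?l v x = (\<Sum>D\<in>DD. of_bool (x \<in> C' D))" if "x < N" for x
      using C'(2) that by (simp add: v(1)[OF that] C(2)[OF that] sum_subtractf)
    ultimately show ?thesis unfolding hom_sums_def using v by (intro CollectI exI[of _ C']) auto
  qed
  have e_total: "(\<Sum>x\<in>{1..N}. ?l (Poly_Mapping.single y (1::int)) x) = 1" if "y \<in> {1..N}" for y
    using that by (simp add: lookup_single when_def)
  have "\<alpha> - Poly_Mapping.single i 1 + Poly_Mapping.single j 1 \<in> hom_sums N d DD"
  proof (rule in_hom[of Q])
    show "swappable N (C D) (B D) (Q D)" if "D \<in> DD" for D using M_swap[OF that Q] .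
    show "(\<Sum>x\<in>{1..N}. ?l (\<alpha> - Poly_Mapping.single i 1 + Poly_Mapping.single j 1) x) = d"
      using C(4) e_total[OF i] e_total[OF j(3)]
      by (simp add: lookup_add lookup_minus sum.distrib sum_subtractf)
  qed (use i j C(3) in \<open>auto simp: sumQ P(3) lookup_add lookup_minus lookup_single when_def\<close>)
  moreover have "\<beta> + Poly_Mapping.single i 1 - Poly_Mapping.single j 1 \<in> hom_sums N d DD"
  proof (rule in_hom[of "\<lambda>D. M D - Q D"])
    show "swappable N (C D) (B D) (M D - Q D)" if "D \<in> DD" for D using M_swap[OF that] by blast
    show "(\<Sum>x\<in>{1..N}. ?l (\<beta> + Poly_Mapping.single i 1 - Poly_Mapping.single j 1) x) = d"
      using B(4) e_total[OF i] e_total[OF j(3)]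
      by (simp add: lookup_add lookup_minus sum.distrib sum_subtractf)
    fix x assume x: "x < N"
    have "(\<Sum>D\<in>DD. flow (M D - Q D) x) = (\<Sum>D\<in>DD. flow (M D) x) - flow P x"
      unfolding sumQ[symmetric] sum_subtractf[symmetric] using M_fin Q flow_diff by (intro sum.cong) auto
    moreover have "?l \<beta> x = ?l \<alpha> x - (\<Sum>D\<in>DD. flow (M D) x)"
    proof (cases "x = 0")
      case True
      have "flow (M D) 0 = 0" if "D \<in> DD" for D
        unfolding flow_def using M_V[OF that] by (intro sum.neutral) force
      moreover have "0 \<notin> C D" "0 \<notin> B D" if "D \<in> DD" for D
        using col_sub[OF that] C(1)[OF that] B(1)[OF that] by fastforce+
      ultimately show ?thesis using C(2)[of 0] B(2)[of 0] x True by simp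
    next
      case False
      then show ?thesis using diff[of x] x by simp
    qed
    ultimately show "?l (\<beta> + Poly_Mapping.single i 1 - Poly_Mapping.single j 1) x =
        ?l \<alpha> x - (\<Sum>D\<in>DD. flow (M D - Q D) x)"
      by (simp add: P(3) lookup_add lookup_minus lookup_single when_def)
  qed (use i j B(3) in \<open>auto simp: lookup_add lookup_minus lookup_single when_def\<close>)
  ultimately show "\<exists>j\<in>{1..N}. ?l \<alpha> j < ?l \<beta> j \<and>
      \<alpha> - Poly_Mapping.single i 1 + Poly_Mapping.single j 1 \<in> hom_sums N d DD \<and>
      \<beta> + Poly_Mapping.single i 1 - Poly_Mapping.single j 1 \<in> hom_sums N d DD"
    using j by blast
qed

section \<open>M-convex sets and generalized permutahedra\<close>

definition coord_sum :: "nat set \<Rightarrow> (nat \<Rightarrow>\<^sub>0 'a) \<Rightarrow> 'a::comm_monoid_add" where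
  "coord_sum I v = (\<Sum>i\<in>I. Poly_Mapping.lookup v i)"

definition dist_on :: "nat set \<Rightarrow> (nat \<Rightarrow>\<^sub>0 int) \<Rightarrow> (nat \<Rightarrow>\<^sub>0 int) \<Rightarrow> nat" where
  "dist_on V \<alpha> \<beta> = (\<Sum>i\<in>V. nat \<bar>Poly_Mapping.lookup \<alpha> i - Poly_Mapping.lookup \<beta> i\<bar>)"

lemma coord_sum_add: "coord_sum I (v + v') = coord_sum I v + coord_sum I v'"
  by (simp add: coord_sum_def lookup_add sum.distrib)

lemma coord_sum_diff: "coord_sum I (v - v') = coord_sum I v - (coord_sum I v' :: 'a :: ab_group_add)"
  by (simp add: coord_sum_def lookup_minus sum_subtractf)

lemma coord_sum_single: "finite I \<Longrightarrow> coord_sum I (Poly_Mapping.single i c) = (if i \<in> I then c else 0)"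
  by (simp add: coord_sum_def lookup_single when_def)

lemma coord_sum_swap:
  assumes "finite I"
  shows "coord_sum I (\<alpha> - Poly_Mapping.single i 1 + Poly_Mapping.single j (1::int)) =
    coord_sum I \<alpha> - of_bool (i \<in> I) + of_bool (j \<in> I)"
    and "coord_sum I (\<alpha> + Poly_Mapping.single i 1 - Poly_Mapping.single j (1::int)) =
    coord_sum I \<alpha> + of_bool (i \<in> I) - of_bool (j \<in> I)"
  using assms by (simp_all add: coord_sum_add coord_sum_diff coord_sum_single)

lemma coord_sum_Un_Int:
  assumes "finite I" "finite J"
  shows "coord_sum (I \<union> J) v + coord_sum (I \<inter> J) v = coord_sum I v + coord_sum J v"
  unfolding coord_sum_def using sum.union_inter[OF assms] .

lemma dist_on_closer:
  assumes V: "finite V" "i \<in> V" "j \<in> V" and ij: "Poly_Mapping.lookup \<beta> i < Poly_Mapping.lookup \<alpha> i"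
      "Poly_Mapping.lookup \<alpha> j < Poly_Mapping.lookup \<beta> j"
    and diff: "\<And>k. Poly_Mapping.lookup \<alpha>' k - Poly_Mapping.lookup \<beta>' k =
      Poly_Mapping.lookup \<alpha> k - Poly_Mapping.lookup \<beta> k - of_bool (k = i) + of_bool (k = j)"
  shows "dist_on V \<alpha>' \<beta>' < dist_on V \<alpha> \<beta>"
  unfolding dist_on_def
proof (rule sum_strict_mono_ex1[OF V(1)])
  have "i \<noteq> j" using ij by auto
  then show "\<forall>k\<in>V. nat \<bar>Poly_Mapping.lookup \<alpha>' k - Poly_Mapping.lookup \<beta>' k\<bar> \<le>
      nat \<bar>Poly_Mapping.lookup \<alpha> k - Poly_Mapping.lookup \<beta> k\<bar>"
    unfolding diff using ij by auto
  show "\<exists>k\<in>V. nat \<bar>Poly_Mapping.lookup \<alpha>' k - Poly_Mapping.lookup \<beta>' k\<bar> <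
      nat \<bar>Poly_Mapping.lookup \<alpha> k - Poly_Mapping.lookup \<beta> k\<bar>"
    unfolding diff using ij V \<open>i \<noteq> j\<close> by (intro bexI[of _ i]) auto
qed

definition m_convex_family :: "nat \<Rightarrow> int \<Rightarrow> (nat \<Rightarrow>\<^sub>0 int) set \<Rightarrow> bool" where
  "m_convex_family N d S \<longleftrightarrow> M_convex N S \<and> finite S \<and> S \<noteq> {} \<and> (\<forall>\<alpha>\<in>S. coord_sum {1..N} \<alpha> = d)"

lemma m_convex_familyE:
  assumes "m_convex_family N d S" "\<alpha> \<in> S" "\<beta> \<in> S" "i \<in> {1..N}"
    "Poly_Mapping.lookup \<beta> i < Poly_Mapping.lookup \<alpha> i"
  obtains j where "j \<in> {1..N}" "Poly_Mapping.lookup \<alpha> j < Poly_Mapping.lookup \<beta> j"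
    "\<alpha> - Poly_Mapping.single i 1 + Poly_Mapping.single j 1 \<in> S"
    "\<beta> + Poly_Mapping.single i 1 - Poly_Mapping.single j 1 \<in> S"
  using assms unfolding m_convex_family_def M_convex_def by blast

definition top_sum :: "(nat \<Rightarrow>\<^sub>0 int) set \<Rightarrow> nat set \<Rightarrow> int" where
  "top_sum S I = Max (coord_sum I ` S)"

lemma top_sum_ge: "finite S \<Longrightarrow> \<alpha> \<in> S \<Longrightarrow> coord_sum I \<alpha> \<le> top_sum S I"
  unfolding top_sum_def by (intro Max_ge) auto

lemma top_sum_attained:
  assumes "finite S" "S \<noteq> {}"
  obtains \<alpha> where "\<alpha> \<in> S" "coord_sum I \<alpha> = top_sum S I"
proof -
  have "Max (coord_sum I ` S) \<in> coord_sum I ` S" using assms by (intro Max_in) auto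
  then obtain \<alpha> where "\<alpha> \<in> S" "Max (coord_sum I ` S) = coord_sum I \<alpha>" by (rule imageE)
  then show ?thesis using that unfolding top_sum_def by simp
qed

text \<open>
  Among the pairs of a maximizer for \<open>A\<close> and a maximizer for \<open>B\<close>, one with the smallest distance
  consists of common maximizers: otherwise an exchange out of the complement of \<open>B\<close> would bring
  the two closer.
\<close>

lemma chain_attained:
  assumes S: "m_convex_family N d S" and AB: "A \<subseteq> B" "B \<subseteq> {1..N}"
  obtains \<alpha> where "\<alpha> \<in> S" "coord_sum A \<alpha> = top_sum S A" "coord_sum B \<alpha> = top_sum S B"
proof -
  let ?V = "{1..N}"
  have finS: "finite S" "S \<noteq> {}" and total: "\<And>\<alpha>. \<alpha> \<in> S \<Longrightarrow> coord_sum ?V \<alpha> = d"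
    using S by (auto simp: m_convex_family_def)
  have finAB: "finite A" "finite B" using AB by (metis finite_atLeastAtMost finite_subset)+
  define P where "P p \<longleftrightarrow> fst p \<in> S \<and> snd p \<in> S \<and> coord_sum A (fst p) = top_sum S A \<and>
    coord_sum B (snd p) = top_sum S B" for p
  obtain \<alpha>0 where a0: "\<alpha>0 \<in> S" "coord_sum A \<alpha>0 = top_sum S A" by (rule top_sum_attained[OF finS])
  obtain \<beta>0 where b0: "\<beta>0 \<in> S" "coord_sum B \<beta>0 = top_sum S B" by (rule top_sum_attained[OF finS])
  have "P (\<alpha>0, \<beta>0)" using a0 b0 by (simp add: P_def)
  then obtain p where p: "P p" and min: "\<And>p'. P p' \<Longrightarrow> dist_on ?V (fst p) (snd p) \<le> dist_on ?V (fst p') (snd p')"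
    using ex_has_least_nat[of P "(\<alpha>0, \<beta>0)" "\<lambda>p. dist_on ?V (fst p) (snd p)"] by blast
  obtain \<alpha> \<beta> where ab: "p = (\<alpha>, \<beta>)" by (cases p)
  have a: "\<alpha> \<in> S" "coord_sum A \<alpha> = top_sum S A" and b: "\<beta> \<in> S" "coord_sum B \<beta> = top_sum S B"
    using p by (auto simp: P_def ab)
  have "coord_sum B \<alpha> = top_sum S B"
  proof (rule ccontr)
    assume "coord_sum B \<alpha> \<noteq> top_sum S B"
    then have lt: "coord_sum B \<alpha> < coord_sum B \<beta>" using top_sum_ge[OF finS(1) a(1), of B] b by simp
    have split: "coord_sum ?V v = coord_sum B v + coord_sum (?V - B) v" for v :: "nat \<Rightarrow>\<^sub>0 int"
      unfolding coord_sum_def using AB(2) by (subst sum.subset_diff[of B]) auto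
    have "coord_sum (?V - B) \<beta> < coord_sum (?V - B) \<alpha>"
      using lt total[OF a(1)] total[OF b(1)] split[of \<alpha>] split[of \<beta>] by simp
    then obtain i where i: "i \<in> ?V - B" "Poly_Mapping.lookup \<beta> i < Poly_Mapping.lookup \<alpha> i"
      unfolding coord_sum_def by (meson not_less sum_mono)
    then obtain j where j: "j \<in> ?V" "Poly_Mapping.lookup \<alpha> j < Poly_Mapping.lookup \<beta> j"
      "\<alpha> - Poly_Mapping.single i 1 + Poly_Mapping.single j 1 \<in> S"
      "\<beta> + Poly_Mapping.single i 1 - Poly_Mapping.single j 1 \<in> S"
      using m_convex_familyE[OF S a(1) b(1)] by blast
    have iA: "i \<notin> A" "i \<notin> B" using i AB by auto
    show False
    proof (cases "j \<in> B")
      case True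
      have "coord_sum A (\<alpha> - Poly_Mapping.single i 1 + Poly_Mapping.single j 1) \<le> top_sum S A"
        by (rule top_sum_ge[OF finS(1) j(3)])
      then have "P (\<alpha> - Poly_Mapping.single i 1 + Poly_Mapping.single j 1, \<beta>)"
        using a b j(3) iA by (auto simp: P_def coord_sum_swap[OF finAB(1)] split: if_splits)
      from min[OF this] have "dist_on ?V \<alpha> \<beta> \<le>
          dist_on ?V (\<alpha> - Poly_Mapping.single i 1 + Poly_Mapping.single j 1) \<beta>" by (simp add: ab)
      moreover have "dist_on ?V (\<alpha> - Poly_Mapping.single i 1 + Poly_Mapping.single j 1) \<beta> < dist_on ?V \<alpha> \<beta>"
        using i j by (intro dist_on_closer[of _ i j]) (auto simp: lookup_add lookup_minus lookup_single when_def)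
      ultimately show False by simp
    next
      case False
      then have "P (\<alpha>, \<beta> + Poly_Mapping.single i 1 - Poly_Mapping.single j 1)"
        using a b j(4) iA by (auto simp: P_def coord_sum_swap[OF finAB(2)])
      from min[OF this] have "dist_on ?V \<alpha> \<beta> \<le>
          dist_on ?V \<alpha> (\<beta> + Poly_Mapping.single i 1 - Poly_Mapping.single j 1)" by (simp add: ab)
      moreover have "dist_on ?V \<alpha> (\<beta> + Poly_Mapping.single i 1 - Poly_Mapping.single j 1) < dist_on ?V \<alpha> \<beta>"
        using i j by (intro dist_on_closer[of _ i j]) (auto simp: lookup_add lookup_minus lookup_single when_def)
      ultimately show False by simp
    qed
  qed
  then show ?thesis using that a by blast
qed

text \<open>
  Evaluate both sides at a common maximizer for the intersection and the union.
\<close>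

lemma top_sum_submodular:
  assumes S: "m_convex_family N d S" and IJ: "I \<subseteq> {1..N}" "J \<subseteq> {1..N}"
  shows "top_sum S (I \<union> J) + top_sum S (I \<inter> J) \<le> top_sum S I + top_sum S J"
proof -
  have fin: "finite S" "finite I" "finite J"
    using S IJ by (simp_all add: m_convex_family_def finite_subset[OF _ finite_atLeastAtMost])
  obtain \<alpha> where \<alpha>: "\<alpha> \<in> S" "coord_sum (I \<inter> J) \<alpha> = top_sum S (I \<inter> J)"
    "coord_sum (I \<union> J) \<alpha> = top_sum S (I \<union> J)"
    using chain_attained[OF S, of "I \<inter> J" "I \<union> J"] IJ by blast
  then show ?thesis
    using coord_sum_Un_Int[OF fin(2,3), of \<alpha>] top_sum_ge[OF fin(1) \<alpha>(1), of I]
      top_sum_ge[OF fin(1) \<alpha>(1), of J] by linarith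
qed

definition face :: "(nat \<Rightarrow>\<^sub>0 int) set \<Rightarrow> nat set \<Rightarrow> (nat \<Rightarrow>\<^sub>0 int) set" where
  "face S I = {\<alpha> \<in> S. coord_sum I \<alpha> = top_sum S I}"

lemma m_convex_family_face:
  assumes S: "m_convex_family N d S" and I: "I \<subseteq> {1..N}"
  shows "m_convex_family N d (face S I)"
proof -
  have fin: "finite S" "S \<noteq> {}" "finite I"
    using S I by (simp_all add: m_convex_family_def finite_subset[OF _ finite_atLeastAtMost])
  have "M_convex N (face S I)"
    unfolding M_convex_def
  proof (intro conjI ballI impI)
    show "face S I \<subseteq> int_space N"
      using S by (auto simp: face_def m_convex_family_def M_convex_def)
    fix \<alpha> \<beta> i assume ab: "\<alpha> \<in> face S I" "\<beta> \<in> face S I" and i: "i \<in> {1..N}"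
      "Poly_Mapping.lookup \<beta> i < Poly_Mapping.lookup \<alpha> i"
    let ?\<alpha>' = "\<lambda>j. \<alpha> - Poly_Mapping.single i 1 + Poly_Mapping.single j 1"
    let ?\<beta>' = "\<lambda>j. \<beta> + Poly_Mapping.single i 1 - Poly_Mapping.single j 1"
    obtain j where j: "j \<in> {1..N}" "Poly_Mapping.lookup \<alpha> j < Poly_Mapping.lookup \<beta> j" "?\<alpha>' j \<in> S" "?\<beta>' j \<in> S"
      using m_convex_familyE[OF S _ _ i] ab by (auto simp: face_def)
    have "coord_sum I (?\<alpha>' j) \<le> top_sum S I" "coord_sum I (?\<beta>' j) \<le> top_sum S I"
      using top_sum_ge[OF fin(1)] j by blast+
    then have "?\<alpha>' j \<in> face S I" "?\<beta>' j \<in> face S I"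
      using ab j by (auto simp: face_def coord_sum_swap[OF fin(3)])
    then show "\<exists>j\<in>{1..N}. Poly_Mapping.lookup \<alpha> j < Poly_Mapping.lookup \<beta> j \<and>
        ?\<alpha>' j \<in> face S I \<and> ?\<beta>' j \<in> face S I" using j by blast
  qed
  moreover obtain \<alpha> where "\<alpha> \<in> S" "coord_sum I \<alpha> = top_sum S I"
    by (rule top_sum_attained[OF fin(1,2)])
  then have "face S I \<noteq> {}" by (auto simp: face_def)
  ultimately show ?thesis using S by (auto simp: m_convex_family_def face_def)
qed

text \<open>
  By \<open>chain_attained\<close>, bounds for sets comparable with \<open>I\<close> carry over to the face on which \<open>I\<close>
  is tight. A common maximizer on the face, for the intersection and the union, then yields the
  bound for \<open>J\<close>.
\<close>

lemma top_sum_face: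
  assumes S: "m_convex_family N d S" and I: "I \<subseteq> {1..N}" and J: "J \<subseteq> {1..N}"
  shows "top_sum S (I \<inter> J) + top_sum S (I \<union> J) - top_sum S I \<le> top_sum (face S I) J"
proof -
  have fin: "finite S" "finite I" "finite J"
    using S I J by (simp_all add: m_convex_family_def finite_subset[OF _ finite_atLeastAtMost])
  note F = m_convex_family_face[OF S I]
  have finF: "finite (face S I)" using F by (auto simp: m_convex_family_def)
  have le: "top_sum S K \<le> top_sum (face S I) K" if "K \<subseteq> {1..N}" "K \<subseteq> I \<or> I \<subseteq> K" for K
  proof -
    from that(2) obtain \<alpha> where "\<alpha> \<in> S" "coord_sum K \<alpha> = top_sum S K" "coord_sum I \<alpha> = top_sum S I"
    proof
      assume "K \<subseteq> I"
      from chain_attained[OF S this I] show ?thesis using that by blast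
    next
      assume "I \<subseteq> K"
      from chain_attained[OF S this \<open>K \<subseteq> {1..N}\<close>] show ?thesis using that by blast
    qed
    then show ?thesis using top_sum_ge[OF finF, of \<alpha> K] by (simp add: face_def)
  qed
  obtain \<alpha> where \<alpha>: "\<alpha> \<in> face S I" "coord_sum (I \<inter> J) \<alpha> = top_sum (face S I) (I \<inter> J)"
    "coord_sum (I \<union> J) \<alpha> = top_sum (face S I) (I \<union> J)"
    using chain_attained[OF F, of "I \<inter> J" "I \<union> J"] I J by blast
  have "top_sum S (I \<inter> J) + top_sum S (I \<union> J) \<le> coord_sum (I \<inter> J) \<alpha> + coord_sum (I \<union> J) \<alpha>"
    unfolding \<alpha> using le[of "I \<inter> J"] le[of "I \<union> J"] I J by (intro add_mono) auto
  also have "\<dots> = coord_sum I \<alpha> + coord_sum J \<alpha>" using coord_sum_Un_Int[OF fin(2,3), of \<alpha>] by simp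
  also have "coord_sum I \<alpha> = top_sum S I" using \<alpha>(1) by (simp add: face_def)
  also have "coord_sum J \<alpha> \<le> top_sum (face S I) J" by (rule top_sum_ge[OF finF \<alpha>(1)])
  finally show ?thesis by simp
qed

lemma lookup_map_zero: "f 0 = 0 \<Longrightarrow> Poly_Mapping.lookup (Poly_Mapping.map f v) i = f (Poly_Mapping.lookup v i)"
  by (auto simp: map.rep_eq when_def)

lemma lookup_scaleR: "Poly_Mapping.lookup (r *\<^sub>R v) i = r *\<^sub>R Poly_Mapping.lookup v i"
proof -
  have "finite {i. r *\<^sub>R Poly_Mapping.lookup v i \<noteq> 0}"
    by (rule finite_subset[OF _ finite_lookup[of v]]) auto
  then show ?thesis unfolding scaleR_poly_mapping_def by simp
qed

abbreviation to_real :: "(nat \<Rightarrow>\<^sub>0 int) \<Rightarrow> (nat \<Rightarrow>\<^sub>0 real)" where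
  "to_real \<equiv> Poly_Mapping.map real_of_int"

lemma lookup_to_real: "Poly_Mapping.lookup (to_real v) i = real_of_int (Poly_Mapping.lookup v i)"
  by (simp add: lookup_map_zero)

lemma coord_sum_to_real: "coord_sum I (to_real v) = real_of_int (coord_sum I v)"
  by (simp add: coord_sum_def lookup_to_real)

lemma coord_sum_scaleR: "coord_sum I (r *\<^sub>R v) = r * (coord_sum I v :: real)"
  by (simp add: coord_sum_def lookup_scaleR sum_distrib_left)

lemma int_space_outside: "v \<in> int_space N \<Longrightarrow> i \<notin> {1..N} \<Longrightarrow> Poly_Mapping.lookup v i = 0"
  unfolding int_space_def by (metis (mono_tags, lifting) in_keys_iff mem_Collect_eq subsetD)

lemma real_space_outside: "v \<in> real_space N \<Longrightarrow> i \<notin> {1..N} \<Longrightarrow> Poly_Mapping.lookup v i = 0"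
  unfolding real_space_def by (metis (mono_tags, lifting) in_keys_iff mem_Collect_eq subsetD)

lemma real_spaceI: "(\<And>i. i \<notin> {1..N} \<Longrightarrow> Poly_Mapping.lookup v i = 0) \<Longrightarrow> v \<in> real_space N"
  unfolding real_space_def by (metis (mono_tags, lifting) in_keys_iff mem_Collect_eq subsetI)

definition base_polytope :: "nat \<Rightarrow> (nat \<Rightarrow>\<^sub>0 int) set \<Rightarrow> (nat \<Rightarrow>\<^sub>0 real) set" where
  "base_polytope N S = {x \<in> real_space N.
     (\<forall>I. I \<subseteq> {1..N} \<longrightarrow> coord_sum I x \<le> real_of_int (top_sum S I)) \<and>
     coord_sum {1..N} x = real_of_int (top_sum S {1..N})}"

lemma top_sum_total: "m_convex_family N d S \<Longrightarrow> top_sum S {1..N} = d"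
  by (rule top_sum_attained[of S "{1..N}"]) (auto simp: m_convex_family_def)

text \<open>
  From a point \<open>\<alpha>\<close> of \<open>S\<close>, follow the ray through \<open>x\<close> until some constraint \<open>I\<close> becomes tight.
  The end point \<open>y\<close> lies in the base polytope of the face of \<open>S\<close> on which \<open>I\<close> is tight, which is
  again M-convex and smaller, and \<open>x\<close> lies between \<open>\<alpha>\<close> and \<open>y\<close>.
\<close>

lemma base_polytope_subset_hull:
  assumes "m_convex_family N d S" "x \<in> base_polytope N S"
  shows "x \<in> convex hull (to_real ` S)"
  using assms
proof (induction "card S" arbitrary: S x rule: less_induct)
  case less
  let ?V = "{1..N}"
  note S = less.prems(1)
  have finS: "finite S" "S \<noteq> {}" using S by (auto simp: m_convex_family_def)
  have x: "x \<in> real_space N" "\<And>I. I \<subseteq> ?V \<Longrightarrow> coord_sum I x \<le> real_of_int (top_sum S I)"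
    "coord_sum ?V x = real_of_int d"
    using less.prems(2) top_sum_total[OF S] by (auto simp: base_polytope_def)
  obtain \<alpha> where \<alpha>: "\<alpha> \<in> S" using finS by blast
  have \<alpha>_int: "\<alpha> \<in> int_space N" using S \<alpha> by (auto simp: m_convex_family_def M_convex_def)
  have \<alpha>_total: "coord_sum ?V \<alpha> = d" using S \<alpha> by (auto simp: m_convex_family_def)
  show ?case
  proof (cases "x = to_real \<alpha>")
    case True
    then show ?thesis using \<alpha> by (intro hull_inc) auto
  next
    case False
    define dv where "dv = x - to_real \<alpha>"
    define T where "T = {I. I \<subseteq> ?V \<and> 0 < coord_sum I dv}"
    have total0: "coord_sum ?V dv = 0" using x(3) \<alpha>_total by (simp add: dv_def coord_sum_diff coord_sum_to_real)
    have out: "Poly_Mapping.lookup dv i = 0" if "i \<notin> ?V" for i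
      using real_space_outside[OF x(1) that] int_space_outside[OF \<alpha>_int that]
      by (simp add: dv_def lookup_minus lookup_to_real)
    have "\<exists>i\<in>?V. 0 < Poly_Mapping.lookup dv i"
    proof (rule ccontr)
      assume n: "\<not> ?thesis"
      then have "\<forall>i\<in>?V. - Poly_Mapping.lookup dv i = 0"
        using total0 by (subst sum_nonneg_eq_0_iff[symmetric]) (auto simp: coord_sum_def not_less sum_negf)
      then have "dv = 0" using out by (intro poly_mapping_eqI) (metis lookup_zero neg_equal_0_iff_equal)
      then show False using False by (simp add: dv_def)
    qed
    then have T_ne: "T \<noteq> {}" by (force simp: T_def coord_sum_def)
    have finT: "finite T" by (rule finite_subset[of _ "Pow ?V"]) (auto simp: T_def)
    \<comment> \<open>The constraint \<open>I\<close> is reached at \<open>x + r I dv\<close>.\<close>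
    define r where "r I = (real_of_int (top_sum S I) - coord_sum I x) / coord_sum I dv" for I
    define t where "t = Min (r ` T)"
    have "t \<in> r ` T" unfolding t_def using finT T_ne by (intro Min_in) auto
    then obtain I where I: "I \<in> T" "r I = t" by blast
    have IV: "I \<subseteq> ?V" "0 < coord_sum I dv" using I by (auto simp: T_def)
    have t0: "0 \<le> t" using I x(2)[OF IV(1)] IV by (auto simp: r_def)
    define y where "y = x + t *\<^sub>R dv"
    have y_sum: "coord_sum J y = coord_sum J x + t * coord_sum J dv" for J
      by (simp add: y_def coord_sum_add coord_sum_scaleR)
    have y_le: "coord_sum J y \<le> real_of_int (top_sum S J)" if "J \<subseteq> ?V" for J
    proof (cases "0 < coord_sum J dv")
      case True
      then have "t \<le> r J" unfolding t_def using finT that by (intro Min_le) (auto simp: T_def)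
      then show ?thesis using True by (simp add: y_sum r_def field_simps)
    next
      case False
      then have "t * coord_sum J dv \<le> 0" using t0 by (simp add: mult_nonneg_nonpos)
      then show ?thesis using x(2)[OF that] by (simp add: y_sum)
    qed
    have y_tight: "coord_sum I y = real_of_int (top_sum S I)"
      using I(2) IV(2) by (simp add: y_sum r_def field_simps)
    have y_space: "y \<in> real_space N"
    proof (rule real_spaceI)
      fix i assume "i \<notin> ?V"
      then show "Poly_Mapping.lookup y i = 0"
        using out real_space_outside[OF x(1)] by (simp add: y_def lookup_add lookup_scaleR)
    qed
    note F = m_convex_family_face[OF S IV(1)]
    have "y \<in> base_polytope N (face S I)"
      unfolding base_polytope_def
    proof (intro CollectI conjI allI impI)
      show "y \<in> real_space N" by (rule y_space)
      show "coord_sum ?V y = real_of_int (top_sum (face S I) ?V)"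
        using total0 x(3) top_sum_total[OF F] by (simp add: y_sum)
      fix J assume J: "J \<subseteq> ?V"
      have fin: "finite I" "finite J" using IV J by (simp_all add: finite_subset[OF _ finite_atLeastAtMost])
      have "coord_sum J y = coord_sum (I \<inter> J) y + coord_sum (I \<union> J) y - coord_sum I y"
        using coord_sum_Un_Int[OF fin, of y] by simp
      also have "\<dots> \<le> real_of_int (top_sum S (I \<inter> J) + top_sum S (I \<union> J) - top_sum S I)"
      proof -
        have "I \<inter> J \<subseteq> ?V" "I \<union> J \<subseteq> ?V" using IV J by auto
        from y_le[OF this(1)] y_le[OF this(2)] show ?thesis using y_tight by simp
      qed
      also have "\<dots> \<le> real_of_int (top_sum (face S I) J)"
        using top_sum_face[OF S IV(1) J] by (simp only: of_int_le_iff)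
      finally show "coord_sum J y \<le> real_of_int (top_sum (face S I) J)" .
    qed
    moreover have "card (face S I) < card S"
    proof (rule psubset_card_mono[OF finS(1)])
      have "real_of_int (coord_sum I \<alpha>) < real_of_int (top_sum S I)"
      proof -
        have "real_of_int (coord_sum I \<alpha>) = coord_sum I x - coord_sum I dv"
          by (simp add: dv_def coord_sum_diff coord_sum_to_real)
        then show ?thesis using x(2)[OF IV(1)] IV(2) by simp
      qed
      then have "\<alpha> \<notin> face S I" by (simp add: face_def)
      then show "face S I \<subset> S" using \<alpha> by (intro psubsetI) (auto simp: face_def)
    qed
    ultimately have "y \<in> convex hull (to_real ` face S I)" using less.hyps F by blast
    then have y_hull: "y \<in> convex hull (to_real ` S)"
      using hull_mono[of "to_real ` face S I" "to_real ` S"] by (auto simp: face_def)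
    have \<alpha>_hull: "to_real \<alpha> \<in> convex hull (to_real ` S)" using \<alpha> by (intro hull_inc) auto
    have "x = (1 / (1 + t)) *\<^sub>R y + (t / (1 + t)) *\<^sub>R to_real \<alpha>"
    proof (rule poly_mapping_eqI)
      fix i
      show "Poly_Mapping.lookup x i = Poly_Mapping.lookup ((1 / (1 + t)) *\<^sub>R y + (t / (1 + t)) *\<^sub>R to_real \<alpha>) i"
      proof -
        have "Poly_Mapping.lookup y i + t * Poly_Mapping.lookup (to_real \<alpha>) i = (1 + t) * Poly_Mapping.lookup x i"
          by (simp add: y_def dv_def lookup_add lookup_minus lookup_scaleR algebra_simps)
        then have "Poly_Mapping.lookup x i =
            (Poly_Mapping.lookup y i + t * Poly_Mapping.lookup (to_real \<alpha>) i) / (1 + t)"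
          using t0 by (simp add: nonzero_eq_divide_eq mult.commute)
        then show ?thesis by (simp add: lookup_add lookup_scaleR add_divide_distrib)
      qed
    qed
    moreover have "(1 / (1 + t)) *\<^sub>R y + (t / (1 + t)) *\<^sub>R to_real \<alpha> \<in> convex hull (to_real ` S)"
      by (rule convexD[OF convex_convex_hull y_hull \<alpha>_hull]) (use t0 in \<open>auto simp: field_simps\<close>)
    ultimately show ?thesis by simp
  qed
qed

lemma hull_eq_base_polytope:
  assumes S: "m_convex_family N d S"
  shows "convex hull (to_real ` S) = base_polytope N S"
proof
  show "base_polytope N S \<subseteq> convex hull (to_real ` S)"
    using base_polytope_subset_hull[OF S] by blast
  have finS: "finite S" using S by (auto simp: m_convex_family_def)
  show "convex hull (to_real ` S) \<subseteq> base_polytope N S"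
  proof (rule hull_minimal)
    show "to_real ` S \<subseteq> base_polytope N S"
    proof
      fix x assume "x \<in> to_real ` S"
      then obtain \<alpha> where \<alpha>: "\<alpha> \<in> S" "x = to_real \<alpha>" by blast
      then have "\<alpha> \<in> int_space N" "coord_sum {1..N} \<alpha> = d"
        using S by (auto simp: m_convex_family_def M_convex_def)
      moreover from this(1) have "to_real \<alpha> \<in> real_space N"
        by (intro real_spaceI) (simp add: int_space_outside lookup_to_real)
      moreover have "coord_sum I \<alpha> \<le> top_sum S I" for I using top_sum_ge[OF finS \<alpha>(1)] .
      ultimately show "x \<in> base_polytope N S"
        using top_sum_total[OF S] unfolding base_polytope_def \<alpha>(2)
        by (simp add: coord_sum_to_real)
    qed
    show "convex (base_polytope N S)"
    proof (rule convexI)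
      fix x y u v assume xy: "x \<in> base_polytope N S" "y \<in> base_polytope N S"
        and uv: "0 \<le> u" "0 \<le> v" "u + v = (1::real)"
      have comb: "u * a + v * b \<le> c" if "a \<le> c" "b \<le> c" for a b c :: real
        using convex_bound_le[OF that uv] .
      have "coord_sum {1..N} (u *\<^sub>R x + v *\<^sub>R y) = (u + v) * real_of_int (top_sum S {1..N})"
        using xy by (simp add: base_polytope_def coord_sum_add coord_sum_scaleR distrib_right)
      moreover have "u *\<^sub>R x + v *\<^sub>R y \<in> real_space N"
      proof (rule real_spaceI)
        fix i assume i: "i \<notin> {1..N}"
        have "x \<in> real_space N" "y \<in> real_space N" using xy by (auto simp: base_polytope_def)
        then show "Poly_Mapping.lookup (u *\<^sub>R x + v *\<^sub>R y) i = 0"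
          using real_space_outside[OF _ i] by (simp add: lookup_add lookup_scaleR)
      qed
      ultimately show "u *\<^sub>R x + v *\<^sub>R y \<in> base_polytope N S"
        using xy uv comb by (simp add: base_polytope_def coord_sum_add coord_sum_scaleR)
    qed
  qed
qed

text \<open>
  Take \<open>\<alpha> \<in> S\<close> closest to \<open>v\<close> and \<open>j\<close> with \<open>\<alpha>\<^sub>j < v\<^sub>j\<close>. The set \<open>T\<close> of indices from which a unit
  can be moved to \<open>j\<close> within \<open>S\<close> is tight at \<open>\<alpha>\<close>. So the sum of \<open>v\<close> over \<open>T\<close> is at most that of
  \<open>\<alpha>\<close>, and since \<open>v\<close> is larger at \<open>j\<close>, it is smaller at some other \<open>i\<close> in \<open>T\<close>. Moving a unit
  from \<open>i\<close> to \<open>j\<close> brings \<open>\<alpha>\<close> closer to \<open>v\<close>.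
\<close>

lemma integral_point_in_family:
  assumes S: "m_convex_family N d S" and v: "v \<in> int_space N"
    and le: "\<And>I. I \<subseteq> {1..N} \<Longrightarrow> coord_sum I v \<le> top_sum S I" and total: "coord_sum {1..N} v = d"
  shows "v \<in> S"
proof -
  let ?V = "{1..N}"
  let ?l = Poly_Mapping.lookup
  have finS: "finite S" "S \<noteq> {}" and S_int: "S \<subseteq> int_space N" using S by (auto simp: m_convex_family_def M_convex_def)
  obtain \<alpha>0 where "\<alpha>0 \<in> S" using finS by blast
  then obtain \<alpha> where \<alpha>: "\<alpha> \<in> S" and min: "\<And>\<beta>. \<beta> \<in> S \<Longrightarrow> dist_on ?V \<alpha> v \<le> dist_on ?V \<beta> v"
    using ex_has_least_nat[of "\<lambda>\<beta>. \<beta> \<in> S" \<alpha>0 "\<lambda>\<beta>. dist_on ?V \<beta> v"] by blast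
  have \<alpha>_total: "coord_sum ?V \<alpha> = d" using S \<alpha> by (auto simp: m_convex_family_def)
  show ?thesis
  proof (rule ccontr)
    assume "v \<notin> S"
    have "\<exists>j\<in>?V. ?l \<alpha> j < ?l v j"
    proof (rule ccontr)
      assume "\<not> ?thesis"
      then have ge: "\<forall>j\<in>?V. 0 \<le> ?l \<alpha> j - ?l v j" by (auto simp: not_less)
      have "(\<Sum>j\<in>?V. ?l \<alpha> j - ?l v j) = 0"
        using total \<alpha>_total by (simp add: coord_sum_def sum_subtractf)
      then have "\<forall>j\<in>?V. ?l \<alpha> j - ?l v j = 0" using ge by (subst (asm) sum_nonneg_eq_0_iff) auto
      moreover have "?l \<alpha> j = 0 \<and> ?l v j = 0" if "j \<notin> ?V" for j
        using v \<alpha> S_int that by (metis int_space_outside subsetD)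
      ultimately have "\<alpha> = v" by (intro poly_mapping_eqI) (metis eq_iff_diff_eq_0)
      then show False using \<alpha> \<open>v \<notin> S\<close> by simp
    qed
    then obtain j where j: "j \<in> ?V" "?l \<alpha> j < ?l v j" by blast
    let ?mv = "\<lambda>k. \<alpha> - Poly_Mapping.single k 1 + Poly_Mapping.single j 1"
    define T where "T = {k \<in> ?V. k = j \<or> ?mv k \<in> S}"
    have TV: "T \<subseteq> ?V" "finite T" by (auto simp: T_def)
    \<comment> \<open>Otherwise take \<open>\<beta> \<in> S\<close> with a larger sum over \<open>T\<close>, closest to \<open>\<alpha>\<close>. Exchanging at some \<open>k\<close> in \<open>T\<close> yields an
      \<open>l\<close>, which by a second exchange belongs to \<open>T\<close> as well, so that \<open>\<beta>\<close> can be moved closer.\<close>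
    have "top_sum S T \<le> coord_sum T \<alpha>"
    proof (rule ccontr)
      assume "\<not> ?thesis"
      moreover obtain \<beta>0 where "\<beta>0 \<in> S" "coord_sum T \<beta>0 = top_sum S T"
        by (rule top_sum_attained[OF finS])
      ultimately have "\<beta>0 \<in> S \<and> coord_sum T \<alpha> < coord_sum T \<beta>0" by simp
      then obtain \<beta> where \<beta>: "\<beta> \<in> S" "coord_sum T \<alpha> < coord_sum T \<beta>"
        and \<beta>_min: "\<And>\<gamma>. \<gamma> \<in> S \<Longrightarrow> coord_sum T \<alpha> < coord_sum T \<gamma> \<Longrightarrow> dist_on ?V \<beta> \<alpha> \<le> dist_on ?V \<gamma> \<alpha>"
        using ex_has_least_nat[of "\<lambda>\<beta>. \<beta> \<in> S \<and> coord_sum T \<alpha> < coord_sum T \<beta>" _ "\<lambda>\<beta>. dist_on ?V \<beta> \<alpha>"]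
        by blast
      obtain k where k: "k \<in> T" "?l \<alpha> k < ?l \<beta> k"
        using \<beta>(2) unfolding coord_sum_def by (meson not_less sum_mono)
      then have kV: "k \<in> ?V" using TV by blast
      obtain l where l: "l \<in> ?V" "?l \<beta> l < ?l \<alpha> l" "\<beta> - Poly_Mapping.single k 1 + Poly_Mapping.single l 1 \<in> S"
        "\<alpha> + Poly_Mapping.single k 1 - Poly_Mapping.single l 1 \<in> S"
        using m_convex_familyE[OF S \<beta>(1) \<alpha> kV k(2)] by blast
      have kl: "k \<noteq> l" using k l by auto
      have "?mv l \<in> S" if "l \<noteq> j"
      proof (cases "k = j")
        case True
        then show ?thesis using l(4) by (simp add: algebra_simps)
      next
        case False
        let ?x = "\<alpha> + Poly_Mapping.single k 1 - Poly_Mapping.single l 1" and ?y = "?mv k"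
        have y: "?y \<in> S" using k False by (simp add: T_def)
        have "?l ?y k < ?l ?x k" using kl False
          by (simp add: lookup_add lookup_minus lookup_single when_def)
        then obtain j' where j': "?l ?x j' < ?l ?y j'"
          "?x - Poly_Mapping.single k 1 + Poly_Mapping.single j' 1 \<in> S"
          "?y + Poly_Mapping.single k 1 - Poly_Mapping.single j' 1 \<in> S"
          using m_convex_familyE[OF S l(4) y kV] by blast
        then have "j' = l \<or> j' = j"
          by (auto simp: lookup_add lookup_minus lookup_single when_def split: if_splits)
        then show ?thesis using j' by (auto simp: algebra_simps)
      qed
      then have lT: "l \<in> T" using l(1) by (auto simp: T_def)
      let ?g = "\<beta> - Poly_Mapping.single k 1 + Poly_Mapping.single l 1"
      have "coord_sum T ?g = coord_sum T \<beta>" using lT k by (simp add: coord_sum_swap[OF TV(2)])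
      then have "dist_on ?V \<beta> \<alpha> \<le> dist_on ?V ?g \<alpha>" using \<beta>_min[OF l(3)] \<beta> by simp
      moreover have "dist_on ?V ?g \<alpha> < dist_on ?V \<beta> \<alpha>"
        using k kV l by (intro dist_on_closer[of _ k l]) (auto simp: lookup_add lookup_minus lookup_single when_def)
      ultimately show False by simp
    qed
    then have "coord_sum T v \<le> coord_sum T \<alpha>" using le[OF TV(1)] by simp
    have "\<exists>i\<in>T. ?l v i < ?l \<alpha> i"
    proof (rule ccontr)
      assume n: "\<not> ?thesis"
      have "j \<in> T" using j by (simp add: T_def)
      then have "coord_sum T \<alpha> < coord_sum T v"
        unfolding coord_sum_def using n j TV(2) by (intro sum_strict_mono_ex1) (auto simp: not_less)
      then show False using \<open>coord_sum T v \<le> coord_sum T \<alpha>\<close> by simp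
    qed
    then obtain i where i: "i \<in> T" "?l v i < ?l \<alpha> i" by blast
    then have "i \<noteq> j" "i \<in> ?V" "?mv i \<in> S" using j by (auto simp: T_def)
    then have "dist_on ?V \<alpha> v \<le> dist_on ?V (?mv i) v" using min by blast
    moreover have "dist_on ?V (?mv i) v < dist_on ?V \<alpha> v"
      using i j \<open>i \<in> ?V\<close> by (intro dist_on_closer[of _ i j]) (auto simp: lookup_add lookup_minus lookup_single when_def)
    ultimately show False by simp
  qed
qed

theorem m_convex_lattice_points:
  assumes S: "m_convex_family N d S"
  shows "S = {v \<in> int_space N. to_real v \<in> convex hull (to_real ` S)}"
proof (intro equalityI subsetI CollectI conjI)
  fix v assume v: "v \<in> {v \<in> int_space N. to_real v \<in> convex hull (to_real ` S)}"
  then have "to_real v \<in> base_polytope N S" by (simp add: hull_eq_base_polytope[OF S])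
  then have "\<forall>I. I \<subseteq> {1..N} \<longrightarrow> coord_sum I v \<le> top_sum S I" "coord_sum {1..N} v = d"
    using top_sum_total[OF S] by (auto simp: base_polytope_def coord_sum_to_real)
  then show "v \<in> S" using integral_point_in_family[OF S, of v] v by blast
next
  fix v assume "v \<in> S"
  then show "v \<in> int_space N" "to_real v \<in> convex hull (to_real ` S)"
    using S by (auto simp: m_convex_family_def M_convex_def intro: hull_inc)
qed

theorem m_convex_generalized_permutahedron:
  assumes S: "m_convex_family N d S"
  shows "generalized_permutahedron N (convex hull (to_real ` S))"
  unfolding generalized_permutahedron_def hull_eq_base_polytope[OF S]
proof (intro exI[of _ "\<lambda>I. real_of_int (top_sum S I)"] conjI)
  have fin: "finite S" "S \<noteq> {}" using S by (auto simp: m_convex_family_def)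
  show "submodular N (\<lambda>I. real_of_int (top_sum S I))"
    unfolding submodular_def using top_sum_submodular[OF S]
    by (simp only: of_int_add[symmetric] of_int_le_iff) blast
  show "real_of_int (top_sum S {}) = 0"
    by (rule top_sum_attained[OF fin, of "{}"]) (simp add: coord_sum_def)
  show "base_polytope N S = {x \<in> real_space N.
     (\<forall>I. I \<subseteq> {1..N} \<longrightarrow> (\<Sum>i\<in>I. Poly_Mapping.lookup x i) \<le> real_of_int (top_sum S I)) \<and>
     (\<Sum>i\<in>{1..N}. Poly_Mapping.lookup x i) = real_of_int (top_sum S {1..N})}"
    by (simp add: base_polytope_def coord_sum_def)
qed

section \<open>Symmetric matrices with one positive eigenvalue\<close>

definition bform :: "'e set \<Rightarrow> ('e \<Rightarrow> 'e \<Rightarrow> real) \<Rightarrow> ('e \<Rightarrow> real) \<Rightarrow> ('e \<Rightarrow> real) \<Rightarrow> real" where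
  "bform E a x y = (\<Sum>i\<in>E. \<Sum>j\<in>E. a i j * x i * y j)"

text \<open>
  At most one positive eigenvalue: the form is negative semidefinite on the kernel of the linear
  form \<open>l\<close>.
\<close>

definition lorentzian_form :: "'e set \<Rightarrow> ('e \<Rightarrow> 'e \<Rightarrow> real) \<Rightarrow> bool" where
  "lorentzian_form E a \<longleftrightarrow> (\<exists>l. \<forall>x. bform E a x x \<le> (\<Sum>i\<in>E. l i * x i)\<^sup>2)"

lemma bform_commute:
  assumes "\<And>i j. i \<in> E \<Longrightarrow> j \<in> E \<Longrightarrow> a i j = a j i"
  shows "bform E a x y = bform E a y x"
  unfolding bform_def
  by (subst sum.swap) (auto intro!: sum.cong simp: assms)

lemma bform_lincomb_left:
  "bform E a (\<lambda>i. s * x i + t * x' i) y = s * bform E a x y + t * bform E a x' y"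
  unfolding bform_def by (simp add: algebra_simps sum.distrib sum_distrib_left)

lemma bform_lincomb_right:
  "bform E a x (\<lambda>i. s * y i + t * y' i) = s * bform E a x y + t * bform E a x y'"
  unfolding bform_def by (simp add: algebra_simps sum.distrib sum_distrib_left)

lemma bform_rows: "bform E a x y = (\<Sum>i\<in>E. x i * (\<Sum>j\<in>E. a i j * y j))"
  unfolding bform_def by (simp add: sum_distrib_left mult_ac)

lemma bform_nonneg:
  assumes "\<And>i j. i \<in> E \<Longrightarrow> j \<in> E \<Longrightarrow> 0 \<le> a i j" "\<And>i. i \<in> E \<Longrightarrow> 0 \<le> x i" "\<And>i. i \<in> E \<Longrightarrow> 0 \<le> y i"
  shows "0 \<le> bform E a x y"
  unfolding bform_def using assms by (intro sum_nonneg mult_nonneg_nonneg) auto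

text \<open>
  Some \<open>x - t y\<close> lies in the kernel of \<open>l\<close>, where the form is nonpositive; the claim follows by
  completing the square.
\<close>

lemma lorentzian_form_reverse_CS:
  assumes sym: "\<And>i j. i \<in> E \<Longrightarrow> j \<in> E \<Longrightarrow> a i j = a j i"
    and a: "lorentzian_form E a" and y: "0 \<le> bform E a y y"
  shows "bform E a x x * bform E a y y \<le> (bform E a x y)\<^sup>2"
proof (cases "bform E a y y = 0")
  case False
  obtain l where l: "\<And>x. bform E a x x \<le> (\<Sum>i\<in>E. l i * x i)\<^sup>2"
    using a unfolding lorentzian_form_def by blast
  define L where "L x = (\<Sum>i\<in>E. l i * x i)" for x
  have "L y \<noteq> 0" using l[of y] False y by (auto simp: L_def)
  define t where "t = L x / L y"
  define u where "u = (\<lambda>i. 1 * x i + (- t) * y i)"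
  have "L u = L x - t * L y"
    by (simp add: L_def u_def algebra_simps sum_subtractf sum_distrib_left)
  then have "L u = 0" using \<open>L y \<noteq> 0\<close> by (simp add: t_def)
  then have "bform E a u u \<le> 0" using l[of u] by (simp add: L_def)
  moreover have "bform E a u u = bform E a x x - 2 * t * bform E a x y + t\<^sup>2 * bform E a y y"
    unfolding u_def bform_lincomb_left bform_lincomb_right
    using bform_commute[of E a x y, OF sym] by (simp add: algebra_simps power2_eq_square)
  ultimately have "bform E a x x \<le> 2 * t * bform E a x y - t\<^sup>2 * bform E a y y" by simp
  then have "bform E a x x * bform E a y y \<le>
      (2 * t * bform E a x y - t\<^sup>2 * bform E a y y) * bform E a y y"
    using y by (rule mult_right_mono)
  also have "\<dots> = (bform E a x y)\<^sup>2 - (bform E a x y - t * bform E a y y)\<^sup>2"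
    by (simp add: power2_eq_square algebra_simps)
  also have "\<dots> \<le> (bform E a x y)\<^sup>2" by simp
  finally show ?thesis .
qed simp

lemma compact_box_fun:
  fixes B :: "'e \<Rightarrow> real"
  shows "compact {x :: 'e \<Rightarrow> real. \<forall>i. x i \<in> {- B i..B i}}"
proof -
  have "{x :: 'e \<Rightarrow> real. \<forall>i. x i \<in> {- B i..B i}} = PiE UNIV (\<lambda>i. {- B i..B i})"
    by (auto simp: PiE_def Pi_def extensional_def)
  moreover have "compactin (product_topology (\<lambda>i::'e. euclidean) UNIV) (PiE UNIV (\<lambda>i. {- B i..B i}))"
    by (subst compactin_PiE) (auto simp: compactin_euclidean_iff)
  ultimately show ?thesis
    unfolding euclidean_product_topology compactin_euclidean_iff by simp
qed

text \<open>
  The vector \<open>z\<close> is a Perron eigenvector of \<open>a\<close> relative to the diagonal form \<open>d\<close>, with eigenvalue 1. If \<open>a\<close>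
  were positive somewhere on the orthogonal complement of \<open>z\<close>, the largest Rayleigh quotient \<open>\<lambda>\<close> there would be
  positive and attained at an eigenvector \<open>x\<close>. The assumption \<open>key\<close>, applied to \<open>x\<close>, gives \<open>\<lambda> \<le> \<lambda>\<^sup>2\<close>, so
  \<open>1 \<le> \<lambda>\<close>. By connectedness the eigenvalue 1 of the Perron vector is simple and the largest one, a contradiction.
\<close>

lemma spectral_step:
  fixes a :: "'e \<Rightarrow> 'e \<Rightarrow> real"
  assumes fin: "finite E"
    and sym: "\<And>i j. i \<in> E \<Longrightarrow> j \<in> E \<Longrightarrow> a i j = a j i"
    and a0: "\<And>i j. i \<in> E \<Longrightarrow> j \<in> E \<Longrightarrow> 0 \<le> a i j"
    and z: "\<And>i. i \<in> E \<Longrightarrow> 0 < z i"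
    and d: "\<And>i. i \<in> E \<Longrightarrow> 0 < d i"
    and dz: "\<And>i. i \<in> E \<Longrightarrow> (\<Sum>j\<in>E. a i j * z j) = d i * z i"
    and conn: "\<And>i j. i \<in> E \<Longrightarrow> j \<in> E \<Longrightarrow> (i, j) \<in> {(i, j). i \<in> E \<and> j \<in> E \<and> 0 < a i j}\<^sup>*"
    and key: "\<And>x. bform E a x x \<le> (\<Sum>i\<in>E. (\<Sum>j\<in>E. a i j * x j)\<^sup>2 / d i)"
    and x0: "(\<Sum>i\<in>E. d i * z i * x0 i) = 0"
  shows "bform E a x0 x0 \<le> 0"
proof (rule ccontr)
  assume "\<not> bform E a x0 x0 \<le> 0"
  define q where "q x = bform E a x x" for x
  define m where "m x y = (\<Sum>i\<in>E. d i * x i * y i)" for x y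
  define orth where "orth x \<longleftrightarrow> (\<Sum>i\<in>E. d i * z i * x i) = 0" for x
  have q_cong: "q x = q y" if "\<And>i. i \<in> E \<Longrightarrow> x i = y i" for x y
    using that by (simp add: q_def bform_def)
  have q0: "0 < q x0" using \<open>\<not> bform E a x0 x0 \<le> 0\<close> by (simp add: q_def)
  have m_pos: "0 < m x x" if "i \<in> E" "x i \<noteq> 0" for i x
  proof -
    have "0 < d i * x i * x i" using d[of i] that by (simp add: mult.assoc) (metis mult_pos_pos not_real_square_gt_zero)
    also have "\<dots> \<le> m x x" unfolding m_def
      by (rule member_le_sum[OF that(1)]) (use fin d in \<open>auto simp: mult.assoc less_imp_le\<close>)
    finally show ?thesis .
  qed
  have m0: "0 \<le> m x x" for x
    unfolding m_def using d by (intro sum_nonneg) (simp add: mult.assoc less_imp_le)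
  \<comment> \<open>The unit sphere of the diagonal form, orthogonal to \<open>z\<close>. The bound \<open>1 + 1 / d i\<close> exceeds
  \<open>1 / \<surd>d i\<close> and holds automatically; it makes the set compact.\<close>
  define K where "K = {x. (\<forall>i. x i \<in> {- (if i \<in> E then 1 + 1 / d i else 0)..(if i \<in> E then 1 + 1 / d i else 0)}) \<and>
     m x x = 1 \<and> orth x}"
  have K_closed: "closed {x. m x x = 1 \<and> orth x}"
  proof -
    have "continuous_on UNIV (\<lambda>x. m x x)" unfolding m_def by (intro continuous_intros continuous_on_product_coordinates)
    moreover have "continuous_on UNIV (\<lambda>x. \<Sum>i\<in>E. d i * z i * x i)"
      by (intro continuous_intros continuous_on_product_coordinates)
    ultimately show ?thesis unfolding orth_def
      by (intro closed_Collect_conj closed_Collect_eq) auto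
  qed
  have "compact K"
    using compact_Int_closed[OF compact_box_fun K_closed, of "\<lambda>i. if i \<in> E then 1 + 1 / d i else 0"]
    by (simp add: K_def Collect_conj_eq[symmetric])
  have in_K: "(\<lambda>i. if i \<in> E then x i / sqrt (m x x) else 0) \<in> K"
    and q_norm: "q (\<lambda>i. if i \<in> E then x i / sqrt (m x x) else 0) = q x / m x x"
    if "orth x" "0 < m x x" for x
  proof -
    define y where "y = (\<lambda>i. if i \<in> E then x i / sqrt (m x x) else 0)"
    have y_out: "i \<notin> E \<Longrightarrow> y i = 0" for i by (simp add: y_def)
    have my: "m y y = 1"
    proof -
      have "m y y = (\<Sum>i\<in>E. d i * x i * x i / m x x)"
        unfolding m_def[of y y] using that by (intro sum.cong) (auto simp: y_def field_simps)
      also have "\<dots> = m x x / m x x" unfolding sum_divide_distrib[symmetric] by (simp add: m_def)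
      finally show ?thesis using that by simp
    qed
    have "(\<Sum>i\<in>E. d i * z i * y i) = (\<Sum>i\<in>E. d i * z i * x i) / sqrt (m x x)"
      unfolding sum_divide_distrib by (intro sum.cong) (auto simp: y_def)
    then have oy: "orth y" using that by (simp add: orth_def)
    have "\<bar>y i\<bar> \<le> 1 + 1 / d i" if i: "i \<in> E" for i
    proof -
      have "d i * y i * y i \<le> m y y" unfolding m_def
        by (rule member_le_sum[OF i]) (use fin d in \<open>auto simp: mult.assoc less_imp_le\<close>)
      then have "(y i)\<^sup>2 \<le> 1 / d i" using my d[OF i] by (simp add: field_simps power2_eq_square)
      also have "\<dots> \<le> (1 + 1 / d i)\<^sup>2" using d[OF i] by (simp add: power2_eq_square field_simps)
      finally show ?thesis using d[OF i] by (intro abs_le_square_iff[THEN iffD2, of "y i" "1 + 1 / d i", simplified] | simp add: abs_le_square_iff[symmetric])+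
    qed
    then have "\<forall>i. y i \<in> {- (if i \<in> E then 1 + 1 / d i else 0)..(if i \<in> E then 1 + 1 / d i else 0)}"
      using y_out by (auto simp: abs_le_iff minus_le_iff)
    then show "(\<lambda>i. if i \<in> E then x i / sqrt (m x x) else 0) \<in> K"
      using my oy unfolding K_def y_def[symmetric] by simp
    have "q y = (\<Sum>i\<in>E. \<Sum>j\<in>E. a i j * x i * x j / m x x)"
      unfolding q_def bform_def using that by (intro sum.cong) (auto simp: y_def field_simps)
    then show "q (\<lambda>i. if i \<in> E then x i / sqrt (m x x) else 0) = q x / m x x"
      unfolding y_def[symmetric] by (simp add: q_def bform_def sum_divide_distrib)
  qed
  have q_zero: "q y = 0" if "\<not> (\<exists>i\<in>E. y i \<noteq> 0)" for y
  proof -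
    have "q y = q (\<lambda>_. 0)" by (rule q_cong) (use that in auto)
    then show ?thesis by (simp add: q_def bform_def)
  qed
  have "\<exists>i\<in>E. x0 i \<noteq> 0"
    using q0 q_zero[of x0] by (metis less_irrefl)
  then have mx0: "0 < m x0 x0" using m_pos by blast
  have ox0: "orth x0" using x0 by (simp add: orth_def)
  have "K \<noteq> {}" using in_K[OF ox0 mx0] by blast
  moreover have "continuous_on K q" unfolding q_def bform_def
    by (intro continuous_intros continuous_on_subset[OF continuous_on_product_coordinates]) auto
  ultimately obtain x where xK: "x \<in> K" and xmax: "\<And>y. y \<in> K \<Longrightarrow> q y \<le> q x"
    using continuous_attains_sup[OF \<open>compact K\<close>] by blast
  define lam where "lam = q x"
  have mx: "m x x = 1" and ox: "orth x" using xK by (auto simp: K_def)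
  have lam: "0 < lam"
  proof -
    have "q x0 / m x0 x0 \<le> lam"
      using xmax[OF in_K[OF ox0 mx0]] unfolding q_norm[OF ox0 mx0] lam_def .
    moreover have "0 < q x0 / m x0 x0" using q0 mx0 by simp
    ultimately show ?thesis by linarith
  qed
  have qle: "q y \<le> lam * m y y" if "orth y" for y
  proof (cases "\<exists>i\<in>E. y i \<noteq> 0")
    case True
    then have my: "0 < m y y" using m_pos by blast
    then show ?thesis
      using xmax[OF in_K[OF that my]] unfolding q_norm[OF that my] lam_def[symmetric]
      by (simp add: field_simps)
  next
    case False
    then have "q y = 0" by (rule q_zero)
    then show ?thesis using m0 lam by simp
  qed
  have bz: "bform E a x' z = (\<Sum>i\<in>E. d i * z i * x' i)" for x'
    unfolding bform_rows using dz by (intro sum.cong) auto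
  \<comment> \<open>The first variation of the Rayleigh quotient at its maximum \<open>x\<close> vanishes.\<close>
  have eig: "bform E a x h = lam * m x h" if "orth h" for h
  proof -
    define b where "b = lam * m x h - bform E a x h"
    define c where "c = lam * m h h - q h"
    have "0 \<le> 2 * t * b + t\<^sup>2 * c" for t
    proof -
      have "orth (\<lambda>i. 1 * x i + t * h i)"
        using ox that unfolding orth_def
        by (simp add: distrib_left sum.distrib mult.left_commute[of _ t] flip: sum_distrib_left)
      then have "q (\<lambda>i. 1 * x i + t * h i) \<le> lam * m (\<lambda>i. 1 * x i + t * h i) (\<lambda>i. 1 * x i + t * h i)"
        by (rule qle)
      moreover have "q (\<lambda>i. 1 * x i + t * h i) = q x + 2 * t * bform E a x h + t\<^sup>2 * q h"
        unfolding q_def bform_lincomb_left bform_lincomb_right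
        using bform_commute[of E a x h, OF sym] by (simp add: algebra_simps power2_eq_square)
      moreover have "m (\<lambda>i. 1 * x i + t * h i) (\<lambda>i. 1 * x i + t * h i) = m x x + 2 * t * m x h + t\<^sup>2 * m h h"
        unfolding m_def by (simp add: algebra_simps power2_eq_square sum.distrib sum_distrib_left)
      ultimately show ?thesis using mx by (simp add: b_def c_def lam_def algebra_simps)
    qed note nn = this
    have "b = 0"
    proof (rule ccontr)
      assume "b \<noteq> 0"
      define C where "C = \<bar>c\<bar> + 1"
      have "0 < C" by (simp add: C_def)
      have "0 \<le> 2 * (- b / C) * b + (- b / C)\<^sup>2 * c" by (rule nn)
      also have "\<dots> \<le> 2 * (- b / C) * b + (- b / C)\<^sup>2 * C"
        by (intro add_left_mono mult_left_mono) (auto simp: C_def)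
      also have "\<dots> = - (b\<^sup>2 / C)" using \<open>0 < C\<close> by (simp add: power2_eq_square field_simps)
      also have "\<dots> < 0" using \<open>b \<noteq> 0\<close> \<open>0 < C\<close> by simp
      finally show False by simp
    qed
    then show ?thesis by (simp add: b_def)
  qed
  have zz: "0 < (\<Sum>i\<in>E. d i * z i * z i)"
    using m_pos[of _ z] z \<open>\<exists>i\<in>E. x0 i \<noteq> 0\<close> unfolding m_def by (metis less_irrefl)
  have eig': "bform E a x h = lam * m x h" for h
  proof -
    define t where "t = (\<Sum>i\<in>E. d i * z i * h i) / (\<Sum>i\<in>E. d i * z i * z i)"
    have "orth (\<lambda>i. 1 * h i + (- t) * z i)"
    proof -
      have "(\<Sum>i\<in>E. d i * z i * (1 * h i + (- t) * z i)) =
        (\<Sum>i\<in>E. d i * z i * h i) - t * (\<Sum>i\<in>E. d i * z i * z i)"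
        by (simp add: algebra_simps sum_subtractf sum_distrib_left)
      then show ?thesis using zz by (simp add: orth_def t_def)
    qed
    from eig[OF this]
    have "bform E a x h - t * bform E a x z = lam * (m x h - t * m x z)"
      unfolding bform_lincomb_right
      by (simp add: m_def algebra_simps sum_subtractf sum_distrib_left)
    moreover have "bform E a x z = 0" using ox by (simp add: bz orth_def)
    moreover have "m x z = 0" using ox by (simp add: m_def orth_def mult_ac)
    ultimately show ?thesis by simp
  qed
  have row: "(\<Sum>j\<in>E. a i j * x j) = lam * d i * x i" if i: "i \<in> E" for i
  proof -
    have "bform E a x (\<lambda>j. if j = i then 1 else 0) = (\<Sum>j\<in>E. a j i * x j)"
      unfolding bform_def using fin i by (simp add: if_distrib[of "\<lambda>u. _ * u"] cong: if_cong)
    also have "\<dots> = (\<Sum>j\<in>E. a i j * x j)" using sym[OF i] by (intro sum.cong) auto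
    finally show ?thesis
      using eig'[of "\<lambda>j. if j = i then 1 else 0"] fin i
      by (simp add: m_def if_distrib[of "\<lambda>u. _ * u"] cong: if_cong)
  qed
  have "lam \<le> (\<Sum>i\<in>E. (lam * d i * x i)\<^sup>2 / d i)"
    using key[of x] row by (simp add: lam_def q_def)
  also have "\<dots> = (\<Sum>i\<in>E. lam\<^sup>2 * (d i * x i * x i))"
    using d by (intro sum.cong) (auto simp: power2_eq_square field_simps)
  also have "\<dots> = lam\<^sup>2 * m x x" by (simp add: m_def sum_distrib_left)
  finally have "1 \<le> lam" using lam mx by (simp add: power2_eq_square)
  \<comment> \<open>The sum of these squares is \<open>2 (1 - \<lambda>) \<le> 0\<close>; so all of them vanish and \<open>x\<close> is proportional
  to \<open>z\<close>.\<close>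
  define e where "e i j = a i j * z i * z j * (x i / z i - x j / z j)\<^sup>2" for i j
  have e0: "0 \<le> e i j" if "i \<in> E" "j \<in> E" for i j
    using a0[OF that] z that by (simp add: e_def less_imp_le)
  have "(\<Sum>i\<in>E. \<Sum>j\<in>E. e i j) = 2 * m x x - 2 * q x"
  proof -
    have "e i j = (x i)\<^sup>2 / z i * (a i j * z j) + (x j)\<^sup>2 / z j * (a j i * z i) - 2 * (a i j * x i * x j)"
      if "i \<in> E" "j \<in> E" for i j
      using z[OF that(1)] z[OF that(2)] sym[OF that] by (simp add: e_def power2_eq_square field_simps)
    then have "(\<Sum>i\<in>E. \<Sum>j\<in>E. e i j) = (\<Sum>i\<in>E. \<Sum>j\<in>E. (x i)\<^sup>2 / z i * (a i j * z j)) +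
      (\<Sum>i\<in>E. \<Sum>j\<in>E. (x j)\<^sup>2 / z j * (a j i * z i)) - 2 * q x"
      by (simp add: sum.distrib sum_subtractf sum_distrib_left q_def bform_def)
    also have "(\<Sum>i\<in>E. \<Sum>j\<in>E. (x j)\<^sup>2 / z j * (a j i * z i)) =
        (\<Sum>i\<in>E. \<Sum>j\<in>E. (x i)\<^sup>2 / z i * (a i j * z j))"
      by (rule sum.swap)
    also have "(\<Sum>i\<in>E. \<Sum>j\<in>E. (x i)\<^sup>2 / z i * (a i j * z j)) = m x x"
      unfolding m_def sum_distrib_left[symmetric] using dz z[THEN less_imp_neq]
      by (intro sum.cong) (auto simp: power2_eq_square field_simps)
    finally show ?thesis by simp
  qed
  then have "(\<Sum>i\<in>E. \<Sum>j\<in>E. e i j) \<le> 0" using \<open>1 \<le> lam\<close> mx by (simp add: lam_def)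
  moreover have "0 \<le> (\<Sum>i\<in>E. \<Sum>j\<in>E. e i j)" using e0 by (intro sum_nonneg) auto
  ultimately have "(\<Sum>i\<in>E. \<Sum>j\<in>E. e i j) = 0" by simp
  then have "\<forall>i\<in>E. (\<Sum>j\<in>E. e i j) = 0"
    using fin e0 by (subst (asm) sum_nonneg_eq_0_iff) (auto intro: sum_nonneg)
  then have e_zero: "e i j = 0" if "i \<in> E" "j \<in> E" for i j
    using that fin e0 sum_nonneg_eq_0_iff[of E "e i"] by auto
  have "x i / z i = x j / z j" if "(i, j) \<in> {(i, j). i \<in> E \<and> j \<in> E \<and> 0 < a i j}\<^sup>*" for i j
    using that
  proof induction
    case (step y w)
    then have "e y w = 0" "0 < a y w" "0 < z y" "0 < z w" using e_zero z by auto
    then show ?case using step by (simp add: e_def)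
  qed simp
  then have ratio: "x i / z i = x j / z j" if "i \<in> E" "j \<in> E" for i j using conn that by blast
  obtain i where i: "i \<in> E" using \<open>\<exists>i\<in>E. x0 i \<noteq> 0\<close> by blast
  have xj: "x j = x i / z i * z j" if "j \<in> E" for j
    using ratio[OF that i] z[OF that] by (simp add: field_simps)
  have "(\<Sum>j\<in>E. d j * z j * x j) = x i / z i * (\<Sum>j\<in>E. d j * z j * z j)"
    unfolding sum_distrib_left by (intro sum.cong) (auto simp: xj)
  then have "x i = 0" using ox zz z[OF i] by (simp add: orth_def)
  then have "m x x = 0" unfolding m_def using xj by (simp add: sum.neutral)
  then show False using mx by simp
qed

text \<open>
  Subtract from \<open>x\<close> its projection to \<open>z\<close> and apply \<open>spectral_step\<close> to the rest.
\<close>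

lemma lorentzian_form_spectral:
  fixes a :: "'e \<Rightarrow> 'e \<Rightarrow> real"
  assumes fin: "finite E"
    and sym: "\<And>i j. i \<in> E \<Longrightarrow> j \<in> E \<Longrightarrow> a i j = a j i"
    and a0: "\<And>i j. i \<in> E \<Longrightarrow> j \<in> E \<Longrightarrow> 0 \<le> a i j"
    and z: "\<And>i. i \<in> E \<Longrightarrow> 0 < z i"
    and d: "\<And>i. i \<in> E \<Longrightarrow> 0 < d i"
    and dz: "\<And>i. i \<in> E \<Longrightarrow> (\<Sum>j\<in>E. a i j * z j) = d i * z i"
    and conn: "\<And>i j. i \<in> E \<Longrightarrow> j \<in> E \<Longrightarrow> (i, j) \<in> {(i, j). i \<in> E \<and> j \<in> E \<and> 0 < a i j}\<^sup>*"
    and key: "\<And>x. bform E a x x \<le> (\<Sum>i\<in>E. (\<Sum>j\<in>E. a i j * x j)\<^sup>2 / d i)"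
  shows "lorentzian_form E a"
proof (cases "E = {}")
  case True
  then show ?thesis by (simp add: lorentzian_form_def bform_def)
next
  case False
  define m where "m x = (\<Sum>i\<in>E. d i * z i * x i)" for x
  have Z: "0 < m z" unfolding m_def using fin False z d by (intro sum_pos) auto
  have bz: "bform E a x z = m x" for x
    unfolding bform_rows m_def using dz by (intro sum.cong) auto
  define l where "l i = d i * z i / sqrt (m z)" for i
  have "bform E a x x \<le> (\<Sum>i\<in>E. l i * x i)\<^sup>2" for x
  proof -
    define t where "t = m x / m z"
    define y where "y = (\<lambda>i. 1 * x i + (- t) * z i)"
    have my: "m y = m x - t * m z"
      by (simp add: m_def y_def algebra_simps sum_subtractf sum_distrib_left)
    then have "m y = 0" using Z by (simp add: t_def)
    then have "bform E a y y \<le> 0"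
      unfolding m_def by (intro spectral_step[OF fin sym a0 z d dz conn key]) auto
    moreover have "bform E a y y = bform E a x x - 2 * t * m x + t\<^sup>2 * m z"
      unfolding y_def bform_lincomb_left bform_lincomb_right
      using bform_commute[of E a z x, OF sym] bz
      by (simp add: algebra_simps power2_eq_square)
    ultimately have "bform E a x x \<le> 2 * t * m x - t\<^sup>2 * m z" by simp
    also have "\<dots> = (m x)\<^sup>2 / m z"
      using Z by (simp add: t_def power2_eq_square field_simps)
    also have "\<dots> = (m x / sqrt (m z))\<^sup>2"
      using Z by (simp add: power_divide)
    also have "m x / sqrt (m z) = (\<Sum>i\<in>E. l i * x i)"
      by (simp add: m_def[of x] l_def sum_divide_distrib)
    finally show ?thesis .
  qed
  then show ?thesis unfolding lorentzian_form_def by blast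
qed

section \<open>From local to global\<close>

text \<open>
  A function \<open>c\<close> on the subsets of \<open>E\<close> stands for the multiaffine polynomial \<open>\<Sum> c K x\<^sup>K\<close> and, at
  the same time, for its partial derivatives at the origin: \<open>c K\<close> is the derivative by the
  variables in \<open>K\<close>. Then \<open>dir_deriv E z c\<close> represents the derivative in direction \<open>z\<close>.
\<close>

definition dir_deriv :: "'e set \<Rightarrow> ('e \<Rightarrow> real) \<Rightarrow> ('e set \<Rightarrow> real) \<Rightarrow> 'e set \<Rightarrow> real" where
  "dir_deriv E z c K = (\<Sum>i\<in>E - K. z i * c (insert i K))"

definition dir_derivs :: "'e set \<Rightarrow> ('e \<Rightarrow> real) list \<Rightarrow> ('e set \<Rightarrow> real) \<Rightarrow> 'e set \<Rightarrow> real" where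
  "dir_derivs E zs c = foldr (dir_deriv E) zs c"

lemma dir_derivs_simps [simp]:
  "dir_derivs E [] c = c" "dir_derivs E (z # zs) c = dir_deriv E z (dir_derivs E zs c)"
  by (simp_all add: dir_derivs_def)

definition hessian :: "('e set \<Rightarrow> real) \<Rightarrow> 'e set \<Rightarrow> 'e \<Rightarrow> 'e \<Rightarrow> real" where
  "hessian c K i j = (if i = j \<or> i \<in> K \<or> j \<in> K then 0 else c (insert i (insert j K)))"

lemma hessian_sym: "hessian c K i j = hessian c K j i"
  by (auto simp: hessian_def insert_commute)

text \<open>
  The local conditions on a multiaffine polynomial of degree \<open>d\<close>: its quadratic derivatives have
  at most one positive eigenvalue, and for its derivatives of higher degree any two variables
  that occur are joined by a path of length at most two, where neighbours are variables that
  occur together in a monomial.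
\<close>

locale lorentzian_weights =
  fixes E :: "'e set" and c :: "'e set \<Rightarrow> real" and d :: nat
  assumes fin: "finite E" and c_nonneg: "0 \<le> c K"
    and quadratic: "\<lbrakk>K \<subseteq> E; card K + 2 = d\<rbrakk> \<Longrightarrow> lorentzian_form E (hessian c K)"
    and connected: "\<lbrakk>K \<subseteq> E; card K + 3 \<le> d; a \<in> E - K; b \<in> E - K; a \<noteq> b;
      \<exists>G. insert a K \<subseteq> G \<and> G \<subseteq> E \<and> card G = d \<and> 0 < c G;
      \<exists>G. insert b K \<subseteq> G \<and> G \<subseteq> E \<and> card G = d \<and> 0 < c G\<rbrakk> \<Longrightarrow>
      (\<exists>G. insert a (insert b K) \<subseteq> G \<and> G \<subseteq> E \<and> card G = d \<and> 0 < c G) \<or>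
      (\<exists>l\<in>E - K - {a, b}.
         (\<exists>G. insert a (insert l K) \<subseteq> G \<and> G \<subseteq> E \<and> card G = d \<and> 0 < c G) \<and>
         (\<exists>G. insert l (insert b K) \<subseteq> G \<and> G \<subseteq> E \<and> card G = d \<and> 0 < c G))"
begin

definition completable :: "'e set \<Rightarrow> bool" where
  "completable K \<longleftrightarrow> (\<exists>G. K \<subseteq> G \<and> G \<subseteq> E \<and> card G = d \<and> 0 < c G)"

lemma completable_mono: "completable K \<Longrightarrow> L \<subseteq> K \<Longrightarrow> completable L"
  unfolding completable_def by blast

lemma dir_derivs_nonneg:
  "(\<And>z i. z \<in> set zs \<Longrightarrow> i \<in> E \<Longrightarrow> 0 \<le> z i) \<Longrightarrow> 0 \<le> dir_derivs E zs c K"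
proof (induction zs arbitrary: K)
  case (Cons z zs)
  then have "0 \<le> dir_derivs E zs c K" for K by simp
  then show ?case using Cons.prems by (auto simp: dir_deriv_def intro!: sum_nonneg mult_nonneg_nonneg)
qed (simp add: c_nonneg)

lemma dir_derivs_pos_iff:
  assumes "\<And>z i. z \<in> set zs \<Longrightarrow> i \<in> E \<Longrightarrow> 0 < z i" "K \<subseteq> E" "card K + length zs = d"
  shows "0 < dir_derivs E zs c K \<longleftrightarrow> completable K"
  using assms
proof (induction zs arbitrary: K)
  case Nil
  have "G = K" if "K \<subseteq> G" "G \<subseteq> E" "card G = d" for G
    using that Nil card_subset_eq[of G K] finite_subset[OF _ fin] by auto
  then show ?case using Nil by (auto simp: completable_def)
next
  case (Cons z zs)
  have finK: "finite K" using Cons.prems(2) fin by (rule finite_subset)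
  have IH: "0 < dir_derivs E zs c (insert i K) \<longleftrightarrow> completable (insert i K)" if "i \<in> E - K" for i
    using that Cons.prems finK by (intro Cons.IH) auto
  have nn: "0 \<le> z i * dir_derivs E zs c (insert i K)" if "i \<in> E - K" for i
  proof (intro mult_nonneg_nonneg dir_derivs_nonneg)
    show "0 \<le> z i" using Cons.prems(1)[of z i] that by simp
    fix z' i assume "z' \<in> set zs" "i \<in> E"
    then show "0 \<le> z' i" using Cons.prems(1)[of z' i] by simp
  qed
  have "0 < dir_derivs E (z # zs) c K \<longleftrightarrow> (\<exists>i\<in>E - K. 0 < z i * dir_derivs E zs c (insert i K))"
  proof
    assume "0 < dir_derivs E (z # zs) c K"
    show "\<exists>i\<in>E - K. 0 < z i * dir_derivs E zs c (insert i K)"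
    proof (rule ccontr)
      assume "\<not> ?thesis"
      then have "dir_derivs E (z # zs) c K \<le> 0"
        by (auto simp: dir_deriv_def not_less intro!: sum_nonpos)
      then show False using \<open>0 < dir_derivs E (z # zs) c K\<close> by simp
    qed
  next
    assume "\<exists>i\<in>E - K. 0 < z i * dir_derivs E zs c (insert i K)"
    then obtain i where i: "i \<in> E - K" "0 < z i * dir_derivs E zs c (insert i K)" by blast
    then show "0 < dir_derivs E (z # zs) c K"
      using fin nn unfolding dir_derivs_simps dir_deriv_def by (intro sum_pos2[of _ i]) auto
  qed
  also have "\<dots> \<longleftrightarrow> (\<exists>i\<in>E - K. completable (insert i K))"
    using IH Cons.prems(1)[of z] by (auto simp: zero_less_mult_iff) (metis less_asym list.set_intros(1))+
  also have "\<dots> \<longleftrightarrow> completable K"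
  proof
    assume "completable K"
    then obtain G where G: "K \<subseteq> G" "G \<subseteq> E" "card G = d" "0 < c G" by (auto simp: completable_def)
    have "K \<noteq> G" using G(3) Cons.prems(3) by auto
    then obtain i where "i \<in> G - K" using G by blast
    then show "\<exists>i\<in>E - K. completable (insert i K)" using G by (auto simp: completable_def)
  qed (auto intro: completable_mono)
  finally show ?case .
qed

text \<open>
  The conditions pass from degree to degree. Let \<open>B k\<close> be the Hessian of the derivative by
  variable \<open>k\<close>, Lorentzian by induction, and \<open>A = \<Sum> z k B k\<close>. Row \<open>i\<close> of \<open>A\<close> is \<open>B i z\<close>, since
  third derivatives are symmetric. So the reverse Cauchy--Schwarz inequality for \<open>B k\<close> and \<open>z\<close>
  bounds \<open>B k x x\<close> by the normalized square of entry \<open>k\<close> of \<open>A x\<close>, which is the assumption that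
  \<open>lorentzian_form_spectral\<close> needs about \<open>A\<close>.
\<close>

theorem lorentzian_dir_derivs:
  assumes "\<And>z i. z \<in> set zs \<Longrightarrow> i \<in> E \<Longrightarrow> 0 < z i" "K \<subseteq> E" "card K + 2 + length zs = d"
  shows "lorentzian_form E (hessian (dir_derivs E zs c) K)"
  using assms
proof (induction zs arbitrary: K)
  case Nil
  then show ?case using quadratic by simp
next
  case (Cons z zs)
  define c' where "c' = dir_derivs E zs c"
  define A where "A = hessian (dir_derivs E (z # zs) c) K"
  define B where "B k = hessian c' (insert k K)" for k
  have finK: "finite K" using Cons.prems(2) fin by (rule finite_subset)
  have zpos: "0 < z i" if "i \<in> E" for i using Cons.prems(1)[of z i] that by simp
  have c'0: "0 \<le> c' L" for L
    unfolding c'_def using Cons.prems(1) by (intro dir_derivs_nonneg) (auto intro: less_imp_le)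
  have B0: "0 \<le> B k i j" for k i j by (simp add: B_def hessian_def c'0)
  have Bsym: "B k i j = B k j i" for k i j unfolding B_def by (rule hessian_sym)
  have A_eq: "A i j = (\<Sum>k\<in>E - K. z k * B k i j)" if "i \<in> E" "j \<in> E" for i j
  proof (cases "i = j \<or> i \<in> K \<or> j \<in> K")
    case True
    then show ?thesis by (auto simp: A_def B_def hessian_def)
  next
    case False
    then have "A i j = (\<Sum>k\<in>E - insert i (insert j K). z k * c' (insert k (insert i (insert j K))))"
      by (simp add: A_def hessian_def dir_deriv_def c'_def)
    also have "\<dots> = (\<Sum>k\<in>E - K. z k * B k i j)"
      using fin False by (intro sum.mono_neutral_cong_left)
        (auto simp: B_def hessian_def insert_commute)
    finally show ?thesis .
  qed
  have A0: "0 \<le> A i j" if "i \<in> E" "j \<in> E" for i j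
    unfolding A_eq[OF that] using B0 zpos by (intro sum_nonneg mult_nonneg_nonneg) (auto intro: less_imp_le)
  have Asym: "A i j = A j i" for i j unfolding A_def by (rule hessian_sym)
  have row: "(\<Sum>j\<in>E. A i j * x j) = bform E (B i) z x" if i: "i \<in> E - K" for i x
  proof -
    have sw: "B k i j = B i k j" if "k \<in> E - K" for k j
      using that i by (auto simp: B_def hessian_def insert_commute)
    have "(\<Sum>j\<in>E. A i j * x j) = (\<Sum>j\<in>E. \<Sum>k\<in>E - K. B i k j * z k * x j)"
      using i by (intro sum.cong) (auto simp: A_eq sum_distrib_right sum_distrib_left sw mult_ac)
    also have "\<dots> = (\<Sum>j\<in>E. \<Sum>k\<in>E. B i k j * z k * x j)"
      using fin by (intro sum.cong sum.mono_neutral_left) (auto simp: B_def hessian_def)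
    also have "\<dots> = bform E (B i) z x" unfolding bform_def by (rule sum.swap)
    finally show ?thesis .
  qed
  have formA: "bform E A x x = (\<Sum>k\<in>E - K. z k * bform E (B k) x x)" for x
  proof -
    have "bform E A x x = (\<Sum>i\<in>E. \<Sum>j\<in>E. \<Sum>k\<in>E - K. z k * (B k i j * x i * x j))"
      unfolding bform_def by (intro sum.cong) (auto simp: A_eq sum_distrib_right sum_distrib_left mult_ac)
    also have "\<dots> = (\<Sum>i\<in>E. \<Sum>k\<in>E - K. \<Sum>j\<in>E. z k * (B k i j * x i * x j))"
      by (intro sum.cong refl sum.swap)
    also have "\<dots> = (\<Sum>k\<in>E - K. \<Sum>i\<in>E. \<Sum>j\<in>E. z k * (B k i j * x i * x j))"
      by (rule sum.swap)
    finally show ?thesis by (simp add: bform_def sum_distrib_left)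
  qed
  have IH: "lorentzian_form E (B k)" if "k \<in> E - K" for k
    unfolding B_def c'_def using that Cons.prems finK by (intro Cons.IH) auto
  have Bzz0: "0 \<le> bform E (B k) z z" for k
    using B0 zpos by (intro bform_nonneg) (auto intro: less_imp_le)
  have B_zero: "B k i j = 0" if "bform E (B k) z z = 0" "i \<in> E" "j \<in> E" for k i j
  proof -
    have nn: "0 \<le> B k i j * z i * z j" if "i \<in> E" "j \<in> E" for i j
      using B0 zpos that by (intro mult_nonneg_nonneg) (auto intro: less_imp_le)
    have "\<forall>i\<in>E. (\<Sum>j\<in>E. B k i j * z i * z j) = 0"
      using that(1) nn fin unfolding bform_def
      by (subst (asm) sum_nonneg_eq_0_iff) (auto intro: sum_nonneg)
    then have "B k i j * z i * z j = 0"
      using that nn fin sum_nonneg_eq_0_iff[of E "\<lambda>j. B k i j * z i * z j"] by auto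
    then show ?thesis using zpos[of i] zpos[of j] that by auto
  qed
  \<comment> \<open>The variables that occur; \<open>A\<close> vanishes outside.\<close>
  define F where "F = {i \<in> E - K. 0 < bform E (B i) z z}"
  have FE: "F \<subseteq> E - K" by (auto simp: F_def)
  have A_out: "A i j = 0" if "i \<in> E" "j \<in> E" "i \<notin> F" for i j
  proof (cases "i \<in> K")
    case True
    then show ?thesis by (simp add: A_def hessian_def)
  next
    case False
    then have "bform E (B i) z z = 0" using that Bzz0[of i] by (auto simp: F_def)
    then have "(\<Sum>j\<in>E. A i j * z j) = 0" using row[of i z] that False by simp
    moreover have "0 \<le> A i j * z j" if "j \<in> E" for j
      using A0 zpos that \<open>i \<in> E\<close> by (intro mult_nonneg_nonneg) (auto intro: less_imp_le)
    ultimately have "A i j * z j = 0"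
      using fin that sum_nonneg_eq_0_iff[of E "\<lambda>j. A i j * z j"] by auto
    then show ?thesis using zpos[OF that(2)] by auto
  qed
  have sumF: "(\<Sum>j\<in>E. A i j * x j) = (\<Sum>j\<in>F. A i j * x j)" if "i \<in> E" for i x
    using fin FE A_out that Asym by (intro sum.mono_neutral_right) auto
  have formF: "bform E A x x = bform F A x x" for x
    unfolding bform_rows sumF using fin FE A_out sumF
    by (intro sum.mono_neutral_cong_right) (auto simp flip: sumF)
  have pos_iff: "0 < A i j \<longleftrightarrow> i \<noteq> j \<and> completable (insert i (insert j K))"
    if "i \<in> E - K" "j \<in> E - K" for i j
  proof (cases "i = j")
    case False
    then have "A i j = dir_derivs E (z # zs) c (insert i (insert j K))"
      using that by (simp add: A_def hessian_def)
    also have "0 < \<dots> \<longleftrightarrow> completable (insert i (insert j K))"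
      using Cons.prems that False finK by (intro dir_derivs_pos_iff) auto
    finally show ?thesis using False by simp
  qed (simp add: A_def hessian_def)
  have F_compl: "completable (insert i K)" if "i \<in> F" for i
  proof -
    have "0 < (\<Sum>j\<in>E. A i j * z j)" using that row[of i z] by (simp add: F_def)
    then obtain j where j: "j \<in> E" "A i j \<noteq> 0" by (metis (no_types, lifting) less_irrefl mult_zero_left sum.neutral)
    then have "j \<in> E - K" by (auto simp: A_def hessian_def split: if_splits)
    then have "completable (insert i (insert j K))"
      using pos_iff[of i j] A0[of i j] j that FE by auto
    then show ?thesis by (rule completable_mono) auto
  qed
  have in_F: "i \<in> F" if "i \<in> E - K" "j \<in> E - K" "0 < A i j" for i j
    using A_out[of i j] that by auto
  have "lorentzian_form F A"
  proof (rule lorentzian_form_spectral[where z = z and d = "\<lambda>i. bform E (B i) z z / z i"])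
    show "finite F" using fin FE finite_subset by blast
    show "A i j = A j i" for i j by (rule Asym)
    show "0 \<le> A i j" if "i \<in> F" "j \<in> F" for i j using A0 that FE by auto
    show "0 < z i" if "i \<in> F" for i using zpos that FE by auto
    show "0 < bform E (B i) z z / z i" if "i \<in> F" for i
      using that zpos by (auto simp: F_def)
    show "(\<Sum>j\<in>F. A i j * z j) = bform E (B i) z z / z i * z i" if "i \<in> F" for i
      using row[of i z] sumF[of i z] zpos[of i] that by (auto simp: F_def)
    show "(i, j) \<in> {(i, j). i \<in> F \<and> j \<in> F \<and> 0 < A i j}\<^sup>*" if "i \<in> F" "j \<in> F" for i j
    proof (cases "i = j")
      case False
      have ij: "i \<in> E - K" "j \<in> E - K" using that FE by auto
      have "card K + 3 \<le> d" using Cons.prems by simp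
      from connected[OF Cons.prems(2) this ij False] F_compl[OF that(1)] F_compl[OF that(2)]
      have "completable (insert i (insert j K)) \<or>
        (\<exists>l\<in>E - K - {i, j}. completable (insert i (insert l K)) \<and> completable (insert l (insert j K)))"
        unfolding completable_def by blast
      then show ?thesis
      proof
        assume "completable (insert i (insert j K))"
        then show ?thesis using that pos_iff[OF ij] False by auto
      next
        assume "\<exists>l\<in>E - K - {i, j}. completable (insert i (insert l K)) \<and> completable (insert l (insert j K))"
        then obtain l where l: "l \<in> E - K" "l \<noteq> i" "l \<noteq> j" "completable (insert i (insert l K))"
          "completable (insert l (insert j K))" by blast
        then have "0 < A i l" "0 < A l j" using pos_iff ij by auto
        moreover have "l \<in> F" using in_F[of l j] \<open>0 < A l j\<close> l ij by blast
        ultimately show ?thesis using that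
          by (intro rtrancl_into_rtrancl[OF r_into_rtrancl, of i l _ j]) auto
      qed
    qed simp
    show "bform F A x x \<le> (\<Sum>i\<in>F. (\<Sum>j\<in>F. A i j * x j)\<^sup>2 / (bform E (B i) z z / z i))" for x
    proof -
      have "bform F A x x = (\<Sum>k\<in>E - K. z k * bform E (B k) x x)"
        unfolding formF[symmetric] formA ..
      also have "\<dots> = (\<Sum>k\<in>F. z k * bform E (B k) x x)"
      proof (intro sum.mono_neutral_right ballI)
        fix k assume "k \<in> E - K - F"
        then have "bform E (B k) z z = 0" using Bzz0[of k] by (auto simp: F_def)
        then have "bform E (B k) x x = 0" using B_zero by (simp add: bform_def)
        then show "z k * bform E (B k) x x = 0" by simp
      qed (use fin FE in auto)
      also have "\<dots> \<le> (\<Sum>i\<in>F. (\<Sum>j\<in>F. A i j * x j)\<^sup>2 / (bform E (B i) z z / z i))"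
      proof (rule sum_mono)
        fix k assume k: "k \<in> F"
        then have kE: "k \<in> E - K" and p: "0 < bform E (B k) z z" using FE by (auto simp: F_def)
        have "bform E (B k) x x * bform E (B k) z z \<le> (bform E (B k) x z)\<^sup>2"
          by (rule lorentzian_form_reverse_CS[OF Bsym IH[OF kE] Bzz0])
        also have "bform E (B k) x z = bform E (B k) z x" by (rule bform_commute) (rule Bsym)
        also have "\<dots> = (\<Sum>j\<in>F. A k j * x j)" using row[OF kE, of x] sumF[of k x] kE by simp
        finally show "z k * bform E (B k) x x \<le> (\<Sum>j\<in>F. A k j * x j)\<^sup>2 / (bform E (B k) z z / z k)"
          using p zpos[of k] kE by (simp add: field_simps)
      qed
      finally show ?thesis .
    qed
  qed
  then obtain l where l: "\<And>x. bform F A x x \<le> (\<Sum>i\<in>F. l i * x i)\<^sup>2"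
    unfolding lorentzian_form_def by blast
  have "bform E A x x \<le> (\<Sum>i\<in>E. (if i \<in> F then l i else 0) * x i)\<^sup>2" for x
  proof -
    have "(\<Sum>i\<in>F. l i * x i) = (\<Sum>i\<in>E. (if i \<in> F then l i else 0) * x i)"
      using fin FE by (intro sum.mono_neutral_cong_left) auto
    then show ?thesis using l[of x] formF[of x] by simp
  qed
  then show ?case unfolding A_def[symmetric] lorentzian_form_def
    by (intro exI[of _ "\<lambda>i. if i \<in> F then l i else 0"] allI)
qed

lemma continuous_dir_derivs:
  "continuous_on UNIV (\<lambda>e. dir_derivs E (map (\<lambda>z i. z i + e) zs) c K)"
proof (induction zs arbitrary: K)
  case (Cons z zs)
  then show ?case unfolding list.map dir_derivs_simps dir_deriv_def
    by (intro continuous_intros)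
qed (simp add: continuous_on_const)

text \<open>
  For positive directions this is the reverse Cauchy--Schwarz inequality. The boundary case
  follows by adding \<open>e > 0\<close> to all directions and letting \<open>e\<close> tend to 0.
\<close>

theorem alexandrov_fenchel:
  assumes zs: "\<And>z i. z \<in> set zs \<Longrightarrow> i \<in> E \<Longrightarrow> 0 \<le> z i" and y: "\<And>i. i \<in> E \<Longrightarrow> 0 \<le> y i"
    and len: "length zs + 2 = d"
  shows "dir_derivs E (x # x # zs) c {} * dir_derivs E (y # y # zs) c {} \<le>
    (dir_derivs E (x # y # zs) c {})\<^sup>2"
proof -
  define ze where "ze e = map (\<lambda>z i. z i + e) zs" for e :: real
  define b where "b e u v = bform E (hessian (dir_derivs E (ze e) c) {}) u v" for e u v
  have cont: "continuous_on UNIV (\<lambda>e. b e u v)" for u v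
  proof -
    have "continuous_on UNIV (\<lambda>e. hessian (dir_derivs E (ze e) c) {} i j)" for i j
      unfolding hessian_def ze_def using continuous_dir_derivs
      by (cases "i = j") (auto intro: continuous_intros)
    then show ?thesis unfolding b_def bform_def by (intro continuous_intros)
  qed
  have b_eq: "dir_derivs E (u # v # zs) c {} = b 0 u v" for u v
  proof -
    have "dir_derivs E (u # v # zs) c {} =
      (\<Sum>i\<in>E. \<Sum>j\<in>E - {i}. hessian (dir_derivs E zs c) {} i j * u i * v j)"
    proof -
      have "u i * (\<Sum>j\<in>E - {i}. v j * dir_derivs E zs c (insert j {i})) =
         (\<Sum>j\<in>E - {i}. hessian (dir_derivs E zs c) {} i j * u i * v j)" for i
        unfolding sum_distrib_left
        by (rule sum.cong[OF refl]) (auto simp: hessian_def insert_commute mult_ac)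
      then show ?thesis by (simp add: dir_deriv_def)
    qed
    also have "\<dots> = (\<Sum>i\<in>E. \<Sum>j\<in>E. hessian (dir_derivs E zs c) {} i j * u i * v j)"
      using fin by (intro sum.cong[OF refl] sum.mono_neutral_left) (auto simp: hessian_def)
    also have "\<dots> = b 0 u v" by (simp add: b_def bform_def ze_def)
    finally show ?thesis .
  qed
  have ineq: "b e x x * b e y y \<le> (b e x y)\<^sup>2" if "0 < e" for e
  proof -
    have pos: "0 < z i" if "z \<in> set (ze e)" "i \<in> E" for z i
      using that zs \<open>0 < e\<close> by (force simp: ze_def intro: add_nonneg_pos)
    have "lorentzian_form E (hessian (dir_derivs E (ze e) c) {})"
      using len pos by (intro lorentzian_dir_derivs) (auto simp: ze_def)
    moreover have "0 \<le> b e y y" unfolding b_def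
      using pos y by (intro bform_nonneg) (auto simp: hessian_def intro!: dir_derivs_nonneg intro: less_imp_le)
    ultimately show ?thesis
      unfolding b_def by (intro lorentzian_form_reverse_CS hessian_sym)
  qed
  have t: "((\<lambda>e. b e u v) \<longlongrightarrow> b 0 u v) (at_right 0)" for u v
    using cont[of u v] by (auto simp: continuous_on_def intro: tendsto_mono[OF at_le])
  have "b 0 x x * b 0 y y \<le> (b 0 x y)\<^sup>2"
  proof (rule tendsto_le[of "at_right (0::real)"])
    show "((\<lambda>e. (b e x y)\<^sup>2) \<longlongrightarrow> (b 0 x y)\<^sup>2) (at_right 0)"
      "((\<lambda>e. b e x x * b e y y) \<longlongrightarrow> b 0 x x * b 0 y y) (at_right 0)"
      by (intro tendsto_intros t)+
    show "\<forall>\<^sub>F e in at_right 0. b e x x * b e y y \<le> (b e x y)\<^sup>2"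
      using ineq by (auto simp: eventually_at_right_less intro: eventually_mono[OF eventually_at_right_less])
  qed simp
  then show ?thesis unfolding b_eq .
qed

end

section \<open>Polarised M-convex sets\<close>

text \<open>
  The exchange property for nonnegative exponents, as functions; subtraction does not truncate
  here because \<open>\<alpha> i\<close> and \<open>\<beta> j\<close> are positive.
\<close>

definition m_exchange :: "nat set \<Rightarrow> (nat \<Rightarrow> nat) set \<Rightarrow> bool" where
  "m_exchange J S \<longleftrightarrow> (\<forall>\<alpha>\<in>S. \<forall>\<beta>\<in>S. \<forall>i\<in>J. \<beta> i < \<alpha> i \<longrightarrow>
     (\<exists>j\<in>J. \<alpha> j < \<beta> j \<and> \<alpha>(i := \<alpha> i - 1, j := Suc (\<alpha> j)) \<in> S \<and>
        \<beta>(i := Suc (\<beta> i), j := \<beta> j - 1) \<in> S))"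

lemma m_exchangeE:
  assumes "m_exchange J S" "\<alpha> \<in> S" "\<beta> \<in> S" "i \<in> J" "\<beta> i < \<alpha> i"
  obtains j where "j \<in> J" "\<alpha> j < \<beta> j" "\<alpha>(i := \<alpha> i - 1, j := Suc (\<alpha> j)) \<in> S"
    "\<beta>(i := Suc (\<beta> i), j := \<beta> j - 1) \<in> S"
  using assms unfolding m_exchange_def by blast

text \<open>
  On each class of a partial equivalence relation the form is the square of a sum.
\<close>

lemma partial_equivalence_psd:
  fixes \<xi> :: "'a \<Rightarrow> real"
  assumes fin: "finite A"
    and sym: "\<And>i j. i \<in> A \<Longrightarrow> j \<in> A \<Longrightarrow> b i j \<Longrightarrow> b j i"
    and trans: "\<And>i j k. i \<in> A \<Longrightarrow> j \<in> A \<Longrightarrow> k \<in> A \<Longrightarrow> b i j \<Longrightarrow> b j k \<Longrightarrow> b i k"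
  shows "0 \<le> (\<Sum>i\<in>A. \<Sum>j\<in>A. if b i j then \<xi> i * \<xi> j else 0)"
proof -
  define cls where "cls i = {j \<in> A. b i j}" for i
  define D where "D = {i \<in> A. b i i}"
  define v where "v c i = (if i \<in> D \<and> cls i = c then \<xi> i else 0)" for c i
  have b_iff: "b i j \<longleftrightarrow> i \<in> D \<and> j \<in> D \<and> cls i = cls j" if "i \<in> A" "j \<in> A" for i j
  proof
    assume "b i j"
    then have "b j i" "b i i" "b j j" using sym trans that by blast+
    then show "i \<in> D \<and> j \<in> D \<and> cls i = cls j"
      using \<open>b i j\<close> that trans unfolding D_def cls_def by blast
  qed (use that in \<open>auto simp: D_def cls_def\<close>)
  have "(\<Sum>i\<in>A. \<Sum>j\<in>A. if b i j then \<xi> i * \<xi> j else 0) =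
      (\<Sum>i\<in>A. \<Sum>j\<in>A. \<Sum>c\<in>cls ` A. v c i * v c j)"
  proof (intro sum.cong refl)
    fix i j assume ij: "i \<in> A" "j \<in> A"
    have "(\<Sum>c\<in>cls ` A. v c i * v c j) = (\<Sum>c\<in>cls ` A. if cls i = c then v c i * v c j else 0)"
      by (intro sum.cong) (auto simp: v_def)
    also have "\<dots> = v (cls i) i * v (cls i) j" using fin ij by simp
    finally show "(if b i j then \<xi> i * \<xi> j else 0) = (\<Sum>c\<in>cls ` A. v c i * v c j)"
      using b_iff[OF ij] by (auto simp: v_def)
  qed
  also have "\<dots> = (\<Sum>c\<in>cls ` A. \<Sum>i\<in>A. \<Sum>j\<in>A. v c i * v c j)"
    by (subst sum.swap[of _ _ "cls ` A"]) (simp add: sum.swap[of _ _ "cls ` A"])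
  also have "\<dots> = (\<Sum>c\<in>cls ` A. (\<Sum>i\<in>A. v c i)\<^sup>2)"
    by (simp add: power2_eq_square sum_product)
  also have "0 \<le> \<dots>" by (intro sum_nonneg) simp
  finally show ?thesis .
qed

text \<open>
  An exponent vector \<open>\<alpha>\<close> bounded by \<open>M\<close> is replaced by the sets \<open>G\<close> with \<open>\<alpha> j\<close> elements in fibre
  \<open>j\<close>; this is the polarization of a monomial.
\<close>

definition content :: "(nat \<times> nat) set \<Rightarrow> nat \<Rightarrow> nat" where
  "content G j = card {p. (j, p) \<in> G}"

lemma finite_fibre: "finite G \<Longrightarrow> finite {p. (j, p) \<in> G}"
  by (rule finite_subset[of _ "snd ` G"]) force+

lemma content_insert:
  assumes "finite G" "(j, p) \<notin> G"
  shows "content (insert (j, p) G) = (content G)(j := Suc (content G j))"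
proof
  fix i
  have "{q. (j, q) \<in> insert (j, p) G} = insert p {q. (j, q) \<in> G}" by auto
  then show "content (insert (j, p) G) i = ((content G)(j := Suc (content G j))) i"
    using assms by (auto simp: content_def finite_fibre)
qed

lemma content_remove:
  assumes "finite G" "(j, p) \<in> G"
  shows "content (G - {(j, p)}) = (content G)(j := content G j - 1)"
proof
  fix i
  have "{q. (j, q) \<in> G - {(j, p)}} = {q. (j, q) \<in> G} - {p}" by auto
  then show "content (G - {(j, p)}) i = ((content G)(j := content G j - 1)) i"
    using assms by (auto simp: content_def)
qed

lemma sum_content:
  assumes "finite J" "G \<subseteq> J \<times> {..<M}"
  shows "(\<Sum>j\<in>J. content G j) = card G"
proof -
  have "G = (SIGMA j:J. {p. (j, p) \<in> G})" using assms(2) by auto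
  moreover have "finite G" using assms finite_subset by blast
  then have "card (SIGMA j:J. {p. (j, p) \<in> G}) = (\<Sum>j\<in>J. content G j)"
    unfolding content_def by (intro card_SigmaI assms(1) ballI finite_fibre)
  ultimately show ?thesis by simp
qed

lemma content_le:
  assumes "G \<subseteq> J \<times> {..<M}"
  shows "content G j \<le> M"
proof -
  have "{p. (j, p) \<in> G} \<subseteq> {..<M}" using assms by auto
  then show ?thesis unfolding content_def by (metis card_lessThan card_mono finite_lessThan)
qed

text \<open>
  The factor \<open>(M - \<alpha> j)!\<close> is \<open>\<alpha>! (M - \<alpha>)!\<close>, the weight of the polarization, divided by \<open>\<alpha>!\<close>, the
  factor by which the generating polynomial of an M-convex set is normalized.
\<close>

definition polar_weight :: "nat set \<Rightarrow> nat \<Rightarrow> ((nat \<Rightarrow> nat) \<Rightarrow> real) \<Rightarrow> (nat \<times> nat) set \<Rightarrow> real" where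
  "polar_weight J M g G = (\<Prod>j\<in>J. fact (M - content G j)) * g (content G)"

locale bounded_m_convex =
  fixes J :: "nat set" and M d :: nat and S :: "(nat \<Rightarrow> nat) set"
  assumes finJ: "finite J" and exch: "m_exchange J S"
    and S_out: "\<alpha> \<in> S \<Longrightarrow> i \<notin> J \<Longrightarrow> \<alpha> i = 0"
    and S_bound: "\<alpha> \<in> S \<Longrightarrow> \<alpha> i \<le> M"
    and S_sum: "\<alpha> \<in> S \<Longrightarrow> (\<Sum>i\<in>J. \<alpha> i) = d"
begin

abbreviation "E \<equiv> J \<times> {..<M}"
abbreviation "w \<equiv> polar_weight J M (indicator S)"

lemma finE: "finite E" using finJ by simp

lemma w_pos_iff: "0 < w G \<longleftrightarrow> content G \<in> S"
  by (auto simp: polar_weight_def indicator_def prod_pos)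

text \<open>
  The sets with content in \<open>S\<close> are the bases of a matroid. If the fibre of \<open>b\<close> is not fuller in
  \<open>G'\<close> than in \<open>G\<close>, the element to be replaced can be found in the same fibre.
\<close>

lemma set_exchange:
  assumes G: "G \<subseteq> E" "content G \<in> S" and G': "G' \<subseteq> E" "content G' \<in> S" and b: "b \<in> G' - G"
  obtains x where "x \<in> G - G'" "insert b (G - {x}) \<subseteq> E" "content (insert b (G - {x})) \<in> S"
proof -
  obtain j q where jq: "b = (j, q)" by (cases b)
  have finG: "finite G" "finite G'" using G G' finE finite_subset by blast+
  have jJ: "j \<in> J" using b jq G' by auto
  show thesis
  proof (cases "content G j < content G' j")
    case True
    obtain t where t: "t \<in> J" "content G' t < content G t"
      "(content G)(j := Suc (content G j), t := content G t - 1) \<in> S"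
      using m_exchangeE[OF exch G'(2) G(2) jJ True] by metis
    have "\<exists>p. (t, p) \<in> G - G'"
    proof (rule ccontr)
      assume "\<not> ?thesis"
      then have "{p. (t, p) \<in> G} \<subseteq> {p. (t, p) \<in> G'}" by blast
      then have "content G t \<le> content G' t"
        unfolding content_def using finG by (intro card_mono finite_fibre)
      then show False using t by simp
    qed
    then obtain p where p: "(t, p) \<in> G - G'" by blast
    have "t \<noteq> j" using True t by auto
    then have "content (insert b (G - {(t, p)})) =
        (content G)(j := Suc (content G j), t := content G t - 1)"
      unfolding jq using finG p b jq by (subst content_insert) (auto simp: content_remove fun_upd_twist)
    moreover have "insert b (G - {(t, p)}) \<subseteq> E" using G G' b by auto
    ultimately show thesis using that[OF p] t by simp
  next
    case False
    have "\<exists>p. (j, p) \<in> G - G'"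
    proof (rule ccontr)
      assume "\<not> ?thesis"
      then have "{p. (j, p) \<in> G} \<subset> {p. (j, p) \<in> G'}" using b jq by blast
      then have "content G j < content G' j"
        unfolding content_def using finG by (intro psubset_card_mono finite_fibre)
      then show False using False by simp
    qed
    then obtain p where p: "(j, p) \<in> G - G'" by blast
    have "0 < content G j" unfolding content_def using p finG
      by (auto simp: card_gt_0_iff finite_fibre)
    then have "content (insert b (G - {(j, p)})) = content G"
      unfolding jq using finG p b jq by (subst content_insert) (auto simp: content_remove)
    moreover have "insert b (G - {(j, p)}) \<subseteq> E" using G G' b by auto
    ultimately show thesis using that[OF p] G by simp
  qed
qed

lemma card_of_content: "G \<subseteq> E \<Longrightarrow> content G \<in> S \<Longrightarrow> card G = d"
  using sum_content[OF finJ] S_sum by metis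

text \<open>
  Exchange \<open>b\<close> into a basis containing \<open>a\<close>. If this removes \<open>a\<close>, any further element of the
  basis serves as the intermediate variable.
\<close>

lemma polar_connected:
  assumes K: "card K + 3 \<le> d" and ab: "a \<in> E - K" "b \<in> E - K" "a \<noteq> b"
    and Ga: "\<exists>G. insert a K \<subseteq> G \<and> G \<subseteq> E \<and> card G = d \<and> 0 < w G"
    and Gb: "\<exists>G. insert b K \<subseteq> G \<and> G \<subseteq> E \<and> card G = d \<and> 0 < w G"
  shows "(\<exists>G. insert a (insert b K) \<subseteq> G \<and> G \<subseteq> E \<and> card G = d \<and> 0 < w G) \<or>
      (\<exists>l\<in>E - K - {a, b}.
         (\<exists>G. insert a (insert l K) \<subseteq> G \<and> G \<subseteq> E \<and> card G = d \<and> 0 < w G) \<and>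
         (\<exists>G. insert l (insert b K) \<subseteq> G \<and> G \<subseteq> E \<and> card G = d \<and> 0 < w G))"
proof -
  have iff: "(\<exists>G. L \<subseteq> G \<and> G \<subseteq> E \<and> card G = d \<and> 0 < w G) \<longleftrightarrow>
      (\<exists>G. L \<subseteq> G \<and> G \<subseteq> E \<and> content G \<in> S)" for L
    using card_of_content by (auto simp: w_pos_iff)
  obtain G where G: "insert a K \<subseteq> G" "G \<subseteq> E" "content G \<in> S" using Ga unfolding iff by blast
  obtain G' where G': "insert b K \<subseteq> G'" "G' \<subseteq> E" "content G' \<in> S" using Gb unfolding iff by blast
  show ?thesis
  proof (cases "b \<in> G")
    case True
    then show ?thesis unfolding iff using G by blast
  next
    case False
    then obtain x where x: "x \<in> G - G'" "insert b (G - {x}) \<subseteq> E" "content (insert b (G - {x})) \<in> S"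
      using set_exchange[OF G(2,3) G'(2,3), of b] G' by blast
    have "x \<notin> K" using x G' by blast
    show ?thesis
    proof (cases "x = a")
      case False
      then have "insert a (insert b K) \<subseteq> insert b (G - {x})" using G \<open>x \<notin> K\<close> by blast
      then show ?thesis unfolding iff using x by blast
    next
      case True
      have finK: "finite K" using G finE finite_subset by (metis insert_subset)
      have "card (insert a K) < card G"
        using card_of_content[OF G(2,3)] K ab finK by simp
      then obtain l where l: "l \<in> G" "l \<notin> insert a K"
        by (metis card_mono finK finite_insert not_le subsetI)
      then have "l \<in> E - K - {a, b}" using G False by blast
      moreover have "insert a (insert l K) \<subseteq> G" using G l by blast
      moreover have "insert l (insert b K) \<subseteq> insert b (G - {x})" using l True G ab by blast
      ultimately show ?thesis unfolding iff using x G by blast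
    qed
  qed
qed

text \<open>
  On fibres the Hessian is constant off the diagonal. The relation \<open>A i j\<close>, which says that \<open>i\<close>
  and \<open>j\<close> together complete \<open>K\<close>, has a transitive complement on the indices that occur, by the
  exchange property; so the corresponding 0/1 form is at most the square of the sum
  (\<open>partial_equivalence_psd\<close>). Within one fibre of \<open>r\<close> free elements, the missing diagonal is
  compensated by Cauchy--Schwarz, as the weights are in the ratio \<open>1 / (r (r - 1))\<close> to
  \<open>1 / r\<^sup>2\<close>.
\<close>

lemma polar_quadratic:
  assumes K: "K \<subseteq> E" "card K + 2 = d"
  shows "lorentzian_form E (hessian w K)"
proof -
  define k where "k = content K"
  define k2 where "k2 i j = (k(i := Suc (k i)))(j := Suc ((k(i := Suc (k i))) j))" for i j
  define A where "A i j \<longleftrightarrow> k2 i j \<in> S" for i j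
  define r where "r j = M - k j" for j
  define W :: real where "W = (\<Prod>j\<in>J. fact (r j))"
  define U where "U j = {p \<in> {..<M}. (j, p) \<notin> K}" for j
  have finK: "finite K" using K finE finite_subset by blast
  have finU: "finite (U j)" for j by (simp add: U_def)
  have W0: "0 < W" by (simp add: W_def prod_pos)
  have cardU: "card (U j) = r j" for j
  proof -
    have "U j = {..<M} - {p. (j, p) \<in> K}" by (auto simp: U_def)
    moreover have "{p. (j, p) \<in> K} \<subseteq> {..<M}" using K by auto
    ultimately show ?thesis
      using finK by (simp add: card_Diff_subset finite_fibre r_def k_def content_def)
  qed
  have A_sym: "A i j \<longleftrightarrow> A j i" for i j
  proof -
    have "k2 i j = k2 j i" by (auto simp: k2_def fun_eq_iff)
    then show ?thesis by (simp add: A_def)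
  qed
  have A_ex: "A i l \<or> A j l" if "A i j" "A l m" "l \<in> J" for i j l m
  proof (cases "l = i \<or> l = j")
    case True
    then show ?thesis using that A_sym by blast
  next
    case False
    then have "k2 i j l < k2 l m l" by (auto simp: k2_def)
    from m_exchangeE[OF exch that(2)[unfolded A_def] that(1)[unfolded A_def] that(3) this]
    obtain t where t: "k2 l m t < k2 i j t"
      "(k2 i j)(l := Suc (k2 i j l), t := k2 i j t - 1) \<in> S" by metis
    have "k t \<le> k2 l m t" by (auto simp: k2_def)
    then have "k t < k2 i j t" using t by simp
    then have "t = i \<or> t = j" by (auto simp: k2_def split: if_splits)
    moreover have "(k2 i j)(l := Suc (k2 i j l), i := k2 i j i - 1) = k2 j l"
      "(k2 i j)(l := Suc (k2 i j l), j := k2 i j j - 1) = k2 i l"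
      using False by (auto simp: k2_def fun_eq_iff)
    ultimately show ?thesis using t(2) by (auto simp: A_def)
  qed
  define Act where "Act = {i \<in> J. \<exists>j\<in>J. A i j}"
  have finAct: "finite Act" using finJ by (simp add: Act_def)
  have A_bound: "(\<Sum>i\<in>J. \<Sum>j\<in>J. if A i j then \<xi> i * \<xi> j else 0) \<le> (\<Sum>i\<in>Act. \<xi> i)\<^sup>2"
    for \<xi> :: "nat \<Rightarrow> real"
  proof -
    have "(\<Sum>i\<in>J. \<Sum>j\<in>J. if A i j then \<xi> i * \<xi> j else 0) =
        (\<Sum>i\<in>Act. \<Sum>j\<in>J. if A i j then \<xi> i * \<xi> j else 0)"
      using finJ by (intro sum.mono_neutral_right) (auto simp: Act_def intro!: sum.neutral)
    also have "\<dots> = (\<Sum>i\<in>Act. \<Sum>j\<in>Act. if A i j then \<xi> i * \<xi> j else 0)"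
      using finJ A_sym by (intro sum.cong sum.mono_neutral_right) (auto simp: Act_def)
    also have "\<dots> = (\<Sum>i\<in>Act. \<Sum>j\<in>Act. \<xi> i * \<xi> j - (if \<not> A i j then \<xi> i * \<xi> j else 0))"
      by (intro sum.cong) auto
    also have "\<dots> = (\<Sum>i\<in>Act. \<xi> i)\<^sup>2 - (\<Sum>i\<in>Act. \<Sum>j\<in>Act. if \<not> A i j then \<xi> i * \<xi> j else 0)"
      by (simp add: power2_eq_square sum_product sum_subtractf)
    also have "\<dots> \<le> (\<Sum>i\<in>Act. \<xi> i)\<^sup>2"
    proof -
      have "0 \<le> (\<Sum>i\<in>Act. \<Sum>j\<in>Act. if \<not> A i j then \<xi> i * \<xi> j else 0)"
      proof (rule partial_equivalence_psd[OF finAct])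
        fix i j l assume "i \<in> Act" "j \<in> Act" "l \<in> Act" "\<not> A i j" "\<not> A j l"
        then show "\<not> A i l" using A_ex[of i l j] A_sym by (auto simp: Act_def)
      qed (use A_sym in auto)
      then show ?thesis by simp
    qed
    finally show ?thesis .
  qed
  have w_val: "hessian w K (i, p) (j, q) =
      (if A i j then (if i = j then W / (real (r i) * (real (r i) - 1)) else W / (real (r i) * real (r j))) else 0)"
    if ij: "i \<in> J" "j \<in> J" and pq: "p \<in> U i" "q \<in> U j" and ne: "(i, p) \<noteq> (j, q)" for i j p q
  proof -
    have c: "content (insert (i, p) (insert (j, q) K)) = k2 j i"
      using finK pq ne by (simp add: content_insert U_def k_def k2_def)
    have fact_pred: "fact (m - 1) = fact m / real m" if "0 < m" for m
      using that by (simp add: fact_reduce)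
    have prod_upd: "(\<Prod>l\<in>J. fact (M - k2 j i l)) =
       (if i = j then W / (real (r i) * (real (r i) - 1)) else W / (real (r i) * real (r j)))"
    proof (cases "i = j")
      case True
      have "card {p, q} \<le> card (U i)" using pq True by (intro card_mono finU) auto
      then have r2: "2 \<le> r i" using ne True by (simp add: cardU)
      have "(\<Prod>l\<in>J. fact (M - k2 j i l)) = fact (r i - 2) * (\<Prod>l\<in>J - {i}. fact (r l) :: real)"
        using finJ ij True by (subst prod.remove[of J i]) (auto simp: k2_def r_def intro!: prod.cong)
      also have "fact (r i - 2) = (fact (r i) / (real (r i) * (real (r i) - 1)) :: real)"
        using r2 fact_pred[of "r i"] fact_pred[of "r i - 1"] by (simp add: of_nat_diff numeral_2_eq_2)
      finally show ?thesis
        using finJ ij True by (simp add: W_def prod.remove[of J i])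
    next
      case False
      have "card {p} \<le> card (U i)" "card {q} \<le> card (U j)" using pq by (intro card_mono finU; simp)+
      then have r1: "0 < r i" "0 < r j" by (simp_all add: cardU)
      have "(\<Prod>l\<in>J. fact (M - k2 j i l)) =
          fact (r i - 1) * (fact (r j - 1) * (\<Prod>l\<in>J - {i} - {j}. fact (r l) :: real))"
        using finJ ij False
        by (subst prod.remove[of J i], simp, simp, subst prod.remove[of "J - {i}" j])
           (auto simp: k2_def r_def intro!: prod.cong)
      also have "\<dots> = fact (r i) * (fact (r j) * (\<Prod>l\<in>J - {i} - {j}. fact (r l))) / (real (r i) * real (r j))"
        unfolding fact_pred[OF r1(1)] fact_pred[OF r1(2)] by simp
      also have "fact (r i) * (fact (r j) * (\<Prod>l\<in>J - {i} - {j}. fact (r l))) = W"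
        unfolding W_def using finJ ij False
        by (subst prod.remove[of J i], simp, simp, subst prod.remove[of "J - {i}" j]) auto
      finally show ?thesis using False by simp
    qed
    have "hessian w K (i, p) (j, q) = w (insert (i, p) (insert (j, q) K))"
      using pq ne by (auto simp: hessian_def U_def)
    also have "\<dots> = (\<Prod>l\<in>J. fact (M - k2 j i l)) * indicator S (k2 j i)"
      by (simp add: polar_weight_def c)
    finally show ?thesis using A_sym[of i j] by (simp add: prod_upd A_def indicator_def)
  qed
  define X where "X x j = (\<Sum>p\<in>U j. x (j, p))" for x :: "nat \<times> nat \<Rightarrow> real" and j
  define T where "T x i j = (\<Sum>p\<in>U i. \<Sum>q\<in>U j. hessian w K (i, p) (j, q) * x (i, p) * x (j, q))"
    for x :: "nat \<times> nat \<Rightarrow> real" and i j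
  have sum_E: "(\<Sum>e\<in>E. f e) = (\<Sum>i\<in>J. \<Sum>p<M. f (i, p))" for f :: "nat \<times> nat \<Rightarrow> real"
    by (simp add: sum.cartesian_product)
  have form: "bform E (hessian w K) x x = (\<Sum>i\<in>J. \<Sum>j\<in>J. T x i j)" for x
  proof -
    have "bform E (hessian w K) x x =
       (\<Sum>i\<in>J. \<Sum>p<M. \<Sum>j\<in>J. \<Sum>q<M. hessian w K (i, p) (j, q) * x (i, p) * x (j, q))"
      unfolding bform_def sum_E ..
    also have "\<dots> = (\<Sum>i\<in>J. \<Sum>p\<in>U i. \<Sum>j\<in>J. \<Sum>q\<in>U j. hessian w K (i, p) (j, q) * x (i, p) * x (j, q))"
      by (intro sum.cong refl sum.mono_neutral_cong_right)
         (auto simp: U_def hessian_def intro!: sum.neutral sum.mono_neutral_right)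
    also have "\<dots> = (\<Sum>i\<in>J. \<Sum>j\<in>J. T x i j)"
      unfolding T_def by (intro sum.cong refl sum.swap)
    finally show ?thesis .
  qed
  have T_le: "T x i j \<le> W * (if A i j then (X x i / r i) * (X x j / r j) else 0)"
    if ij: "i \<in> J" "j \<in> J" for x i j
  proof (cases "A i j")
    case False
    have "T x i j = 0" unfolding T_def
    proof (intro sum.neutral ballI)
      fix p q assume "p \<in> U i" "q \<in> U j"
      then show "hessian w K (i, p) (j, q) * x (i, p) * x (j, q) = 0"
        using w_val[OF ij] False by (cases "(i, p) = (j, q)") (auto simp: hessian_def)
    qed
    then show ?thesis using False by simp
  next
    case True
    show ?thesis
    proof (cases "i = j")
      case False
      have "T x i j = (\<Sum>p\<in>U i. \<Sum>q\<in>U j. W / (real (r i) * real (r j)) * (x (i, p) * x (j, q)))"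
        unfolding T_def using w_val[OF ij] False True by (intro sum.cong refl) auto
      also have "\<dots> = W / (real (r i) * real (r j)) * (X x i * X x j)"
        unfolding X_def unfolding sum_product unfolding sum_distrib_left ..
      finally show ?thesis using True by simp
    next
      case eq: True
      define Q where "Q = (\<Sum>p\<in>U i. (x (i, p))\<^sup>2)"
      define C where "C = W / (real (r i) * (real (r i) - 1))"
      have "T x i j = (\<Sum>p\<in>U i. \<Sum>q\<in>U i. C * (x (i, p) * x (i, q)) - (if p = q then C * (x (i, p))\<^sup>2 else 0))"
        unfolding T_def eq using w_val[of i i] ij True eq
        by (intro sum.cong refl) (auto simp: C_def hessian_def power2_eq_square)
      also have "\<dots> = C * ((X x i)\<^sup>2 - Q)"
        unfolding X_def Q_def right_diff_distrib power2_eq_square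
        unfolding sum_product unfolding sum_distrib_left
        using finU by (simp add: sum_subtractf)
      finally have T: "T x i j = C * ((X x i)\<^sup>2 - Q)" .
      have CS: "(X x i)\<^sup>2 \<le> real (r i) * Q"
        using sum_squared_le_sum_of_squares[of "\<lambda>p. x (i, p)" "U i"] finU
        by (simp add: X_def Q_def cardU mult.commute)
      show ?thesis
      proof (cases "2 \<le> r i")
        case True
        then have r: "1 < real (r i)" by simp
        then have C0: "0 \<le> C" using W0 by (simp add: C_def)
        have "(X x i)\<^sup>2 - Q \<le> (X x i)\<^sup>2 * (real (r i) - 1) / real (r i)"
          using CS r by (simp add: field_simps)
        then have "T x i j \<le> C * ((X x i)\<^sup>2 * (real (r i) - 1) / real (r i))"
          unfolding T using C0 by (rule mult_left_mono)
        also have "\<dots> = W * ((X x i / r i) * (X x i / r i))"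
          using r by (simp add: C_def power2_eq_square field_simps)
        finally show ?thesis using \<open>A i j\<close> eq by simp
      next
        case False
        then have "C = 0" by (cases "r i = 0"; cases "r i = 1") (auto simp: C_def)
        then show ?thesis using T W0 \<open>A i j\<close> eq by simp
      qed
    qed
  qed
  define l where "l = (\<lambda>(i, p). if i \<in> Act \<and> (i, p) \<notin> K then sqrt W / real (r i) else 0)"
  have "bform E (hessian w K) x x \<le> (\<Sum>e\<in>E. l e * x e)\<^sup>2" for x
  proof -
    have "bform E (hessian w K) x x \<le>
        (\<Sum>i\<in>J. \<Sum>j\<in>J. W * (if A i j then (X x i / r i) * (X x j / r j) else 0))"
      unfolding form using T_le by (intro sum_mono)
    also have "\<dots> = W * (\<Sum>i\<in>J. \<Sum>j\<in>J. if A i j then (X x i / r i) * (X x j / r j) else 0)"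
      by (simp add: sum_distrib_left)
    also have "\<dots> \<le> W * (\<Sum>i\<in>Act. X x i / r i)\<^sup>2"
      using A_bound W0 by (intro mult_left_mono) auto
    also have "\<dots> = (sqrt W * (\<Sum>i\<in>Act. X x i / r i))\<^sup>2"
      using W0 by (simp add: power_mult_distrib)
    also have "sqrt W * (\<Sum>i\<in>Act. X x i / r i) = (\<Sum>i\<in>Act. \<Sum>p\<in>U i. l (i, p) * x (i, p))"
      by (auto simp: X_def l_def U_def sum_distrib_left sum_divide_distrib intro!: sum.cong)
    also have "\<dots> = (\<Sum>i\<in>J. \<Sum>p\<in>U i. l (i, p) * x (i, p))"
      using finJ by (intro sum.mono_neutral_left) (auto simp: Act_def l_def intro!: sum.neutral)
    also have "\<dots> = (\<Sum>i\<in>J. \<Sum>p<M. l (i, p) * x (i, p))"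
      by (intro sum.cong refl sum.mono_neutral_left) (auto simp: U_def l_def)
    also have "\<dots> = (\<Sum>e\<in>E. l e * x e)" unfolding sum_E ..
    finally show ?thesis .
  qed
  then show ?thesis unfolding lorentzian_form_def by (intro exI[of _ l]) simp
qed

sublocale polar: lorentzian_weights E w d
proof
  show "finite E" by (rule finE)
  show "0 \<le> w K" for K by (simp add: polar_weight_def prod_nonneg)
qed (rule polar_quadratic polar_connected; assumption)+

end

section \<open>Log-concavity of slices\<close>

lemma dir_deriv_cong:
  assumes "\<And>L. L \<subseteq> E \<Longrightarrow> c L = c' L" "K \<subseteq> E"
  shows "dir_deriv E z c K = dir_deriv E z c' K"
  unfolding dir_deriv_def using assms by (intro sum.cong) auto

lemma dir_derivs_cong:
  assumes "\<And>L. L \<subseteq> E \<Longrightarrow> c L = c' L" "K \<subseteq> E"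
  shows "dir_derivs E zs c K = dir_derivs E zs c' K"
  using assms(2)
proof (induction zs arbitrary: K)
  case (Cons z zs)
  then show ?case unfolding dir_derivs_simps by (intro dir_deriv_cong) auto
qed (simp add: assms)

lemma dir_deriv_commute:
  assumes "finite E"
  shows "dir_deriv E x (dir_deriv E y c) = dir_deriv E y (dir_deriv E x c)"
proof
  fix K
  have *: "dir_deriv E x (dir_deriv E y c) K =
      (\<Sum>i\<in>E - K. \<Sum>j\<in>E - K. if i = j then 0 else x i * y j * c (insert i (insert j K)))" for x y
  proof -
    have "x i * (\<Sum>j\<in>E - insert i K. y j * c (insert j (insert i K))) =
      (\<Sum>j\<in>E - K. if i = j then 0 else x i * y j * c (insert i (insert j K)))" for i
      unfolding sum_distrib_left using assms
      by (intro sum.mono_neutral_cong_left) (auto simp: insert_commute)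
    then show ?thesis by (simp add: dir_deriv_def)
  qed
  show "dir_deriv E x (dir_deriv E y c) K = dir_deriv E y (dir_deriv E x c) K"
    unfolding * by (subst sum.swap) (intro sum.cong refl, auto simp: insert_commute)
qed

lemma dir_derivs_append: "dir_derivs E (xs @ ys) c = dir_derivs E xs (dir_derivs E ys c)"
  by (simp add: dir_derivs_def)

lemma dir_derivs_Cons_snoc:
  assumes "finite E"
  shows "dir_derivs E (x # xs) c = dir_derivs E (xs @ [x]) c"
  by (induction xs) (simp_all add: dir_deriv_commute[OF assms, of x])

lemma dir_derivs_mset:
  assumes "finite E" "mset xs = mset ys"
  shows "dir_derivs E xs c = dir_derivs E ys c"
  using assms(2)
proof (induction xs arbitrary: ys)
  case (Cons x xs)
  then have "x \<in> set ys" by (metis list.set_intros(1) mset_eq_setD)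
  then obtain ys1 ys2 where ys: "ys = ys1 @ x # ys2" by (meson split_list)
  then have "dir_derivs E (x # xs) c = dir_derivs E (x # (ys1 @ ys2)) c"
    using Cons.prems Cons.IH[of "ys1 @ ys2"] by simp
  also have "\<dots> = dir_derivs E (x # ys1) (dir_derivs E ys2 c)"
    by (simp add: dir_derivs_append)
  also have "\<dots> = dir_derivs E ys c"
    unfolding dir_derivs_Cons_snoc[OF assms(1)] ys by (simp add: dir_derivs_append)
  finally show ?case .
qed simp

text \<open>
  Differentiation in direction \<open>coord_dir s\<close> is differentiation by the unpolarized variable \<open>s\<close>.
\<close>

definition coord_dir :: "nat \<Rightarrow> nat \<times> nat \<Rightarrow> real" where
  "coord_dir s e = (if fst e = s then 1 else 0)"

definition pair_dir :: "'e \<Rightarrow> 'e \<Rightarrow> 'e \<Rightarrow> real" where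
  "pair_dir a b e = (if e = a \<or> e = b then 1 else 0)"

text \<open>
  There are \<open>M - k s\<close> free elements in fibre \<open>s\<close>, and this number makes \<open>(M - k s - 1)!\<close> into
  \<open>(M - k s)!\<close>: a derivative only shifts the exponent and produces no factor.
\<close>

lemma dir_deriv_coord:
  assumes J: "finite J" "s \<in> J" and K: "K \<subseteq> J \<times> {..<M}" and g: "\<And>k. M < k s \<Longrightarrow> g k = 0"
  shows "dir_deriv (J \<times> {..<M}) (coord_dir s) (polar_weight J M g) K =
    polar_weight J M (\<lambda>k. g (k(s := Suc (k s)))) K"
proof -
  define k where "k = content K"
  define U where "U = {p \<in> {..<M}. (s, p) \<notin> K}"
  have finK: "finite K" using K J finite_subset by blast
  have "U = {..<M} - {p. (s, p) \<in> K}" by (auto simp: U_def)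
  moreover have "{p. (s, p) \<in> K} \<subseteq> {..<M}" using K by auto
  ultimately have cU: "card U = M - k s"
    using finK by (simp add: card_Diff_subset finite_fibre k_def content_def)
  have "dir_deriv (J \<times> {..<M}) (coord_dir s) (polar_weight J M g) K =
      (\<Sum>e\<in>Pair s ` U. polar_weight J M g (insert e K))"
    unfolding dir_deriv_def using J
    by (intro sum.mono_neutral_cong_right) (auto simp: coord_dir_def U_def)
  also have "\<dots> = (\<Sum>p\<in>U. polar_weight J M g (insert (s, p) K))"
    by (subst sum.reindex) (auto simp: inj_on_def)
  also have "\<dots> = (\<Sum>p\<in>U. (\<Prod>j\<in>J. fact (M - (k(s := Suc (k s))) j)) * g (k(s := Suc (k s))))"
    using finK by (intro sum.cong) (auto simp: U_def polar_weight_def content_insert k_def)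
  also have "\<dots> = real (M - k s) * (fact (M - Suc (k s)) * (\<Prod>j\<in>J - {s}. fact (M - k j))) * g (k(s := Suc (k s)))"
  proof -
    have "(\<Prod>j\<in>J. fact (M - (k(s := Suc (k s))) j)) =
        fact (M - Suc (k s)) * (\<Prod>j\<in>J - {s}. fact (M - k j) :: real)"
      using J by (subst prod.remove[of J s]) (auto intro!: prod.cong)
    then show ?thesis by (simp add: cU)
  qed
  also have "\<dots> = fact (M - k s) * (\<Prod>j\<in>J - {s}. fact (M - k j)) * g (k(s := Suc (k s)))"
  proof (cases "k s < M")
    case True
    then have "fact (M - k s) = real (M - k s) * fact (M - Suc (k s))"
      by (subst fact_reduce) auto
    then show ?thesis by simp
  next
    case False
    then show ?thesis using g[of "k(s := Suc (k s))"] by simp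
  qed
  also have "\<dots> = polar_weight J M (\<lambda>k. g (k(s := Suc (k s)))) K"
    using J by (simp add: polar_weight_def k_def prod.remove[of J s])
  finally show ?thesis .
qed

lemma dir_derivs_coord:
  assumes J: "finite J" "s \<in> J" and g: "\<And>k. M < k s \<Longrightarrow> g k = 0" and K: "K \<subseteq> J \<times> {..<M}"
  shows "dir_derivs (J \<times> {..<M}) (replicate a (coord_dir s)) (polar_weight J M g) K =
    polar_weight J M (\<lambda>k. g (k(s := k s + a))) K"
  using K
proof (induction a arbitrary: K)
  case (Suc a)
  let ?E = "J \<times> {..<M}"
  have "dir_derivs ?E (replicate (Suc a) (coord_dir s)) (polar_weight J M g) K =
      dir_deriv ?E (coord_dir s) (polar_weight J M (\<lambda>k. g (k(s := k s + a)))) K"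
    unfolding replicate_Suc dir_derivs_simps by (rule dir_deriv_cong[OF Suc.IH Suc.prems])
  also have "\<dots> = polar_weight J M (\<lambda>k. g (k(s := k s + Suc a))) K"
    using Suc.prems J g by (subst dir_deriv_coord) auto
  finally show ?case .
qed simp

text \<open>
  Each direction puts exactly one of the elements \<open>v t\<close> and \<open>u t\<close> into the set, and the choices
  are independent.
\<close>

lemma dir_derivs_pairs:
  assumes fin: "finite E" and "distinct ts"
    and "inj_on v (set ts)" "inj_on u (set ts)" "v ` set ts \<inter> u ` set ts = {}"
    and "v ` set ts \<subseteq> E - K" "u ` set ts \<subseteq> E - K"
  shows "dir_derivs E (map (\<lambda>t. pair_dir (v t) (u t)) ts) c K =
    (\<Sum>A\<in>Pow (set ts). c (K \<union> v ` A \<union> u ` (set ts - A)))"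
  using assms(2-)
proof (induction ts arbitrary: K)
  case (Cons t ts)
  let ?D = "dir_derivs E (map (\<lambda>t. pair_dir (v t) (u t)) ts) c"
  have t: "v t \<in> E - K" "u t \<in> E - K" "v t \<noteq> u t" "t \<notin> set ts" using Cons.prems by auto
  have "set ts - {t} = set ts" using t(4) by simp
  then have ts: "distinct ts" "inj_on v (set ts)" "inj_on u (set ts)"
    "v ` set ts \<inter> u ` set ts = {}" "v ` set ts \<subseteq> E - K" "u ` set ts \<subseteq> E - K"
    "v t \<notin> v ` set ts" "v t \<notin> u ` set ts" "u t \<notin> v ` set ts" "u t \<notin> u ` set ts"
    using Cons.prems by simp_all
  have "dir_derivs E (map (\<lambda>t. pair_dir (v t) (u t)) (t # ts)) c K =
      (\<Sum>e\<in>{v t, u t}. ?D (insert e K))"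
    unfolding list.map dir_derivs_simps dir_deriv_def using fin t
    by (intro sum.mono_neutral_cong_right) (auto simp: pair_dir_def)
  also have "\<dots> = ?D (insert (v t) K) + ?D (insert (u t) K)" using t by simp
  also have "?D (insert (v t) K) = (\<Sum>A\<in>Pow (set ts). c (insert (v t) K \<union> v ` A \<union> u ` (set ts - A)))"
    by (rule Cons.IH) (use ts in blast)+
  also have "\<dots> = (\<Sum>A\<in>insert t ` Pow (set ts). c (K \<union> v ` A \<union> u ` (set (t # ts) - A)))"
  proof (subst sum.reindex)
    show "inj_on (insert t) (Pow (set ts))"
      using t(4) by (intro inj_onI) (metis PowD insert_ident subsetD)
    have "set (t # ts) - insert t A = set ts - A" for A using t(4) by auto
    then show "(\<Sum>A\<in>Pow (set ts). c (insert (v t) K \<union> v ` A \<union> u ` (set ts - A))) =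
      sum ((\<lambda>A. c (K \<union> v ` A \<union> u ` (set (t # ts) - A))) \<circ> insert t) (Pow (set ts))"
      by (simp add: o_def)
  qed
  also have "?D (insert (u t) K) = (\<Sum>A\<in>Pow (set ts). c (insert (u t) K \<union> v ` A \<union> u ` (set ts - A)))"
    by (rule Cons.IH) (use ts in blast)+
  also have "\<dots> = (\<Sum>A\<in>Pow (set ts). c (K \<union> v ` A \<union> u ` (set (t # ts) - A)))"
  proof (intro sum.cong refl arg_cong[of _ _ c])
    fix A assume "A \<in> Pow (set ts)"
    then have "set (t # ts) - A = insert t (set ts - A)" using t(4) by auto
    then show "insert (u t) K \<union> v ` A \<union> u ` (set ts - A) = K \<union> v ` A \<union> u ` (set (t # ts) - A)"
      by auto
  qed
  also have "(\<Sum>A\<in>insert t ` Pow (set ts). c (K \<union> v ` A \<union> u ` (set (t # ts) - A))) +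
      (\<Sum>A\<in>Pow (set ts). c (K \<union> v ` A \<union> u ` (set (t # ts) - A))) =
      (\<Sum>A\<in>Pow (set (t # ts)). c (K \<union> v ` A \<union> u ` (set (t # ts) - A)))"
    unfolding list.set(2) Pow_insert using t(4)
    by (subst sum.union_disjoint) (auto simp: add.commute)
  finally show ?case .
qed simp

lemma card_with_content:
  assumes "finite L"
  shows "card {A \<in> Pow (L \<times> {..<M}). \<forall>i\<in>L. content A i = \<alpha> i} = (\<Prod>i\<in>L. M choose \<alpha> i)"
proof -
  let ?B = "PiE L (\<lambda>i. {B. B \<subseteq> {..<M} \<and> card B = \<alpha> i})"
  have "bij_betw (\<lambda>A. restrict (\<lambda>i. {p. (i, p) \<in> A}) L)
      {A \<in> Pow (L \<times> {..<M}). \<forall>i\<in>L. content A i = \<alpha> i} ?B"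
  proof (rule bij_betw_byWitness[where f' = "\<lambda>f. SIGMA i:L. f i"])
    show "\<forall>f\<in>?B. restrict (\<lambda>i. {p. (i, p) \<in> (SIGMA i:L. f i)}) L = f"
      by (auto simp: fun_eq_iff PiE_def extensional_def)
    show "(\<lambda>f. SIGMA i:L. f i) ` ?B \<subseteq> {A \<in> Pow (L \<times> {..<M}). \<forall>i\<in>L. content A i = \<alpha> i}"
      by (auto simp: content_def PiE_def Pi_def)
  qed (auto simp: content_def)
  then have "card {A \<in> Pow (L \<times> {..<M}). \<forall>i\<in>L. content A i = \<alpha> i} = card ?B"
    by (rule bij_betw_same_card)
  also have "\<dots> = (\<Prod>i\<in>L. M choose \<alpha> i)"
    using assms by (simp add: card_PiE n_subsets)
  finally show ?thesis .
qed

text \<open>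
  The exponents in \<open>S\<close> live on \<open>1, \<dots>, n + 1\<close>, where \<open>s = n + 1\<close> is the coordinate that is
  sliced. Besides, there are coordinates \<open>n + 2, \<dots>, 2 n + 1\<close> to complement the first \<open>n\<close> ones,
  and one more coordinate \<open>y\<close> for the remaining degree. Differentiate the polarized product once
  in each direction \<open>(i, p) + (n + 1 + i, p)\<close>, with \<open>i \<le> n\<close> and \<open>p < M\<close>, further \<open>e1\<close> times in
  direction \<open>s\<close> and \<open>e2\<close> times in direction \<open>y\<close>. This selects the exponents \<open>\<alpha>\<close> with \<open>\<alpha> s = e1\<close>.
  Each of them arises from \<open>\<Prod> (M choose \<alpha> i)\<close> sets, each with weight \<open>M!\<^sup>2 \<Prod> (M - \<alpha> i)! (\<alpha> i)!\<close>,
  so its contribution \<open>M!\<^sup>n\<^sup>+\<^sup>2\<close> does not depend on \<open>\<alpha>\<close>, and the Alexandrov--Fenchel inequality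
  for two copies of \<open>s\<close> and \<open>y\<close> is the claim.
\<close>

theorem m_exchange_slices_log_concave:
  fixes n d :: nat and S :: "(nat \<Rightarrow> nat) set"
  assumes exch: "m_exchange {1..n + 1} S"
    and out: "\<And>\<alpha> i. \<alpha> \<in> S \<Longrightarrow> i \<notin> {1..n + 1} \<Longrightarrow> \<alpha> i = 0"
    and total: "\<And>\<alpha>. \<alpha> \<in> S \<Longrightarrow> (\<Sum>i\<in>{1..n + 1}. \<alpha> i) = d"
  shows "card {\<alpha> \<in> S. \<alpha> (n + 1) = e} * card {\<alpha> \<in> S. \<alpha> (n + 1) = e + 2} \<le>
    (card {\<alpha> \<in> S. \<alpha> (n + 1) = e + 1})\<^sup>2"
proof (cases "e + 2 \<le> d")
  case False
  have "\<alpha> (n + 1) \<le> d" if "\<alpha> \<in> S" for \<alpha>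
    using total[OF that] member_le_sum[of "n + 1" "{1..n + 1}" \<alpha>] by simp
  then have "{\<alpha> \<in> S. \<alpha> (n + 1) = e + 2} = {}" using False by force
  then show ?thesis by (simp only: card.empty)
next
  case True
  define M where "M = d"
  define J where "J = {1..2 * n + 2}"
  define s where "s = n + 1"
  define y where "y = 2 * n + 2"
  \<comment> \<open>T is the product of S with the vectors of entries at most \<open>M\<close> and sum \<open>n M\<close> on the
  additional coordinates.\<close>
  define res where "res \<kappa> = (\<lambda>i. if i \<le> n + 1 then \<kappa> i else 0)" for \<kappa> :: "nat \<Rightarrow> nat"
  define T where "T = {\<kappa>. res \<kappa> \<in> S \<and> (\<forall>i>n + 1. \<kappa> i \<le> M) \<and> (\<forall>i>y. \<kappa> i = 0) \<and>
     (\<Sum>i\<in>{n + 2..y}. \<kappa> i) = n * M}"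
  have bound: "\<alpha> i \<le> M" if "\<alpha> \<in> S" for \<alpha> i
  proof (cases "i \<in> {1..n + 1}")
    case True
    then show ?thesis using total[OF that] member_le_sum[OF True, of \<alpha>] by (simp add: M_def)
  qed (use out[OF that] in simp)
  have Jsplit: "J = {1..n + 1} \<union> {n + 2..y}" by (auto simp: J_def y_def)
  interpret bounded_m_convex J M "d + n * M" T
  proof
    show "finite J" by (simp add: J_def)
    show "m_exchange J T"
      unfolding m_exchange_def
    proof (intro ballI impI)
      fix \<alpha> \<beta> i assume ab: "\<alpha> \<in> T" "\<beta> \<in> T" and i: "i \<in> J" "\<beta> i < \<alpha> i"
      show "\<exists>j\<in>J. \<alpha> j < \<beta> j \<and> \<alpha>(i := \<alpha> i - 1, j := Suc (\<alpha> j)) \<in> T \<and>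
          \<beta>(i := Suc (\<beta> i), j := \<beta> j - 1) \<in> T"
      proof (cases "i \<le> n + 1")
        case True
        have "res \<alpha> \<in> S" "res \<beta> \<in> S" "i \<in> {1..n + 1}" "res \<beta> i < res \<alpha> i"
          using ab i True by (auto simp: T_def res_def J_def)
        then obtain j where j: "j \<in> {1..n + 1}" "res \<alpha> j < res \<beta> j"
          "(res \<alpha>)(i := res \<alpha> i - 1, j := Suc (res \<alpha> j)) \<in> S"
          "(res \<beta>)(i := Suc (res \<beta> i), j := res \<beta> j - 1) \<in> S"
          using m_exchangeE[OF exch] by metis
        have r: "res (\<alpha>(i := \<alpha> i - 1, j := Suc (\<alpha> j))) = (res \<alpha>)(i := res \<alpha> i - 1, j := Suc (res \<alpha> j))"
          "res (\<beta>(i := Suc (\<beta> i), j := \<beta> j - 1)) = (res \<beta>)(i := Suc (res \<beta> i), j := res \<beta> j - 1)"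
          using True j by (auto simp: res_def fun_eq_iff)
        have "(\<Sum>l\<in>{n + 2..y}. (f(i := a, j := b)) l) = (\<Sum>l\<in>{n + 2..y}. f l)" for f :: "nat \<Rightarrow> nat" and a b
          using True j by (intro sum.cong) auto
        then show ?thesis using ab j True r
          by (intro bexI[of _ j]) (auto simp: T_def res_def J_def y_def)
      next
        case False
        have i': "i \<in> {n + 2..y}" using i False by (auto simp: J_def y_def)
        have "\<exists>j\<in>{n + 2..y}. \<alpha> j < \<beta> j"
        proof (rule ccontr)
          assume "\<not> ?thesis"
          then have "(\<Sum>j\<in>{n + 2..y}. \<beta> j) < (\<Sum>j\<in>{n + 2..y}. \<alpha> j)"
            using i i' by (intro sum_strict_mono_ex1) (auto simp: not_less)
          then show False using ab by (simp add: T_def)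
        qed
        then obtain j where j: "j \<in> {n + 2..y}" "\<alpha> j < \<beta> j" by blast
        have ij: "i \<noteq> j" using i j by auto
        have sum_eq: "(\<Sum>l\<in>{n + 2..y}. (f(i := a, j := b)) l) + f i + f j = (\<Sum>l\<in>{n + 2..y}. f l) + a + b"
          for f :: "nat \<Rightarrow> nat" and a b
        proof -
          have "(\<Sum>l\<in>{n + 2..y}. h l) = h i + (h j + (\<Sum>l\<in>{n + 2..y} - {i} - {j}. h l))" for h :: "nat \<Rightarrow> nat"
            using i' j ij by (subst sum.remove[of _ i], simp, simp, subst sum.remove[of _ j]) auto
          from this[of f] this[of "f(i := a, j := b)"] ij show ?thesis
            by simp
        qed
        have r: "res (\<alpha>(i := a, j := b)) = res \<alpha>" "res (\<beta>(i := a, j := b)) = res \<beta>" for a b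
          using i' j by (auto simp: res_def fun_eq_iff)
        have upd: "f(i := a, j := b) \<in> T"
          if "f \<in> T" "res (f(i := a, j := b)) = res f" "a \<le> M" "b \<le> M" "a + b = f i + f j" for f a b
        proof -
          have "(\<Sum>l\<in>{n + 2..y}. (f(i := a, j := b)) l) = n * M"
            using that sum_eq[of f a b] by (simp add: T_def)
          then show ?thesis using that i' j by (simp add: T_def)
        qed
        have "\<alpha> i \<le> M" "\<beta> j \<le> M" using ab i' j by (auto simp: T_def)
        then have "\<alpha>(i := \<alpha> i - 1, j := Suc (\<alpha> j)) \<in> T" "\<beta>(i := Suc (\<beta> i), j := \<beta> j - 1) \<in> T"
          using i j by (auto intro!: upd ab r)
        then show ?thesis using j by (intro bexI[of _ j]) (auto simp: J_def y_def)
      qed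
    qed
    show "\<alpha> i = 0" if "\<alpha> \<in> T" "i \<notin> J" for \<alpha> i
    proof (cases "i = 0")
      case True
      have "res \<alpha> 0 = 0" using that by (intro out) (auto simp: T_def)
      then show ?thesis using True by (simp add: res_def)
    next
      case False
      then show ?thesis using that by (auto simp: T_def J_def y_def)
    qed
    show "\<alpha> i \<le> M" if "\<alpha> \<in> T" for \<alpha> i
      using bound[of "res \<alpha>" i] that by (cases "i \<le> n + 1") (auto simp: T_def res_def)
    show "(\<Sum>i\<in>J. \<alpha> i) = d + n * M" if "\<alpha> \<in> T" for \<alpha>
    proof -
      have "(\<Sum>i\<in>J. \<alpha> i) = (\<Sum>i\<in>{1..n + 1}. res \<alpha> i) + (\<Sum>i\<in>{n + 2..y}. \<alpha> i)"
        unfolding Jsplit by (subst sum.union_disjoint) (auto simp: res_def)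
      then show ?thesis using that total[of "res \<alpha>"] by (simp add: T_def)
    qed
  qed
  define I where "I = {1..n} \<times> {..<M}"
  define u :: "nat \<times> nat \<Rightarrow> nat \<times> nat" where "u = (\<lambda>(i, p). (n + 1 + i, p))"
  obtain ts where ts: "set ts = I" "distinct ts"
    using finite_distinct_list[of I] by (auto simp: I_def)
  have len_ts: "length ts = n * M"
    using distinct_card[OF ts(2)] by (simp add: ts(1) I_def)
  define pairs where "pairs = map (\<lambda>t. pair_dir t (u t)) ts"
  define a where "a b = card {\<alpha> \<in> S. \<alpha> (n + 1) = b}" for b
  define C :: real where "C = fact M ^ (n + 2)"
  have main: "dir_derivs E (pairs @ replicate e1 (coord_dir s) @ replicate e2 (coord_dir y)) w {} = C * a e1"
    if e12: "e1 + e2 = d" for e1 e2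
  proof -
    define g where "g = (\<lambda>k. indicator T (k(s := k s + e1, y := k y + e2)) :: real)"
    have sy: "s \<noteq> y" "s \<in> J" "y \<in> J" by (auto simp: s_def y_def J_def)
    have ind0: "indicator T k = (0::real)" if "M < k i" for k i
      using S_bound[of k i] that by (auto simp: indicator_def)
    have inner: "dir_derivs E (replicate e1 (coord_dir s) @ replicate e2 (coord_dir y)) w K =
        polar_weight J M g K" if "K \<subseteq> E" for K
    proof -
      have "dir_derivs E (replicate e1 (coord_dir s) @ replicate e2 (coord_dir y)) w K =
        dir_derivs E (replicate e1 (coord_dir s)) (polar_weight J M (\<lambda>k. indicator T (k(y := k y + e2)))) K"
        unfolding dir_derivs_append using sy that ind0
        by (intro dir_derivs_cong dir_derivs_coord finJ) auto
      also have "\<dots> = polar_weight J M g K"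
      proof -
        have "indicator T (k(y := k y + e2)) = (0::real)" if "M < k s" for k
          using ind0[where k = "k(y := k y + e2)" and i = s] that sy by simp
        then show ?thesis
          unfolding g_def using sy that
          by (subst dir_derivs_coord) (auto simp: finJ fun_upd_twist)
      qed
      finally show ?thesis .
    qed
    have "dir_derivs E (pairs @ replicate e1 (coord_dir s) @ replicate e2 (coord_dir y)) w {} =
        dir_derivs E pairs (polar_weight J M g) {}"
      unfolding dir_derivs_append[of _ pairs] by (rule dir_derivs_cong[OF inner]) simp_all
    also have "\<dots> = (\<Sum>A\<in>Pow I. polar_weight J M g ({} \<union> (\<lambda>t. t) ` A \<union> u ` (I - A)))"
    proof -
      have "inj_on u I" by (auto simp: inj_on_def u_def)
      moreover have "I \<inter> u ` I = {}" by (auto simp: I_def u_def)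
      moreover have "I \<subseteq> E" "u ` I \<subseteq> E" by (auto simp: I_def J_def u_def)
      ultimately show ?thesis
        unfolding pairs_def using ts dir_derivs_pairs[OF finE, of ts "\<lambda>t. t" u "{}" "polar_weight J M g"]
        by simp
    qed
    also have "\<dots> = (\<Sum>A\<in>Pow I. polar_weight J M g (A \<union> u ` (I - A)))" by simp
    also have "\<dots> = (\<Sum>A\<in>Pow I. if (\<lambda>i. if i = s then e1 else content A i) \<in> S
        then fact M ^ 2 * (\<Prod>i\<in>{1..n}. fact (M - content A i) * fact (content A i)) else 0)"
    proof (intro sum.cong refl)
      fix A assume "A \<in> Pow I"
      then have AI: "A \<subseteq> I" by simp
      define \<kappa> where "\<kappa> = content (A \<union> u ` (I - A))"
      have finA: "finite A" using AI finite_subset by (auto simp: I_def)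
      have k1: "\<kappa> i = content A i" if "i \<le> n + 1" for i
      proof -
        have "{p. (i, p) \<in> A \<union> u ` (I - A)} = {p. (i, p) \<in> A}"
          using that by (auto simp: u_def I_def)
        then show ?thesis by (simp add: \<kappa>_def content_def)
      qed
      have A_out: "content A i = 0" if "i \<notin> {1..n}" for i
      proof -
        have "{p. (i, p) \<in> A} = {}" using AI that by (auto simp: I_def)
        then show ?thesis by (simp add: content_def)
      qed
      have k2: "\<kappa> (n + 1 + i) = M - content A i" if "i \<in> {1..n}" for i
      proof -
        have "{p. (n + 1 + i, p) \<in> A \<union> u ` (I - A)} = {..<M} - {p. (i, p) \<in> A}"
        proof -
          have "(n + 1 + i, p) \<in> u ` B \<longleftrightarrow> (i, p) \<in> B" for p B by (force simp: u_def)
          moreover have "(n + 1 + i, p) \<notin> A" for p using AI that by (auto simp: I_def)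
          ultimately show ?thesis using that by (auto simp: I_def)
        qed
        moreover have "{p. (i, p) \<in> A} \<subseteq> {..<M}" using AI by (auto simp: I_def)
        ultimately show ?thesis
          by (simp add: \<kappa>_def content_def card_Diff_subset finite_fibre finA)
      qed
      have k3: "\<kappa> i = 0" if "y \<le> i" for i
      proof -
        have "{p. (i, p) \<in> A \<union> u ` (I - A)} = {}"
          using that AI by (auto simp: u_def I_def y_def)
        then show ?thesis by (simp add: \<kappa>_def content_def)
      qed
      have cM: "content A i \<le> M" for i using content_le[of A "{1..n}" M] AI by (simp add: I_def)
      have img: "{n + 2..2 * n + 1} = (\<lambda>i. n + 1 + i) ` {1..n}"
      proof (intro equalityI subsetI)
        fix j assume "j \<in> {n + 2..2 * n + 1}"
        then show "j \<in> (\<lambda>i. n + 1 + i) ` {1..n}" by (intro image_eqI[of _ _ "j - (n + 1)"]) auto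
      qed auto
      have Js: "J = {1..n} \<union> ({n + 2..2 * n + 1} \<union> {s, y})" by (auto simp: J_def s_def y_def)
      have "(\<Prod>j\<in>J. fact (M - \<kappa> j) :: real) =
          (\<Prod>i\<in>{1..n}. fact (M - content A i)) * ((\<Prod>i\<in>{1..n}. fact (content A i)) * fact M ^ 2)"
      proof -
        have 1: "(\<Prod>j\<in>{1..n}. fact (M - \<kappa> j) :: real) = (\<Prod>i\<in>{1..n}. fact (M - content A i))"
          using k1 by (intro prod.cong) auto
        have 2: "(\<Prod>j\<in>{n + 2..2 * n + 1}. fact (M - \<kappa> j) :: real) = (\<Prod>i\<in>{1..n}. fact (content A i))"
          unfolding img using k2 cM by (subst prod.reindex) (auto intro!: prod.cong simp: inj_on_def)
        have 3: "(\<Prod>j\<in>{s, y}. fact (M - \<kappa> j) :: real) = fact M ^ 2"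
          using sy k1[of s] A_out[of s] k3[of y] by (simp add: s_def power2_eq_square)
        show ?thesis unfolding Js
          by (subst prod.union_disjoint, simp, simp, force simp: s_def y_def,
              subst prod.union_disjoint, simp, simp, force simp: s_def y_def)
             (simp only: 1 2 3)
      qed
      moreover have "g \<kappa> = (if (\<lambda>i. if i = s then e1 else content A i) \<in> S then 1 else 0)"
      proof -
        define \<kappa>' where "\<kappa>' = \<kappa>(s := \<kappa> s + e1, y := \<kappa> y + e2)"
        have ks: "\<kappa> s = 0" "\<kappa> y = 0" using k1[of s] A_out[of s] k3[of y] by (auto simp: s_def)
        have r: "res \<kappa>' = (\<lambda>i. if i = s then e1 else content A i)"
          using k1 A_out ks sy by (auto simp: res_def \<kappa>'_def fun_eq_iff s_def y_def)
        have up: "\<kappa>' i \<le> M" if "n + 1 < i" for i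
        proof -
          consider "i = y" | "y < i" | "i \<in> {n + 2..2 * n + 1}" using \<open>n + 1 < i\<close> y_def by atomize_elim auto
          then show ?thesis
          proof cases
            case 3
            then obtain j where "j \<in> {1..n}" "i = n + 1 + j" unfolding img by blast
            then show ?thesis using k2 by (auto simp: \<kappa>'_def s_def y_def)
          qed (use ks e12 k3 that in \<open>auto simp: \<kappa>'_def s_def y_def M_def\<close>)
        qed
        have sm: "(\<Sum>i\<in>{n + 2..y}. \<kappa>' i) = n * M" if "res \<kappa>' \<in> S"
        proof -
          have "(\<Sum>i\<in>{1..n + 1}. res \<kappa>' i) = (\<Sum>i\<in>{1..n}. content A i) + e1"
            unfolding r by (simp add: s_def)
          then have e2: "e2 = (\<Sum>i\<in>{1..n}. content A i)" using total[OF that] e12 by simp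
          have "{n + 2..y} = insert y {n + 2..2 * n + 1}" by (auto simp: y_def)
          then have "(\<Sum>i\<in>{n + 2..y}. \<kappa>' i) = e2 + (\<Sum>i\<in>{n + 2..2 * n + 1}. \<kappa> i)"
            using ks by (auto simp: \<kappa>'_def y_def s_def intro!: sum.cong)
          also have "(\<Sum>i\<in>{n + 2..2 * n + 1}. \<kappa> i) = (\<Sum>i\<in>{1..n}. M - content A i)"
            unfolding img using k2 by (subst sum.reindex) (auto simp: inj_on_def)
          also have "e2 + \<dots> = (\<Sum>i\<in>{1..n}. content A i + (M - content A i))"
            by (simp add: e2 sum.distrib)
          also have "\<dots> = n * M" using cM by simp
          finally show ?thesis .
        qed
        have "\<kappa>' \<in> T \<longleftrightarrow> res \<kappa>' \<in> S"
          using up sm k3 by (auto simp: T_def) (auto simp: \<kappa>'_def s_def y_def)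
        then show ?thesis by (simp add: g_def \<kappa>'_def[symmetric] r indicator_def)
      qed
      ultimately show "polar_weight J M g (A \<union> u ` (I - A)) =
        (if (\<lambda>i. if i = s then e1 else content A i) \<in> S
         then fact M ^ 2 * (\<Prod>i\<in>{1..n}. fact (M - content A i) * fact (content A i)) else 0)"
        by (simp add: polar_weight_def \<kappa>_def[symmetric] prod.distrib)
    qed
    also have "\<dots> = (\<Sum>\<alpha>\<in>{\<alpha> \<in> S. \<alpha> s = e1}. \<Sum>A\<in>{A \<in> Pow I. (\<lambda>i. if i = s then e1 else content A i) = \<alpha>}.
        fact M ^ 2 * (\<Prod>i\<in>{1..n}. fact (M - \<alpha> i) * fact (\<alpha> i)))"
    proof -
      define h where "h \<alpha> = fact M ^ 2 * (\<Prod>i\<in>{1..n}. fact (M - \<alpha> i) * fact (\<alpha> i) :: real)" for \<alpha>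
      define f where "f A = (\<lambda>i. if i = s then e1 else content A i)" for A
      define P where "P = {A \<in> Pow I. f A \<in> S}"
      have finP: "finite P" by (simp add: P_def I_def)
      have hf: "fact M ^ 2 * (\<Prod>i\<in>{1..n}. fact (M - content A i) * fact (content A i)) = h (f A)" for A
        unfolding h_def f_def by (simp add: s_def)
      have "(\<Sum>A\<in>Pow I. if f A \<in> S then h (f A) else 0) = (\<Sum>A\<in>P. h (f A))"
        unfolding P_def by (subst sum.inter_filter[symmetric]) (auto simp: I_def)
      also have "\<dots> = (\<Sum>\<alpha>\<in>f ` P. \<Sum>A\<in>{A \<in> P. f A = \<alpha>}. h (f A))"
        using finP by (rule sum.image_gen)
      also have "\<dots> = (\<Sum>\<alpha>\<in>f ` P. \<Sum>A\<in>{A \<in> Pow I. f A = \<alpha>}. h \<alpha>)"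
        by (intro sum.cong) (auto simp: P_def)
      also have "\<dots> = (\<Sum>\<alpha>\<in>{\<alpha> \<in> S. \<alpha> s = e1}. \<Sum>A\<in>{A \<in> Pow I. f A = \<alpha>}. h \<alpha>)"
      proof -
        have "finite {\<alpha> \<in> S. \<alpha> s = e1}"
        proof (rule finite_subset)
          show "{\<alpha> \<in> S. \<alpha> s = e1} \<subseteq> {\<alpha>. \<forall>i. (i \<in> {1..n + 1} \<longrightarrow> \<alpha> i \<in> {..M}) \<and> (i \<notin> {1..n + 1} \<longrightarrow> \<alpha> i = 0)}"
            using out bound by auto
          show "finite {\<alpha>::nat\<Rightarrow>nat. \<forall>i. (i \<in> {1..n + 1} \<longrightarrow> \<alpha> i \<in> {..M}) \<and> (i \<notin> {1..n + 1} \<longrightarrow> \<alpha> i = 0)}"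
            by (rule finite_set_of_finite_funs) auto
        qed
        moreover have "f ` P \<subseteq> {\<alpha> \<in> S. \<alpha> s = e1}" by (auto simp: P_def f_def)
        moreover have "{A \<in> Pow I. f A = \<alpha>} = {}" if "\<alpha> \<in> {\<alpha> \<in> S. \<alpha> s = e1} - f ` P" for \<alpha>
          using that by (auto simp: P_def)
        then have "(\<Sum>A\<in>{A \<in> Pow I. f A = \<alpha>}. h \<alpha>) = 0"
          if "\<alpha> \<in> {\<alpha> \<in> S. \<alpha> s = e1} - f ` P" for \<alpha>
          using that by (metis (no_types, lifting) sum.empty)
        ultimately show ?thesis by (intro sum.mono_neutral_left) blast+
      qed
      finally show ?thesis by (simp only: hf) (simp only: f_def h_def)
    qed
    also have "\<dots> = (\<Sum>\<alpha>\<in>{\<alpha> \<in> S. \<alpha> s = e1}. C)"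
    proof (intro sum.cong refl)
      fix \<alpha> assume \<alpha>: "\<alpha> \<in> {\<alpha> \<in> S. \<alpha> s = e1}"
      have "{A \<in> Pow I. (\<lambda>i. if i = s then e1 else content A i) = \<alpha>} =
          {A \<in> Pow I. \<forall>i\<in>{1..n}. content A i = \<alpha> i}"
      proof (intro Collect_cong conj_cong refl iffI)
        fix A assume "A \<in> Pow I" "\<forall>i\<in>{1..n}. content A i = \<alpha> i"
        moreover have "content A i = \<alpha> i" if "i \<notin> {1..n}" "i \<noteq> s"
          for i
        proof -
          have "{p. (i, p) \<in> A} = {}" using \<open>A \<in> Pow I\<close> that by (auto simp: I_def)
          moreover have "\<alpha> i = 0" using \<alpha> that by (intro out) (auto simp: s_def)
          ultimately show ?thesis by (simp add: content_def)
        qed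
        ultimately show "(\<lambda>i. if i = s then e1 else content A i) = \<alpha>" using \<alpha> by (force simp: fun_eq_iff)
      qed (auto simp: s_def)
      then have "card {A \<in> Pow I. (\<lambda>i. if i = s then e1 else content A i) = \<alpha>} = (\<Prod>i\<in>{1..n}. M choose \<alpha> i)"
        using card_with_content[of "{1..n}" M \<alpha>] by (simp add: I_def)
      then have "(\<Sum>A\<in>{A \<in> Pow I. (\<lambda>i. if i = s then e1 else content A i) = \<alpha>}.
         fact M ^ 2 * (\<Prod>i\<in>{1..n}. fact (M - \<alpha> i) * fact (\<alpha> i))) =
         fact M ^ 2 * (\<Prod>i\<in>{1..n}. real (M choose \<alpha> i) * (fact (M - \<alpha> i) * fact (\<alpha> i)))"
        by (simp add: prod.distrib)
      also have "\<dots> = fact M ^ 2 * (\<Prod>i\<in>{1..n}. fact M)"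
      proof (intro arg_cong2[of _ _ _ _ "(*)"] prod.cong refl)
        fix i
        have "\<alpha> i \<le> M" using \<alpha> bound by simp
        then show "real (M choose \<alpha> i) * (fact (M - \<alpha> i) * fact (\<alpha> i)) = fact M"
          by (simp add: binomial_fact)
      qed
      also have "\<dots> = C" by (simp add: C_def power2_eq_square)
      finally show "(\<Sum>A\<in>{A \<in> Pow I. (\<lambda>i. if i = s then e1 else content A i) = \<alpha>}.
         fact M ^ 2 * (\<Prod>i\<in>{1..n}. fact (M - \<alpha> i) * fact (\<alpha> i))) = C" .
    qed
    also have "\<dots> = C * a e1" by (simp add: a_def s_def)
    finally show ?thesis .
  qed
  define x1 where "x1 = coord_dir s"
  define x2 where "x2 = coord_dir y"
  define zs where "zs = pairs @ replicate e x1 @ replicate (d - e - 2) x2"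
  have val: "dir_derivs E xs w {} = C * a e1"
    if "mset xs = mset (pairs @ replicate e1 x1 @ replicate e2 x2)" "e1 + e2 = d" for xs e1 e2
    using dir_derivs_mset[OF finE that(1)] main[OF that(2)] by (simp add: x1_def x2_def)
  have v: "dir_derivs E (x1 # x1 # zs) w {} = C * a (e + 2)"
    "dir_derivs E (x1 # x2 # zs) w {} = C * a (e + 1)"
    "dir_derivs E (x2 # x2 # zs) w {} = C * a e"
    using True val[of "x1 # x1 # zs" "e + 2" "d - e - 2"]
      val[of "x1 # x2 # zs" "e + 1" "Suc (d - e - 2)"] val[of "x2 # x2 # zs" e "Suc (Suc (d - e - 2))"]
    by (simp_all add: zs_def)
  have "dir_derivs E (x1 # x1 # zs) w {} * dir_derivs E (x2 # x2 # zs) w {} \<le>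
      (dir_derivs E (x1 # x2 # zs) w {})\<^sup>2"
  proof (rule polar.alexandrov_fenchel)
    show "0 \<le> z i" if "z \<in> set zs" for z i
      using that by (auto simp: zs_def pairs_def x1_def x2_def coord_dir_def pair_dir_def)
    show "length zs + 2 = d + n * M" using True by (simp add: zs_def pairs_def len_ts)
  qed (simp add: x2_def coord_dir_def)
  then have "C\<^sup>2 * (real (a (e + 2)) * real (a e)) \<le> C\<^sup>2 * (real (a (e + 1)))\<^sup>2"
    unfolding v by (simp add: power2_eq_square mult_ac)
  moreover have "0 < C\<^sup>2" by (simp add: C_def)
  ultimately have "real (a (e + 2)) * real (a e) \<le> (real (a (e + 1)))\<^sup>2"
    by (simp only: mult_le_cancel_left_pos)
  then have "a (e + 2) * a e \<le> (a (e + 1))\<^sup>2"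
    by (simp only: of_nat_mult[symmetric] of_nat_power[symmetric] of_nat_le_iff)
  then show ?thesis by (simp add: a_def mult.commute)
qed

lemma M_convex_slices_log_concave:
  assumes M: "M_convex (n + 1) S"
    and nonneg: "\<And>v i. v \<in> S \<Longrightarrow> 0 \<le> Poly_Mapping.lookup v i"
    and total: "\<And>v. v \<in> S \<Longrightarrow> (\<Sum>i\<in>{1..n + 1}. Poly_Mapping.lookup v i) = int d"
  shows "card {v \<in> S. Poly_Mapping.lookup v (n + 1) = int e} *
      card {v \<in> S. Poly_Mapping.lookup v (n + 1) = int (e + 2)} \<le>
    (card {v \<in> S. Poly_Mapping.lookup v (n + 1) = int (e + 1)})\<^sup>2"
proof -
  let ?r = "\<lambda>(v :: nat \<Rightarrow>\<^sub>0 int) i. nat (Poly_Mapping.lookup v i)"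
  have lookup_r: "Poly_Mapping.lookup v i = int (?r v i)" if "v \<in> S" for v i
    using nonneg[OF that] by simp
  have nat_dec: "nat (k - 1) = nat k - Suc 0" for k :: int by simp
  have nat_inc: "nat (k + 1) = Suc (nat k)" if "0 \<le> k" for k :: int using that by simp
  have inj: "inj_on ?r S"
  proof (rule inj_onI)
    fix v v' assume "v \<in> S" "v' \<in> S" "?r v = ?r v'"
    then show "v = v'" by (intro poly_mapping_eqI) (metis lookup_r)
  qed
  have slice: "card {\<alpha> \<in> ?r ` S. \<alpha> (n + 1) = k} = card {v \<in> S. Poly_Mapping.lookup v (n + 1) = int k}" for k
  proof -
    have "{\<alpha> \<in> ?r ` S. \<alpha> (n + 1) = k} = ?r ` {v \<in> S. Poly_Mapping.lookup v (n + 1) = int k}"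
    proof (intro equalityI subsetI)
      fix \<alpha> assume "\<alpha> \<in> {\<alpha> \<in> ?r ` S. \<alpha> (n + 1) = k}"
      then obtain v where v: "v \<in> S" "\<alpha> = ?r v" "?r v (n + 1) = k" by blast
      then show "\<alpha> \<in> ?r ` {v \<in> S. Poly_Mapping.lookup v (n + 1) = int k}"
        using lookup_r[OF v(1), of "n + 1"] by simp
    qed auto
    then show ?thesis by (simp add: card_image inj_on_subset[OF inj])
  qed
  have "m_exchange {1..n + 1} (?r ` S)"
    unfolding m_exchange_def
  proof (intro ballI impI)
    fix \<alpha> \<beta> i assume "\<alpha> \<in> ?r ` S" "\<beta> \<in> ?r ` S" and i: "i \<in> {1..n + 1}" "\<beta> i < \<alpha> i"
    then obtain a b where a: "a \<in> S" "\<alpha> = ?r a" and b: "b \<in> S" "\<beta> = ?r b" by blast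
    have "Poly_Mapping.lookup b i < Poly_Mapping.lookup a i" using i a b lookup_r by simp
    then obtain j where j: "j \<in> {1..n + 1}" "Poly_Mapping.lookup a j < Poly_Mapping.lookup b j"
      "a - Poly_Mapping.single i 1 + Poly_Mapping.single j 1 \<in> S"
      "b + Poly_Mapping.single i 1 - Poly_Mapping.single j 1 \<in> S"
      using M a(1) b(1) i(1) unfolding M_convex_def by blast
    have ij: "i \<noteq> j" using j(2) \<open>Poly_Mapping.lookup b i < Poly_Mapping.lookup a i\<close> by auto
    have "?r (a - Poly_Mapping.single i 1 + Poly_Mapping.single j 1) = \<alpha>(i := \<alpha> i - 1, j := Suc (\<alpha> j))"
    proof
      fix x show "?r (a - Poly_Mapping.single i 1 + Poly_Mapping.single j 1) x = (\<alpha>(i := \<alpha> i - 1, j := Suc (\<alpha> j))) x"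
        using ij nonneg[OF a(1), of j] by (simp add: nat_dec nat_inc a(2) lookup_add lookup_minus lookup_single when_def)
    qed
    then have in1: "\<alpha>(i := \<alpha> i - 1, j := Suc (\<alpha> j)) \<in> ?r ` S" using j(3) by (metis image_eqI)
    have "?r (b + Poly_Mapping.single i 1 - Poly_Mapping.single j 1) = \<beta>(i := Suc (\<beta> i), j := \<beta> j - 1)"
    proof
      fix x show "?r (b + Poly_Mapping.single i 1 - Poly_Mapping.single j 1) x = (\<beta>(i := Suc (\<beta> i), j := \<beta> j - 1)) x"
        using ij nonneg[OF b(1), of i] by (simp add: nat_dec nat_inc b(2) lookup_add lookup_minus lookup_single when_def)
    qed
    then have in2: "\<beta>(i := Suc (\<beta> i), j := \<beta> j - 1) \<in> ?r ` S" using j(4) by (metis image_eqI)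
    have "\<alpha> j < \<beta> j" using j(2) nonneg[OF a(1), of j] by (simp add: a(2) b(2))
    then show "\<exists>j\<in>{1..n + 1}. \<alpha> j < \<beta> j \<and> \<alpha>(i := \<alpha> i - 1, j := Suc (\<alpha> j)) \<in> ?r ` S \<and>
        \<beta>(i := Suc (\<beta> i), j := \<beta> j - 1) \<in> ?r ` S" using j(1) in1 in2 by blast
  qed
  moreover have "\<alpha> i = 0" if "\<alpha> \<in> ?r ` S" "i \<notin> {1..n + 1}" for \<alpha> i
  proof -
    from that(1) obtain v where v: "\<alpha> = ?r v" "v \<in> S" by (rule imageE)
    then have "Poly_Mapping.keys v \<subseteq> {1..n + 1}" using M by (auto simp: M_convex_def int_space_def)
    then have "i \<notin> Poly_Mapping.keys v" using that(2) by blast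
    then show ?thesis by (simp add: v(1) in_keys_iff)
  qed
  moreover have "(\<Sum>i\<in>{1..n + 1}. \<alpha> i) = d" if "\<alpha> \<in> ?r ` S" for \<alpha>
  proof -
    from that obtain v where v: "\<alpha> = ?r v" "v \<in> S" by (rule imageE)
    have "int (\<Sum>i\<in>{1..n + 1}. \<alpha> i) = (\<Sum>i\<in>{1..n + 1}. Poly_Mapping.lookup v i)"
      unfolding of_nat_sum using lookup_r[OF v(2)] v(1) by (intro sum.cong) simp_all
    then show ?thesis using total[OF v(2)] by linarith
  qed
  ultimately have "card {\<alpha> \<in> ?r ` S. \<alpha> (n + 1) = e} * card {\<alpha> \<in> ?r ` S. \<alpha> (n + 1) = e + 2} \<le>
      (card {\<alpha> \<in> ?r ` S. \<alpha> (n + 1) = e + 1})\<^sup>2"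
    by (rule m_exchange_slices_log_concave)
  then show ?thesis unfolding slice .
qed

section \<open>What M-convexity of the homogenized support implies\<close>

lemma keys_sum_single:
  assumes "finite K" "inj_on h K" "\<And>m. m \<in> K \<Longrightarrow> a m \<noteq> 0"
  shows "Poly_Mapping.keys (\<Sum>m\<in>K. Poly_Mapping.single (h m) (a m)) = h ` K"
proof -
  have look: "Poly_Mapping.lookup (\<Sum>m\<in>K. Poly_Mapping.single (h m) (a m)) k =
      (\<Sum>m\<in>K. if h m = k then a m else 0)" for k
    by (simp add: lookup_sum lookup_single when_def)
  show ?thesis
  proof (intro equalityI subsetI)
    fix k assume "k \<in> Poly_Mapping.keys (\<Sum>m\<in>K. Poly_Mapping.single (h m) (a m))"
    then have "(\<Sum>m\<in>K. if h m = k then a m else 0) \<noteq> 0" by (simp add: in_keys_iff look)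
    then obtain m where "m \<in> K" "(if h m = k then a m else 0) \<noteq> 0" by (rule sum.not_neutral_contains_not_neutral)
    then show "k \<in> h ` K" by (auto split: if_splits)
  next
    fix k assume "k \<in> h ` K"
    then obtain m where m: "m \<in> K" "k = h m" by blast
    have "(\<Sum>m'\<in>K. if h m' = k then a m' else 0) = (\<Sum>m'\<in>K. if m' = m then a m' else 0)"
      using m assms(2) by (intro sum.cong) (auto dest: inj_onD)
    also have "\<dots> = a m" using m assms(1) by simp
    finally show "k \<in> Poly_Mapping.keys (\<Sum>m\<in>K. Poly_Mapping.single (h m) (a m))"
      using assms(3) m by (simp add: in_keys_iff look)
  qed
qed

lemma keys_hom_component: "Poly_Mapping.keys (hom_component c f) = {m \<in> Poly_Mapping.keys f. mon_degree m = c}"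
proof -
  have "finite {m. m \<in> Poly_Mapping.keys f \<and> mon_degree m = c}" by simp
  moreover have "inj_on (\<lambda>m. m) {m. m \<in> Poly_Mapping.keys f \<and> mon_degree m = c}" by (rule inj_on_id2)
  moreover have "Poly_Mapping.lookup f m \<noteq> 0" if "m \<in> {m. m \<in> Poly_Mapping.keys f \<and> mon_degree m = c}" for m
    using that by (simp add: in_keys_iff)
  ultimately have "Poly_Mapping.keys (hom_component c f) =
      (\<lambda>m. m) ` {m. m \<in> Poly_Mapping.keys f \<and> mon_degree m = c}"
    unfolding hom_component_def by (rule keys_sum_single)
  then show ?thesis by simp
qed

lemma mon_degree_le_total_degree: "m \<in> Poly_Mapping.keys f \<Longrightarrow> mon_degree m \<le> total_degree f"
  unfolding total_degree_def by (intro Max_ge) auto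

lemma Var_power: "Var i ^ k = Poly_Mapping.single (Poly_Mapping.single i k) 1"
  by (induction k) (simp_all add: Var_def mult_single single_add[symmetric])

definition homogenize_exp :: "nat \<Rightarrow> nat \<Rightarrow> (nat \<Rightarrow>\<^sub>0 nat) \<Rightarrow> (nat \<Rightarrow>\<^sub>0 nat)" where
  "homogenize_exp n d m = m + Poly_Mapping.single (Suc n) (d - mon_degree m)"

lemma lookup_homogenize_exp:
  assumes "Poly_Mapping.keys m \<subseteq> {1..n}"
  shows "Poly_Mapping.lookup (homogenize_exp n d m) i =
    (if i = Suc n then d - mon_degree m else Poly_Mapping.lookup m i)"
proof -
  have "Suc n \<notin> Poly_Mapping.keys m" using assms by auto
  then show ?thesis by (auto simp: homogenize_exp_def lookup_add lookup_single when_def in_keys_iff)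
qed

lemma keys_homogenization:
  assumes vars: "\<And>m. m \<in> Poly_Mapping.keys f \<Longrightarrow> Poly_Mapping.keys m \<subseteq> {1..n}"
  shows "Poly_Mapping.keys (homogenization n f) = homogenize_exp n (total_degree f) ` Poly_Mapping.keys f"
proof -
  let ?d = "total_degree f"
  let ?h = "homogenize_exp n ?d"
  have "homogenization n f = (\<Sum>c\<in>{..?d}. \<Sum>m\<in>{m \<in> Poly_Mapping.keys f. mon_degree m = c}.
      Poly_Mapping.single (?h m) (Poly_Mapping.lookup f m))"
    unfolding homogenization_def hom_component_def
    by (intro sum.cong refl)
       (auto simp: sum_distrib_left Var_power mult_single homogenize_exp_def add.commute intro!: sum.cong)
  also have "\<dots> = (\<Sum>m\<in>Poly_Mapping.keys f. Poly_Mapping.single (?h m) (Poly_Mapping.lookup f m))"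
    by (rule sum.group) (auto intro: mon_degree_le_total_degree)
  finally have eq: "homogenization n f = \<dots>" .
  have "inj_on ?h (Poly_Mapping.keys f)"
  proof (rule inj_onI)
    fix m m' assume m: "m \<in> Poly_Mapping.keys f" "m' \<in> Poly_Mapping.keys f" "?h m = ?h m'"
    show "m = m'"
    proof (rule poly_mapping_eqI)
      fix i
      show "Poly_Mapping.lookup m i = Poly_Mapping.lookup m' i"
      proof (cases "i = Suc n")
        case True
        then have "i \<notin> Poly_Mapping.keys m" "i \<notin> Poly_Mapping.keys m'"
          using vars[OF m(1)] vars[OF m(2)] by auto
        then show ?thesis by (simp add: in_keys_iff)
      next
        case False
        then show ?thesis
          using m(3) lookup_homogenize_exp[OF vars[OF m(1)], of ?d i]
            lookup_homogenize_exp[OF vars[OF m(2)], of ?d i] by simp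
      qed
    qed
  qed
  then show ?thesis unfolding eq by (intro keys_sum_single) (auto simp: in_keys_iff)
qed

abbreviation to_int :: "(nat \<Rightarrow>\<^sub>0 nat) \<Rightarrow> (nat \<Rightarrow>\<^sub>0 int)" where
  "to_int \<equiv> Poly_Mapping.map int"

lemma lookup_to_int: "Poly_Mapping.lookup (to_int m) i = int (Poly_Mapping.lookup m i)"
  by (simp add: lookup_map_zero)

lemma inj_to_int: "inj to_int"
proof (rule injI)
  fix m m' assume "to_int m = to_int m'"
  then have "int (Poly_Mapping.lookup m i) = int (Poly_Mapping.lookup m' i)" for i
    by (metis lookup_to_int)
  then show "m = m'" by (intro poly_mapping_eqI) simp
qed

lemma coord_sum_to_int:
  assumes "Poly_Mapping.keys m \<subseteq> {1..n}"
  shows "coord_sum {1..n} (to_int m) = int (mon_degree m)"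
  using mon_degree_superset[OF finite_atLeastAtMost assms] by (simp add: coord_sum_def lookup_to_int)

text \<open>
  A polynomial in \<open>n\<close> variables, assumed nonzero since M-convexity alone allows the empty set.
\<close>

locale m_convex_homogenization =
  fixes n :: nat and f :: ipoly
  assumes vars: "\<And>m. m \<in> Poly_Mapping.keys f \<Longrightarrow> Poly_Mapping.keys m \<subseteq> {1..n}"
    and nonzero: "f \<noteq> 0"
    and M_convex: "M_convex (n + 1) (supp (homogenization n f))"
begin

abbreviation "d \<equiv> total_degree f"

abbreviation "H \<equiv> supp (homogenization n f)"

definition lifted :: "(nat \<Rightarrow>\<^sub>0 nat) \<Rightarrow> (nat \<Rightarrow>\<^sub>0 int)" where
  "lifted m = to_int (homogenize_exp n d m)"

lemma H_eq: "H = lifted ` Poly_Mapping.keys f"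
  by (auto simp: supp_def keys_homogenization[OF vars] lifted_def)

lemma degree_le: "m \<in> Poly_Mapping.keys f \<Longrightarrow> mon_degree m \<le> d"
  by (rule mon_degree_le_total_degree)

lemma lookup_lifted:
  assumes "m \<in> Poly_Mapping.keys f"
  shows "Poly_Mapping.lookup (lifted m) i =
    (if i = Suc n then int d - int (mon_degree m) else int (Poly_Mapping.lookup m i))"
  using degree_le[OF assms] by (simp add: lifted_def lookup_to_int lookup_homogenize_exp[OF vars[OF assms]] of_nat_diff)

lemma lookup_last: "m \<in> Poly_Mapping.keys f \<Longrightarrow> Poly_Mapping.lookup m (Suc n) = 0"
  using vars[of m] by (auto simp: in_keys_iff subset_iff)

lemma lifted_eq:
  assumes "m \<in> Poly_Mapping.keys f"
  shows "lifted m = to_int m + Poly_Mapping.single (Suc n) (int d - int (mon_degree m))"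
  by (rule poly_mapping_eqI)
    (simp add: lookup_lifted[OF assms] lookup_last[OF assms] lookup_to_int lookup_add lookup_single when_def)

lemma coord_sum_lifted:
  assumes "m \<in> Poly_Mapping.keys f"
  shows "coord_sum {1..n + 1} (lifted m) = int d"
proof -
  have "coord_sum {1..n + 1} (to_int m) = int (mon_degree m)"
    using vars[OF assms] by (intro coord_sum_to_int) auto
  then show ?thesis by (simp add: lifted_eq[OF assms] coord_sum_add coord_sum_single)
qed

lemma family: "m_convex_family (n + 1) (int d) H"
  unfolding m_convex_family_def using M_convex nonzero coord_sum_lifted by (auto simp: H_eq)

lemma SNP_homogenization: "SNP (n + 1) (homogenization n f)"
  unfolding SNP_def newton_def by (rule m_convex_lattice_points[OF family])

lemma permutahedron_homogenization:
  "generalized_permutahedron (n + 1) (newton (homogenization n f))"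
  unfolding newton_def by (rule m_convex_generalized_permutahedron[OF family])

text \<open>
  Homogenization of exponents extends to an affine map. So a lattice point of the Newton
  polytope of \<open>f\<close> is lifted to one of the Newton polytope of the homogenization.
\<close>

definition lift_real :: "(nat \<Rightarrow>\<^sub>0 real) \<Rightarrow> (nat \<Rightarrow>\<^sub>0 real)" where
  "lift_real x = x + Poly_Mapping.single (Suc n) (real d - coord_sum {1..n} x)"

lemma lift_real_affine:
  assumes "u + v = 1"
  shows "lift_real (u *\<^sub>R x + v *\<^sub>R y) = u *\<^sub>R lift_real x + v *\<^sub>R lift_real y"
proof (rule poly_mapping_eqI)
  fix i
  have "real d = u * real d + v * real d" using assms by (metis distrib_right mult_1)
  then show "Poly_Mapping.lookup (lift_real (u *\<^sub>R x + v *\<^sub>R y)) i =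
      Poly_Mapping.lookup (u *\<^sub>R lift_real x + v *\<^sub>R lift_real y) i"
    by (simp add: lift_real_def lookup_add lookup_scaleR lookup_single when_def
        coord_sum_add coord_sum_scaleR algebra_simps)
qed

lemma lift_real_hull:
  assumes "x \<in> convex hull A"
  shows "lift_real x \<in> convex hull (lift_real ` A)"
proof -
  have "convex {x. lift_real x \<in> convex hull (lift_real ` A)}"
    by (rule convexI) (auto simp: lift_real_affine intro: convexD[OF convex_convex_hull])
  then have "convex hull A \<subseteq> {x. lift_real x \<in> convex hull (lift_real ` A)}"
    by (intro hull_minimal) (auto intro: hull_inc)
  then show ?thesis using assms by blast
qed

lemma lift_real_to_real:
  "lift_real (to_real v) = to_real (v + Poly_Mapping.single (Suc n) (int d - coord_sum {1..n} v))"
  by (rule poly_mapping_eqI)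
    (simp add: lift_real_def lookup_add lookup_to_real lookup_single when_def coord_sum_to_real)

lemma SNP_original: "SNP n f"
  unfolding SNP_def
proof (intro equalityI subsetI CollectI conjI)
  fix v assume "v \<in> supp f"
  then obtain m where m: "m \<in> Poly_Mapping.keys f" "v = to_int m" by (auto simp: supp_def)
  then have "Poly_Mapping.keys v \<subseteq> Poly_Mapping.keys m" by (auto simp: in_keys_iff lookup_to_int)
  then show "v \<in> int_space n" using vars[OF m(1)] by (auto simp: int_space_def)
  show "to_real v \<in> newton f" unfolding newton_def using \<open>v \<in> supp f\<close> by (intro hull_inc) auto
next
  fix v assume v: "v \<in> {v \<in> int_space n. to_real v \<in> newton f}"
  let ?v = "v + Poly_Mapping.single (Suc n) (int d - coord_sum {1..n} v)"
  have "lift_real (to_real v) \<in> convex hull (lift_real ` to_real ` supp f)"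
    using v by (intro lift_real_hull) (simp add: newton_def)
  moreover have "lift_real ` to_real ` supp f \<subseteq> to_real ` H"
  proof
    fix y assume "y \<in> lift_real ` to_real ` supp f"
    then obtain m where m: "m \<in> Poly_Mapping.keys f" "y = lift_real (to_real (to_int m))"
      by (auto simp: supp_def)
    have "coord_sum {1..n} (to_int m) = int (mon_degree m)" by (rule coord_sum_to_int[OF vars[OF m(1)]])
    then have "y = to_real (lifted m)"
      unfolding m(2) lift_real_to_real lifted_eq[OF m(1)] by (rule arg_cong)
    then show "y \<in> to_real ` H" using m(1) by (auto simp: H_eq)
  qed
  ultimately have "to_real ?v \<in> convex hull (to_real ` H)"
    unfolding lift_real_to_real using hull_mono by blast
  moreover have "?v \<in> int_space (n + 1)"
    using v int_space_outside[of v n] unfolding int_space_def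
    by (auto simp: in_keys_iff lookup_add lookup_single when_def split: if_splits)
  ultimately have "?v \<in> H" using m_convex_lattice_points[OF family] by blast
  then obtain m where m: "m \<in> Poly_Mapping.keys f" "?v = lifted m" by (auto simp: H_eq)
  have v_last: "Poly_Mapping.lookup v (Suc n) = 0" using v by (intro int_space_outside[of v n]) auto
  have "v = to_int m"
  proof (rule poly_mapping_eqI)
    fix i
    show "Poly_Mapping.lookup v i = Poly_Mapping.lookup (to_int m) i"
    proof (cases "i = Suc n")
      case True
      then show ?thesis using v_last lookup_last[OF m(1)] by (simp add: lookup_to_int)
    next
      case False
      then have "Poly_Mapping.lookup v i = Poly_Mapping.lookup (lifted m) i"
        unfolding m(2)[symmetric] by (simp add: lookup_add lookup_single)
      then show ?thesis using False by (simp add: lookup_lifted[OF m(1)] lookup_to_int)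
    qed
  qed
  then show "v \<in> supp f" using m by (auto simp: supp_def)
qed

text \<open>
  A component is the slice at a fixed last coordinate. Exchanging two of its exponents at
  \<open>i \<le> n\<close> stays in the slice, because the last coordinates agree and \<open>j\<close> is chosen where they
  differ.
\<close>

lemma M_convex_component: "M_convex n (supp (hom_component c f))"
  unfolding M_convex_def
proof (intro conjI ballI impI)
  have supp_c: "supp (hom_component c f) = to_int ` {m \<in> Poly_Mapping.keys f. mon_degree m = c}"
    by (simp add: supp_def keys_hom_component)
  show "supp (hom_component c f) \<subseteq> int_space n"
  proof
    fix v assume "v \<in> supp (hom_component c f)"
    then have "v \<in> to_int ` {m \<in> Poly_Mapping.keys f. mon_degree m = c}" by (simp only: supp_c)
    then obtain m where "v = to_int m" "m \<in> Poly_Mapping.keys f" by (elim imageE) simp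
    then have "v \<in> supp f" unfolding supp_def by (intro image_eqI)
    then show "v \<in> int_space n" using SNP_original by (auto simp: SNP_def)
  qed
  fix \<alpha> \<beta> i
  assume ab: "\<alpha> \<in> supp (hom_component c f)" "\<beta> \<in> supp (hom_component c f)" and i: "i \<in> {1..n}"
    and lt: "Poly_Mapping.lookup \<beta> i < Poly_Mapping.lookup \<alpha> i"
  obtain a where a: "a \<in> Poly_Mapping.keys f" "mon_degree a = c" "\<alpha> = to_int a"
    using ab(1) by (auto simp: supp_c)
  obtain b where b: "b \<in> Poly_Mapping.keys f" "mon_degree b = c" "\<beta> = to_int b"
    using ab(2) by (auto simp: supp_c)
  let ?z = "Poly_Mapping.single (Suc n) (int d - int c)"
  have lift_a: "lifted a = \<alpha> + ?z" and lift_b: "lifted b = \<beta> + ?z"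
    using a b by (simp_all add: lifted_eq)
  have "lifted a \<in> H" "lifted b \<in> H" using a b by (auto simp: H_eq)
  moreover have "i \<in> {1..n + 1}" using i by auto
  moreover have "Poly_Mapping.lookup (lifted b) i < Poly_Mapping.lookup (lifted a) i"
    using lt by (simp add: lift_a lift_b lookup_add)
  ultimately obtain j where j: "j \<in> {1..n + 1}"
      "Poly_Mapping.lookup (lifted a) j < Poly_Mapping.lookup (lifted b) j"
      "lifted a - Poly_Mapping.single i 1 + Poly_Mapping.single j 1 \<in> H"
      "lifted b + Poly_Mapping.single i 1 - Poly_Mapping.single j 1 \<in> H"
    by (rule m_convex_familyE[OF family])
  have jn: "j \<noteq> Suc n" using j(2) a b by (auto simp: lookup_lifted)
  have in_slice: "v \<in> supp (hom_component c f)"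
    if "v + ?z \<in> H" "Poly_Mapping.lookup v (Suc n) = 0" for v
  proof -
    from that(1) obtain m where m: "v + ?z = lifted m" "m \<in> Poly_Mapping.keys f" unfolding H_eq by (rule imageE)
    have "Poly_Mapping.lookup (v + ?z) (Suc n) = int d - int c"
      using that(2) by (simp add: lookup_add)
    then have "mon_degree m = c" by (simp add: m(1) lookup_lifted[OF m(2)])
    moreover from this have "v = to_int m" using m(1) by (simp add: lifted_eq[OF m(2)])
    ultimately show ?thesis using m(2) by (simp add: supp_c)
  qed
  have ab0: "Poly_Mapping.lookup \<alpha> (Suc n) = 0" "Poly_Mapping.lookup \<beta> (Suc n) = 0"
    using a b lookup_last by (simp_all add: lookup_to_int)
  have "\<alpha> - Poly_Mapping.single i 1 + Poly_Mapping.single j 1 \<in> supp (hom_component c f)"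
    using j(3) i jn ab0 by (intro in_slice) (auto simp: lift_a lookup_add lookup_minus lookup_single algebra_simps)
  moreover have "\<beta> + Poly_Mapping.single i 1 - Poly_Mapping.single j 1 \<in> supp (hom_component c f)"
    using j(4) i jn ab0 by (intro in_slice) (auto simp: lift_b lookup_add lookup_minus lookup_single algebra_simps)
  moreover have "j \<in> {1..n}" using j(1) jn by auto
  moreover have "Poly_Mapping.lookup \<alpha> j < Poly_Mapping.lookup \<beta> j"
    using j(2) by (simp add: lift_a lift_b lookup_add)
  ultimately show "\<exists>j\<in>{1..n}. Poly_Mapping.lookup \<alpha> j < Poly_Mapping.lookup \<beta> j \<and>
      \<alpha> - Poly_Mapping.single i 1 + Poly_Mapping.single j 1 \<in> supp (hom_component c f) \<and>
      \<beta> + Poly_Mapping.single i 1 - Poly_Mapping.single j 1 \<in> supp (hom_component c f)" by blast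
qed

lemma card_component:
  "card (supp (hom_component c f)) = card {v \<in> H. Poly_Mapping.lookup v (Suc n) = int d - int c}"
proof -
  let ?K = "{m \<in> Poly_Mapping.keys f. mon_degree m = c}"
  have "{v \<in> H. Poly_Mapping.lookup v (Suc n) = int d - int c} = lifted ` ?K"
    by (auto simp: H_eq lookup_lifted)
  moreover have "inj_on lifted ?K"
    by (rule inj_onI) (auto simp: lifted_eq dest: injD[OF inj_to_int])
  moreover have "supp (hom_component c f) = to_int ` ?K" by (simp add: supp_def keys_hom_component)
  ultimately show ?thesis by (simp add: card_image inj_on_subset[OF inj_to_int])
qed

end

context m_convex_homogenization
begin

lemma lookup_H_nonneg: "v \<in> H \<Longrightarrow> 0 \<le> Poly_Mapping.lookup v i"
  by (auto simp: supp_def lookup_to_int)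

text \<open>
  Component \<open>c\<close> is the slice at last coordinate \<open>d - c\<close>. Beyond the degree \<open>d\<close> the components
  are zero.
\<close>

lemma log_concave_components: "log_concave (\<lambda>c. real (card (supp (hom_component c f))))"
  unfolding log_concave_def
proof (intro conjI allI impI)
  fix c :: nat
  show "0 \<le> real (card (supp (hom_component c f)))" by simp
next
  fix c :: nat assume c: "1 \<le> c"
  let ?a = "\<lambda>c. card (supp (hom_component c f))"
  have "?a (c - 1) * ?a (c + 1) \<le> (?a c)\<^sup>2"
  proof (cases "c + 1 \<le> d")
    case True
    define e where "e = d - c - 1"
    have "int d - int (c + 1) = int e" "int d - int c = int (e + 1)" "int d - int (c - 1) = int (e + 2)"
      using True c by (simp_all add: e_def)
    then have a: "?a (c + 1) = card {v \<in> H. Poly_Mapping.lookup v (n + 1) = int e}"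
      "?a c = card {v \<in> H. Poly_Mapping.lookup v (n + 1) = int (e + 1)}"
      "?a (c - 1) = card {v \<in> H. Poly_Mapping.lookup v (n + 1) = int (e + 2)}"
      by (simp_all only: card_component Suc_eq_plus1)
    have "(\<Sum>i\<in>{1..n + 1}. Poly_Mapping.lookup v i) = int d" if "v \<in> H" for v
      using family that unfolding m_convex_family_def coord_sum_def by blast
    from M_convex_slices_log_concave[OF M_convex lookup_H_nonneg this, of e]
    show ?thesis unfolding a by (simp only: mult.commute)
  next
    case False
    have "mon_degree m \<noteq> c + 1" if "m \<in> Poly_Mapping.keys f" for m
      using degree_le[OF that] False by simp
    then have "Poly_Mapping.keys (hom_component (c + 1) f) = {}" unfolding keys_hom_component by blast
    then show ?thesis by (simp add: supp_def)
  qed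
  then have "real (?a (c - 1) * ?a (c + 1)) \<le> real ((?a c)\<^sup>2)" by (simp only: of_nat_le_iff)
  then show "real (?a (c - 1)) * real (?a (c + 1)) \<le> (real (?a c))\<^sup>2"
    by (simp only: of_nat_mult of_nat_power)
qed

end

section \<open>Fireworks Grothendieck polynomials\<close>

lemma ex_col_sum:
  assumes "finite DD" "\<And>D. D \<in> DD \<Longrightarrow> finite (C D)"
  obtains m :: "nat \<Rightarrow>\<^sub>0 nat" where "\<And>i. Poly_Mapping.lookup m i = card {D \<in> DD. i \<in> C D}"
proof
  fix i
  show "Poly_Mapping.lookup (\<Sum>D\<in>DD. \<Sum>x\<in>C D. Poly_Mapping.single x (1::nat)) i = card {D \<in> DD. i \<in> C D}"
  proof -
    have "Poly_Mapping.lookup (\<Sum>D\<in>DD. \<Sum>x\<in>C D. Poly_Mapping.single x (1::nat)) i =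
        (\<Sum>D\<in>DD. \<Sum>x\<in>C D. if x = i then 1 else 0)"
      by (simp add: lookup_sum lookup_single when_def del: One_nat_def)
    also have "\<dots> = (\<Sum>D\<in>DD. if i \<in> C D then 1 else 0)"
      using assms(2) by (intro sum.cong) auto
    also have "\<dots> = card {D \<in> DD. i \<in> C D}" using assms(1) by (simp add: sum.If_cases Int_def)
    finally show ?thesis .
  qed
qed

lemma col_sums_vars:
  assumes "\<And>D. D \<in> DD \<Longrightarrow> D \<noteq> {} \<and> D \<subseteq> {1..<n}" "m \<in> col_sums DD cols"
  shows "Poly_Mapping.keys m \<subseteq> {1..n}"
proof
  fix i assume i: "i \<in> Poly_Mapping.keys m"
  obtain C where C: "\<And>D. D \<in> DD \<Longrightarrow> C D \<in> cols D"
    "\<And>i. Poly_Mapping.lookup m i = card {D \<in> DD. i \<in> C D}"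
    using assms(2) unfolding col_sums_def by blast
  have "card {D \<in> DD. i \<in> C D} \<noteq> 0" using i by (simp add: in_keys_iff C(2))
  then have "{D \<in> DD. i \<in> C D} \<noteq> {}" by (metis card.empty)
  then obtain D where D: "D \<in> DD" "i \<in> C D" by blast
  have "finite D" using assms(1)[OF D(1)] finite_subset by blast
  then have "Max D \<in> D" using assms(1)[OF D(1)] by (intro Max_in) auto
  then show "i \<in> {1..n}" using C(1)[OF D(1)] D(2) assms(1)[OF D(1)] unfolding cols_def by fastforce
qed

text \<open>
  Summing up column sets determines all coordinates but the last, and the last one is determined
  by the total degree in both descriptions.
\<close>

lemma supp_homogenization_col_sums:
  assumes fin: "finite DD" and D: "\<And>D. D \<in> DD \<Longrightarrow> D \<noteq> {} \<and> D \<subseteq> {1..<n}"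
    and keys: "Poly_Mapping.keys f = col_sums DD cols"
  shows "supp (homogenization n f) = hom_sums (n + 1) (int (total_degree f)) DD"
proof -
  let ?d = "total_degree f"
  let ?h = "\<lambda>m. to_int (homogenize_exp n ?d m)"
  have vars: "Poly_Mapping.keys m \<subseteq> {1..n}" if "m \<in> Poly_Mapping.keys f" for m
    using col_sums_vars[OF D, of DD m] that by (simp add: keys)
  have supp: "supp (homogenization n f) = ?h ` Poly_Mapping.keys f"
    by (simp add: supp_def keys_homogenization[OF vars] image_image)
  have look: "Poly_Mapping.lookup (?h m) i =
      (if i = n + 1 then int ?d - int (mon_degree m) else int (Poly_Mapping.lookup m i))"
    if "m \<in> Poly_Mapping.keys f" for m i
    using mon_degree_le_total_degree[OF that]
    by (simp add: lookup_to_int lookup_homogenize_exp[OF vars[OF that]] of_nat_diff)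
  have deg: "(\<Sum>i\<in>{1..n}. int (Poly_Mapping.lookup m i)) = int (mon_degree m)" if "m \<in> Poly_Mapping.keys f" for m
    using mon_degree_superset[OF finite_atLeastAtMost vars[OF that]] by simp
  have split_sum: "(\<Sum>i\<in>{1..n + 1}. Poly_Mapping.lookup v i) =
      (\<Sum>i\<in>{1..n}. Poly_Mapping.lookup v i) + Poly_Mapping.lookup v (n + 1)" for v :: "nat \<Rightarrow>\<^sub>0 int"
    by (simp add: sum.cl_ivl_Suc)
  have count: "(\<Sum>D\<in>DD. of_bool (x \<in> C D)) = int (card {D \<in> DD. x \<in> C D})" for x C
    using fin by (simp add: of_bool_def sum.If_cases Int_def)
  show ?thesis
  proof (intro equalityI subsetI)
    fix v assume "v \<in> supp (homogenization n f)"
    then obtain m where m: "v = ?h m" "m \<in> Poly_Mapping.keys f" unfolding supp by (rule imageE)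
    obtain C where C: "\<And>D. D \<in> DD \<Longrightarrow> C D \<in> cols D"
      "\<And>i. Poly_Mapping.lookup m i = card {D \<in> DD. i \<in> C D}"
      using m(2) unfolding keys col_sums_def by blast
    have low: "Poly_Mapping.lookup v i = int (Poly_Mapping.lookup m i)" if "i \<noteq> n + 1" for i
      using look[OF m(2), of i] that m(1) by simp
    have "(\<Sum>i\<in>{1..n}. Poly_Mapping.lookup v i) = int (mon_degree m)"
      unfolding deg[OF m(2), symmetric] by (intro sum.cong) (auto simp: low)
    then have "(\<Sum>i\<in>{1..n + 1}. Poly_Mapping.lookup v i) = int ?d"
      unfolding split_sum using look[OF m(2), of "n + 1"] m(1) by simp
    moreover have "Poly_Mapping.lookup v x = 0" if "x > n + 1" for x
    proof -
      have "x \<notin> Poly_Mapping.keys m" using vars[OF m(2)] that by auto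
      then show ?thesis using low[of x] that by (simp add: in_keys_iff)
    qed
    moreover have "Poly_Mapping.lookup v x = (\<Sum>D\<in>DD. of_bool (x \<in> C D))" if "x < n + 1" for x
      unfolding count using low[of x] C(2)[of x] that by simp
    ultimately show "v \<in> hom_sums (n + 1) (int ?d) DD"
      unfolding hom_sums_def using C(1) by blast
  next
    fix v assume "v \<in> hom_sums (n + 1) (int ?d) DD"
    then obtain C where C: "\<And>D. D \<in> DD \<Longrightarrow> C D \<in> cols D"
      and v: "\<And>x. x < n + 1 \<Longrightarrow> Poly_Mapping.lookup v x = (\<Sum>D\<in>DD. of_bool (x \<in> C D))"
        "\<And>x. x > n + 1 \<Longrightarrow> Poly_Mapping.lookup v x = 0"
        "(\<Sum>i\<in>{1..n + 1}. Poly_Mapping.lookup v i) = int ?d"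
      unfolding hom_sums_def by blast
    have "finite (C D)" if "D \<in> DD" for D
      using C[OF that] by (auto simp: cols_def intro: finite_subset)
    then obtain m where m: "\<And>i. Poly_Mapping.lookup m i = card {D \<in> DD. i \<in> C D}"
      using ex_col_sum[OF fin, of C] by blast
    have "m \<in> Poly_Mapping.keys f" unfolding keys col_sums_def using C m by blast
    have low: "Poly_Mapping.lookup v i = int (Poly_Mapping.lookup m i)" if "i < n + 1" for i
      using v(1)[OF that] by (simp add: count m)
    have "(\<Sum>i\<in>{1..n}. Poly_Mapping.lookup v i) = int (mon_degree m)"
      unfolding deg[OF \<open>m \<in> Poly_Mapping.keys f\<close>, symmetric] by (intro sum.cong) (auto simp: low)
    then have last: "Poly_Mapping.lookup v (n + 1) = int ?d - int (mon_degree m)"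
      using v(3) unfolding split_sum by simp
    have "v = ?h m"
    proof (rule poly_mapping_eqI)
      fix i
      consider "i < n + 1" | "i = n + 1" | "i > n + 1" by linarith
      then show "Poly_Mapping.lookup v i = Poly_Mapping.lookup (?h m) i"
      proof cases
        case 1
        then show ?thesis using low[of i] look[OF \<open>m \<in> Poly_Mapping.keys f\<close>, of i] by simp
      next
        case 2
        then show ?thesis using last look[OF \<open>m \<in> Poly_Mapping.keys f\<close>, of i] by simp
      next
        case 3
        then have "i \<notin> Poly_Mapping.keys m" using vars[OF \<open>m \<in> Poly_Mapping.keys f\<close>] by auto
        then show ?thesis using v(2)[OF 3] 3 look[OF \<open>m \<in> Poly_Mapping.keys f\<close>, of i]
          by (simp add: in_keys_iff)
      qed
    qed
    then show "v \<in> supp (homogenization n f)"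
      unfolding supp using \<open>m \<in> Poly_Mapping.keys f\<close> by (rule image_eqI)
  qed
qed

lemma self_in_cols: "finite D \<Longrightarrow> D \<subseteq> {1..} \<Longrightarrow> D \<in> cols D"
  by (auto simp: cols_def)

theorem corollary1p2:
  fixes n :: nat and w :: "nat \<Rightarrow> nat"
  assumes "w permutes {1..n}" and "fireworks n w"
  shows "M_convex (n + 1) (supp (homogenization n (grothendieck n w))) \<and>
    SNP (n + 1) (homogenization n (grothendieck n w)) \<and>
    generalized_permutahedron (n + 1) (newton (homogenization n (grothendieck n w))) \<and>
    SNP n (grothendieck n w) \<and>
    (\<forall>c. M_convex n (supp (hom_component c (grothendieck n w)))) \<and>
    log_concave (\<lambda>c. real (card (supp (hom_component c (grothendieck n w)))))"
proof -
  let ?G = "grothendieck n w"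
  from fireworks_support[OF assms(1) fireworks_records[OF assms]]
  obtain DD where fin: "finite DD" and D': "\<forall>D\<in>DD. D \<noteq> {} \<and> D \<subseteq> {1..<n}"
    and keys: "Poly_Mapping.keys ?G = col_sums DD cols"
    unfolding keys_pgroth by (elim exE conjE) (rule that)
  have D: "D \<noteq> {} \<and> D \<subseteq> {1..<n}" if "D \<in> DD" for D using D' that by (rule bspec)
  have finD: "finite D" if "D \<in> DD" for D
    using D[OF that] finite_subset[OF _ finite_atLeastLessThan] by (elim conjE)
  obtain m :: "nat \<Rightarrow>\<^sub>0 nat" where m: "\<And>i. Poly_Mapping.lookup m i = card {D \<in> DD. i \<in> D}"
    using ex_col_sum[OF fin, of "\<lambda>D. D"] finD by blast
  have "D \<in> cols D" if "D \<in> DD" for D using finD[OF that] D[OF that] by (intro self_in_cols) auto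
  then have "m \<in> Poly_Mapping.keys ?G"
    unfolding keys col_sums_def by (intro CollectI exI[of _ "\<lambda>D. D"]) (simp add: m)
  then have "?G \<noteq> 0" by auto
  have eq: "supp (homogenization n ?G) = hom_sums (n + 1) (int (total_degree ?G)) DD"
    by (rule supp_homogenization_col_sums[OF fin _ keys]) (rule D)
  have "M_convex (n + 1) (supp (homogenization n ?G))"
    unfolding eq
  proof (rule hom_sums_M_convex[OF fin])
    fix D assume "D \<in> DD"
    from D[OF this] finD[OF this] show "finite D \<and> D \<noteq> {} \<and> D \<subseteq> {1..<n + 1}" by auto
  qed simp
  then interpret m_convex_homogenization n ?G
  proof unfold_locales
    fix m assume "m \<in> Poly_Mapping.keys ?G"
    then show "Poly_Mapping.keys m \<subseteq> {1..n}" unfolding keys by (rule col_sums_vars[rotated]) (rule D)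
  qed (rule \<open>?G \<noteq> 0\<close>)
  show ?thesis
    using M_convex SNP_homogenization permutahedron_homogenization SNP_original M_convex_component
      log_concave_components by blast
qed

end
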